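(* Let $m\ge 2$, let $\Omega_j\subset\mathbb{R}^{n_j}$, $j=1,\dots,m$, be bounded Lipschitz domains, and let $f\in H^k(\Omega_1\times\dots\times\Omega_m)$ for some fixed $k>0$. Then there is a constant $C>0$, which may depend on $f$, $k$ and the domains but not on $\varepsilon$, such that for every $0<\varepsilon<1$ the following holds. If the ranks are chosen as $r_j=\lceil\varepsilon^{-n_j/k}\rceil$ for all $j=1,\dots,m$, then the truncation error of the truncated Tucker decomposition $f^{\mathrm{TF}}_{r_1,\dots,r_m}$ of $f$ satisfies $$\big\|f-f^{\mathrm{TF}}_{r_1,\dots,r_m}\big\|_{L^2(\Omega_1\times\dots\times\Omega_m)}\le\sqrt{\sum_{j=1}^m\sum_{\alpha_j=r_j+1}^\infty\lambda_j(\alpha_j)}\le C\sqrt{m}\,\varepsilon,$$ while the storage cost (number of coefficients) of the core tensor of $f^{\mathrm{TF}}_{r_1,\dots,r_m}$ is $\prod_{j=1}^m r_j$, which equals $\varepsilon^{-(n_1+\dots+n_m)/k}$ up to the rounding of the ranks, i.e. $\prod_{j=1}^m r_j\sim\varepsilon^{-(n_1+\dots+n_m)/k}$ with constants independent of $\varepsilon$.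
   Context: All functions are real-valued; $H^k$ denotes the standard (isotropic) Sobolev space of order $k\ge 0$, $H^0=L^2$. Let $f\in L^2(\Omega_1\times\dots\times\Omega_m)$. For $j\in\{1,\dots,m\}$ write $\hat{\boldsymbol{x}}_j=(\boldsymbol{x}_1,\dots,\boldsymbol{x}_{j-1},\boldsymbol{x}_{j+1},\dots,\boldsymbol{x}_m)$ for the variables other than $\boldsymbol{x}_j\in\Omega_j$, ranging over $\hat\Omega_j=\prod_{i\ne j}\Omega_i$. The singular value decomposition separating $\boldsymbol{x}_j$ from $\hat{\boldsymbol{x}}_j$ is $$f=\sum_{\alpha_j=1}^\infty\sqrt{\lambda_j(\alpha_j)}\,\varphi_j(\boldsymbol{x}_j,\alpha_j)\,\psi_j(\alpha_j,\hat{\boldsymbol{x}}_j),$$ where $\lambda_j(1)\ge\lambda_j(2)\ge\dots\ge0$ are the eigenvalues (with multiplicity) of the integral operator on $L^2(\Omega_j)$ with kernel $k_j(\boldsymbol{x},\boldsymbol{x}')=\int_{\hat\Omega_j}f(\boldsymbol{x},\hat{\boldsymbol{x}}_j)f(\boldsymbol{x}',\hat{\boldsymbol{x}}_j)\,d\hat{\boldsymbol{x}}_j$, and $\{\varphi_j(\cdot,\alpha_j)\}_{\alpha_j\in\mathbb{N}}$ is an associated orthonormal basis of $L^2(\Omega_j)$ of eigenfunctions. We also write $\varphi_j(\alpha_j,\boldsymbol{x}_j)=\varphi_j(\boldsymbol{x}_j,\alpha_j)$. The core tensor has the entries $$\omega(\alpha_1,\dots,\alpha_m)=\int_{\Omega_1\times\dots\times\Omega_m}f(\boldsymbol{x}_1,\dots,\boldsymbol{x}_m)\,\varphi_1(\alpha_1,\boldsymbol{x}_1)\cdots\varphi_m(\alpha_m,\boldsymbol{x}_m)\,d(\boldsymbol{x}_1,\dots,\boldsymbol{x}_m),$$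 and the truncated Tucker decomposition of $f$ with ranks $r_1,\dots,r_m\in\mathbb{N}$ is $$f^{\mathrm{TF}}_{r_1,\dots,r_m}(\boldsymbol{x}_1,\dots,\boldsymbol{x}_m)=\sum_{\alpha_1=1}^{r_1}\cdots\sum_{\alpha_m=1}^{r_m}\omega(\alpha_1,\dots,\alpha_m)\,\varphi_1(\alpha_1,\boldsymbol{x}_1)\cdots\varphi_m(\alpha_m,\boldsymbol{x}_m).$$ Its core tensor is $[\omega(\alpha_1,\dots,\alpha_m)]_{1\le\alpha_j\le r_j}$. $A\sim B$ means that $A\le cB$ and $B\le cA$ for a constant $c>0$. *)

theory Defs
  imports "HOL-Analysis.Analysis"
begin

text \<open>
  For a finite index set \<open>I\<close>, the Euclidean space \<open>\<real>\<^sup>I\<close> is represented by the extensional functions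
  \<open>I \<rightarrow>\<^sub>E UNIV\<close>, so that the dimension \<open>card I\<close> may vary inside a statement.  Its topology is the
  product topology and its Lebesgue measure the product of the one-dimensional ones; elements of
  \<open>L\<^sup>2\<close> are given by Borel representatives.
\<close>

definition eucl_top :: "'i set \<Rightarrow> ('i \<Rightarrow> real) topology" where
  "eucl_top I = product_topology (\<lambda>_. euclideanreal) I"

definition eucl_dist :: "'i set \<Rightarrow> ('i \<Rightarrow> real) \<Rightarrow> ('i \<Rightarrow> real) \<Rightarrow> real" where
  "eucl_dist I x y = L2_set (\<lambda>i. x i - y i) I"

definition eucl_inner :: "'i set \<Rightarrow> ('i \<Rightarrow> real) \<Rightarrow> ('i \<Rightarrow> real) \<Rightarrow> real" where
  "eucl_inner I x y = (\<Sum>i\<in>I. x i * y i)"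

definition dom_measure :: "'i set \<Rightarrow> ('i \<Rightarrow> real) set \<Rightarrow> ('i \<Rightarrow> real) measure" where
  "dom_measure I \<Omega> = restrict_space (\<Pi>\<^sub>M i\<in>I. lborel) \<Omega>"

definition square_integrable :: "'a measure \<Rightarrow> ('a \<Rightarrow> real) \<Rightarrow> bool" where
  "square_integrable M u \<longleftrightarrow> u \<in> borel_measurable M \<and> integrable M (\<lambda>x. (u x)\<^sup>2)"

definition L2_norm :: "'a measure \<Rightarrow> ('a \<Rightarrow> real) \<Rightarrow> real" where
  "L2_norm M u = sqrt (\<integral>x. (u x)\<^sup>2 \<partial>M)"


subsection \<open>Bounded Lipschitz domains\<close>

text \<open>
  Near each boundary point the domain is the strict epigraph of a Lipschitz function, after a
  rotation of the coordinate axes.  Only the direction \<open>e\<close> of the last rotated axis matters; the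
  graph function \<open>\<gamma>\<close> lives on the hyperplane orthogonal to \<open>e\<close>.
\<close>

definition lipschitz_graph_near :: "'i set \<Rightarrow> ('i \<Rightarrow> real) set \<Rightarrow> ('i \<Rightarrow> real) \<Rightarrow> bool" where
  "lipschitz_graph_near I \<Omega> p \<longleftrightarrow>
     (\<exists>\<rho>>0. \<exists>e \<in> I \<rightarrow>\<^sub>E UNIV. \<exists>\<gamma> L.
        eucl_inner I e e = 1 \<and>
        (\<forall>y \<in> I \<rightarrow>\<^sub>E UNIV. \<forall>z \<in> I \<rightarrow>\<^sub>E UNIV.
           eucl_inner I y e = 0 \<longrightarrow> eucl_inner I z e = 0 \<longrightarrow>
           \<bar>\<gamma> y - \<gamma> z\<bar> \<le> L * eucl_dist I y z) \<and>
        (\<forall>x \<in> I \<rightarrow>\<^sub>E UNIV. eucl_dist I x p < \<rho> \<longrightarrow>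
           (x \<in> \<Omega> \<longleftrightarrow> \<gamma> (\<lambda>i\<in>I. x i - eucl_inner I x e * e i) < eucl_inner I x e)))"

definition bounded_lipschitz_domain :: "'i set \<Rightarrow> ('i \<Rightarrow> real) set \<Rightarrow> bool" where
  "bounded_lipschitz_domain I \<Omega> \<longleftrightarrow>
     \<Omega> \<noteq> {} \<and> openin (eucl_top I) \<Omega> \<and> connectedin (eucl_top I) \<Omega> \<and>
     (\<exists>R. \<forall>x\<in>\<Omega>. \<forall>y\<in>\<Omega>. eucl_dist I x y \<le> R) \<and>
     (\<forall>p \<in> eucl_top I frontier_of \<Omega>. lipschitz_graph_near I \<Omega> p)"


subsection \<open>Sobolev spaces\<close>

definition partial_deriv :: "'i \<Rightarrow> (('i \<Rightarrow> real) \<Rightarrow> real) \<Rightarrow> ('i \<Rightarrow> real) \<Rightarrow> real" where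
  "partial_deriv i \<phi> x = deriv (\<lambda>t. \<phi> (x(i := t))) (x i)"

text \<open>
  A partial derivative of order \<open>l\<close> is given by the list of the \<open>l\<close> coordinates with respect to
  which one differentiates; on smooth functions the order of the list is irrelevant.
\<close>

definition partial_derivs :: "'i list \<Rightarrow> (('i \<Rightarrow> real) \<Rightarrow> real) \<Rightarrow> ('i \<Rightarrow> real) \<Rightarrow> real" where
  "partial_derivs is \<phi> = foldr partial_deriv is \<phi>"

definition smooth :: "'i set \<Rightarrow> (('i \<Rightarrow> real) \<Rightarrow> real) \<Rightarrow> bool" where
  "smooth I \<phi> \<longleftrightarrow>
     (\<forall>is \<in> lists I.
        continuous_map (eucl_top I) euclideanreal (partial_derivs is \<phi>) \<and>
        (\<forall>i\<in>I. \<forall>x \<in> I \<rightarrow>\<^sub>E UNIV.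
           (\<lambda>t. partial_derivs is \<phi> (x(i := t))) field_differentiable (at (x i))))"

definition test_function :: "'i set \<Rightarrow> ('i \<Rightarrow> real) set \<Rightarrow> (('i \<Rightarrow> real) \<Rightarrow> real) \<Rightarrow> bool" where
  "test_function I \<Omega> \<phi> \<longleftrightarrow>
     smooth I \<phi> \<and>
     (\<exists>K \<subseteq> \<Omega>. compactin (eucl_top I) K \<and> (\<forall>x \<in> (I \<rightarrow>\<^sub>E UNIV) - K. \<phi> x = 0))"

definition weak_deriv ::
  "'i set \<Rightarrow> ('i \<Rightarrow> real) set \<Rightarrow> 'i list \<Rightarrow> (('i \<Rightarrow> real) \<Rightarrow> real) \<Rightarrow> (('i \<Rightarrow> real) \<Rightarrow> real) \<Rightarrow> bool"
where
  "weak_deriv I \<Omega> is u g \<longleftrightarrow>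
     (\<forall>\<phi>. test_function I \<Omega> \<phi> \<longrightarrow>
        (\<integral>x. u x * partial_derivs is \<phi> x \<partial>dom_measure I \<Omega>) =
        (- 1) ^ length is * (\<integral>x. g x * \<phi> x \<partial>dom_measure I \<Omega>))"

definition gagliardo_finite ::
  "'i set \<Rightarrow> ('i \<Rightarrow> real) set \<Rightarrow> real \<Rightarrow> (('i \<Rightarrow> real) \<Rightarrow> real) \<Rightarrow> bool"
where
  "gagliardo_finite I \<Omega> \<theta> g \<longleftrightarrow>
     integrable (dom_measure I \<Omega> \<Otimes>\<^sub>M dom_measure I \<Omega>)
       (\<lambda>(x, y). (g x - g y)\<^sup>2 / eucl_dist I x y powr (real (card I) + 2 * \<theta>))"

text \<open>
  \<open>H\<^sup>k(\<Omega>)\<close> for real \<open>k \<ge> 0\<close>: square integrable weak derivatives up to order \<open>\<lfloor>k\<rfloor>\<close> and, for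
  non-integer \<open>k\<close>, finite Sobolev--Slobodeckij seminorm of fractional order \<open>frac k\<close> of those of
  order \<open>\<lfloor>k\<rfloor>\<close>.
\<close>

definition sobolev ::
  "real \<Rightarrow> 'i set \<Rightarrow> ('i \<Rightarrow> real) set \<Rightarrow> (('i \<Rightarrow> real) \<Rightarrow> real) \<Rightarrow> bool"
where
  "sobolev k I \<Omega> u \<longleftrightarrow>
     square_integrable (dom_measure I \<Omega>) u \<and>
     (\<forall>is \<in> lists I. length is \<le> nat \<lfloor>k\<rfloor> \<longrightarrow>
        (\<exists>g. square_integrable (dom_measure I \<Omega>) g \<and> weak_deriv I \<Omega> is u g \<and>
             (length is = nat \<lfloor>k\<rfloor> \<and> k \<notin> \<int> \<longrightarrow> gagliardo_finite I \<Omega> (frac k) g)))"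


subsection \<open>Functions on a product of domains\<close>

text \<open>
  \<open>\<Omega> j \<subseteq> \<real>\<^bsup>n j\<^esup>\<close> for \<open>j \<in> {1..m}\<close>.  A point of the product is the family \<open>x\<close> of its blocks
  \<open>x j \<in> \<Omega> j\<close>.  For the isotropic Sobolev space the product is regarded as a subset of the Euclidean
  space of dimension \<open>n 1 + \<dots> + n m\<close>, with coordinates indexed by the pairs \<open>(j, i)\<close>.
\<close>

definition block_measure ::
  "(nat \<Rightarrow> nat) \<Rightarrow> (nat \<Rightarrow> (nat \<Rightarrow> real) set) \<Rightarrow> nat \<Rightarrow> (nat \<Rightarrow> real) measure"
where
  "block_measure n \<Omega> j = dom_measure {1..n j} (\<Omega> j)"

definition prod_measure ::
  "nat \<Rightarrow> (nat \<Rightarrow> nat) \<Rightarrow> (nat \<Rightarrow> (nat \<Rightarrow> real) set) \<Rightarrow> (nat \<Rightarrow> nat \<Rightarrow> real) measure"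
where
  "prod_measure m n \<Omega> = (\<Pi>\<^sub>M j\<in>{1..m}. block_measure n \<Omega> j)"

definition flat_index :: "nat \<Rightarrow> (nat \<Rightarrow> nat) \<Rightarrow> (nat \<times> nat) set" where
  "flat_index m n = (SIGMA j:{1..m}. {1..n j})"

definition blocks ::
  "nat \<Rightarrow> (nat \<Rightarrow> nat) \<Rightarrow> (nat \<times> nat \<Rightarrow> real) \<Rightarrow> nat \<Rightarrow> nat \<Rightarrow> real"
where
  "blocks m n x = (\<lambda>j\<in>{1..m}. \<lambda>i\<in>{1..n j}. x (j, i))"

definition flat_domain ::
  "nat \<Rightarrow> (nat \<Rightarrow> nat) \<Rightarrow> (nat \<Rightarrow> (nat \<Rightarrow> real) set) \<Rightarrow> (nat \<times> nat \<Rightarrow> real) set"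
where
  "flat_domain m n \<Omega> =
     {x \<in> flat_index m n \<rightarrow>\<^sub>E UNIV. blocks m n x \<in> (\<Pi>\<^sub>E j\<in>{1..m}. \<Omega> j)}"

definition sobolev_prod ::
  "real \<Rightarrow> nat \<Rightarrow> (nat \<Rightarrow> nat) \<Rightarrow> (nat \<Rightarrow> (nat \<Rightarrow> real) set) \<Rightarrow> ((nat \<Rightarrow> nat \<Rightarrow> real) \<Rightarrow> real) \<Rightarrow> bool"
where
  "sobolev_prod k m n \<Omega> f \<longleftrightarrow>
     sobolev k (flat_index m n) (flat_domain m n \<Omega>) (\<lambda>x. f (blocks m n x))"


subsection \<open>Singular value decomposition and Tucker decomposition\<close>

definition svd_kernel ::
  "nat \<Rightarrow> (nat \<Rightarrow> nat) \<Rightarrow> (nat \<Rightarrow> (nat \<Rightarrow> real) set) \<Rightarrow> ((nat \<Rightarrow> nat \<Rightarrow> real) \<Rightarrow> real) \<Rightarrow> nat \<Rightarrow>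
    (nat \<Rightarrow> real) \<Rightarrow> (nat \<Rightarrow> real) \<Rightarrow> real"
where
  "svd_kernel m n \<Omega> f j x x' =
     (\<integral>y. f (y(j := x)) * f (y(j := x')) \<partial>(\<Pi>\<^sub>M i\<in>{1..m} - {j}. block_measure n \<Omega> i))"

definition integral_op :: "'a measure \<Rightarrow> ('a \<Rightarrow> 'a \<Rightarrow> real) \<Rightarrow> ('a \<Rightarrow> real) \<Rightarrow> 'a \<Rightarrow> real" where
  "integral_op M \<kappa> g x = (\<integral>x'. \<kappa> x x' * g x' \<partial>M)"

text \<open>
  Nonincreasing enumeration \<open>lam 1 \<ge> lam 2 \<ge> \<dots> \<ge> 0\<close> of the eigenvalues, with multiplicity, and
  orthonormal eigenfunctions \<open>\<phi> 1, \<phi> 2, \<dots>\<close> of the integral operator.  If the operator has infinitely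
  many positive eigenvalues and a nontrivial null space, no nonincreasing enumeration by the natural
  numbers can belong to an orthonormal basis of all of \<open>L\<^sup>2\<close>.  Hence completeness is required only up
  to the null space: whatever is orthogonal to all \<open>\<phi> \<alpha>\<close> is annihilated by the operator.  Every
  orthonormal basis of eigenfunctions satisfies this.
\<close>

definition eigensystem ::
  "'a measure \<Rightarrow> ('a \<Rightarrow> 'a \<Rightarrow> real) \<Rightarrow> (nat \<Rightarrow> real) \<Rightarrow> (nat \<Rightarrow> 'a \<Rightarrow> real) \<Rightarrow> bool"
where
  "eigensystem M \<kappa> lam \<phi> \<longleftrightarrow>
     (\<forall>\<alpha>\<ge>1. 0 \<le> lam (Suc \<alpha>) \<and> lam (Suc \<alpha>) \<le> lam \<alpha>) \<and>
     (\<forall>\<alpha>\<ge>1. square_integrable M (\<phi> \<alpha>)) \<and>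
     (\<forall>\<alpha>\<ge>1. \<forall>\<beta>\<ge>1. (\<integral>x. \<phi> \<alpha> x * \<phi> \<beta> x \<partial>M) = (if \<alpha> = \<beta> then 1 else 0)) \<and>
     (\<forall>\<alpha>\<ge>1. AE x in M. integral_op M \<kappa> (\<phi> \<alpha>) x = lam \<alpha> * \<phi> \<alpha> x) \<and>
     (\<forall>g. square_integrable M g \<longrightarrow> (\<forall>\<alpha>\<ge>1. (\<integral>x. g x * \<phi> \<alpha> x \<partial>M) = 0) \<longrightarrow>
        (AE x in M. integral_op M \<kappa> g x = 0))"

definition svd_family ::
  "nat \<Rightarrow> (nat \<Rightarrow> nat) \<Rightarrow> (nat \<Rightarrow> (nat \<Rightarrow> real) set) \<Rightarrow> ((nat \<Rightarrow> nat \<Rightarrow> real) \<Rightarrow> real) \<Rightarrow>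
    (nat \<Rightarrow> nat \<Rightarrow> real) \<Rightarrow> (nat \<Rightarrow> nat \<Rightarrow> (nat \<Rightarrow> real) \<Rightarrow> real) \<Rightarrow> bool"
where
  "svd_family m n \<Omega> f lam \<phi> \<longleftrightarrow>
     (\<forall>j\<in>{1..m}. eigensystem (block_measure n \<Omega> j) (svd_kernel m n \<Omega> f j) (lam j) (\<phi> j))"

definition core ::
  "nat \<Rightarrow> (nat \<Rightarrow> nat) \<Rightarrow> (nat \<Rightarrow> (nat \<Rightarrow> real) set) \<Rightarrow> ((nat \<Rightarrow> nat \<Rightarrow> real) \<Rightarrow> real) \<Rightarrow>
    (nat \<Rightarrow> nat \<Rightarrow> (nat \<Rightarrow> real) \<Rightarrow> real) \<Rightarrow> (nat \<Rightarrow> nat) \<Rightarrow> real"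
where
  "core m n \<Omega> f \<phi> \<alpha> = (\<integral>x. f x * (\<Prod>j=1..m. \<phi> j (\<alpha> j) (x j)) \<partial>prod_measure m n \<Omega>)"

definition core_index :: "nat \<Rightarrow> (nat \<Rightarrow> nat) \<Rightarrow> (nat \<Rightarrow> nat) set" where
  "core_index m r = (\<Pi>\<^sub>E j\<in>{1..m}. {1..r j})"

definition tucker ::
  "nat \<Rightarrow> (nat \<Rightarrow> nat) \<Rightarrow> (nat \<Rightarrow> (nat \<Rightarrow> real) set) \<Rightarrow> ((nat \<Rightarrow> nat \<Rightarrow> real) \<Rightarrow> real) \<Rightarrow>
    (nat \<Rightarrow> nat \<Rightarrow> (nat \<Rightarrow> real) \<Rightarrow> real) \<Rightarrow> (nat \<Rightarrow> nat) \<Rightarrow> (nat \<Rightarrow> nat \<Rightarrow> real) \<Rightarrow> real"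
where
  "tucker m n \<Omega> f \<phi> r x =
     (\<Sum>\<alpha>\<in>core_index m r. core m n \<Omega> f \<phi> \<alpha> * (\<Prod>j=1..m. \<phi> j (\<alpha> j) (x j)))"

definition core_storage :: "nat \<Rightarrow> (nat \<Rightarrow> nat) \<Rightarrow> nat" where
  "core_storage m r = card (core_index m r)"

end

theory Submission imports Defs begin

text \<open>
 The error of the truncated Tucker decomposition is governed, one mode at a time, by how well \<open>f\<close>,
 seen as a function of the pair of \<open>x\<^sub>j\<close> and the remaining variables, is approximated by functions
 of finite rank.  Projecting onto the leading singular functions of one mode after the other, each
 projection adds at most the error that it would cause for \<open>f\<close> itself, because the errors in
 different modes are controlled by Pythagoras' theorem (\<open>one_mode_projection_error\<close>,
 \<open>truncated_expansion_error\<close>).  The error in mode \<open>j\<close> is \<open>\<parallel>f\<parallel>\<^sup>2\<close> minus the sum of the first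
 \<open>r j\<close> eigenvalues, and this is the tail of the series of eigenvalues, since all eigenvalues together
 exhaust \<open>\<parallel>f\<parallel>\<^sup>2\<close> (\<open>lam_sums_norm\<close>).

 The tail after \<open>r\<close> eigenvalues is at most the squared distance of \<open>f\<close> from any function of rank
 \<open>r\<close> (Eckart--Young, \<open>finite_rank_lower_bound\<close>).  So it suffices to exhibit one good approximation
 of small rank, and piecewise polynomials on a grid of width \<open>h\<close> do it.  Their error is \<open>O(h\<^sup>k)\<close>
 for \<open>f \<in> H\<^sup>k\<close> (\<open>piecewise_polynomial_approximation\<close>).  Although the grid lives in dimension
 \<open>n 1 + \<dots> + n m\<close>, the rank with respect to block \<open>j\<close> is only the number of pieces and monomials in
 that block, which is \<open>O(h\<^sup>-\<^sup>n)\<close> for \<open>n = n j\<close> (\<open>mode_finite_rank_approximation\<close>).  With \<open>h\<close>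
 proportional to \<open>\<epsilon> powr (1 / k)\<close> the rank is at most \<open>\<epsilon> powr (- n j / k) \<le> r j\<close> and the error is
 \<open>O(\<epsilon>)\<close> (\<open>lam_tail_bound\<close>).

 The approximation by polynomials on a single cell uses a Taylor formula for weak derivatives.  It is
 obtained by testing with translates of smooth bumps, on which Taylor's formula is classical
 (\<open>weak_Taylor_tested\<close>), and holds, for each fixed increment, at almost every base point
 (\<open>weak_Taylor_AE_bound\<close>).  Averaging over base points in a cube from which the whole cell is visible
 inside the domain gives a Taylor polynomial with small error in \<open>L\<^sup>2\<close>
 (\<open>local_Taylor_approximation\<close>).  Such cubes exist because Lipschitz domains satisfy a uniform cone
 condition (\<open>cone_condition_lipschitz_domain\<close>), which passes to products.  For fractional \<open>k\<close> the
 coefficients of top order are values of the derivatives of order \<open>\<lfloor>k\<rfloor>\<close> at a suitable point, and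
 the Sobolev--Slobodeckij seminorm controls the deviation from them
 (\<open>fractional_constant_approximation\<close>).
\<close>

section \<open>Square integrable functions and orthonormal systems\<close>

abbreviation L2 :: "'a measure \<Rightarrow> ('a \<Rightarrow> real) \<Rightarrow> bool" where
 "L2 \<equiv> square_integrable"

lemma L2D:
 assumes "L2 M f"
 shows "f \<in> borel_measurable M" "integrable M (\<lambda>x. (f x)\<^sup>2)"
 using assms by (auto simp: square_integrable_def)

lemma L2_mult:
 assumes "L2 M f" "L2 M g"
 shows "integrable M (\<lambda>x. f x * g x)"
proof (rule Bochner_Integration.integrable_bound[where f = "\<lambda>x. (f x)\<^sup>2 + (g x)\<^sup>2"])
 note [measurable] = assms[THEN L2D(1)]
 show "(\<lambda>x. f x * g x) \<in> borel_measurable M" by measurable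
 show "integrable M (\<lambda>x. (f x)\<^sup>2 + (g x)\<^sup>2)"
  using assms by (auto simp: square_integrable_def)
 have "\<bar>a * b\<bar> \<le> a\<^sup>2 + b\<^sup>2" for a b :: real
 proof -
  have "2 * (\<bar>a\<bar> * \<bar>b\<bar>) \<le> a\<^sup>2 + b\<^sup>2"
   using sum_squares_bound[of "\<bar>a\<bar>" "\<bar>b\<bar>"] by (simp add: mult.assoc)
  moreover have "0 \<le> \<bar>a\<bar> * \<bar>b\<bar>" by simp
  ultimately show ?thesis unfolding abs_mult by linarith
 qed
 then show "AE x in M. norm (f x * g x) \<le> norm ((f x)\<^sup>2 + (g x)\<^sup>2)"
  by auto
qed

lemma L2_add:
 assumes "L2 M f" "L2 M g"
 shows "L2 M (\<lambda>x. f x + g x)"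
 using assms L2_mult[OF assms]
 by (auto simp: square_integrable_def power2_sum mult.assoc)

lemma L2_cmult:
 assumes "L2 M f"
 shows "L2 M (\<lambda>x. c * f x)"
 using assms by (auto simp: square_integrable_def power_mult_distrib)

lemma L2_diff:
 assumes "L2 M f" "L2 M g"
 shows "L2 M (\<lambda>x. f x - g x)"
 using L2_add[OF assms(1) L2_cmult[OF assms(2), of "-1"]] by simp

lemma L2_zero: "L2 M (\<lambda>_. 0)"
 by (simp add: square_integrable_def)

lemma L2_sum:
 assumes "\<And>i. i \<in> A \<Longrightarrow> L2 M (f i)"
 shows "L2 M (\<lambda>x. \<Sum>i\<in>A. f i x)"
 using assms
 by (induction A rule: infinite_finite_induct)
   (auto intro: L2_add L2_zero)

lemma L2_cong_AE:
 assumes "L2 M f" "g \<in> borel_measurable M" "AE x in M. f x = g x"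
 shows "L2 M g"
proof -
 note [measurable] = assms(2) L2D(1)[OF assms(1)]
 have "integrable M (\<lambda>x. (f x)\<^sup>2) \<longleftrightarrow> integrable M (\<lambda>x. (g x)\<^sup>2)"
  by (rule integrable_cong_AE) (use assms(3) in auto)
 with assms show ?thesis by (simp add: square_integrable_def)
qed

lemma (in finite_measure) L2_bounded:
 assumes "f \<in> borel_measurable M" "\<And>x. x \<in> space M \<Longrightarrow> \<bar>f x\<bar> \<le> B"
 shows "L2 M f"
proof -
 note [measurable] = assms(1)
 have "integrable M (\<lambda>x. (f x)\<^sup>2)"
 proof (rule integrable_const_bound[where B = "B\<^sup>2"])
  show "AE x in M. norm ((f x)\<^sup>2) \<le> B\<^sup>2"
   using power_mono[OF assms(2) abs_ge_zero, of _ 2] by (intro AE_I2) simp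
 qed measurable
 then show ?thesis by (simp add: square_integrable_def)
qed

lemma (in finite_measure) L2_integrable:
 "L2 M f \<Longrightarrow> integrable M f"
 by (auto simp: square_integrable_def intro: square_integrable_imp_integrable)

lemma integral_power2_sum:
 assumes "finite A" "\<And>i. i \<in> A \<Longrightarrow> L2 M (f i)"
 shows "(\<integral>x. (\<Sum>i\<in>A. f i x)\<^sup>2 \<partial>M) = (\<Sum>i\<in>A. \<Sum>j\<in>A. \<integral>x. f i x * f j x \<partial>M)"
proof -
 have "(\<integral>x. (\<Sum>i\<in>A. f i x)\<^sup>2 \<partial>M) = (\<integral>x. (\<Sum>i\<in>A. \<Sum>j\<in>A. f i x * f j x) \<partial>M)"
  by (simp add: power2_eq_square sum_product)
 also have "\<dots> = (\<Sum>i\<in>A. \<Sum>j\<in>A. \<integral>x. f i x * f j x \<partial>M)"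
  by (simp add: L2_mult assms(2))
 finally show ?thesis .
qed

lemma integral_power2_diff:
 assumes "L2 M f" "L2 M g"
 shows "(\<integral>x. (f x - g x)\<^sup>2 \<partial>M) = (\<integral>x. (f x)\<^sup>2 \<partial>M) - 2 * (\<integral>x. f x * g x \<partial>M) + (\<integral>x. (g x)\<^sup>2 \<partial>M)"
 using assms L2_mult[OF assms]
 by (simp add: power2_diff square_integrable_def mult.assoc)

lemma Cauchy_Schwarz_integral:
 assumes "L2 M f" "L2 M g"
 shows "(\<integral>x. f x * g x \<partial>M)\<^sup>2 \<le> (\<integral>x. (f x)\<^sup>2 \<partial>M) * (\<integral>x. (g x)\<^sup>2 \<partial>M)"
proof -
 define A where "A = (\<integral>x. (f x)\<^sup>2 \<partial>M)"
 define B where "B = (\<integral>x. (g x)\<^sup>2 \<partial>M)"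
 define C where "C = (\<integral>x. f x * g x \<partial>M)"
 have q: "0 \<le> A - 2 * t * C + t\<^sup>2 * B" for t
 proof -
  have "0 \<le> (\<integral>x. (f x - t * g x)\<^sup>2 \<partial>M)" by simp
  also have "\<dots> = A - 2 * t * C + t\<^sup>2 * B"
   by (subst integral_power2_diff[OF assms(1) L2_cmult[OF assms(2)]])
     (simp add: A_def B_def C_def power_mult_distrib mult.left_commute)
  finally show ?thesis .
 qed
 have "B \<ge> 0" by (simp add: B_def)
 show ?thesis
 proof (cases "B = 0")
  case True
  have "C = 0"
  proof (rule ccontr)
   assume "C \<noteq> 0"
   with q[of "(A + 1) / (2 * C)"] True show False by (simp add: field_simps)
  qed
  then show ?thesis by (simp add: C_def[symmetric] A_def[symmetric] B_def[symmetric] True)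
 next
  case False
  with \<open>B \<ge> 0\<close> have "B > 0" by simp
  with q[of "C / B"] have "0 \<le> A * B - C\<^sup>2"
   by (simp add: field_simps power2_eq_square)
  then show ?thesis by (simp add: C_def[symmetric] A_def[symmetric] B_def[symmetric])
 qed
qed

lemma orthonormal_sum_power2:
 assumes "finite A" "\<And>i. i \<in> A \<Longrightarrow> L2 M (\<phi> i)"
  and "\<And>i j. i \<in> A \<Longrightarrow> j \<in> A \<Longrightarrow> (\<integral>x. \<phi> i x * \<phi> j x \<partial>M) = (if i = j then 1 else 0)"
 shows "(\<integral>x. (\<Sum>i\<in>A. a i * \<phi> i x)\<^sup>2 \<partial>M) = (\<Sum>i\<in>A. (a i)\<^sup>2)"
proof -
 have "(\<integral>x. (\<Sum>i\<in>A. a i * \<phi> i x)\<^sup>2 \<partial>M) = (\<Sum>i\<in>A. \<Sum>j\<in>A. \<integral>x. (a i * \<phi> i x) * (a j * \<phi> j x) \<partial>M)"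
  by (intro integral_power2_sum L2_cmult assms)
 also have "\<dots> = (\<Sum>i\<in>A. \<Sum>j\<in>A. a i * a j * (\<integral>x. \<phi> i x * \<phi> j x \<partial>M))"
 proof (intro sum.cong refl)
  fix i j
  have "(\<integral>x. (a i * \<phi> i x) * (a j * \<phi> j x) \<partial>M) = (\<integral>x. (a i * a j) * (\<phi> i x * \<phi> j x) \<partial>M)"
   by (simp add: mult_ac)
  then show "(\<integral>x. (a i * \<phi> i x) * (a j * \<phi> j x) \<partial>M) = a i * a j * (\<integral>x. \<phi> i x * \<phi> j x \<partial>M)"
   by simp
 qed
 also have "\<dots> = (\<Sum>i\<in>A. \<Sum>j\<in>A. if i = j then (a i)\<^sup>2 else 0)"
  by (intro sum.cong refl) (auto simp: assms power2_eq_square)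
 also have "\<dots> = (\<Sum>i\<in>A. (a i)\<^sup>2)" using assms(1) by simp
 finally show ?thesis .
qed

text \<open>Pythagoras: the excess over the best approximation is the distance of the coefficient vectors.\<close>
lemma orthonormal_distance:
 assumes A: "finite A" "\<And>i. i \<in> A \<Longrightarrow> L2 M (\<phi> i)"
  and on: "\<And>i j. i \<in> A \<Longrightarrow> j \<in> A \<Longrightarrow> (\<integral>x. \<phi> i x * \<phi> j x \<partial>M) = (if i = j then 1 else 0)"
  and h: "L2 M h"
 shows "(\<integral>x. (h x - (\<Sum>i\<in>A. a i * \<phi> i x))\<^sup>2 \<partial>M) =
   (\<integral>x. (h x)\<^sup>2 \<partial>M) - (\<Sum>i\<in>A. (\<integral>x. h x * \<phi> i x \<partial>M)\<^sup>2) + (\<Sum>i\<in>A. (a i - (\<integral>x. h x * \<phi> i x \<partial>M))\<^sup>2)"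
proof -
 let ?c = "\<lambda>i. \<integral>x. h x * \<phi> i x \<partial>M"
 have s: "L2 M (\<lambda>x. \<Sum>i\<in>A. a i * \<phi> i x)"
  by (intro L2_sum L2_cmult A)
 have "(\<integral>x. h x * (\<Sum>i\<in>A. a i * \<phi> i x) \<partial>M) = (\<integral>x. (\<Sum>i\<in>A. a i * (h x * \<phi> i x)) \<partial>M)"
  by (simp add: sum_distrib_left mult_ac)
 also have "\<dots> = (\<Sum>i\<in>A. a i * ?c i)"
  using L2_mult[OF h] A by (subst Bochner_Integration.integral_sum) auto
 finally have 1: "(\<integral>x. h x * (\<Sum>i\<in>A. a i * \<phi> i x) \<partial>M) = (\<Sum>i\<in>A. a i * ?c i)" .
 have "(\<Sum>i\<in>A. (a i - ?c i)\<^sup>2) = (\<Sum>i\<in>A. (a i)\<^sup>2) - 2 * (\<Sum>i\<in>A. a i * ?c i) + (\<Sum>i\<in>A. (?c i)\<^sup>2)"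
  by (simp add: power2_diff sum.distrib sum_subtractf sum_distrib_left mult.assoc)
 then show ?thesis
  by (subst integral_power2_diff[OF h s]) (simp add: 1 orthonormal_sum_power2[OF A on])
qed

lemma Bessel_inequality:
 assumes A: "finite A" "\<And>i. i \<in> A \<Longrightarrow> L2 M (\<phi> i)"
  and on: "\<And>i j. i \<in> A \<Longrightarrow> j \<in> A \<Longrightarrow> (\<integral>x. \<phi> i x * \<phi> j x \<partial>M) = (if i = j then 1 else 0)"
  and h: "L2 M h"
 shows "(\<Sum>i\<in>A. (\<integral>x. h x * \<phi> i x \<partial>M)\<^sup>2) \<le> (\<integral>x. (h x)\<^sup>2 \<partial>M)"
proof -
 have "0 \<le> (\<integral>x. (h x - (\<Sum>i\<in>A. (\<integral>x. h x * \<phi> i x \<partial>M) * \<phi> i x))\<^sup>2 \<partial>M)" by simp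
 then show ?thesis by (subst (asm) orthonormal_distance[OF A on h]) auto
qed

text \<open>Completeness of \<open>L\<^sup>2\<close> for fast Cauchy sequences: along such a sequence the increments are
 summable almost everywhere, and Fatou's lemma identifies the pointwise limit as the \<open>L\<^sup>2\<close> limit.\<close>
lemma (in finite_measure) L2_limit_fast_Cauchy:
 fixes S :: "nat \<Rightarrow> 'a \<Rightarrow> real"
 assumes S: "\<And>k. L2 M (S k)"
  and cauchy: "\<And>k j. k \<le> j \<Longrightarrow> (\<integral>x. (S j x - S k x)\<^sup>2 \<partial>M) \<le> (1/4)^k"
 shows "\<exists>s. L2 M s \<and> (\<forall>k. (\<integral>x. (s x - S k x)\<^sup>2 \<partial>M) \<le> (1/4)^k)"
proof -
 note [measurable] = L2D(1)[OF S]
 define d where "d k x = S (Suc k) x - S k x" for k x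
 have d: "L2 M (d k)" for k
  unfolding d_def by (intro L2_diff S)
 note [measurable] = L2D(1)[OF d]
 have ai: "integrable M (\<lambda>x. norm (d k x))" for k
  using L2_integrable[OF d] by simp
 have one: "L2 M (\<lambda>_. 1)" by (simp add: square_integrable_def)
 have dk: "(\<integral>x. norm (d k x) \<partial>M) \<le> sqrt (measure M (space M)) * (1/2)^k" for k
 proof -
  have sq: "L2 M (\<lambda>x. norm (d k x))"
   using d[of k] by (simp add: square_integrable_def)
  have "(\<integral>x. norm (d k x) * 1 \<partial>M)\<^sup>2 \<le> (\<integral>x. (norm (d k x))\<^sup>2 \<partial>M) * (\<integral>x. 1\<^sup>2 \<partial>M)"
   by (rule Cauchy_Schwarz_integral[OF sq one])
  also have "\<dots> \<le> (1/4)^k * measure M (space M)"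
   using cauchy[of k "Suc k"] by (simp add: d_def mult_right_mono)
  also have "\<dots> = (sqrt (measure M (space M)) * (1/2)^k)\<^sup>2"
  proof -
   have "((1/2::real)^k)\<^sup>2 = ((1/2)\<^sup>2)^k" by (metis power_mult mult.commute)
   also have "(1/2::real)\<^sup>2 = 1/4" by (simp add: power2_eq_square)
   finally show ?thesis by (simp add: power_mult_distrib)
  qed
  finally have "(\<integral>x. norm (d k x) \<partial>M)\<^sup>2 \<le> (sqrt (measure M (space M)) * (1/2)^k)\<^sup>2"
   by simp
  then show ?thesis by (rule power2_le_imp_le) simp
 qed
 have summ: "AE x in M. summable (\<lambda>k. norm (d k x))"
 proof (rule AE_mp[OF _ AE_I2])
  have "(\<integral>\<^sup>+x. (\<Sum>k. ennreal (norm (d k x))) \<partial>M) = (\<Sum>k. \<integral>\<^sup>+x. ennreal (norm (d k x)) \<partial>M)"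
   by (rule nn_integral_suminf) measurable
  also have "\<dots> = (\<Sum>k. ennreal (\<integral>x. norm (d k x) \<partial>M))"
   by (intro suminf_cong nn_integral_eq_integral ai) auto
  also have "\<dots> \<le> (\<Sum>k. ennreal (sqrt (measure M (space M)) * (1/2)^k))"
   by (intro suminf_le ennreal_leI dk) auto
  also have "\<dots> < \<infinity>"
   by (subst suminf_ennreal2) (auto intro!: summable_mult summable_geometric)
  finally have "(\<integral>\<^sup>+x. (\<Sum>k. ennreal (norm (d k x))) \<partial>M) \<noteq> \<infinity>" by simp
  then show "AE x in M. (\<Sum>k. ennreal (norm (d k x))) \<noteq> \<infinity>"
   by (rule nn_integral_noteq_infinite[rotated]) measurable
 next
  fix x
  show "(\<Sum>k. ennreal (norm (d k x))) \<noteq> \<infinity> \<longrightarrow> summable (\<lambda>k. norm (d k x))"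
   by (auto intro: summable_suminf_not_top)
 qed
 define s where "s x = lim (\<lambda>k. S k x)" for x
 have [measurable]: "s \<in> borel_measurable M"
  unfolding s_def by measurable
 have conv: "AE x in M. (\<lambda>k. S k x) \<longlonglongrightarrow> s x"
  using summ
 proof eventually_elim
  case (elim x)
  have "summable (\<lambda>k. d k x)" using elim by (rule summable_norm_cancel)
  then have "convergent (\<lambda>n. \<Sum>k<n. d k x)" by (simp add: summable_iff_convergent)
  moreover have "(\<Sum>k<n. d k x) = S n x - S 0 x" for n
   unfolding d_def by (rule sum_lessThan_telescope)
  ultimately have "convergent (\<lambda>n. (S n x - S 0 x) + S 0 x)"
   by (intro convergent_add convergent_const) auto
  then show ?case by (simp add: s_def convergent_LIMSEQ_iff)
 qed
 have fat: "(\<integral>\<^sup>+x. ennreal ((s x - S k x)\<^sup>2) \<partial>M) \<le> ennreal ((1/4)^k)" for k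
 proof -
  have "(\<integral>\<^sup>+x. ennreal ((s x - S k x)\<^sup>2) \<partial>M) = (\<integral>\<^sup>+x. liminf (\<lambda>j. ennreal ((S j x - S k x)\<^sup>2)) \<partial>M)"
  proof (rule nn_integral_cong_AE)
   show "AE x in M. ennreal ((s x - S k x)\<^sup>2) = liminf (\<lambda>j. ennreal ((S j x - S k x)\<^sup>2))"
    using conv
   proof eventually_elim
    case (elim x)
    have "(\<lambda>j. ennreal ((S j x - S k x)\<^sup>2)) \<longlonglongrightarrow> ennreal ((s x - S k x)\<^sup>2)"
     by (intro tendsto_ennrealI tendsto_intros elim)
    then show ?case by (rule lim_imp_Liminf[OF trivial_limit_sequentially, symmetric])
   qed
  qed
  also have "\<dots> \<le> liminf (\<lambda>j. \<integral>\<^sup>+x. ennreal ((S j x - S k x)\<^sup>2) \<partial>M)"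
   by (rule nn_integral_liminf) measurable
  also have "\<dots> \<le> liminf (\<lambda>j::nat. ennreal ((1/4)^k))"
  proof (rule Liminf_mono)
   show "\<forall>\<^sub>F j in sequentially. (\<integral>\<^sup>+x. ennreal ((S j x - S k x)\<^sup>2) \<partial>M) \<le> ennreal ((1/4)^k)"
    using eventually_ge_at_top[of k]
   proof eventually_elim
    case (elim j)
    have "(\<integral>\<^sup>+x. ennreal ((S j x - S k x)\<^sup>2) \<partial>M) = ennreal (\<integral>x. (S j x - S k x)\<^sup>2 \<partial>M)"
     using L2_diff[OF S S]
     by (intro nn_integral_eq_integral) (auto simp: square_integrable_def)
    with cauchy[OF elim] show ?case by (simp add: ennreal_leI)
   qed
  qed
  also have "\<dots> = ennreal ((1/4)^k)" by (simp add: Liminf_const)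
  finally show ?thesis .
 qed
 have sd: "L2 M (\<lambda>x. s x - S k x)" for k
 proof -
  have "integrable M (\<lambda>x. (s x - S k x)\<^sup>2)"
   by (rule integrableI_bounded) (use fat[of k] in \<open>auto simp: le_less_trans\<close>)
  then show ?thesis by (simp add: square_integrable_def)
 qed
 have "L2 M s"
  using L2_add[OF sd[of 0] S[of 0]] by simp
 moreover have "(\<integral>x. (s x - S k x)\<^sup>2 \<partial>M) \<le> (1/4)^k" for k
 proof -
  have "ennreal (\<integral>x. (s x - S k x)\<^sup>2 \<partial>M) \<le> ennreal ((1/4)^k)"
   using fat[of k] sd[of k] by (subst (asm) nn_integral_eq_integral) (auto simp: square_integrable_def)
  then show ?thesis by simp
 qed
 ultimately show ?thesis by blast
qed

section \<open>Functions of two variables\<close>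

locale finite_pair = pair_sigma_finite M1 M2 + M1: finite_measure M1 + M2: finite_measure M2
 for M1 :: "'a measure" and M2 :: "'b measure"
begin

abbreviation M12 where "M12 \<equiv> M1 \<Otimes>\<^sub>M M2"

text \<open>The operator \<open>A\<close> with kernel \<open>F\<close>, from functions of the first variable to functions of the second.\<close>
definition coef :: "('a \<times> 'b \<Rightarrow> real) \<Rightarrow> ('a \<Rightarrow> real) \<Rightarrow> 'b \<Rightarrow> real" where
 "coef F g y = (\<integral>x. F (x, y) * g x \<partial>M1)"

lemma iterated_integrals:
 fixes H :: "'a \<times> 'b \<Rightarrow> real"
 assumes "integrable M12 H"
 shows "(\<integral>z. H z \<partial>M12) = (\<integral>x. (\<integral>y. H (x, y) \<partial>M2) \<partial>M1)"
  and "(\<integral>z. H z \<partial>M12) = (\<integral>y. (\<integral>x. H (x, y) \<partial>M1) \<partial>M2)"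
  and "AE x in M1. integrable M2 (\<lambda>y. H (x, y))"
  and "AE y in M2. integrable M1 (\<lambda>x. H (x, y))"
  and "integrable M2 (\<lambda>y. \<integral>x. H (x, y) \<partial>M1)"
 using integral_fst[of "curry H"] integral_snd[of "curry H"] AE_integrable_fst[of "curry H"]
  AE_integrable_snd[of "curry H"] integrable_snd[of "curry H"] assms by simp_all

lemma coef_measurable [measurable]:
 assumes [measurable]: "F \<in> borel_measurable M12" "g \<in> borel_measurable M1"
 shows "coef F g \<in> borel_measurable M2"
 unfolding coef_def by measurable

lemma AE_L2_slice2:
 assumes F: "L2 M12 F"
 shows "AE y in M2. L2 M1 (\<lambda>x. F (x, y))"
proof -
 note [measurable] = L2D(1)[OF F]
 have "AE y in M2. integrable M1 (\<lambda>x. (F (x, y))\<^sup>2)"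
  by (rule iterated_integrals(4)[OF L2D(2)[OF F]])
 then show ?thesis
  by (rule AE_mp) (auto intro!: AE_I2 simp: square_integrable_def)
qed

lemma AE_L2_slice1:
 assumes F: "L2 M12 F"
 shows "AE x in M1. L2 M2 (\<lambda>y. F (x, y))"
proof -
 note [measurable] = L2D(1)[OF F]
 have "AE x in M1. integrable M2 (\<lambda>y. (F (x, y))\<^sup>2)"
  by (rule iterated_integrals(3)[OF L2D(2)[OF F]])
 then show ?thesis
  by (rule AE_mp) (auto intro!: AE_I2 simp: square_integrable_def)
qed

lemma integral_power2_pair:
 assumes F: "L2 M12 F"
 shows "(\<integral>z. (F z)\<^sup>2 \<partial>M12) = (\<integral>y. (\<integral>x. (F (x, y))\<^sup>2 \<partial>M1) \<partial>M2)"
  "integrable M2 (\<lambda>y. \<integral>x. (F (x, y))\<^sup>2 \<partial>M1)"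
 by (rule iterated_integrals[OF L2D(2)[OF F]])+

lemma L2_tensor:
 assumes g: "L2 M1 g" and c: "L2 M2 c"
 shows "L2 M12 (\<lambda>z. g (fst z) * c (snd z))"
proof -
 note [measurable] = L2D(1)[OF g] L2D(1)[OF c]
 have "integrable M12 (\<lambda>(x, y). (g x)\<^sup>2 * (c y)\<^sup>2)"
 proof (rule Fubini_integrable)
  show "(\<lambda>(x, y). (g x)\<^sup>2 * (c y)\<^sup>2) \<in> borel_measurable M12" by measurable
  show "integrable M1 (\<lambda>x. \<integral>y. norm (case (x, y) of (x, y) \<Rightarrow> (g x)\<^sup>2 * (c y)\<^sup>2) \<partial>M2)"
   using g by (simp add: square_integrable_def)
  show "AE x in M1. integrable M2 (\<lambda>y. case (x, y) of (x, y) \<Rightarrow> (g x)\<^sup>2 * (c y)\<^sup>2)"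
   using c by (simp add: square_integrable_def)
 qed
 then show ?thesis by (simp add: square_integrable_def power_mult_distrib split_beta')
qed

text \<open>Fubini: pairing with a tensor means pairing the coefficient function.\<close>
lemma integral_coef_mult:
 assumes F: "L2 M12 F" and g: "L2 M1 g"
  and c: "L2 M2 c"
 shows "(\<integral>y. coef F g y * c y \<partial>M2) = (\<integral>z. F z * (g (fst z) * c (snd z)) \<partial>M12)"
proof -
 have "(\<integral>z. F z * (g (fst z) * c (snd z)) \<partial>M12) =
   (\<integral>y. (\<integral>x. F (x, y) * (g x * c y) \<partial>M1) \<partial>M2)"
  using iterated_integrals(2)[OF L2_mult[OF F L2_tensor[OF g c]]]
  by simp
 also have "\<dots> = (\<integral>y. coef F g y * c y \<partial>M2)"
  by (simp add: coef_def mult.assoc[symmetric])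
 finally show ?thesis ..
qed

text \<open>The Hilbert--Schmidt bound, from the Cauchy--Schwarz inequality in almost every slice.\<close>
lemma coef_L2:
 assumes F: "L2 M12 F" and g: "L2 M1 g"
 shows "L2 M2 (coef F g)"
  and "(\<integral>y. (coef F g y)\<^sup>2 \<partial>M2) \<le> (\<integral>x. (g x)\<^sup>2 \<partial>M1) * (\<integral>z. (F z)\<^sup>2 \<partial>M12)"
proof -
 note [measurable] = L2D(1)[OF g] L2D(1)[OF F]
 let ?G = "\<integral>x. (g x)\<^sup>2 \<partial>M1"
 have b: "AE y in M2. (coef F g y)\<^sup>2 \<le> ?G * (\<integral>x. (F (x, y))\<^sup>2 \<partial>M1)"
  using AE_L2_slice2[OF F]
 proof eventually_elim
  case (elim y)
  show ?case using Cauchy_Schwarz_integral[OF elim g] by (simp add: coef_def mult.commute)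
 qed
 have i: "integrable M2 (\<lambda>y. ?G * (\<integral>x. (F (x, y))\<^sup>2 \<partial>M1))"
  using integral_power2_pair(2)[OF F] by simp
 have i2: "integrable M2 (\<lambda>y. (coef F g y)\<^sup>2)"
 proof (rule Bochner_Integration.integrable_bound[OF i])
  show "AE y in M2. norm ((coef F g y)\<^sup>2) \<le> norm (?G * (\<integral>x. (F (x, y))\<^sup>2 \<partial>M1))"
   using b by eventually_elim simp
 qed measurable
 then show "L2 M2 (coef F g)" by (simp add: square_integrable_def)
 show "(\<integral>y. (coef F g y)\<^sup>2 \<partial>M2) \<le> (\<integral>x. (g x)\<^sup>2 \<partial>M1) * (\<integral>z. (F z)\<^sup>2 \<partial>M12)"
  using integral_mono_AE[OF i2 i b] by (simp add: integral_power2_pair(1)[OF F])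
qed

lemma coef_diff:
 assumes F: "L2 M12 F"
  and g: "L2 M1 g" "L2 M1 h"
 shows "AE y in M2. coef F (\<lambda>x. g x - h x) y = coef F g y - coef F h y"
 using AE_L2_slice2[OF F]
 by eventually_elim (simp add: coef_def right_diff_distrib L2_mult g)


lemma coef_sum:
 assumes F: "L2 M12 F" and g: "\<And>i. i \<in> A \<Longrightarrow> L2 M1 (g i)"
 shows "AE y in M2. coef F (\<lambda>x. \<Sum>i\<in>A. a i * g i x) y = (\<Sum>i\<in>A. a i * coef F (g i) y)"
 using AE_L2_slice2[OF F]
proof eventually_elim
 case (elim y)
 have "coef F (\<lambda>x. \<Sum>i\<in>A. a i * g i x) y = (\<integral>x. (\<Sum>i\<in>A. a i * (F (x, y) * g i x)) \<partial>M1)"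
  by (simp add: coef_def sum_distrib_left mult.left_commute)
 also have "\<dots> = (\<Sum>i\<in>A. \<integral>x. a i * (F (x, y) * g i x) \<partial>M1)"
  by (rule Bochner_Integration.integral_sum) (use L2_mult[OF elim g] in auto)
 finally show ?case by (simp add: coef_def)
qed

text \<open>The integral operator with kernel \<open>\<integral>F(x,y)F(x',y)dy\<close> is \<open>A\<^sup>*A\<close> for the operator
 \<open>A = coef F\<close>.\<close>
lemma integral_coef_coef:
 assumes F: "L2 M12 F"
  and g: "L2 M1 g" and h: "L2 M1 h"
  and \<kappa>: "\<And>x x'. x \<in> space M1 \<Longrightarrow> x' \<in> space M1 \<Longrightarrow> \<kappa> x x' = (\<integral>y. F (x, y) * F (x', y) \<partial>M2)"
 shows "(\<integral>y. coef F g y * coef F h y \<partial>M2) = (\<integral>x. g x * integral_op M1 \<kappa> h x \<partial>M1)"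
proof -
 note [measurable] = L2D(1)[OF g] L2D(1)[OF h] L2D(1)[OF F]
 have ch: "L2 M2 (coef F h)" by (rule coef_L2(1)[OF F h])
 have op: "AE x in M1. (\<integral>y. F (x, y) * coef F h y \<partial>M2) = integral_op M1 \<kappa> h x"
  using AE_L2_slice1[OF F] AE_space
 proof eventually_elim
  case (elim x)
  have t: "L2 M12 (\<lambda>z. h (fst z) * F (x, snd z))"
   by (rule L2_tensor[OF h elim(1)])
  have i: "integrable M12 (\<lambda>z. F z * (h (fst z) * F (x, snd z)))"
   by (rule L2_mult[OF F t])
  have "(\<integral>y. F (x, y) * coef F h y \<partial>M2) = (\<integral>y. coef F h y * F (x, y) \<partial>M2)"
   by (simp add: mult.commute)
  also have "\<dots> = (\<integral>z. F z * (h (fst z) * F (x, snd z)) \<partial>M12)"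
   by (rule integral_coef_mult[OF F h elim(1)])
  also have "\<dots> = (\<integral>x'. (\<integral>y. F (x', y) * (h x' * F (x, y)) \<partial>M2) \<partial>M1)"
   using iterated_integrals(1)[OF i] by simp
  also have "\<dots> = (\<integral>x'. \<kappa> x x' * h x' \<partial>M1)"
  proof (rule Bochner_Integration.integral_cong[OF refl])
   fix x' assume "x' \<in> space M1"
   have "(\<integral>y. F (x', y) * (h x' * F (x, y)) \<partial>M2) = (\<integral>y. h x' * (F (x, y) * F (x', y)) \<partial>M2)"
    by (simp add: mult_ac)
   then show "(\<integral>y. F (x', y) * (h x' * F (x, y)) \<partial>M2) = \<kappa> x x' * h x'"
    using \<kappa>[OF elim(2) \<open>x' \<in> space M1\<close>] by (simp add: mult.commute)
  qed
  finally show ?case by (simp add: integral_op_def)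
 qed
 have "(\<integral>y. coef F g y * coef F h y \<partial>M2) = (\<integral>z. F z * (g (fst z) * coef F h (snd z)) \<partial>M12)"
  by (rule integral_coef_mult[OF F g ch])
 also have "\<dots> = (\<integral>x. (\<integral>y. F (x, y) * (g x * coef F h y) \<partial>M2) \<partial>M1)"
  using iterated_integrals(1)[OF L2_mult[OF F L2_tensor[OF g ch]]]
  by simp
 also have "\<dots> = (\<integral>x. g x * (\<integral>y. F (x, y) * coef F h y \<partial>M2) \<partial>M1)"
  by (simp add: mult.left_commute)
 also have "\<dots> = (\<integral>x. g x * integral_op M1 \<kappa> h x \<partial>M1)"
 proof (rule integral_cong_AE)
  show a: "(\<lambda>x. g x * (\<integral>y. F (x, y) * coef F h y \<partial>M2)) \<in> borel_measurable M1" by measurable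
  have k: "(\<lambda>x. g x * integral_op M1 \<kappa> h x) \<in> borel_measurable M1 \<longleftrightarrow>
    (\<lambda>x. g x * (\<integral>x'. (\<integral>y. F (x, y) * F (x', y) \<partial>M2) * h x' \<partial>M1)) \<in> borel_measurable M1"
   unfolding integral_op_def
   by (intro measurable_cong arg_cong2[where f = "(*)"] refl Bochner_Integration.integral_cong) (simp add: \<kappa>)
  show "(\<lambda>x. g x * integral_op M1 \<kappa> h x) \<in> borel_measurable M1"
   unfolding k by measurable
  show "AE x in M1. g x * (\<integral>y. F (x, y) * coef F h y \<partial>M2) = g x * integral_op M1 \<kappa> h x"
   using op by eventually_elim simp
 qed
 finally show ?thesis .
qed

text \<open>Pythagoras: only the component of the error in the span of the \<open>\<phi> i\<close> depends on the \<open>c i\<close>, and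
 there the best choice is \<open>coef F (\<phi> i)\<close>.\<close>
lemma tensor_expansion_distance:
 assumes A: "finite A" "\<And>i. i \<in> A \<Longrightarrow> L2 M1 (\<phi> i)"
  and on: "\<And>i j. i \<in> A \<Longrightarrow> j \<in> A \<Longrightarrow> (\<integral>x. \<phi> i x * \<phi> j x \<partial>M1) = (if i = j then 1 else 0)"
  and F: "L2 M12 F"
  and c: "\<And>i. i \<in> A \<Longrightarrow> L2 M2 (c i)"
 shows "(\<integral>z. (F z - (\<Sum>i\<in>A. \<phi> i (fst z) * c i (snd z)))\<^sup>2 \<partial>M12) =
   (\<integral>z. (F z)\<^sup>2 \<partial>M12) - (\<Sum>i\<in>A. \<integral>y. (coef F (\<phi> i) y)\<^sup>2 \<partial>M2)
    + (\<Sum>i\<in>A. \<integral>y. (c i y - coef F (\<phi> i) y)\<^sup>2 \<partial>M2)"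
proof -
 let ?T = "\<lambda>z. \<Sum>i\<in>A. \<phi> i (fst z) * c i (snd z)"
 let ?c = "\<lambda>i. coef F (\<phi> i)"
 have cc: "L2 M2 (?c i)" if "i \<in> A" for i
  by (rule coef_L2(1)[OF F A(2)[OF that]])
 have T: "L2 M12 ?T"
  by (intro L2_sum L2_tensor A c)
 have D: "L2 M12 (\<lambda>z. F z - ?T z)"
  by (rule L2_diff[OF F T])
 have iF: "integrable M2 (\<lambda>y. \<integral>x. (F (x, y))\<^sup>2 \<partial>M1)" by (rule integral_power2_pair(2)[OF F])
 have i1: "integrable M2 (\<lambda>y. (?c i y)\<^sup>2)" if "i \<in> A" for i
  using cc[OF that] by (simp add: square_integrable_def)
 have i2: "integrable M2 (\<lambda>y. (c i y - ?c i y)\<^sup>2)" if "i \<in> A" for i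
  using L2_diff[OF c[OF that] cc[OF that]] by (simp add: square_integrable_def)
 have "(\<integral>z. (F z - ?T z)\<^sup>2 \<partial>M12) =
   (\<integral>y. (\<integral>x. (F (x, y) - ?T (x, y))\<^sup>2 \<partial>M1) \<partial>M2)"
  by (rule integral_power2_pair(1)[OF D])
 also have "\<dots> = (\<integral>y. ((\<integral>x. (F (x, y))\<^sup>2 \<partial>M1) - (\<Sum>i\<in>A. (?c i y)\<^sup>2)) + (\<Sum>i\<in>A. (c i y - ?c i y)\<^sup>2) \<partial>M2)"
 proof (rule integral_cong_AE)
  note [measurable] = L2D(1)[OF F] L2D(1)[OF T]
  show "(\<lambda>y. \<integral>x. (F (x, y) - ?T (x, y))\<^sup>2 \<partial>M1) \<in> borel_measurable M2" by measurable
  show "(\<lambda>y. ((\<integral>x. (F (x, y))\<^sup>2 \<partial>M1) - (\<Sum>i\<in>A. (?c i y)\<^sup>2)) + (\<Sum>i\<in>A. (c i y - ?c i y)\<^sup>2)) \<in> borel_measurable M2"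
   using c cc
   by (auto simp: square_integrable_def
     intro!: borel_measurable_diff borel_measurable_add borel_measurable_sum borel_measurable_power)
  show "AE y in M2. (\<integral>x. (F (x, y) - ?T (x, y))\<^sup>2 \<partial>M1) =
    ((\<integral>x. (F (x, y))\<^sup>2 \<partial>M1) - (\<Sum>i\<in>A. (?c i y)\<^sup>2)) + (\<Sum>i\<in>A. (c i y - ?c i y)\<^sup>2)"
   using AE_L2_slice2[OF F]
  proof eventually_elim
   case (elim y)
   show ?case
    using orthonormal_distance[OF A on elim, of "\<lambda>i. c i y"]
    by (simp add: coef_def mult.commute)
  qed
 qed
 also have "\<dots> = (\<integral>z. (F z)\<^sup>2 \<partial>M12) - (\<Sum>i\<in>A. \<integral>y. (?c i y)\<^sup>2 \<partial>M2)
    + (\<Sum>i\<in>A. \<integral>y. (c i y - ?c i y)\<^sup>2 \<partial>M2)"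
  using iF i1 i2 by (simp add: integral_power2_pair(1)[OF F])
 finally show ?thesis .
qed

end

section \<open>Singular values and approximation by functions of finite rank\<close>

lemma L2_count_space:
 "finite A \<Longrightarrow> L2 (count_space A) f"
 by (simp add: square_integrable_def integrable_count_space)

text \<open>Gram--Schmidt in \<open>\<real>\<^sup>A\<close>; vectors that depend on earlier ones contribute no new direction.\<close>
lemma Gram_Schmidt_finite:
 fixes w :: "'s \<Rightarrow> 'c \<Rightarrow> real"
 assumes "finite A" "finite S"
 shows "\<exists>T\<subseteq>S. \<exists>e. (\<forall>b\<in>T. \<forall>c\<in>T. (\<Sum>i\<in>A. e b i * e c i) = (if b = c then 1 else 0)) \<and>
   (\<forall>b\<in>S. \<exists>a. \<forall>i\<in>A. w b i = (\<Sum>c\<in>T. a c * e c i))"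
 using \<open>finite S\<close>
proof (induction S)
 case empty
 then show ?case by auto
next
 case (insert b S)
 then obtain T e where T: "T \<subseteq> S" "\<And>b c. b \<in> T \<Longrightarrow> c \<in> T \<Longrightarrow> (\<Sum>i\<in>A. e b i * e c i) = (if b = c then 1 else 0)"
   "\<And>b. b \<in> S \<Longrightarrow> \<exists>a. \<forall>i\<in>A. w b i = (\<Sum>c\<in>T. a c * e c i)" by blast
 have fT: "finite T" using T(1) insert.hyps finite_subset by auto
 have bT: "b \<notin> T" using T(1) insert.hyps by auto
 define p where "p c = (\<Sum>i\<in>A. w b i * e c i)" for c
 define r where "r i = w b i - (\<Sum>c\<in>T. p c * e c i)" for i
 have orth: "(\<Sum>i\<in>A. r i * e d i) = 0" if "d \<in> T" for d
 proof -
  have "(\<Sum>i\<in>A. r i * e d i) = p d - (\<Sum>i\<in>A. \<Sum>c\<in>T. p c * (e c i * e d i))"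
   by (simp add: r_def left_diff_distrib sum_subtractf p_def sum_distrib_right mult.assoc)
  also have "(\<Sum>i\<in>A. \<Sum>c\<in>T. p c * (e c i * e d i)) = (\<Sum>c\<in>T. p c * (\<Sum>i\<in>A. e c i * e d i))"
   by (subst sum.swap) (simp add: sum_distrib_left)
  also have "\<dots> = (\<Sum>c\<in>T. if c = d then p d else 0)"
   by (intro sum.cong) (auto simp: T(2) that)
  finally show ?thesis using fT that by simp
 qed
 show ?case
 proof (cases "(\<Sum>i\<in>A. (r i)\<^sup>2) = 0")
  case True
  then have "\<forall>i\<in>A. r i = 0" using assms(1) by (simp add: sum_nonneg_eq_0_iff)
  then have "\<forall>i\<in>A. w b i = (\<Sum>c\<in>T. p c * e c i)" by (simp add: r_def)
  with T show ?thesis by (intro exI[of _ T] conjI exI[of _ e]) auto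
 next
  case False
  define n where "n = sqrt (\<Sum>i\<in>A. (r i)\<^sup>2)"
  have n: "n > 0" "n\<^sup>2 = (\<Sum>i\<in>A. (r i)\<^sup>2)"
   using False sum_nonneg[of A "\<lambda>i. (r i)\<^sup>2"] by (auto simp: n_def less_le)
  define e' where "e' = e(b := \<lambda>i. r i / n)"
  have e'T: "e' c = e c" if "c \<in> T" for c using that bT by (auto simp: e'_def)
  have e'b: "e' b i = r i / n" for i by (simp add: e'_def)
  have bb: "(\<Sum>i\<in>A. e' b i * e' b i) = 1"
   using n False by (simp add: e'b power2_eq_square[symmetric] power_divide sum_divide_distrib[symmetric])
  have bd: "(\<Sum>i\<in>A. e' b i * e' d i) = 0" if "d \<in> T" for d
   using orth[OF that] by (simp add: e'b e'T[OF that] sum_divide_distrib[symmetric])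
  have db: "(\<Sum>i\<in>A. e' d i * e' b i) = 0" if "d \<in> T" for d
   using bd[OF that] by (simp add: mult.commute)
  have on: "(\<Sum>i\<in>A. e' c i * e' d i) = (if c = d then 1 else 0)"
   if "c \<in> insert b T" "d \<in> insert b T" for c d
   using that bb bd db bT T(2) by (auto simp: e'T)
  have sp: "\<exists>a. \<forall>i\<in>A. w c i = (\<Sum>d\<in>insert b T. a d * e' d i)" if "c \<in> insert b S" for c
  proof (cases "c = b")
   case True
   have "w b i = (\<Sum>d\<in>insert b T. (if d = b then n else p d) * e' d i)" for i
   proof -
    have "(\<Sum>d\<in>insert b T. (if d = b then n else p d) * e' d i) = r i + (\<Sum>d\<in>T. p d * e d i)"
    proof -
     have "(\<Sum>d\<in>T. (if d = b then n else p d) * e' d i) = (\<Sum>d\<in>T. p d * e d i)"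
      by (rule sum.cong[OF refl]) (use bT e'T in auto)
     then show ?thesis using n(1) by (simp only: sum.insert[OF fT bT]) (simp add: e'b)
    qed
    then show ?thesis by (simp add: r_def)
   qed
   then have "\<forall>i\<in>A. w c i = (\<Sum>d\<in>insert b T. (if d = b then n else p d) * e' d i)"
    unfolding True by blast
   then show ?thesis by (rule exI[of _ "\<lambda>d. if d = b then n else p d"])
  next
   case False
   then obtain a where a: "\<And>i. i \<in> A \<Longrightarrow> w c i = (\<Sum>d\<in>T. a d * e d i)"
    using T(3) \<open>c \<in> insert b S\<close> by blast
   have "w c i = (\<Sum>d\<in>insert b T. (if d = b then 0 else a d) * e' d i)" if "i \<in> A" for i
   proof -
    have "(\<Sum>d\<in>T. a d * e d i) = (\<Sum>d\<in>T. (if d = b then 0 else a d) * e' d i)"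
     by (rule sum.cong[OF refl]) (use bT e'T in auto)
    then show ?thesis using a[OF that] by (simp only: sum.insert[OF fT bT]) simp
   qed
   then have "\<forall>i\<in>A. w c i = (\<Sum>d\<in>insert b T. (if d = b then 0 else a d) * e' d i)"
    by (rule ballI)
   then show ?thesis by (rule exI[of _ "\<lambda>d. if d = b then 0 else a d"])
  qed
  have sub: "insert b T \<subseteq> insert b S" using T(1) by blast
  show ?thesis
   by (rule exI[of _ "insert b T"], rule conjI[OF sub], rule exI[of _ e'], intro conjI ballI on sp)
 qed
qed

text \<open>Moving the mass to the \<open>r\<close> largest terms, which can hold all of it, does not decrease the sum.\<close>
lemma weighted_sum_le_top_sum:
 fixes lam w :: "nat \<Rightarrow> real"
 assumes lam: "\<And>\<alpha>. \<alpha> \<ge> 1 \<Longrightarrow> 0 \<le> lam (Suc \<alpha>)" "\<And>\<alpha>. \<alpha> \<ge> 1 \<Longrightarrow> lam (Suc \<alpha>) \<le> lam \<alpha>"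
  and w: "\<And>\<alpha>. 0 \<le> w \<alpha>" "\<And>\<alpha>. \<alpha> \<in> {1..N} \<Longrightarrow> w \<alpha> \<le> 1" and mass: "(\<Sum>\<alpha>=1..N. w \<alpha>) \<le> real r" and "r \<le> N"
 shows "(\<Sum>\<alpha>=1..N. lam \<alpha> * w \<alpha>) \<le> (\<Sum>\<alpha>=1..r. lam \<alpha>)"
proof -
 have mono: "lam b \<le> lam a" if "1 \<le> a" "a \<le> b" for a b
  using \<open>a \<le> b\<close> by (induction b rule: dec_induct) (use lam(2) that(1) in \<open>auto intro: order_trans\<close>)
 have nn: "0 \<le> lam (Suc r)" using lam(1)[of r] lam(1)[of 1] lam(2)[of 1] by (cases r) auto
 have split: "{1..N} = {1..r} \<union> {Suc r..N}" using \<open>r \<le> N\<close> by auto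
 have sp: "(\<Sum>\<alpha>=1..N. g \<alpha>) = (\<Sum>\<alpha>=1..r. g \<alpha>) + (\<Sum>\<alpha>=Suc r..N. g \<alpha>)" for g :: "nat \<Rightarrow> real"
  unfolding split by (rule sum.union_disjoint) auto
 have "(\<Sum>\<alpha>=Suc r..N. lam \<alpha> * w \<alpha>) \<le> (\<Sum>\<alpha>=Suc r..N. lam (Suc r) * w \<alpha>)"
  by (intro sum_mono mult_right_mono mono w) auto
 also have "\<dots> = lam (Suc r) * (\<Sum>\<alpha>=Suc r..N. w \<alpha>)" by (simp add: sum_distrib_left)
 also have "\<dots> \<le> lam (Suc r) * (real r - (\<Sum>\<alpha>=1..r. w \<alpha>))"
  using mass nn sp[of w] by (intro mult_left_mono) auto
 also have "\<dots> = (\<Sum>\<alpha>=1..r. lam (Suc r) * (1 - w \<alpha>))"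
  by (simp add: sum_distrib_left[symmetric] sum_subtractf)
 also have "\<dots> \<le> (\<Sum>\<alpha>=1..r. lam \<alpha> * (1 - w \<alpha>))"
  using \<open>r \<le> N\<close> by (intro sum_mono mult_right_mono mono) (auto simp: w)
 finally have "(\<Sum>\<alpha>=Suc r..N. lam \<alpha> * w \<alpha>) \<le> (\<Sum>\<alpha>=1..r. lam \<alpha>) - (\<Sum>\<alpha>=1..r. lam \<alpha> * w \<alpha>)"
  by (simp add: right_diff_distrib sum_subtractf)
 then show ?thesis using sp[of "\<lambda>\<alpha>. lam \<alpha> * w \<alpha>"] by linarith
qed

context finite_pair begin

lemma tensor_Bessel:
 assumes A: "finite A" "\<And>i. i \<in> A \<Longrightarrow> L2 M1 (\<phi> i)"
  and on: "\<And>i j. i \<in> A \<Longrightarrow> j \<in> A \<Longrightarrow> (\<integral>x. \<phi> i x * \<phi> j x \<partial>M1) = (if i = j then 1 else 0)"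
  and F: "L2 M12 F"
 shows "(\<Sum>i\<in>A. \<integral>y. (coef F (\<phi> i) y)\<^sup>2 \<partial>M2) \<le> (\<integral>z. (F z)\<^sup>2 \<partial>M12)"
proof -
 have "0 \<le> (\<integral>z. (F z - (\<Sum>i\<in>A. \<phi> i (fst z) * coef F (\<phi> i) (snd z)))\<^sup>2 \<partial>M12)" by simp
 then show ?thesis
  by (subst (asm) tensor_expansion_distance[OF A on F coef_L2(1)[OF F A(2)]]) auto
qed

lemma coef_residual:
 assumes F: "L2 M12 F" and g: "L2 M1 g"
  and S: "\<And>b. b \<in> S \<Longrightarrow> L2 M1 (\<psi> b)"
 shows "AE y in M2. coef (\<lambda>z. F z - (\<Sum>b\<in>S. \<psi> b (fst z) * G b (snd z))) g y =
   coef F g y - (\<Sum>b\<in>S. (\<integral>x. \<psi> b x * g x \<partial>M1) * G b y)"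
 using AE_L2_slice2[OF F]
proof eventually_elim
 case (elim y)
 have i1: "integrable M1 (\<lambda>x. F (x, y) * g x)" by (rule L2_mult[OF elim g])
 have i2: "integrable M1 (\<lambda>x. \<psi> b x * g x)" if "b \<in> S" for b
  by (rule L2_mult[OF S[OF that] g])
 have "(\<lambda>x. (F (x, y) - (\<Sum>b\<in>S. \<psi> b x * G b y)) * g x) =
   (\<lambda>x. F (x, y) * g x - (\<Sum>b\<in>S. G b y * (\<psi> b x * g x)))"
  by (rule ext, simp only: left_diff_distrib sum_distrib_right, intro arg_cong2[where f = "(-)"] refl sum.cong) simp
 then show ?case
  using i1 i2 by (simp add: coef_def mult.commute)
qed

end

text \<open>The eigensystem is that of \<open>A\<^sup>*A\<close> for \<open>A = coef F\<close>; so the \<open>lam \<alpha>\<close> are the squared singular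
 values of \<open>F\<close>.\<close>
locale eigen_pair = finite_pair +
 fixes F :: "'a \<times> 'b \<Rightarrow> real" and \<kappa> :: "'a \<Rightarrow> 'a \<Rightarrow> real" and lam :: "nat \<Rightarrow> real"
  and \<phi> :: "nat \<Rightarrow> 'a \<Rightarrow> real"
 assumes F: "L2 M12 F"
  and kernel: "\<And>x x'. x \<in> space M1 \<Longrightarrow> x' \<in> space M1 \<Longrightarrow> \<kappa> x x' = (\<integral>y. F (x, y) * F (x', y) \<partial>M2)"
  and es: "eigensystem M1 \<kappa> lam \<phi>"
begin

lemma phi_L2: "\<alpha> \<ge> 1 \<Longrightarrow> L2 M1 (\<phi> \<alpha>)"
 and phi_orthonormal: "\<alpha> \<ge> 1 \<Longrightarrow> \<beta> \<ge> 1 \<Longrightarrow> (\<integral>x. \<phi> \<alpha> x * \<phi> \<beta> x \<partial>M1) = (if \<alpha> = \<beta> then 1 else 0)"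
 and lam_nonneg_Suc: "\<alpha> \<ge> 1 \<Longrightarrow> 0 \<le> lam (Suc \<alpha>)"
 and lam_mono: "\<alpha> \<ge> 1 \<Longrightarrow> lam (Suc \<alpha>) \<le> lam \<alpha>"
 using es by (auto simp: eigensystem_def)

lemma lam_nonneg: "\<alpha> \<ge> 1 \<Longrightarrow> 0 \<le> lam \<alpha>"
 using lam_nonneg_Suc lam_mono by (meson order_trans)

lemma coef_phi_L2: "\<alpha> \<ge> 1 \<Longrightarrow> L2 M2 (coef F (\<phi> \<alpha>))"
 by (rule coef_L2(1)[OF F phi_L2])

text \<open>The inner product of two images under \<open>A\<close> is that of one function with the image of the other under
 \<open>A\<^sup>*A\<close>.\<close>
lemma coef_phi_orthogonal:
 assumes "\<alpha> \<ge> 1" "\<beta> \<ge> 1"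
 shows "(\<integral>y. coef F (\<phi> \<alpha>) y * coef F (\<phi> \<beta>) y \<partial>M2) = (if \<alpha> = \<beta> then lam \<alpha> else 0)"
proof -
 note [measurable] = phi_L2[OF assms(1), THEN L2D(1)]
  phi_L2[OF assms(2), THEN L2D(1)] L2D(1)[OF F]
 have "(\<integral>y. coef F (\<phi> \<alpha>) y * coef F (\<phi> \<beta>) y \<partial>M2) = (\<integral>x. \<phi> \<alpha> x * integral_op M1 \<kappa> (\<phi> \<beta>) x \<partial>M1)"
  by (rule integral_coef_coef[OF F]) (use assms phi_L2 kernel in auto)
 also have "\<dots> = (\<integral>x. lam \<beta> * (\<phi> \<alpha> x * \<phi> \<beta> x) \<partial>M1)"
 proof (rule integral_cong_AE)
  have k: "(\<lambda>x. \<phi> \<alpha> x * integral_op M1 \<kappa> (\<phi> \<beta>) x) \<in> borel_measurable M1 \<longleftrightarrow>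
    (\<lambda>x. \<phi> \<alpha> x * (\<integral>x'. (\<integral>y. F (x, y) * F (x', y) \<partial>M2) * \<phi> \<beta> x' \<partial>M1)) \<in> borel_measurable M1"
   unfolding integral_op_def
   by (intro measurable_cong arg_cong2[where f = "(*)"] refl Bochner_Integration.integral_cong) (simp add: kernel)
  show "(\<lambda>x. \<phi> \<alpha> x * integral_op M1 \<kappa> (\<phi> \<beta>) x) \<in> borel_measurable M1"
   unfolding k by measurable
  show "(\<lambda>x. lam \<beta> * (\<phi> \<alpha> x * \<phi> \<beta> x)) \<in> borel_measurable M1" by measurable
  have "AE x in M1. integral_op M1 \<kappa> (\<phi> \<beta>) x = lam \<beta> * \<phi> \<beta> x"
   using es assms(2) by (auto simp: eigensystem_def)
  then show "AE x in M1. \<phi> \<alpha> x * integral_op M1 \<kappa> (\<phi> \<beta>) x = lam \<beta> * (\<phi> \<alpha> x * \<phi> \<beta> x)"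
   by eventually_elim simp
 qed
 also have "\<dots> = (if \<alpha> = \<beta> then lam \<alpha> else 0)"
  using phi_orthonormal[OF assms] by simp
 finally show ?thesis .
qed

lemma integral_coef_phi_power2: "\<alpha> \<ge> 1 \<Longrightarrow> (\<integral>y. (coef F (\<phi> \<alpha>) y)\<^sup>2 \<partial>M2) = lam \<alpha>"
 using coef_phi_orthogonal[of \<alpha> \<alpha>] by (simp add: power2_eq_square)

lemma sum_lam_le: "(\<Sum>\<alpha>=1..N. lam \<alpha>) \<le> (\<integral>z. (F z)\<^sup>2 \<partial>M12)"
proof -
 have "(\<Sum>\<alpha>=1..N. \<integral>y. (coef F (\<phi> \<alpha>) y)\<^sup>2 \<partial>M2) \<le> (\<integral>z. (F z)\<^sup>2 \<partial>M12)"
  by (rule tensor_Bessel[OF finite_atLeastAtMost phi_L2 phi_orthonormal F]) simp_all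
 then show ?thesis by (simp add: integral_coef_phi_power2)
qed

text \<open>Testing the residual against \<open>\<phi> 1, \<dots>, \<phi> N\<close> turns the problem into one about vectors in
 \<open>\<real>\<^sup>N\<close>, where subtracting a rank \<open>r\<close> function moves the coefficient vector inside a fixed subspace
 of dimension at most \<open>r\<close>.\<close>
theorem finite_rank_lower_bound:
 assumes S: "finite S" "card S \<le> r"
  and \<psi>: "\<And>b. b \<in> S \<Longrightarrow> L2 M1 (\<psi> b)"
  and G: "\<And>b. b \<in> S \<Longrightarrow> L2 M2 (G b)"
  and "r \<le> N"
 shows "(\<Sum>\<alpha>=Suc r..N. lam \<alpha>) \<le>
  (\<integral>z. (F z - (\<Sum>b\<in>S. \<psi> b (fst z) * G b (snd z)))\<^sup>2 \<partial>M12)"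
proof -
 let ?H = "\<lambda>z. F z - (\<Sum>b\<in>S. \<psi> b (fst z) * G b (snd z))"
 define w where "w b \<alpha> = (\<integral>x. \<psi> b x * \<phi> \<alpha> x \<partial>M1)" for b \<alpha>
 define A where "A = {1..N}"
 have fA: "finite A" by (simp add: A_def)
 obtain T e where T: "T \<subseteq> S"
   and on0: "\<forall>b\<in>T. \<forall>c\<in>T. (\<Sum>i\<in>A. e b i * e c i) = (if b = c then 1 else 0)"
   and sp: "\<forall>b\<in>S. \<exists>a. \<forall>i\<in>A. w b i = (\<Sum>c\<in>T. a c * e c i)"
  using Gram_Schmidt_finite[OF fA S(1), of w] by (elim exE conjE) (rule that)
 note on = on0[rule_format]
 have fT: "finite T" using T S(1) finite_subset by auto
 have on': "(\<integral>i. e b i * e c i \<partial>count_space A) = (if b = c then 1 else 0)" if "b \<in> T" "c \<in> T" for b c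
  using on[OF that] fA by (simp add: lebesgue_integral_count_space_finite)
 obtain a where a0: "\<forall>b\<in>S. \<forall>i\<in>A. w b i = (\<Sum>c\<in>T. a b c * e c i)"
  using bchoice[OF sp] by (elim exE) (rule that)
 note a = a0[rule_format]
 have H: "L2 M12 ?H"
  by (intro L2_diff[OF F] L2_sum L2_tensor \<psi> G)
 let ?c = "\<lambda>\<alpha>. coef F (\<phi> \<alpha>)"
 have cs: "L2 M2 (?c \<alpha>)" if "\<alpha> \<in> A" for \<alpha>
  using that coef_phi_L2 by (simp add: A_def)
 have phis: "L2 M1 (\<phi> \<alpha>)" if "\<alpha> \<in> A" for \<alpha>
  using that phi_L2 by (simp add: A_def)
 have phion: "(\<integral>x. \<phi> \<alpha> x * \<phi> \<beta> x \<partial>M1) = (if \<alpha> = \<beta> then 1 else 0)" if "\<alpha> \<in> A" "\<beta> \<in> A" for \<alpha> \<beta>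
  using that by (intro phi_orthonormal) (simp_all add: A_def)
 have hs: "L2 M2 (coef ?H (\<phi> \<alpha>))" if "\<alpha> \<in> A" for \<alpha>
  by (rule coef_L2(1)[OF H phis[OF that]])
 have pt: "AE y in M2. (\<Sum>\<alpha>\<in>A. (?c \<alpha> y)\<^sup>2) - (\<Sum>t\<in>T. (\<Sum>\<alpha>\<in>A. ?c \<alpha> y * e t \<alpha>)\<^sup>2) \<le> (\<Sum>\<alpha>\<in>A. (coef ?H (\<phi> \<alpha>) y)\<^sup>2)"
 proof -
  have "AE y in M2. \<forall>\<alpha>\<in>A. coef ?H (\<phi> \<alpha>) y = ?c \<alpha> y - (\<Sum>b\<in>S. w b \<alpha> * G b y)"
   unfolding w_def by (rule AE_finite_allI[OF fA]) (rule coef_residual[OF F phis \<psi>])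
  then show ?thesis
  proof eventually_elim
   case (elim y)
   have "(\<Sum>b\<in>S. w b \<alpha> * G b y) = (\<Sum>t\<in>T. (\<Sum>b\<in>S. a b t * G b y) * e t \<alpha>)" if "\<alpha> \<in> A" for \<alpha>
   proof -
    have "(\<Sum>b\<in>S. w b \<alpha> * G b y) = (\<Sum>b\<in>S. \<Sum>t\<in>T. a b t * G b y * e t \<alpha>)"
    proof (rule sum.cong[OF refl])
     fix b assume "b \<in> S"
     show "w b \<alpha> * G b y = (\<Sum>t\<in>T. a b t * G b y * e t \<alpha>)"
      unfolding a[OF \<open>b \<in> S\<close> that] sum_distrib_right by (simp add: mult_ac)
    qed
    also have "\<dots> = (\<Sum>t\<in>T. \<Sum>b\<in>S. a b t * G b y * e t \<alpha>)" by (rule sum.swap)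
    finally show ?thesis unfolding sum_distrib_right .
   qed
   then have "(\<Sum>\<alpha>\<in>A. (coef ?H (\<phi> \<alpha>) y)\<^sup>2) =
     (\<Sum>\<alpha>\<in>A. (?c \<alpha> y - (\<Sum>t\<in>T. (\<Sum>b\<in>S. a b t * G b y) * e t \<alpha>))\<^sup>2)"
    using elim by (intro sum.cong refl) simp
   also have "\<dots> = (\<integral>\<alpha>. (?c \<alpha> y - (\<Sum>t\<in>T. (\<Sum>b\<in>S. a b t * G b y) * e t \<alpha>))\<^sup>2 \<partial>count_space A)"
    using fA by (simp add: lebesgue_integral_count_space_finite)
   also have "\<dots> \<ge> (\<Sum>\<alpha>\<in>A. (?c \<alpha> y)\<^sup>2) - (\<Sum>t\<in>T. (\<Sum>\<alpha>\<in>A. ?c \<alpha> y * e t \<alpha>)\<^sup>2)"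
    using fA
    by (subst orthonormal_distance[OF fT L2_count_space[OF fA] on' L2_count_space[OF fA]])
      (auto simp: lebesgue_integral_count_space_finite intro: sum_nonneg)
   finally show ?case by simp
  qed
 qed
 have ic: "integrable M2 (\<lambda>y. (?c \<alpha> y)\<^sup>2)" if "\<alpha> \<in> A" for \<alpha>
  using cs[OF that] by (simp add: square_integrable_def)
 have comm: "(\<Sum>\<alpha>\<in>A. ?c \<alpha> y * e t \<alpha>) = (\<Sum>\<alpha>\<in>A. e t \<alpha> * ?c \<alpha> y)" for t y
  by (intro sum.cong refl mult.commute)
 have ce: "L2 M2 (\<lambda>y. \<Sum>\<alpha>\<in>A. ?c \<alpha> y * e t \<alpha>)" for t
 proof -
  have "L2 M2 (\<lambda>y. \<Sum>\<alpha>\<in>A. e t \<alpha> * ?c \<alpha> y)"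
   by (intro L2_sum L2_cmult cs)
  then show ?thesis unfolding comm .
 qed
 have ice: "(\<integral>y. (\<Sum>\<alpha>\<in>A. ?c \<alpha> y * e t \<alpha>)\<^sup>2 \<partial>M2) = (\<Sum>\<alpha>\<in>A. lam \<alpha> * (e t \<alpha>)\<^sup>2)" for t
 proof -
  have "(\<integral>y. (\<Sum>\<alpha>\<in>A. e t \<alpha> * ?c \<alpha> y)\<^sup>2 \<partial>M2) =
    (\<Sum>\<alpha>\<in>A. \<Sum>\<beta>\<in>A. \<integral>y. (e t \<alpha> * ?c \<alpha> y) * (e t \<beta> * ?c \<beta> y) \<partial>M2)"
   by (intro integral_power2_sum fA L2_cmult cs)
  also have "\<dots> = (\<Sum>\<alpha>\<in>A. \<Sum>\<beta>\<in>A. if \<alpha> = \<beta> then lam \<alpha> * (e t \<alpha>)\<^sup>2 else 0)"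
  proof (intro sum.cong refl)
   fix \<alpha> \<beta> assume "\<alpha> \<in> A" "\<beta> \<in> A"
   have "(\<integral>y. (e t \<alpha> * ?c \<alpha> y) * (e t \<beta> * ?c \<beta> y) \<partial>M2) =
     (\<integral>y. (e t \<alpha> * e t \<beta>) * (?c \<alpha> y * ?c \<beta> y) \<partial>M2)" by (simp add: mult_ac)
   also have "\<dots> = (e t \<alpha> * e t \<beta>) * (\<integral>y. ?c \<alpha> y * ?c \<beta> y \<partial>M2)" by simp
   also have "\<dots> = (if \<alpha> = \<beta> then lam \<alpha> * (e t \<alpha>)\<^sup>2 else 0)"
    using \<open>\<alpha> \<in> A\<close> \<open>\<beta> \<in> A\<close> by (subst coef_phi_orthogonal) (auto simp: A_def power2_eq_square)
   finally show "(\<integral>y. (e t \<alpha> * ?c \<alpha> y) * (e t \<beta> * ?c \<beta> y) \<partial>M2) =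
     (if \<alpha> = \<beta> then lam \<alpha> * (e t \<alpha>)\<^sup>2 else 0)" .
  qed
  also have "\<dots> = (\<Sum>\<alpha>\<in>A. lam \<alpha> * (e t \<alpha>)\<^sup>2)" using fA by simp
  finally show ?thesis unfolding comm .
 qed
 have i3: "integrable M2 (\<lambda>y. \<Sum>\<alpha>\<in>A. (?c \<alpha> y)\<^sup>2)"
  "integrable M2 (\<lambda>y. \<Sum>t\<in>T. (\<Sum>\<alpha>\<in>A. ?c \<alpha> y * e t \<alpha>)\<^sup>2)"
  "integrable M2 (\<lambda>y. \<Sum>\<alpha>\<in>A. (coef ?H (\<phi> \<alpha>) y)\<^sup>2)"
  by (intro Bochner_Integration.integrable_sum ic L2D(2)[OF ce] L2D(2)[OF hs]; assumption)+
 define W where "W \<alpha> = (\<Sum>t\<in>T. (e t \<alpha>)\<^sup>2)" for \<alpha>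
 have W1: "W \<alpha> \<le> 1" if "\<alpha> \<in> A" for \<alpha>
 proof -
  define d where "d i = (if i = \<alpha> then 1 else 0 :: real)" for i
  have "(\<Sum>t\<in>T. (\<integral>i. d i * e t i \<partial>count_space A)\<^sup>2) \<le> (\<integral>i. (d i)\<^sup>2 \<partial>count_space A)"
   by (rule Bessel_inequality[OF fT L2_count_space[OF fA] on' L2_count_space[OF fA]])
  moreover have "(\<integral>i. d i * e t i \<partial>count_space A) = e t \<alpha>" for t
  proof -
   have "(\<integral>i. d i * e t i \<partial>count_space A) = (\<Sum>i\<in>A. if i = \<alpha> then e t i else 0)"
    unfolding lebesgue_integral_count_space_finite[OF fA] by (intro sum.cong) (auto simp: d_def)
   then show ?thesis using fA that by simp
  qed
  moreover have "(\<integral>i. (d i)\<^sup>2 \<partial>count_space A) = 1"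
  proof -
   have "(\<integral>i. (d i)\<^sup>2 \<partial>count_space A) = (\<Sum>i\<in>A. if i = \<alpha> then 1 else 0)"
    unfolding lebesgue_integral_count_space_finite[OF fA] by (intro sum.cong) (auto simp: d_def)
   then show ?thesis using fA that by simp
  qed
  ultimately show ?thesis by (simp add: W_def)
 qed
 have W2: "(\<Sum>\<alpha>\<in>A. W \<alpha>) \<le> real r"
 proof -
  have "(\<Sum>\<alpha>\<in>A. W \<alpha>) = (\<Sum>t\<in>T. \<Sum>\<alpha>\<in>A. e t \<alpha> * e t \<alpha>)"
   unfolding W_def power2_eq_square by (rule sum.swap)
  also have "\<dots> = real (card T)" by (simp add: on)
  finally show ?thesis using card_mono[OF S(1) T] S(2) by simp
 qed
 have "(\<Sum>\<alpha>\<in>A. lam \<alpha>) - (\<Sum>t\<in>T. \<Sum>\<alpha>\<in>A. lam \<alpha> * (e t \<alpha>)\<^sup>2)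
   = (\<integral>y. (\<Sum>\<alpha>\<in>A. (?c \<alpha> y)\<^sup>2) - (\<Sum>t\<in>T. (\<Sum>\<alpha>\<in>A. ?c \<alpha> y * e t \<alpha>)\<^sup>2) \<partial>M2)"
 proof -
  have "(\<integral>y. (\<Sum>\<alpha>\<in>A. (?c \<alpha> y)\<^sup>2) \<partial>M2) = (\<Sum>\<alpha>\<in>A. \<integral>y. (?c \<alpha> y)\<^sup>2 \<partial>M2)"
   by (rule Bochner_Integration.integral_sum) (rule ic)
  also have "\<dots> = (\<Sum>\<alpha>\<in>A. lam \<alpha>)"
   by (intro sum.cong refl integral_coef_phi_power2) (simp add: A_def)
  finally have p: "(\<integral>y. (\<Sum>\<alpha>\<in>A. (?c \<alpha> y)\<^sup>2) \<partial>M2) = (\<Sum>\<alpha>\<in>A. lam \<alpha>)" .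
  have "(\<integral>y. (\<Sum>t\<in>T. (\<Sum>\<alpha>\<in>A. ?c \<alpha> y * e t \<alpha>)\<^sup>2) \<partial>M2) = (\<Sum>t\<in>T. \<Sum>\<alpha>\<in>A. lam \<alpha> * (e t \<alpha>)\<^sup>2)"
   using ce by (subst Bochner_Integration.integral_sum) (simp_all only: ice square_integrable_def)
  with p show ?thesis
   using i3 by (subst Bochner_Integration.integral_diff) simp_all
 qed
 also have "\<dots> \<le> (\<integral>y. (\<Sum>\<alpha>\<in>A. (coef ?H (\<phi> \<alpha>) y)\<^sup>2) \<partial>M2)"
  by (rule integral_mono_AE[OF Bochner_Integration.integrable_diff[OF i3(1,2)] i3(3) pt])
 also have "\<dots> = (\<Sum>\<alpha>\<in>A. \<integral>y. (coef ?H (\<phi> \<alpha>) y)\<^sup>2 \<partial>M2)"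
  by (rule Bochner_Integration.integral_sum) (rule L2D(2)[OF hs])
 also have "\<dots> \<le> (\<integral>z. (?H z)\<^sup>2 \<partial>M12)"
  by (rule tensor_Bessel[OF fA phis phion H])
 finally have 1: "(\<Sum>\<alpha>\<in>A. lam \<alpha>) - (\<Sum>t\<in>T. \<Sum>\<alpha>\<in>A. lam \<alpha> * (e t \<alpha>)\<^sup>2) \<le> (\<integral>z. (?H z)\<^sup>2 \<partial>M12)" .
 have "(\<Sum>t\<in>T. \<Sum>\<alpha>\<in>A. lam \<alpha> * (e t \<alpha>)\<^sup>2) = (\<Sum>\<alpha>\<in>A. lam \<alpha> * W \<alpha>)"
 proof -
  have "(\<Sum>t\<in>T. \<Sum>\<alpha>\<in>A. lam \<alpha> * (e t \<alpha>)\<^sup>2) = (\<Sum>\<alpha>\<in>A. \<Sum>t\<in>T. lam \<alpha> * (e t \<alpha>)\<^sup>2)"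
   by (rule sum.swap)
  then show ?thesis unfolding W_def sum_distrib_left .
 qed
 also have "\<dots> \<le> (\<Sum>\<alpha>=1..r. lam \<alpha>)"
  unfolding A_def
 proof (rule weighted_sum_le_top_sum[where lam = lam and w = W and N = N and r = r])
  show "0 \<le> W \<alpha>" for \<alpha> by (simp add: W_def sum_nonneg)
  show "W \<alpha> \<le> 1" if "\<alpha> \<in> {1..N}" for \<alpha> using that unfolding A_def[symmetric] by (rule W1)
  show "(\<Sum>\<alpha>=1..N. W \<alpha>) \<le> real r" using W2 unfolding A_def .
 qed (use \<open>r \<le> N\<close> in \<open>simp_all add: lam_nonneg_Suc lam_mono\<close>)
 finally have 2: "(\<Sum>t\<in>T. \<Sum>\<alpha>\<in>A. lam \<alpha> * (e t \<alpha>)\<^sup>2) \<le> (\<Sum>\<alpha>=1..r. lam \<alpha>)" .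
 have "{1..N} = {1..r} \<union> {Suc r..N}" using \<open>r \<le> N\<close> by auto
 then have "(\<Sum>\<alpha>\<in>A. lam \<alpha>) = (\<Sum>\<alpha>=1..r. lam \<alpha>) + (\<Sum>\<alpha>=Suc r..N. lam \<alpha>)"
  unfolding A_def by (simp add: sum.union_disjoint)
 with 1 2 show ?thesis by linarith
qed

end

text \<open>Bessel's inequality makes the squared coefficients summable, so the partial sums have a fast Cauchy
 subsequence; Pythagoras' theorem extends its convergence to the whole sequence.\<close>
lemma (in finite_measure) orthonormal_series_limit:
 fixes \<phi> :: "nat \<Rightarrow> 'a \<Rightarrow> real"
 assumes \<phi>: "\<And>\<alpha>. \<alpha> \<ge> 1 \<Longrightarrow> L2 M (\<phi> \<alpha>)"
  and on: "\<And>\<alpha> \<beta>. \<alpha> \<ge> 1 \<Longrightarrow> \<beta> \<ge> 1 \<Longrightarrow> (\<integral>x. \<phi> \<alpha> x * \<phi> \<beta> x \<partial>M) = (if \<alpha> = \<beta> then 1 else 0)"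
  and g: "L2 M g"
 defines "a \<equiv> \<lambda>\<alpha>. \<integral>x. g x * \<phi> \<alpha> x \<partial>M"
 shows "\<exists>s. L2 M s \<and> (\<forall>\<alpha>\<ge>1. (\<integral>x. s x * \<phi> \<alpha> x \<partial>M) = a \<alpha>) \<and>
   (\<lambda>N. \<integral>x. (s x - (\<Sum>\<alpha>=1..N. a \<alpha> * \<phi> \<alpha> x))\<^sup>2 \<partial>M) \<longlonglongrightarrow> 0"
proof -
 define P where "P N x = (\<Sum>\<alpha>=1..N. a \<alpha> * \<phi> \<alpha> x)" for N x
 have P: "L2 M (P N)" for N
  unfolding P_def by (intro L2_sum L2_cmult \<phi>) simp
 have fin: "finite {1..N}" for N :: nat by simp
 have \<phi>': "L2 M (\<phi> \<alpha>)" if "\<alpha> \<in> {Suc m..N}" for \<alpha> m N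
  using that by (intro \<phi>) simp
 have on': "(\<integral>x. \<phi> \<alpha> x * \<phi> \<beta> x \<partial>M) = (if \<alpha> = \<beta> then 1 else 0)" if "\<alpha> \<in> {Suc m..N}" "\<beta> \<in> {Suc m..N}" for \<alpha> \<beta> m N
  using that by (intro on) simp_all
 have bes: "(\<Sum>\<alpha>=1..N. (a \<alpha>)\<^sup>2) \<le> (\<integral>x. (g x)\<^sup>2 \<partial>M)" for N
  unfolding a_def One_nat_def by (rule Bessel_inequality[OF finite_atLeastAtMost \<phi>' on' g])
 have sm: "summable (\<lambda>i. (a (Suc i))\<^sup>2)"
 proof (rule bounded_imp_summable)
  show "(\<Sum>k\<le>n. (a (Suc k))\<^sup>2) \<le> (\<integral>x. (g x)\<^sup>2 \<partial>M)" for n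
   using bes[of "Suc n"] unfolding lessThan_Suc_atMost[symmetric]
   by (simp add: sum.atLeast1_atMost_eq)
 qed simp
 have diff: "(\<integral>x. (P j x - P k x)\<^sup>2 \<partial>M) = (\<Sum>\<alpha>=Suc k..j. (a \<alpha>)\<^sup>2)" if "k \<le> j" for j k
 proof -
  have "{1..j} = {1..k} \<union> {Suc k..j}" using that by auto
  then have "P j x - P k x = (\<Sum>\<alpha>=Suc k..j. a \<alpha> * \<phi> \<alpha> x)" for x
   unfolding P_def by (simp add: sum.union_disjoint)
  moreover have "(\<integral>x. (\<Sum>\<alpha>=Suc k..j. a \<alpha> * \<phi> \<alpha> x)\<^sup>2 \<partial>M) = (\<Sum>\<alpha>=Suc k..j. (a \<alpha>)\<^sup>2)"
   by (rule orthonormal_sum_power2[OF finite_atLeastAtMost \<phi>' on'])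
  ultimately show ?thesis by simp
 qed
 have "\<exists>n. \<forall>N\<ge>n. \<forall>j\<ge>N. (\<Sum>\<alpha>=Suc N..j. (a \<alpha>)\<^sup>2) \<le> (1/4)^k" for k :: nat
 proof -
  obtain n where n: "\<And>m j. m \<ge> n \<Longrightarrow> norm (\<Sum>i\<in>{m..<j}. (a (Suc i))\<^sup>2) < (1/4)^k"
   using sm[unfolded summable_Cauchy, rule_format, of "(1/4)^k"] by auto
  have "(\<Sum>\<alpha>=Suc N..j. (a \<alpha>)\<^sup>2) \<le> (1/4)^k" if "N \<ge> n" for N j
  proof -
   have "(\<Sum>\<alpha>=Suc N..j. (a \<alpha>)\<^sup>2) = (\<Sum>i\<in>{N..<j}. (a (Suc i))\<^sup>2)"
    using sum.shift_bounds_Suc_ivl[of "\<lambda>\<alpha>. (a \<alpha>)\<^sup>2" N j] by (simp only: atLeastLessThanSuc_atLeastAtMost)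
   then show ?thesis using n[OF that, of j] by simp
  qed
  then show ?thesis by blast
 qed
 then have "\<forall>k. \<exists>n. \<forall>N\<ge>n. \<forall>j\<ge>N. (\<Sum>\<alpha>=Suc N..j. (a \<alpha>)\<^sup>2) \<le> (1/4)^k" by (rule allI)
 from choice[OF this] obtain n where n: "\<And>k N j. N \<ge> n k \<Longrightarrow> j \<ge> N \<Longrightarrow> (\<Sum>\<alpha>=Suc N..j. (a \<alpha>)\<^sup>2) \<le> (1/4)^k"
  by (elim exE) (rule that, elim allE impE)
 define N where "N k = k + (\<Sum>i\<le>k. n i)" for k
 have Nn: "n k \<le> N k" for k
  unfolding N_def using member_le_sum[of k "{..k}" n] by simp
 have Nm: "N k \<le> N j" if "k \<le> j" for k j
  unfolding N_def using that by (intro add_mono sum_mono2) auto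
 have Nk: "k \<le> N k" for k by (simp add: N_def)
 obtain s where s: "L2 M s" "\<And>k. (\<integral>x. (s x - P (N k) x)\<^sup>2 \<partial>M) \<le> (1/4)^k"
 proof -
  have "\<exists>s. L2 M s \<and> (\<forall>k. (\<integral>x. (s x - P (N k) x)\<^sup>2 \<partial>M) \<le> (1/4)^k)"
  proof (rule L2_limit_fast_Cauchy)
   show "L2 M (P (N k))" for k by (rule P)
   show "(\<integral>x. (P (N j) x - P (N k) x)\<^sup>2 \<partial>M) \<le> (1/4)^k" if "k \<le> j" for k j
    unfolding diff[OF Nm[OF that]] by (rule n[OF Nn Nm[OF that]])
  qed
  then show ?thesis using that by blast
 qed
 have Pc: "(\<integral>x. P m x * \<phi> \<alpha> x \<partial>M) = a \<alpha>" if "\<alpha> \<ge> 1" "\<alpha> \<le> m" for \<alpha> m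
 proof -
  have "(\<integral>x. P m x * \<phi> \<alpha> x \<partial>M) = (\<integral>x. (\<Sum>\<beta>=1..m. a \<beta> * (\<phi> \<beta> x * \<phi> \<alpha> x)) \<partial>M)"
   unfolding P_def sum_distrib_right by (simp add: mult.assoc)
  also have "\<dots> = (\<Sum>\<beta>=1..m. \<integral>x. a \<beta> * (\<phi> \<beta> x * \<phi> \<alpha> x) \<partial>M)"
   by (rule Bochner_Integration.integral_sum) (use that \<phi> in \<open>auto intro!: integrable_mult_right L2_mult\<close>)
  also have "\<dots> = (\<Sum>\<beta>=1..m. if \<beta> = \<alpha> then a \<alpha> else 0)"
   using that by (intro sum.cong refl) (simp add: on)
  also have "\<dots> = a \<alpha>" using that by simp
  finally show ?thesis .
 qed
 have sc: "(\<integral>x. s x * \<phi> \<alpha> x \<partial>M) = a \<alpha>" if \<alpha>: "\<alpha> \<ge> 1" for \<alpha>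
 proof -
  let ?t = "(\<integral>x. s x * \<phi> \<alpha> x \<partial>M) - a \<alpha>"
  have bd: "?t\<^sup>2 \<le> (1/4)^k" if "k \<ge> \<alpha>" for k
  proof -
   have sP: "L2 M (\<lambda>x. s x - P (N k) x)" by (rule L2_diff[OF s(1) P])
   have "\<alpha> \<le> N k" using that Nk[of k] by simp
   then have eq: "?t = (\<integral>x. (s x - P (N k) x) * \<phi> \<alpha> x \<partial>M)"
    using Pc[OF \<alpha>, of "N k"] L2_mult[OF s(1) \<phi>[OF \<alpha>]] L2_mult[OF P \<phi>[OF \<alpha>], of "N k"]
    by (simp add: left_diff_distrib)
   have "?t\<^sup>2 \<le> (\<integral>x. (s x - P (N k) x)\<^sup>2 \<partial>M) * (\<integral>x. (\<phi> \<alpha> x)\<^sup>2 \<partial>M)"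
    unfolding eq by (rule Cauchy_Schwarz_integral[OF sP \<phi>[OF \<alpha>]])
   also have "(\<integral>x. (\<phi> \<alpha> x)\<^sup>2 \<partial>M) = 1" using on[OF \<alpha> \<alpha>] by (simp add: power2_eq_square)
   finally show ?thesis using s(2)[of k] by simp
  qed
  have "(\<lambda>k. (1/4::real)^k) \<longlonglongrightarrow> 0" by (rule LIMSEQ_realpow_zero) auto
  then have "?t\<^sup>2 \<le> 0"
   by (rule tendsto_lowerbound) (use bd in \<open>auto simp: eventually_at_top_linorder\<close>)
  then show ?thesis by simp
 qed
 have dist: "(\<integral>x. (s x - P m x)\<^sup>2 \<partial>M) = (\<integral>x. (s x)\<^sup>2 \<partial>M) - (\<Sum>\<alpha>=1..m. (a \<alpha>)\<^sup>2)" for m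
 proof -
  have "(\<Sum>\<alpha>=1..m. (a \<alpha> - (\<integral>x. s x * \<phi> \<alpha> x \<partial>M))\<^sup>2) = 0"
   by (rule sum.neutral) (simp add: sc)
  moreover have "(\<Sum>\<alpha>=1..m. (\<integral>x. s x * \<phi> \<alpha> x \<partial>M)\<^sup>2) = (\<Sum>\<alpha>=1..m. (a \<alpha>)\<^sup>2)"
   by (rule sum.cong[OF refl]) (simp add: sc)
  ultimately show ?thesis
   unfolding P_def One_nat_def by (subst orthonormal_distance[OF finite_atLeastAtMost \<phi>' on' s(1)]) simp_all
 qed
 have lim: "(\<lambda>m. \<integral>x. (s x - P m x)\<^sup>2 \<partial>M) \<longlonglongrightarrow> 0"
 proof (rule LIMSEQ_I)
  fix e :: real assume "e > 0"
  then obtain k where k: "(1/4)^k < e" using real_arch_pow_inv[of e "1/4"] by auto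
  have "norm ((\<integral>x. (s x - P m x)\<^sup>2 \<partial>M) - 0) < e" if "m \<ge> N k" for m
  proof -
   have "(\<Sum>\<alpha>=1..N k. (a \<alpha>)\<^sup>2) \<le> (\<Sum>\<alpha>=1..m. (a \<alpha>)\<^sup>2)"
    using that by (intro sum_mono2) auto
   then have "(\<integral>x. (s x - P m x)\<^sup>2 \<partial>M) \<le> (\<integral>x. (s x - P (N k) x)\<^sup>2 \<partial>M)" by (simp add: dist)
   also have "\<dots> \<le> (1/4)^k" by (rule s(2))
   finally show ?thesis using k by simp
  qed
  then show "\<exists>no. \<forall>m\<ge>no. norm ((\<integral>x. (s x - P m x)\<^sup>2 \<partial>M) - 0) < e" by blast
 qed
 show ?thesis
  by (intro exI[of _ s] conjI s(1) allI impI sc lim[unfolded P_def])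
qed

context eigen_pair begin

text \<open>A function annihilated by all \<open>\<phi> \<alpha>\<close> lies in the null space of the integral operator
 \<open>A\<^sup>*A\<close>, hence in that of \<open>A = coef F\<close>.\<close>
lemma coef_eq_0_if_orthogonal:
 assumes g: "L2 M1 g" and orth: "\<And>\<alpha>. \<alpha> \<ge> 1 \<Longrightarrow> (\<integral>x. g x * \<phi> \<alpha> x \<partial>M1) = 0"
 shows "(\<integral>y. (coef F g y)\<^sup>2 \<partial>M2) = 0"
proof -
 have ae: "AE x in M1. integral_op M1 \<kappa> g x = 0"
  using es g orth by (simp add: eigensystem_def)
 have "(\<integral>y. (coef F g y)\<^sup>2 \<partial>M2) = (\<integral>y. coef F g y * coef F g y \<partial>M2)"
  by (simp add: power2_eq_square)
 also have "\<dots> = (\<integral>x. g x * integral_op M1 \<kappa> g x \<partial>M1)"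
  by (rule integral_coef_coef[OF F g g kernel])
 also have "\<dots> = 0"
  by (rule integral_eq_zero_AE) (use ae in eventually_elim, simp)
 finally show ?thesis .
qed

text \<open>Let \<open>s\<close> be the sum of the expansion of \<open>\<psi>\<close> in the \<open>\<phi> \<alpha>\<close>.  Then \<open>\<psi> - s\<close> is orthogonal to all of
 them and hence invisible to \<open>F\<close>, while \<open>s\<close> is approximated by the partial sums, which the residual
 annihilates.\<close>
lemma residual_tensor_tendsto_0:
 assumes \<psi>: "L2 M1 \<psi>" and c: "L2 M2 c"
 shows "(\<lambda>N. \<integral>z. (F z - (\<Sum>\<alpha>=1..N. \<phi> \<alpha> (fst z) * coef F (\<phi> \<alpha>) (snd z))) * (\<psi> (fst z) * c (snd z)) \<partial>M12) \<longlonglongrightarrow> 0"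
proof -
 define a where "a \<alpha> = (\<integral>x. \<psi> x * \<phi> \<alpha> x \<partial>M1)" for \<alpha>
 define P where "P N x = (\<Sum>\<alpha>=1..N. a \<alpha> * \<phi> \<alpha> x)" for N x
 define D where "D N z = F z - (\<Sum>\<alpha>=1..N. \<phi> \<alpha> (fst z) * coef F (\<phi> \<alpha>) (snd z))" for N z
 define E where "E = (\<integral>z. (F z)\<^sup>2 \<partial>M12)"
 obtain s where s: "L2 M1 s" "\<And>\<alpha>. \<alpha> \<ge> 1 \<Longrightarrow> (\<integral>x. s x * \<phi> \<alpha> x \<partial>M1) = a \<alpha>"
  "(\<lambda>N. \<integral>x. (s x - P N x)\<^sup>2 \<partial>M1) \<longlonglongrightarrow> 0"
 proof -
  have "\<exists>s. L2 M1 s \<and> (\<forall>\<alpha>\<ge>1. (\<integral>x. s x * \<phi> \<alpha> x \<partial>M1) = a \<alpha>) \<and>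
    (\<lambda>N. \<integral>x. (s x - P N x)\<^sup>2 \<partial>M1) \<longlonglongrightarrow> 0"
   unfolding P_def a_def
   by (rule M1.orthonormal_series_limit[OF phi_L2 phi_orthonormal \<psi>])
  then show ?thesis by (elim exE conjE) (rule that, simp_all)
 qed
 have phs: "L2 M1 (\<phi> \<alpha>)" if "\<alpha> \<in> {1..N}" for \<alpha> N
  using that by (intro phi_L2) simp
 have P: "L2 M1 (P N)" for N
  unfolding P_def by (intro L2_sum L2_cmult phs)
 have D: "L2 M12 (D N)" for N
  unfolding D_def
  by (intro L2_diff[OF F] L2_sum L2_tensor phs coef_L2(1)[OF F])
 have c0: "(\<integral>y. (coef F (\<lambda>x. \<psi> x - s x) y)\<^sup>2 \<partial>M2) = 0"
 proof (rule coef_eq_0_if_orthogonal[OF L2_diff[OF \<psi> s(1)]])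
  fix \<alpha> :: nat assume \<alpha>: "\<alpha> \<ge> 1"
  show "(\<integral>x. (\<psi> x - s x) * \<phi> \<alpha> x \<partial>M1) = 0"
   using s(2)[OF \<alpha>] L2_mult[OF \<psi> phi_L2[OF \<alpha>]]
    L2_mult[OF s(1) phi_L2[OF \<alpha>]]
   by (simp add: left_diff_distrib a_def)
 qed
 have d0: "AE y in M2. coef F (\<lambda>x. \<psi> x - s x) y = 0"
 proof -
  have cs: "L2 M2 (coef F (\<lambda>x. \<psi> x - s x))"
   by (rule coef_L2(1)[OF F L2_diff[OF \<psi> s(1)]])
  then have "AE y in M2. (coef F (\<lambda>x. \<psi> x - s x) y)\<^sup>2 = 0"
   using c0 integral_nonneg_eq_0_iff_AE[OF L2D(2)[OF cs]] by simp
  then show ?thesis by simp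
 qed
 have key: "(\<integral>z. D N z * (\<psi> (fst z) * c (snd z)) \<partial>M12) = (\<integral>y. coef F (\<lambda>x. s x - P N x) y * c y \<partial>M2)" for N
 proof -
  have "(\<integral>z. D N z * (\<psi> (fst z) * c (snd z)) \<partial>M12) = (\<integral>y. coef (D N) \<psi> y * c y \<partial>M2)"
   by (rule integral_coef_mult[OF D \<psi> c, symmetric])
  also have "\<dots> = (\<integral>y. coef F (\<lambda>x. s x - P N x) y * c y \<partial>M2)"
  proof (rule integral_cong_AE)
   show "(\<lambda>y. coef (D N) \<psi> y * c y) \<in> borel_measurable M2"
    using L2D(1)[OF c] L2D(1)[OF coef_L2(1)[OF D \<psi>]] by simp
   show "(\<lambda>y. coef F (\<lambda>x. s x - P N x) y * c y) \<in> borel_measurable M2"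
    using L2D(1)[OF c]
     L2D(1)[OF coef_L2(1)[OF F L2_diff[OF s(1) P]]] by simp
   have r: "AE y in M2. coef (D N) \<psi> y = coef F \<psi> y - (\<Sum>\<alpha>=1..N. (\<integral>x. \<phi> \<alpha> x * \<psi> x \<partial>M1) * coef F (\<phi> \<alpha>) y)"
    unfolding D_def by (rule coef_residual[OF F \<psi> phs])
   have p: "AE y in M2. coef F (P N) y = (\<Sum>\<alpha>=1..N. a \<alpha> * coef F (\<phi> \<alpha>) y)"
    unfolding P_def by (rule coef_sum[OF F phs])
   have am: "(\<integral>x. \<phi> \<alpha> x * \<psi> x \<partial>M1) = a \<alpha>" for \<alpha> by (simp add: a_def mult.commute)
   show "AE y in M2. coef (D N) \<psi> y * c y = coef F (\<lambda>x. s x - P N x) y * c y"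
    using r p coef_diff[OF F s(1) P, of N] coef_diff[OF F \<psi> s(1)] d0
    by eventually_elim (simp add: am)
  qed
  finally show ?thesis .
 qed
 have "(\<lambda>N. (\<integral>z. D N z * (\<psi> (fst z) * c (snd z)) \<partial>M12)\<^sup>2) \<longlonglongrightarrow> 0"
 proof (rule real_tendsto_sandwich[OF _ _ tendsto_const])
  show "(\<lambda>N. (\<integral>x. (s x - P N x)\<^sup>2 \<partial>M1) * E * (\<integral>y. (c y)\<^sup>2 \<partial>M2)) \<longlonglongrightarrow> 0"
   using tendsto_mult_left_zero[OF tendsto_mult_left_zero[OF s(3)]] by blast
  show "\<forall>\<^sub>F N in sequentially. 0 \<le> (\<integral>z. D N z * (\<psi> (fst z) * c (snd z)) \<partial>M12)\<^sup>2" by simp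
  show "\<forall>\<^sub>F N in sequentially. (\<integral>z. D N z * (\<psi> (fst z) * c (snd z)) \<partial>M12)\<^sup>2 \<le>
    (\<integral>x. (s x - P N x)\<^sup>2 \<partial>M1) * E * (\<integral>y. (c y)\<^sup>2 \<partial>M2)"
  proof (intro always_eventually allI)
   fix N
   note sP = L2_diff[OF s(1) P, of N]
   have "(\<integral>z. D N z * (\<psi> (fst z) * c (snd z)) \<partial>M12)\<^sup>2 \<le>
     (\<integral>y. (coef F (\<lambda>x. s x - P N x) y)\<^sup>2 \<partial>M2) * (\<integral>y. (c y)\<^sup>2 \<partial>M2)"
    unfolding key by (rule Cauchy_Schwarz_integral[OF coef_L2(1)[OF F sP] c])
   also have "\<dots> \<le> (\<integral>x. (s x - P N x)\<^sup>2 \<partial>M1) * E * (\<integral>y. (c y)\<^sup>2 \<partial>M2)"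
    unfolding E_def by (intro mult_right_mono coef_L2(2)[OF F sP]) simp
   finally show "(\<integral>z. D N z * (\<psi> (fst z) * c (snd z)) \<partial>M12)\<^sup>2 \<le>
    (\<integral>x. (s x - P N x)\<^sup>2 \<partial>M1) * E * (\<integral>y. (c y)\<^sup>2 \<partial>M2)" .
  qed
 qed
 then have "(\<lambda>N. \<integral>z. D N z * (\<psi> (fst z) * c (snd z)) \<partial>M12) \<longlonglongrightarrow> 0"
  using tendsto_power_zero by (simp add: power_tendsto_0_iff)
 then show ?thesis unfolding D_def .
qed

text \<open>The eigenvalues exhaust the squared norm: the residual after \<open>N\<close> terms is orthogonal to what
 has been subtracted, so its squared norm is its inner product with \<open>F\<close>, and \<open>F\<close> may be replaced
 there by a function of finite rank.\<close>
theorem lam_sums_norm: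
 assumes approx: "\<And>d. d > 0 \<Longrightarrow> \<exists>(S :: 's set) \<psi> G. finite S \<and> (\<forall>b\<in>S. L2 M1 (\<psi> b)) \<and>
   (\<forall>b\<in>S. L2 M2 (G b)) \<and>
   (\<integral>z. (F z - (\<Sum>b\<in>S. \<psi> b (fst z) * G b (snd z)))\<^sup>2 \<partial>M12) \<le> d"
 shows "(\<lambda>i. lam (Suc i)) sums (\<integral>z. (F z)\<^sup>2 \<partial>M12)"
proof -
 define E where "E = (\<integral>z. (F z)\<^sup>2 \<partial>M12)"
 define D where "D N z = F z - (\<Sum>\<alpha>=1..N. \<phi> \<alpha> (fst z) * coef F (\<phi> \<alpha>) (snd z))" for N z
 have E0: "E \<ge> 0" by (simp add: E_def)
 have phs: "L2 M1 (\<phi> \<alpha>)" if "\<alpha> \<in> {1..N}" for \<alpha> N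
  using that by (intro phi_L2) simp
 have pho: "(\<integral>x. \<phi> \<alpha> x * \<phi> \<beta> x \<partial>M1) = (if \<alpha> = \<beta> then 1 else 0)" if "\<alpha> \<in> {1..N}" "\<beta> \<in> {1..N}" for \<alpha> \<beta> N
  using that by (intro phi_orthonormal) simp_all
 have T: "L2 M12 (\<lambda>z. \<Sum>\<alpha>=1..N. \<phi> \<alpha> (fst z) * coef F (\<phi> \<alpha>) (snd z))" for N
  by (intro L2_sum L2_tensor phs coef_L2(1)[OF F])
 have D: "L2 M12 (D N)" for N
  unfolding D_def by (rule L2_diff[OF F T])
 have DN: "(\<integral>z. (D N z)\<^sup>2 \<partial>M12) = E - (\<Sum>\<alpha>=1..N. lam \<alpha>)" for N
 proof -
  have "(\<Sum>i=1..N. \<integral>y. (coef F (\<phi> i) y)\<^sup>2 \<partial>M2) = (\<Sum>\<alpha>=1..N. lam \<alpha>)"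
   by (intro sum.cong[OF refl]) (simp add: integral_coef_phi_power2)
  then show ?thesis unfolding D_def E_def
   by (subst tensor_expansion_distance[OF finite_atLeastAtMost phs[where N = N] pho[where N = N] F
     coef_L2(1)[OF F phs[where N = N]]]) simp_all
 qed
 have DF: "(\<integral>z. D N z * F z \<partial>M12) = E - (\<Sum>\<alpha>=1..N. lam \<alpha>)" for N
 proof -
  let ?T = "\<lambda>z. \<Sum>\<alpha>=1..N. \<phi> \<alpha> (fst z) * coef F (\<phi> \<alpha>) (snd z)"
  have "(\<integral>z. F z * ?T z \<partial>M12) = (\<integral>z. (\<Sum>\<alpha>=1..N. F z * (\<phi> \<alpha> (fst z) * coef F (\<phi> \<alpha>) (snd z))) \<partial>M12)"
   unfolding sum_distrib_left ..
  also have "\<dots> = (\<Sum>\<alpha>=1..N. \<integral>z. F z * (\<phi> \<alpha> (fst z) * coef F (\<phi> \<alpha>) (snd z)) \<partial>M12)"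
   by (rule Bochner_Integration.integral_sum)
     (intro L2_mult[OF F] L2_tensor phs coef_L2(1)[OF F])
  also have "\<dots> = (\<Sum>\<alpha>=1..N. lam \<alpha>)"
  proof (rule sum.cong[OF refl])
   fix \<alpha> assume a: "\<alpha> \<in> {1..N}"
   have "(\<integral>z. F z * (\<phi> \<alpha> (fst z) * coef F (\<phi> \<alpha>) (snd z)) \<partial>M12) = (\<integral>y. coef F (\<phi> \<alpha>) y * coef F (\<phi> \<alpha>) y \<partial>M2)"
    by (rule integral_coef_mult[OF F phs[OF a] coef_L2(1)[OF F phs[OF a]], symmetric])
   then show "(\<integral>z. F z * (\<phi> \<alpha> (fst z) * coef F (\<phi> \<alpha>) (snd z)) \<partial>M12) = lam \<alpha>"
    using a coef_phi_orthogonal[of \<alpha> \<alpha>] by simp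
  qed
  finally have 1: "(\<integral>z. F z * ?T z \<partial>M12) = (\<Sum>\<alpha>=1..N. lam \<alpha>)" .
  have "(\<integral>z. D N z * F z \<partial>M12) = (\<integral>z. (F z)\<^sup>2 - F z * ?T z \<partial>M12)"
  proof -
   have "(u - t) * u = u\<^sup>2 - u * t" for u t :: real by (simp add: power2_eq_square algebra_simps)
   then show ?thesis unfolding D_def by (simp only:)
  qed
  also have "\<dots> = E - (\<Sum>\<alpha>=1..N. lam \<alpha>)"
   unfolding E_def 1[symmetric]
   by (rule Bochner_Integration.integral_diff[OF L2D(2)[OF F] L2_mult[OF F T]])
  finally show ?thesis .
 qed
 have sle: "(\<Sum>\<alpha>=1..N. lam \<alpha>) \<le> E" for N unfolding E_def by (rule sum_lam_le)
 have smono: "(\<Sum>\<alpha>=1..N. lam \<alpha>) \<le> (\<Sum>\<alpha>=1..N'. lam \<alpha>)" if "N \<le> N'" for N N'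
  using that by (intro sum_mono2) (auto simp: lam_nonneg)
 have lim: "(\<lambda>N. \<Sum>\<alpha>=1..N. lam \<alpha>) \<longlonglongrightarrow> E"
 proof (rule LIMSEQ_I)
  fix e :: real assume e: "e > 0"
  define d where "d = (e / 2)\<^sup>2 / (E + 1)"
  have "d > 0" using e E0 by (simp add: d_def)
  then obtain S :: "'s set" and \<psi> G where S: "finite S" "\<And>b. b \<in> S \<Longrightarrow> L2 M1 (\<psi> b)"
    "\<And>b. b \<in> S \<Longrightarrow> L2 M2 (G b)"
    "(\<integral>z. (F z - (\<Sum>b\<in>S. \<psi> b (fst z) * G b (snd z)))\<^sup>2 \<partial>M12) \<le> d"
   using approx[OF \<open>d > 0\<close>] by (elim exE conjE) (rule that, simp_all)
  let ?H = "\<lambda>z. \<Sum>b\<in>S. \<psi> b (fst z) * G b (snd z)"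
  have H: "L2 M12 ?H"
   by (intro L2_sum L2_tensor S)
  note FH = L2_diff[OF F H]
  have "(\<lambda>N. \<Sum>b\<in>S. \<integral>z. D N z * (\<psi> b (fst z) * G b (snd z)) \<partial>M12) \<longlonglongrightarrow> (\<Sum>b\<in>S. 0)"
   unfolding D_def by (intro tendsto_sum residual_tensor_tendsto_0 S)
  moreover have "(\<Sum>b\<in>S. \<integral>z. D N z * (\<psi> b (fst z) * G b (snd z)) \<partial>M12) = (\<integral>z. D N z * ?H z \<partial>M12)" for N
   unfolding sum_distrib_left
   by (rule Bochner_Integration.integral_sum[symmetric]) (intro L2_mult[OF D] L2_tensor S)
  ultimately have "(\<lambda>N. \<integral>z. D N z * ?H z \<partial>M12) \<longlonglongrightarrow> 0" by simp
  from LIMSEQ_D[OF this half_gt_zero[OF e]]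
  obtain N0 where N0': "\<forall>N\<ge>N0. norm ((\<integral>z. D N z * ?H z \<partial>M12) - 0) < e / 2"
   by (elim exE) (rule that)
  have N0: "\<bar>\<integral>z. D N z * ?H z \<partial>M12\<bar> < e / 2" if "N \<ge> N0" for N
   using N0'[rule_format, OF that] by simp
  have "norm ((\<Sum>\<alpha>=1..N. lam \<alpha>) - E) < e" if "N \<ge> N0" for N
  proof -
   let ?I = "\<integral>z. D N z * (F z - ?H z) \<partial>M12"
   have "(\<integral>z. D N z * F z \<partial>M12) = ?I + (\<integral>z. D N z * ?H z \<partial>M12)"
    by (subst Bochner_Integration.integral_add[symmetric, OF L2_mult[OF D FH] L2_mult[OF D H]])
      (simp add: right_diff_distrib)
   moreover have "?I \<le> e / 2"
   proof (rule power2_le_imp_le)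
    have "?I\<^sup>2 \<le> (\<integral>z. (D N z)\<^sup>2 \<partial>M12) * (\<integral>z. (F z - ?H z)\<^sup>2 \<partial>M12)"
     by (rule Cauchy_Schwarz_integral[OF D FH])
    also have "\<dots> \<le> E * d"
     using S(4) sle[of N] smono[of 0 N] E0 by (intro mult_mono) (simp_all add: DN)
    also have "\<dots> \<le> (e / 2)\<^sup>2"
     using E0 e by (simp add: d_def field_simps)
    finally show "?I\<^sup>2 \<le> (e / 2)\<^sup>2" .
   qed (use e in simp)
   ultimately have "E - (\<Sum>\<alpha>=1..N. lam \<alpha>) < e" using N0[OF that] unfolding DF by linarith
   then show ?thesis using sle[of N] by simp
  qed
  then show "\<exists>no. \<forall>N\<ge>no. norm ((\<Sum>\<alpha>=1..N. lam \<alpha>) - E) < e"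
   by (intro exI[of _ N0] allI impI)
 qed
 have "(\<Sum>i<n. lam (Suc i)) = (\<Sum>\<alpha>=1..n. lam \<alpha>)" for n
  by (simp add: sum.atLeast1_atMost_eq)
 then show ?thesis using lim unfolding sums_def E_def by simp
qed

end

section \<open>Projecting one mode after the other\<close>

locale finite_product = product_sigma_finite M for M :: "'i \<Rightarrow> 'a measure" +
 fixes I :: "'i set"
 assumes finite_I: "finite I" and finite_M: "\<And>i. finite_measure (M i)"
begin

definition slice :: "'i \<Rightarrow> (('i \<Rightarrow> 'a) \<Rightarrow> real) \<Rightarrow> 'a \<times> ('i \<Rightarrow> 'a) \<Rightarrow> real" where
 "slice j h z = h ((snd z)(j := fst z))"

lemma finite_measure_PiM: "finite J \<Longrightarrow> finite_measure (PiM J M)"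
proof -
 assume J: "finite J"
 interpret J: finite_product_sigma_finite M J by standard (rule J)
 show ?thesis
 proof (rule finite_measureI)
  have "emeasure (PiM J M) (space (PiM J M)) = (\<Prod>i\<in>J. emeasure (M i) (space (M i)))"
   unfolding space_PiM by (rule J.measure_times) simp
  also have "\<dots> \<noteq> \<infinity>"
   using finite_measure.emeasure_finite[OF finite_M] by (simp add: ennreal_prod_eq_top J)
  finally show "emeasure (PiM J M) (space (PiM J M)) \<noteq> \<infinity>" .
 qed
qed

lemma finite_pair_slice: "finite_pair (M j) (PiM (I - {j}) M)"
proof -
 have fr: "finite (I - {j})" using finite_I by simp
 interpret R: finite_measure "PiM (I - {j}) M" by (rule finite_measure_PiM[OF fr])
 interpret Mj: finite_measure "M j" by (rule finite_M)
 show ?thesis by unfold_locales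
qed

lemma measurable_update_pair:
 assumes "j \<in> I"
 shows "(\<lambda>z. (snd z)(j := fst z)) \<in> measurable (M j \<Otimes>\<^sub>M PiM (I - {j}) M) (PiM I M)"
proof -
 have "insert j (I - {j}) = I" using assms by auto
 then show ?thesis
  using measurable_fun_upd[of I "I - {j}" j snd "M j \<Otimes>\<^sub>M PiM (I - {j}) M" M fst] assms by auto
qed

lemma distr_update_pair:
 assumes j: "j \<in> I"
 shows "distr (M j \<Otimes>\<^sub>M PiM (I - {j}) M) (PiM I M) (\<lambda>z. (snd z)(j := fst z)) = PiM I M"
proof (rule PiM_eqI[OF finite_I])
 interpret P: finite_pair "M j" "PiM (I - {j}) M" by (rule finite_pair_slice)
 interpret R: finite_product_sigma_finite M "I - {j}" by standard (use finite_I in simp)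
 fix A assume A: "\<And>i. i \<in> I \<Longrightarrow> A i \<in> sets (M i)"
 have Asp: "A i \<subseteq> space (M i)" if "i \<in> I" for i using sets.sets_into_space[OF A[OF that]] .
 have "(\<lambda>z. (snd z)(j := fst z)) -` (Pi\<^sub>E I A) \<inter> space (M j \<Otimes>\<^sub>M PiM (I - {j}) M) = A j \<times> Pi\<^sub>E (I - {j}) A"
 proof (intro set_eqI iffI)
  fix z assume z: "z \<in> (\<lambda>z. (snd z)(j := fst z)) -` (Pi\<^sub>E I A) \<inter> space (M j \<Otimes>\<^sub>M PiM (I - {j}) M)"
  then have u: "(snd z)(j := fst z) \<in> Pi\<^sub>E I A" and e: "snd z \<in> extensional (I - {j})"
   by (auto simp: space_pair_measure space_PiM PiE_def)
  have "fst z \<in> A j" using PiE_mem[OF u j] by simp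
  moreover have "snd z i \<in> A i" if "i \<in> I - {j}" for i using PiE_mem[OF u, of i] that by simp
  ultimately show "z \<in> A j \<times> Pi\<^sub>E (I - {j}) A" using e by (auto simp: mem_Times_iff PiE_def)
 next
  fix z assume "z \<in> A j \<times> Pi\<^sub>E (I - {j}) A"
  then have z: "fst z \<in> A j" "snd z \<in> Pi\<^sub>E (I - {j}) A" by (auto simp: mem_Times_iff)
  have "(snd z)(j := fst z) \<in> Pi\<^sub>E I A"
   using z j by (auto simp: PiE_def extensional_def Pi_def)
  moreover have "z \<in> space (M j \<Otimes>\<^sub>M PiM (I - {j}) M)"
   using z j Asp by (auto simp: space_pair_measure space_PiM mem_Times_iff PiE_def Pi_def)
  ultimately show "z \<in> (\<lambda>z. (snd z)(j := fst z)) -` (Pi\<^sub>E I A) \<inter> space (M j \<Otimes>\<^sub>M PiM (I - {j}) M)" by simp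
 qed
 then have "emeasure (distr (M j \<Otimes>\<^sub>M PiM (I - {j}) M) (PiM I M) (\<lambda>z. (snd z)(j := fst z))) (Pi\<^sub>E I A) =
   emeasure (M j \<Otimes>\<^sub>M PiM (I - {j}) M) (A j \<times> Pi\<^sub>E (I - {j}) A)"
  using sets_PiM_I_finite[OF finite_I A]
  by (simp add: emeasure_distr measurable_update_pair[OF j])
 also have "\<dots> = emeasure (M j) (A j) * emeasure (PiM (I - {j}) M) (Pi\<^sub>E (I - {j}) A)"
  using A j finite_I by (intro P.M2.emeasure_pair_measure_Times sets_PiM_I_finite) auto
 also have "emeasure (PiM (I - {j}) M) (Pi\<^sub>E (I - {j}) A) = (\<Prod>i\<in>I - {j}. emeasure (M i) (A i))"
  by (rule R.measure_times) (use A in auto)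
 also have "emeasure (M j) (A j) * \<dots> = (\<Prod>i\<in>I. emeasure (M i) (A i))"
  using finite_I j by (simp add: prod.remove[of I j])
 finally show "emeasure (distr (M j \<Otimes>\<^sub>M PiM (I - {j}) M) (PiM I M) (\<lambda>z. (snd z)(j := fst z))) (Pi\<^sub>E I A) =
   (\<Prod>i\<in>I. emeasure (M i) (A i))" .
qed simp

lemma slice_measurable:
 assumes "j \<in> I" "h \<in> borel_measurable (PiM I M)"
 shows "slice j h \<in> borel_measurable (M j \<Otimes>\<^sub>M PiM (I - {j}) M)"
 using measurable_compose[OF measurable_update_pair[OF assms(1)] assms(2)]
 unfolding slice_def[abs_def] .

lemma integral_slice:
 assumes j: "j \<in> I" and h: "h \<in> borel_measurable (PiM I M)"
 shows "(\<integral>z. slice j h z \<partial>(M j \<Otimes>\<^sub>M PiM (I - {j}) M)) = (\<integral>x. h x \<partial>PiM I M)"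
  and "integrable (M j \<Otimes>\<^sub>M PiM (I - {j}) M) (slice j h) \<longleftrightarrow> integrable (PiM I M) h"
proof -
 show "(\<integral>z. slice j h z \<partial>(M j \<Otimes>\<^sub>M PiM (I - {j}) M)) = (\<integral>x. h x \<partial>PiM I M)"
  using integral_distr[OF measurable_update_pair[OF j] h]
  unfolding distr_update_pair[OF j] slice_def by simp
 show "integrable (M j \<Otimes>\<^sub>M PiM (I - {j}) M) (slice j h) \<longleftrightarrow> integrable (PiM I M) h"
  using integrable_distr_eq[OF measurable_update_pair[OF j] h]
  unfolding distr_update_pair[OF j] slice_def[abs_def] by simp
qed

lemma slice_L2:
 assumes j: "j \<in> I" and h: "h \<in> borel_measurable (PiM I M)"
 shows "L2 (M j \<Otimes>\<^sub>M PiM (I - {j}) M) (slice j h) \<longleftrightarrow> L2 (PiM I M) h"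
proof -
 have "(\<lambda>z. (slice j h z)\<^sup>2) = slice j (\<lambda>x. (h x)\<^sup>2)" by (simp add: slice_def[abs_def])
 moreover have "(\<lambda>x. (h x)\<^sup>2) \<in> borel_measurable (PiM I M)" using h by simp
 ultimately show ?thesis
  using integral_slice(2)[OF j, of "\<lambda>x. (h x)\<^sup>2"] slice_measurable[OF j h] h
  by (simp add: square_integrable_def)
qed

lemma integral_slice_power2:
 assumes j: "j \<in> I" and h: "L2 (PiM I M) h"
 shows "(\<integral>z. (slice j h z)\<^sup>2 \<partial>(M j \<Otimes>\<^sub>M PiM (I - {j}) M)) = (\<integral>x. (h x)\<^sup>2 \<partial>PiM I M)"
proof -
 have "(\<lambda>z. (slice j h z)\<^sup>2) = slice j (\<lambda>x. (h x)\<^sup>2)" by (simp add: slice_def[abs_def])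
 then show ?thesis using integral_slice(1)[OF j, of "\<lambda>x. (h x)\<^sup>2"] L2D(1)[OF h] by simp
qed

end

text \<open>Projecting one mode of an approximation \<open>\<Sum> b\<close> onto the span of an orthonormal system costs
 only the distance of \<open>F\<close> itself from that span, because the two errors are orthogonal.\<close>
lemma (in finite_pair) one_mode_projection_error:
 assumes F: "L2 M12 F"
  and A: "finite A" "\<And>i. i \<in> A \<Longrightarrow> L2 M1 (\<phi> i)"
  and on: "\<And>i j. i \<in> A \<Longrightarrow> j \<in> A \<Longrightarrow> (\<integral>x. \<phi> i x * \<phi> j x \<partial>M1) = (if i = j then 1 else 0)"
  and b: "\<And>k. k \<in> B \<Longrightarrow> L2 M12 (b k)"
 shows "(\<integral>z. (F z - (\<Sum>i\<in>A. \<phi> i (fst z) * (\<Sum>k\<in>B. coef (b k) (\<phi> i) (snd z))))\<^sup>2 \<partial>M12) \<le>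
  ((\<integral>z. (F z)\<^sup>2 \<partial>M12) - (\<Sum>i\<in>A. \<integral>y. (coef F (\<phi> i) y)\<^sup>2 \<partial>M2))
   + (\<integral>z. (F z - (\<Sum>k\<in>B. b k z))\<^sup>2 \<partial>M12)"
proof -
 let ?q = "\<lambda>z. \<Sum>k\<in>B. b k z"
 let ?D = "\<lambda>z. F z - ?q z"
 let ?c = "\<lambda>i y. \<Sum>k\<in>B. coef (b k) (\<phi> i) y"
 have q: "L2 M12 ?q" by (intro L2_sum b)
 have D: "L2 M12 ?D" by (rule L2_diff[OF F q])
 have c: "L2 M2 (?c i)" if "i \<in> A" for i
  by (intro L2_sum coef_L2(1) b A that)
 have eq: "(\<integral>y. (?c i y - coef F (\<phi> i) y)\<^sup>2 \<partial>M2) = (\<integral>y. (coef ?D (\<phi> i) y)\<^sup>2 \<partial>M2)" if i: "i \<in> A" for i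
 proof (rule integral_cong_AE)
  show "(\<lambda>y. (?c i y - coef F (\<phi> i) y)\<^sup>2) \<in> borel_measurable M2"
   by (rule L2D(2)[OF L2_diff[OF c[OF i] coef_L2(1)[OF F A(2)[OF i]]], THEN borel_measurable_integrable])
  show "(\<lambda>y. (coef ?D (\<phi> i) y)\<^sup>2) \<in> borel_measurable M2"
   by (rule L2D(2)[OF coef_L2(1)[OF D A(2)[OF i]], THEN borel_measurable_integrable])
  have 1: "AE y in M2. L2 M1 (\<lambda>x. F (x, y))" by (rule AE_L2_slice2[OF F])
  have 2: "AE y in M2. L2 M1 (\<lambda>x. ?q (x, y))" by (rule AE_L2_slice2[OF q])
  have lin: "AE y in M2. coef ?q (\<phi> i) y = ?c i y"
  proof (cases "finite B")
   case True
   have "AE y in M2. \<forall>k\<in>B. L2 M1 (\<lambda>x. b k (x, y))"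
    by (rule AE_finite_allI[OF True]) (rule AE_L2_slice2[OF b])
   then show ?thesis
   proof eventually_elim
    case (elim y)
    have "coef ?q (\<phi> i) y = (\<integral>x. (\<Sum>k\<in>B. b k (x, y) * \<phi> i x) \<partial>M1)"
     unfolding coef_def sum_distrib_right ..
    also have "\<dots> = ?c i y"
     unfolding coef_def
     by (rule Bochner_Integration.integral_sum) (use elim in \<open>intro L2_mult A(2)[OF i], blast\<close>)
    finally show ?case .
   qed
  qed (simp add: coef_def)
  show "AE y in M2. (?c i y - coef F (\<phi> i) y)\<^sup>2 = (coef ?D (\<phi> i) y)\<^sup>2"
   using 1 2 lin
  proof eventually_elim
   case (elim y)
   have "coef ?D (\<phi> i) y = (\<integral>x. F (x, y) * \<phi> i x - ?q (x, y) * \<phi> i x \<partial>M1)"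
    unfolding coef_def left_diff_distrib ..
   also have "\<dots> = coef F (\<phi> i) y - coef ?q (\<phi> i) y"
    unfolding coef_def
    by (rule Bochner_Integration.integral_diff[OF L2_mult[OF elim(1) A(2)[OF i]] L2_mult[OF elim(2) A(2)[OF i]]])
   finally show ?case unfolding elim(3) by (simp add: power2_commute)
  qed
 qed
 have "(\<Sum>i\<in>A. \<integral>y. (?c i y - coef F (\<phi> i) y)\<^sup>2 \<partial>M2) = (\<Sum>i\<in>A. \<integral>y. (coef ?D (\<phi> i) y)\<^sup>2 \<partial>M2)"
  by (rule sum.cong[OF refl eq])
 also have "\<dots> \<le> (\<integral>z. (?D z)\<^sup>2 \<partial>M12)"
  by (rule tensor_Bessel[OF A on D])
 finally show ?thesis
  by (subst tensor_expansion_distance[OF A on F c]) simp_all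
qed

context finite_product begin

text \<open>By Pythagoras, the squared error of projecting \<open>f\<close> in mode \<open>j\<close> onto the first \<open>r j\<close> functions.\<close>
definition mode_error ::
 "(('i \<Rightarrow> 'a) \<Rightarrow> real) \<Rightarrow> ('i \<Rightarrow> nat \<Rightarrow> 'a \<Rightarrow> real) \<Rightarrow> ('i \<Rightarrow> nat) \<Rightarrow> 'i \<Rightarrow> real" where
 "mode_error f \<phi> r j = (\<integral>x. (f x)\<^sup>2 \<partial>PiM I M) -
   (\<Sum>\<alpha>=1..r j. \<integral>y. (finite_pair.coef (M j) (slice j f) (\<phi> j \<alpha>) y)\<^sup>2 \<partial>PiM (I - {j}) M)"

text \<open>Projecting the modes one after the other: the approximations stay sums of elementary products
 in the modes already treated, with factors that do not depend on these modes.\<close>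
lemma successive_mode_projection:
 fixes f :: "('i \<Rightarrow> 'a) \<Rightarrow> real" and \<phi> :: "'i \<Rightarrow> nat \<Rightarrow> 'a \<Rightarrow> real"
 assumes f: "L2 (PiM I M) f"
  and \<phi>: "\<And>j \<alpha>. j \<in> I \<Longrightarrow> \<alpha> \<ge> 1 \<Longrightarrow> L2 (M j) (\<phi> j \<alpha>)"
  and on: "\<And>j \<alpha> \<beta>. j \<in> I \<Longrightarrow> \<alpha> \<ge> 1 \<Longrightarrow> \<beta> \<ge> 1 \<Longrightarrow>
    (\<integral>x. \<phi> j \<alpha> x * \<phi> j \<beta> x \<partial>M j) = (if \<alpha> = \<beta> then 1 else 0)"
  and "J \<subseteq> I"
 shows "\<exists>b a. (\<forall>\<alpha>\<in>PiE J (\<lambda>j. {1..r j}). L2 (PiM I M) (b \<alpha>) \<and>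
    (\<forall>x\<in>space (PiM I M). b \<alpha> x = (\<Prod>i\<in>J. \<phi> i (\<alpha> i) (x i)) * a \<alpha> x) \<and>
    (\<forall>x\<in>space (PiM I M). \<forall>x'\<in>space (PiM I M). (\<forall>i\<in>I - J. x i = x' i) \<longrightarrow> a \<alpha> x = a \<alpha> x')) \<and>
   (\<integral>x. (f x - (\<Sum>\<alpha>\<in>PiE J (\<lambda>j. {1..r j}). b \<alpha> x))\<^sup>2 \<partial>PiM I M) \<le> (\<Sum>j\<in>J. mode_error f \<phi> r j)"
 using finite_subset[OF \<open>J \<subseteq> I\<close> finite_I] \<open>J \<subseteq> I\<close>
proof (induction J)
 case empty
 let ?P = "PiM I M"
 have ex: "x = x'" if x: "x \<in> space ?P" "x' \<in> space ?P" "\<forall>i\<in>I - {}. x i = x' i" for x x'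
  by (rule PiE_ext[of x I "\<lambda>i. space (M i)" x'])
    (use x(1,2) in \<open>simp_all only: space_PiM\<close>, use x(3) in blast)
 have Q: "\<forall>\<alpha>\<in>PiE {} (\<lambda>j. {1..r j}). L2 ?P f \<and>
    (\<forall>x\<in>space ?P. f x = (\<Prod>i\<in>{}. \<phi> i (\<alpha> i) (x i)) * f x) \<and>
    (\<forall>x\<in>space ?P. \<forall>x'\<in>space ?P. (\<forall>i\<in>I - {}. x i = x' i) \<longrightarrow> f x = f x')"
 proof (intro ballI conjI impI)
  fix x x' assume "x \<in> space ?P" "x' \<in> space ?P" "\<forall>i\<in>I - {}. x i = x' i"
  then have "x = x'" by (rule ex)
  then show "f x = f x'" by (rule arg_cong)
 qed (simp_all only: f prod.empty mult_1)
 have err: "(\<integral>x. (f x - (\<Sum>\<alpha>\<in>PiE {} (\<lambda>j. {1..r j}). f x))\<^sup>2 \<partial>?P) \<le> (\<Sum>j\<in>{}. mode_error f \<phi> r j)"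
  by simp
 show ?case
  by (rule exI[of _ "\<lambda>_. f"], rule exI[of _ "\<lambda>_. f"], rule conjI[OF Q err])
next
 case (insert j J)
 define S where "S = (\<lambda>j. {1..r j})"
 let ?P = "PiM I M" and ?R = "PiM (I - {j}) M"
 have j: "j \<in> I" and jJ: "j \<notin> J" and J: "J \<subseteq> I" using insert by auto
 define Q1 where "Q1 b a \<longleftrightarrow> (\<forall>\<alpha>\<in>PiE J S. L2 ?P (b \<alpha>) \<and>
    (\<forall>x\<in>space ?P. b \<alpha> x = (\<Prod>i\<in>J. \<phi> i (\<alpha> i) (x i)) * a \<alpha> x) \<and>
    (\<forall>x\<in>space ?P. \<forall>x'\<in>space ?P. (\<forall>i\<in>I - J. x i = x' i) \<longrightarrow> a \<alpha> x = a \<alpha> x'))"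
  for b a :: "('i \<Rightarrow> nat) \<Rightarrow> ('i \<Rightarrow> 'a) \<Rightarrow> real"
 define Q2 where "Q2 b \<longleftrightarrow> (\<integral>x. (f x - (\<Sum>\<alpha>\<in>PiE J S. b \<alpha> x))\<^sup>2 \<partial>?P) \<le> (\<Sum>j\<in>J. mode_error f \<phi> r j)"
  for b :: "('i \<Rightarrow> nat) \<Rightarrow> ('i \<Rightarrow> 'a) \<Rightarrow> real"
 have "\<exists>b a. Q1 b a \<and> Q2 b"
  unfolding Q1_def Q2_def S_def by (rule insert.IH[OF J])
 then obtain b a where Q: "Q1 b a" "Q2 b" by blast
 note IH = Q(1)[unfolded Q1_def] and err = Q(2)[unfolded Q2_def]
 have b: "L2 ?P (b \<alpha>)" if "\<alpha> \<in> PiE J S" for \<alpha> using bspec[OF IH that] by (rule conjunct1)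
 have ba: "b \<alpha> x = (\<Prod>i\<in>J. \<phi> i (\<alpha> i) (x i)) * a \<alpha> x" if "\<alpha> \<in> PiE J S" "x \<in> space ?P" for \<alpha> x
  using bspec[OF IH that(1), THEN conjunct2, THEN conjunct1] that(2) by (rule bspec)
 have dep: "a \<alpha> x = a \<alpha> x'" if "\<alpha> \<in> PiE J S" "x \<in> space ?P" "x' \<in> space ?P" "\<And>i. i \<in> I - J \<Longrightarrow> x i = x' i" for \<alpha> x x'
  using bspec[OF IH that(1), THEN conjunct2, THEN conjunct2, rule_format, OF that(2,3)] that(4) by simp
 interpret P: finite_pair "M j" ?R by (rule finite_pair_slice)
 have upd: "x(j := t) \<in> space ?P" if "x \<in> space ?P" "t \<in> space (M j)" for x t
  using that j by (auto simp: space_PiM PiE_def extensional_def Pi_def)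
 have Sj: "\<beta> \<ge> 1" if "\<beta> \<in> S j" for \<beta> using that by (simp add: S_def)
 define a' where "a' \<gamma> x = (\<integral>t. a (restrict \<gamma> J) (x(j := t)) * \<phi> j (\<gamma> j) t \<partial>M j)" for \<gamma> x
 define b' where "b' \<gamma> x = \<phi> j (\<gamma> j) (x j) * P.coef (slice j (b (restrict \<gamma> J))) (\<phi> j (\<gamma> j)) (restrict x (I - {j}))" for \<gamma> x
 have rJ: "restrict \<gamma> J \<in> PiE J S" "\<gamma> j \<in> S j" if "\<gamma> \<in> PiE (insert j J) S" for \<gamma>
  using that by (auto simp: PiE_def Pi_def)
 have sb: "L2 (M j \<Otimes>\<^sub>M ?R) (slice j (b \<alpha>))" if "\<alpha> \<in> PiE J S" for \<alpha>
  using slice_L2[OF j L2D(1)[OF b[OF that]]] b[OF that] by simp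
 have cs: "L2 ?R (P.coef (slice j (b \<alpha>)) (\<phi> j \<beta>))" if "\<alpha> \<in> PiE J S" "\<beta> \<in> S j" for \<alpha> \<beta>
  by (rule P.coef_L2(1)[OF sb[OF that(1)] \<phi>[OF j Sj[OF that(2)]]])
 have slice_b': "slice j (b' \<gamma>) z = \<phi> j (\<gamma> j) (fst z) * P.coef (slice j (b (restrict \<gamma> J))) (\<phi> j (\<gamma> j)) (snd z)"
  if "z \<in> space (M j \<Otimes>\<^sub>M ?R)" for \<gamma> z
 proof -
  have "restrict ((snd z)(j := fst z)) (I - {j}) = snd z"
   using that by (auto simp: space_pair_measure space_PiM PiE_def extensional_def fun_eq_iff)
  then show ?thesis by (simp add: slice_def b'_def)
 qed
 have b'm: "b' \<gamma> \<in> borel_measurable ?P" if "\<gamma> \<in> PiE (insert j J) S" for \<gamma>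
 proof -
  note [measurable] = L2D(1)[OF cs[OF rJ[OF that]]] L2D(1)[OF \<phi>[OF j Sj[OF rJ(2)[OF that]]]]
  have [measurable]: "(\<lambda>x. restrict x (I - {j})) \<in> measurable ?P ?R"
   by (rule measurable_restrict_subset) auto
  have [measurable]: "(\<lambda>x. x j) \<in> measurable ?P (M j)" by (rule measurable_component_singleton[OF j])
  show ?thesis unfolding b'_def[abs_def] by measurable
 qed
 have b'sq: "L2 ?P (b' \<gamma>)" if "\<gamma> \<in> PiE (insert j J) S" for \<gamma>
 proof -
  have t: "L2 (M j \<Otimes>\<^sub>M ?R) (\<lambda>z. \<phi> j (\<gamma> j) (fst z) * P.coef (slice j (b (restrict \<gamma> J))) (\<phi> j (\<gamma> j)) (snd z))"
   by (rule P.L2_tensor[OF \<phi>[OF j Sj[OF rJ(2)[OF that]]] cs[OF rJ[OF that]]])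
  have "L2 (M j \<Otimes>\<^sub>M ?R) (slice j (b' \<gamma>))"
   by (rule L2_cong_AE[OF t slice_measurable[OF j b'm[OF that]]]) (auto intro!: AE_I2 simp: slice_b')
  then show ?thesis using slice_L2[OF j b'm[OF that]] by simp
 qed
 have b'a': "b' \<gamma> x = (\<Prod>i\<in>insert j J. \<phi> i (\<gamma> i) (x i)) * a' \<gamma> x"
  if g: "\<gamma> \<in> PiE (insert j J) S" and x: "x \<in> space ?P" for \<gamma> x
 proof -
  have xr: "(restrict x (I - {j}))(j := t) = x(j := t)" for t
   using x by (auto simp: space_PiM PiE_def extensional_def fun_eq_iff)
  have "P.coef (slice j (b (restrict \<gamma> J))) (\<phi> j (\<gamma> j)) (restrict x (I - {j})) =
    (\<integral>t. b (restrict \<gamma> J) (x(j := t)) * \<phi> j (\<gamma> j) t \<partial>M j)"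
   by (simp add: P.coef_def slice_def xr)
  also have "\<dots> = (\<integral>t. (\<Prod>i\<in>J. \<phi> i (\<gamma> i) (x i)) * (a (restrict \<gamma> J) (x(j := t)) * \<phi> j (\<gamma> j) t) \<partial>M j)"
  proof (rule Bochner_Integration.integral_cong[OF refl])
   fix t assume t: "t \<in> space (M j)"
   have "(\<Prod>i\<in>J. \<phi> i (restrict \<gamma> J i) ((x(j := t)) i)) = (\<Prod>i\<in>J. \<phi> i (\<gamma> i) (x i))"
    using jJ by (intro prod.cong) auto
   then show "b (restrict \<gamma> J) (x(j := t)) * \<phi> j (\<gamma> j) t =
     (\<Prod>i\<in>J. \<phi> i (\<gamma> i) (x i)) * (a (restrict \<gamma> J) (x(j := t)) * \<phi> j (\<gamma> j) t)"
    by (simp only: ba[OF rJ(1)[OF g] upd[OF x t]] mult.assoc)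
  qed
  also have "\<dots> = (\<Prod>i\<in>J. \<phi> i (\<gamma> i) (x i)) * a' \<gamma> x" by (simp add: a'_def)
  finally show ?thesis using jJ insert.hyps(1) by (simp add: b'_def)
 qed
 have dep': "a' \<gamma> x = a' \<gamma> x'"
  if g: "\<gamma> \<in> PiE (insert j J) S" and x: "x \<in> space ?P" "x' \<in> space ?P" "\<And>i. i \<in> I - insert j J \<Longrightarrow> x i = x' i" for \<gamma> x x'
  unfolding a'_def
 proof (rule Bochner_Integration.integral_cong[OF refl])
  fix t assume t: "t \<in> space (M j)"
  have "a (restrict \<gamma> J) (x(j := t)) = a (restrict \<gamma> J) (x'(j := t))"
   by (rule dep[OF rJ(1)[OF g] upd[OF x(1) t] upd[OF x(2) t]]) (use x(3) in auto)
  then show "a (restrict \<gamma> J) (x(j := t)) * \<phi> j (\<gamma> j) t = a (restrict \<gamma> J) (x'(j := t)) * \<phi> j (\<gamma> j) t" by simp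
 qed
 have inj: "inj_on (\<lambda>(\<beta>, \<alpha>). \<alpha>(j := \<beta>)) (S j \<times> PiE J S)"
  using inj_combinator[OF jJ, of S] by (simp add: PiE_def)
 have reidx: "(\<Sum>\<gamma>\<in>PiE (insert j J) S. h \<gamma>) = (\<Sum>\<beta>\<in>S j. \<Sum>\<alpha>\<in>PiE J S. h (\<alpha>(j := \<beta>)))" for h :: "_ \<Rightarrow> real"
  unfolding PiE_insert_eq sum.reindex[OF inj] sum.cartesian_product by (simp add: case_prod_beta)
 have resJ: "restrict (\<alpha>(j := \<beta>)) J = \<alpha>" if "\<alpha> \<in> PiE J S" for \<alpha> \<beta>
  using that jJ by (auto simp: PiE_def extensional_def fun_eq_iff)
 have fs: "L2 (M j \<Otimes>\<^sub>M ?R) (slice j f)"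
  using slice_L2[OF j L2D(1)[OF f]] f by simp
 have q: "L2 ?P (\<lambda>x. f x - (\<Sum>\<alpha>\<in>PiE J S. b \<alpha> x))"
  by (intro L2_diff[OF f] L2_sum b)
 have q': "L2 ?P (\<lambda>x. f x - (\<Sum>\<gamma>\<in>PiE (insert j J) S. b' \<gamma> x))"
  by (intro L2_diff[OF f] L2_sum b'sq)
 have "(\<integral>x. (f x - (\<Sum>\<gamma>\<in>PiE (insert j J) S. b' \<gamma> x))\<^sup>2 \<partial>?P) =
   (\<integral>z. (slice j (\<lambda>x. f x - (\<Sum>\<gamma>\<in>PiE (insert j J) S. b' \<gamma> x)) z)\<^sup>2 \<partial>(M j \<Otimes>\<^sub>M ?R))"
  by (rule integral_slice_power2[OF j q', symmetric])
 also have "\<dots> = (\<integral>z. (slice j f z - (\<Sum>\<beta>\<in>S j. \<phi> j \<beta> (fst z) * (\<Sum>\<alpha>\<in>PiE J S. P.coef (slice j (b \<alpha>)) (\<phi> j \<beta>) (snd z))))\<^sup>2 \<partial>(M j \<Otimes>\<^sub>M ?R))"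
 proof (rule Bochner_Integration.integral_cong[OF refl])
  fix z assume z: "z \<in> space (M j \<Otimes>\<^sub>M ?R)"
  have "slice j (\<lambda>x. f x - (\<Sum>\<gamma>\<in>PiE (insert j J) S. b' \<gamma> x)) z = slice j f z - (\<Sum>\<gamma>\<in>PiE (insert j J) S. slice j (b' \<gamma>) z)"
   by (simp add: slice_def)
  also have "(\<Sum>\<gamma>\<in>PiE (insert j J) S. slice j (b' \<gamma>) z) =
    (\<Sum>\<beta>\<in>S j. \<Sum>\<alpha>\<in>PiE J S. \<phi> j \<beta> (fst z) * P.coef (slice j (b \<alpha>)) (\<phi> j \<beta>) (snd z))"
   unfolding reidx by (intro sum.cong refl) (simp add: slice_b'[OF z] resJ)
  finally show "(slice j (\<lambda>x. f x - (\<Sum>\<gamma>\<in>PiE (insert j J) S. b' \<gamma> x)) z)\<^sup>2 =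
   (slice j f z - (\<Sum>\<beta>\<in>S j. \<phi> j \<beta> (fst z) * (\<Sum>\<alpha>\<in>PiE J S. P.coef (slice j (b \<alpha>)) (\<phi> j \<beta>) (snd z))))\<^sup>2"
   by (simp only: sum_distrib_left)
 qed
 also have "\<dots> \<le> ((\<integral>z. (slice j f z)\<^sup>2 \<partial>(M j \<Otimes>\<^sub>M ?R)) - (\<Sum>\<beta>\<in>S j. \<integral>y. (P.coef (slice j f) (\<phi> j \<beta>) y)\<^sup>2 \<partial>?R))
   + (\<integral>z. (slice j f z - (\<Sum>\<alpha>\<in>PiE J S. slice j (b \<alpha>) z))\<^sup>2 \<partial>(M j \<Otimes>\<^sub>M ?R))"
  by (rule P.one_mode_projection_error[OF fs _ \<phi>[OF j Sj] on[OF j Sj Sj] sb]) (simp add: S_def)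
 also have "(\<integral>z. (slice j f z - (\<Sum>\<alpha>\<in>PiE J S. slice j (b \<alpha>) z))\<^sup>2 \<partial>(M j \<Otimes>\<^sub>M ?R)) =
   (\<integral>x. (f x - (\<Sum>\<alpha>\<in>PiE J S. b \<alpha> x))\<^sup>2 \<partial>?P)"
  using integral_slice_power2[OF j q] by (simp add: slice_def)
 also have "((\<integral>z. (slice j f z)\<^sup>2 \<partial>(M j \<Otimes>\<^sub>M ?R)) - (\<Sum>\<beta>\<in>S j. \<integral>y. (P.coef (slice j f) (\<phi> j \<beta>) y)\<^sup>2 \<partial>?R)) = mode_error f \<phi> r j"
  unfolding mode_error_def integral_slice_power2[OF j f] S_def ..
 finally have err': "(\<integral>x. (f x - (\<Sum>\<gamma>\<in>PiE (insert j J) S. b' \<gamma> x))\<^sup>2 \<partial>?P) \<le> (\<Sum>j\<in>insert j J. mode_error f \<phi> r j)"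
  using err jJ insert.hyps(1) by simp
 have fin: "\<forall>\<gamma>\<in>PiE (insert j J) S. L2 ?P (b' \<gamma>) \<and>
    (\<forall>x\<in>space ?P. b' \<gamma> x = (\<Prod>i\<in>insert j J. \<phi> i (\<gamma> i) (x i)) * a' \<gamma> x) \<and>
    (\<forall>x\<in>space ?P. \<forall>x'\<in>space ?P. (\<forall>i\<in>I - insert j J. x i = x' i) \<longrightarrow> a' \<gamma> x = a' \<gamma> x')"
 proof (intro ballI conjI impI)
  fix \<gamma> assume g: "\<gamma> \<in> PiE (insert j J) S"
  show "L2 ?P (b' \<gamma>)" by (rule b'sq[OF g])
  fix x assume x: "x \<in> space ?P"
  show "b' \<gamma> x = (\<Prod>i\<in>insert j J. \<phi> i (\<gamma> i) (x i)) * a' \<gamma> x" by (rule b'a'[OF g x])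
  fix x' assume x': "x' \<in> space ?P" "\<forall>i\<in>I - insert j J. x i = x' i"
  show "a' \<gamma> x = a' \<gamma> x'" by (rule dep'[OF g x x'(1) x'(2)[rule_format]])
 qed
 show ?case
  unfolding S_def[symmetric] by (rule exI[of _ b'], rule exI[of _ a'], rule conjI[OF fin err'])
qed

text \<open>Truncating the expansion in the orthonormal products \<open>\<Prod>i. \<phi> i (\<alpha> i) (x i)\<close> is at least as good
 as the successive projections, which also end in their span.\<close>
theorem truncated_expansion_error:
 fixes f :: "('i \<Rightarrow> 'a) \<Rightarrow> real" and \<phi> :: "'i \<Rightarrow> nat \<Rightarrow> 'a \<Rightarrow> real" and r :: "'i \<Rightarrow> nat"
 assumes f: "L2 (PiM I M) f"
  and \<phi>: "\<And>j \<alpha>. j \<in> I \<Longrightarrow> \<alpha> \<ge> 1 \<Longrightarrow> L2 (M j) (\<phi> j \<alpha>)"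
  and on: "\<And>j \<alpha> \<beta>. j \<in> I \<Longrightarrow> \<alpha> \<ge> 1 \<Longrightarrow> \<beta> \<ge> 1 \<Longrightarrow>
    (\<integral>x. \<phi> j \<alpha> x * \<phi> j \<beta> x \<partial>M j) = (if \<alpha> = \<beta> then 1 else 0)"
 defines "\<Phi> \<equiv> \<lambda>\<alpha> x. \<Prod>i\<in>I. \<phi> i (\<alpha> i) (x i)"
 defines "t \<equiv> \<lambda>x. \<Sum>\<alpha>\<in>PiE I (\<lambda>j. {1..r j}). (\<integral>x. f x * \<Phi> \<alpha> x \<partial>PiM I M) * \<Phi> \<alpha> x"
 shows "L2 (PiM I M) (\<lambda>x. f x - t x)"
  and "(\<integral>x. (f x - t x)\<^sup>2 \<partial>PiM I M) \<le> (\<Sum>j\<in>I. mode_error f \<phi> r j)"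
proof -
 let ?P = "PiM I M"
 define A where "A = PiE I (\<lambda>j. {1..r j})"
 have fA: "finite A" unfolding A_def by (intro finite_PiE finite_I) simp
 have ge1: "\<alpha> i \<ge> 1" if "\<alpha> \<in> A" "i \<in> I" for \<alpha> i using that by (auto simp: A_def PiE_def Pi_def)
 have sq: "L2 ?P (\<Phi> \<alpha>)" if a: "\<alpha> \<in> A" for \<alpha>
 proof -
  have "integrable ?P (\<lambda>x. \<Prod>i\<in>I. (\<phi> i (\<alpha> i) (x i))\<^sup>2)"
   by (rule product_integrable_prod[OF finite_I]) (rule L2D(2)[OF \<phi>[OF _ ge1[OF a]]])
  moreover have "\<Phi> \<alpha> \<in> borel_measurable ?P"
  proof -
   have "(\<lambda>x. \<phi> i (\<alpha> i) (x i)) \<in> borel_measurable ?P" if "i \<in> I" for i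
    using measurable_compose[of "\<lambda>x. x i" ?P "M i" "\<phi> i (\<alpha> i)" borel]
     measurable_component_singleton[OF that] L2D(1)[OF \<phi>[OF that ge1[OF a that]]] by blast
   then show ?thesis unfolding \<Phi>_def by (rule borel_measurable_prod)
  qed
  ultimately show ?thesis by (simp add: square_integrable_def \<Phi>_def prod_power_distrib)
 qed
 have ort: "(\<integral>x. \<Phi> \<alpha> x * \<Phi> \<beta> x \<partial>?P) = (if \<alpha> = \<beta> then 1 else 0)" if a: "\<alpha> \<in> A" and b: "\<beta> \<in> A" for \<alpha> \<beta>
 proof -
  have "(\<integral>x. \<Phi> \<alpha> x * \<Phi> \<beta> x \<partial>?P) = (\<integral>x. (\<Prod>i\<in>I. \<phi> i (\<alpha> i) (x i) * \<phi> i (\<beta> i) (x i)) \<partial>?P)"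
   by (simp add: \<Phi>_def prod.distrib)
  also have "\<dots> = (\<Prod>i\<in>I. \<integral>x. \<phi> i (\<alpha> i) x * \<phi> i (\<beta> i) x \<partial>M i)"
   by (rule product_integral_prod[OF finite_I])
     (rule L2_mult[OF \<phi>[OF _ ge1[OF a]] \<phi>[OF _ ge1[OF b]]])
  also have "\<dots> = (\<Prod>i\<in>I. if \<alpha> i = \<beta> i then 1 else 0)"
   by (rule prod.cong[OF refl]) (rule on[OF _ ge1[OF a] ge1[OF b]])
  also have "\<dots> = (if \<alpha> = \<beta> then 1 else 0)"
  proof (cases "\<alpha> = \<beta>")
   case False
   then obtain i where "i \<in> I" "\<alpha> i \<noteq> \<beta> i" using a b unfolding A_def by (metis PiE_ext)
   then show ?thesis using finite_I False by auto
  qed simp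
  finally show ?thesis .
 qed
 show sqt: "L2 ?P (\<lambda>x. f x - t x)"
  unfolding t_def A_def[symmetric]
  by (intro L2_diff[OF f] L2_sum L2_cmult sq)
 define Q1 where "Q1 b a \<longleftrightarrow> (\<forall>\<alpha>\<in>A. L2 ?P (b \<alpha>) \<and>
    (\<forall>x\<in>space ?P. b \<alpha> x = \<Phi> \<alpha> x * a \<alpha> x) \<and>
    (\<forall>x\<in>space ?P. \<forall>x'\<in>space ?P. (\<forall>i\<in>I - I. x i = x' i) \<longrightarrow> a \<alpha> x = a \<alpha> x'))"
  for b a :: "('i \<Rightarrow> nat) \<Rightarrow> ('i \<Rightarrow> 'a) \<Rightarrow> real"
 define Q2 where "Q2 b \<longleftrightarrow> (\<integral>x. (f x - (\<Sum>\<alpha>\<in>A. b \<alpha> x))\<^sup>2 \<partial>?P) \<le> (\<Sum>j\<in>I. mode_error f \<phi> r j)"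
  for b :: "('i \<Rightarrow> nat) \<Rightarrow> ('i \<Rightarrow> 'a) \<Rightarrow> real"
 have "\<exists>b a. Q1 b a \<and> Q2 b"
  unfolding Q1_def Q2_def A_def \<Phi>_def by (rule successive_mode_projection[OF f \<phi> on order_refl])
 then obtain b a where Q: "Q1 b a" "Q2 b" by blast
 have err: "(\<integral>x. (f x - (\<Sum>\<alpha>\<in>A. b \<alpha> x))\<^sup>2 \<partial>?P) \<le> (\<Sum>j\<in>I. mode_error f \<phi> r j)"
  using Q(2) by (simp add: Q2_def)
 define x0 where "x0 = (SOME x. x \<in> space ?P)"
 define c where "c \<alpha> = a \<alpha> x0" for \<alpha>
 have bc: "b \<alpha> x = c \<alpha> * \<Phi> \<alpha> x" if "\<alpha> \<in> A" "x \<in> space ?P" for \<alpha> x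
 proof -
  have "x0 \<in> space ?P" unfolding x0_def by (rule someI[where P = "\<lambda>x. x \<in> space ?P", OF that(2)])
  then have "a \<alpha> x = c \<alpha>" using Q(1) that unfolding Q1_def c_def by blast
  then show ?thesis using Q(1) that unfolding Q1_def by (metis mult.commute)
 qed
 let ?k = "\<lambda>\<alpha>. \<integral>x. f x * \<Phi> \<alpha> x \<partial>?P"
 have "(\<integral>x. (f x - t x)\<^sup>2 \<partial>?P) = (\<integral>x. (f x)\<^sup>2 \<partial>?P) - (\<Sum>\<alpha>\<in>A. (?k \<alpha>)\<^sup>2)"
  using orthonormal_distance[where \<phi> = \<Phi> and a = ?k, OF fA sq ort f] unfolding t_def A_def[symmetric] by simp
 also have "\<dots> \<le> (\<integral>x. (f x)\<^sup>2 \<partial>?P) - (\<Sum>\<alpha>\<in>A. (?k \<alpha>)\<^sup>2) + (\<Sum>\<alpha>\<in>A. (c \<alpha> - ?k \<alpha>)\<^sup>2)"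
  by (simp add: sum_nonneg)
 also have "\<dots> = (\<integral>x. (f x - (\<Sum>\<alpha>\<in>A. c \<alpha> * \<Phi> \<alpha> x))\<^sup>2 \<partial>?P)"
  by (rule orthonormal_distance[where \<phi> = \<Phi> and a = c, OF fA sq ort f, symmetric])
 also have "\<dots> = (\<integral>x. (f x - (\<Sum>\<alpha>\<in>A. b \<alpha> x))\<^sup>2 \<partial>?P)"
 proof (rule Bochner_Integration.integral_cong[OF refl])
  fix x assume "x \<in> space ?P"
  then have "(\<Sum>\<alpha>\<in>A. b \<alpha> x) = (\<Sum>\<alpha>\<in>A. c \<alpha> * \<Phi> \<alpha> x)" by (intro sum.cong[OF refl] bc)
  then show "(f x - (\<Sum>\<alpha>\<in>A. c \<alpha> * \<Phi> \<alpha> x))\<^sup>2 = (f x - (\<Sum>\<alpha>\<in>A. b \<alpha> x))\<^sup>2" by simp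
 qed
 also note err
 finally show "(\<integral>x. (f x - t x)\<^sup>2 \<partial>?P) \<le> (\<Sum>j\<in>I. mode_error f \<phi> r j)" .
qed

end

section \<open>Smooth bumps\<close>

text \<open>The powers in the denominator make the family closed under differentiation.\<close>
definition flat_exp :: "real \<Rightarrow> nat \<Rightarrow> real \<Rightarrow> real" where
 "flat_exp c k w = (if w > 0 then exp (- c / w) / w ^ k else 0)"

lemma flat_exp_tendsto_0:
 assumes "c > 0"
 shows "(flat_exp c k \<longlongrightarrow> 0) (at 0)"
proof (rule filterlim_split_at_real)
 have "eventually (\<lambda>w. flat_exp c k w = 0) (at_left 0)"
  by (auto simp: eventually_at_left_field flat_exp_def intro: exI[of _ "-1"])
 then show "(flat_exp c k \<longlongrightarrow> 0) (at_left 0)" by (rule tendsto_eventually)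
 have "filterlim (\<lambda>w. c * inverse w) at_top (at_right (0::real))"
  by (rule filterlim_tendsto_pos_mult_at_top[OF tendsto_const assms filterlim_inverse_at_top_right])
 then have "((\<lambda>w. (c * inverse w) ^ k / exp (c * inverse w) / c ^ k) \<longlongrightarrow> 0 / c ^ k) (at_right 0)"
  using assms by (intro tendsto_divide tendsto_const filterlim_compose[OF tendsto_power_div_exp_0]) auto
 moreover have "eventually (\<lambda>w. (c * inverse w) ^ k / exp (c * inverse w) / c ^ k = flat_exp c k w) (at_right 0)"
  unfolding eventually_at_right_field
  using assms
  by (intro exI[of _ 1])
    (auto simp: flat_exp_def exp_minus power_mult_distrib field_simps)
 ultimately show "(flat_exp c k \<longlongrightarrow> 0) (at_right 0)"
  using tendsto_cong by fastforce
qed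

lemma flat_exp_has_derivative:
 assumes c: "c > 0"
 shows "(flat_exp c k has_real_derivative (c * flat_exp c (k + 2) w - real k * flat_exp c (k + 1) w)) (at w)"
proof -
 consider "w > 0" | "w < 0" | "w = 0" by linarith
 then show ?thesis
 proof cases
  case 1
  have d: "((\<lambda>w. exp (- c / w) / w ^ k) has_real_derivative
    (c * (exp (- c / w) / w ^ (k + 2)) - real k * (exp (- c / w) / w ^ (k + 1)))) (at w)"
   using 1
   by (auto intro!: derivative_eq_intros simp: power2_eq_square field_simps split: nat_diff_split)
  show ?thesis
  proof -
   have "eventually (\<lambda>x. exp (- c / x) / x ^ k = flat_exp c k x) (nhds w)"
    using 1 by (intro eventually_mono[OF eventually_nhds_in_open[of "{0<..}"]]) (auto simp: flat_exp_def)
   then have "(flat_exp c k has_real_derivative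
    (c * (exp (- c / w) / w ^ (k + 2)) - real k * (exp (- c / w) / w ^ (k + 1)))) (at w)"
    using DERIV_cong_ev[OF refl _ refl, of "\<lambda>x. exp (- c / x) / x ^ k" "flat_exp c k" w] d by simp
   then show ?thesis using 1 by (simp add: flat_exp_def)
  qed
 next
  case 2
  have "((\<lambda>_. 0) has_real_derivative 0) (at w)" by simp
  moreover have "eventually (\<lambda>x. 0 = flat_exp c k x) (nhds w)"
   using 2 by (intro eventually_mono[OF eventually_nhds_in_open[of "{..<0}"]]) (auto simp: flat_exp_def)
  ultimately have "(flat_exp c k has_real_derivative 0) (at w)"
   using DERIV_cong_ev[of w w "\<lambda>_. 0" "flat_exp c k" 0 0] by simp
  then show ?thesis using 2 by (simp add: flat_exp_def)
 next
  case 3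
  have "(\<lambda>h. (flat_exp c k (0 + h) - flat_exp c k 0) / h) = flat_exp c (k + 1)"
   by (auto simp: flat_exp_def fun_eq_iff)
  then show ?thesis using flat_exp_tendsto_0[OF c, of "k + 1"]
   unfolding 3 DERIV_def by (simp add: flat_exp_def)
 qed
qed

text \<open>The bump is \<open>\<beta> 0\<close>, and \<open>\<beta> n\<close> is its derivative of order \<open>n\<close>.\<close>
definition smooth_bump :: "real \<Rightarrow> real \<Rightarrow> (nat \<Rightarrow> real \<Rightarrow> real) \<Rightarrow> bool" where
 "smooth_bump a b \<beta> \<longleftrightarrow> (\<forall>n t. (\<beta> n has_real_derivative \<beta> (Suc n) t) (at t)) \<and>
   (\<forall>n t. t \<notin> {a..b} \<longrightarrow> \<beta> n t = 0)"

lemma smooth_bump_translate: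
 assumes "smooth_bump a b \<beta>"
 shows "smooth_bump (a + h) (b + h) (\<lambda>n t. \<beta> n (t - h))"
proof -
 have "((\<lambda>t. \<beta> n (t - h)) has_real_derivative \<beta> (Suc n) (t - h)) (at t)" for n t
 proof -
  have "(\<beta> n has_real_derivative \<beta> (Suc n) (t - h)) (at (t - h))"
   using assms by (simp add: smooth_bump_def)
  then show ?thesis using DERIV_shift[of "\<beta> n" "\<beta> (Suc n) (t - h)" t "- h"] by simp
 qed
 then show ?thesis using assms unfolding smooth_bump_def by auto
qed

lemma smooth_bump_continuous: "smooth_bump a b \<beta> \<Longrightarrow> continuous_on UNIV (\<beta> n)"
 by (auto simp: smooth_bump_def continuous_on_eq_continuous_at intro: DERIV_isCont)

lemma smooth_bump_bounded:
 assumes "smooth_bump a b \<beta>"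
 shows "\<exists>C\<ge>0. \<forall>t. \<bar>\<beta> n t\<bar> \<le> C"
proof -
 have "compact (\<beta> n ` {a..b})"
  using smooth_bump_continuous[OF assms] by (intro compact_continuous_image) (auto intro: continuous_on_subset)
 then obtain C where C: "\<forall>t\<in>{a..b}. \<bar>\<beta> n t\<bar> \<le> C"
  using compact_imp_bounded[of "\<beta> n ` {a..b}"] unfolding bounded_iff by auto
 have "\<bar>\<beta> n t\<bar> \<le> max C 0" for t
  using C[rule_format, of t] assms by (cases "t \<in> {a..b}") (auto simp: smooth_bump_def)
 then show ?thesis by (intro exI[of _ "max C 0"]) auto
qed

text \<open>With \<open>w = (t - a) (b - t)\<close>, functions of the form \<open>p(t) w\<^sup>-\<^sup>k exp(-c/w)\<close> are closed under
 differentiation.\<close>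
lemma smooth_bump_exists:
 assumes "a < b" and c: "c > 0"
 shows "\<exists>\<beta>. smooth_bump a b \<beta> \<and> \<beta> 0 = (\<lambda>t. flat_exp c 0 ((t - a) * (b - t)))"
proof -
 define W where "W = [:- (a * b), a + b, -1:]"
 have W: "poly W t = (t - a) * (b - t)" for t by (simp add: W_def algebra_simps)
 define H where "H s t = poly (fst s) t * flat_exp c (snd s) (poly W t)" for s t
 define step where "step s = (pderiv (fst s) * W\<^sup>2 + fst s * pderiv W * ([:c:] - of_nat (snd s) * W), snd s + 2)" for s :: "real poly \<times> nat"
 have dH: "(H s has_real_derivative H (step s) t) (at t)" for s t
 proof -
  let ?w = "poly W t" and ?k = "snd s"
  have "(H s has_real_derivative
    (poly (pderiv (fst s)) t * flat_exp c ?k ?w +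
    (c * flat_exp c (?k + 2) ?w - real ?k * flat_exp c (?k + 1) ?w) * poly (pderiv W) t * poly (fst s) t)) (at t)"
   unfolding H_def[abs_def]
   by (rule DERIV_mult[OF poly_DERIV DERIV_chain2[OF flat_exp_has_derivative[OF c] poly_DERIV]])
  moreover have "flat_exp c ?k ?w = ?w\<^sup>2 * flat_exp c (?k + 2) ?w"
   "flat_exp c (?k + 1) ?w = ?w * flat_exp c (?k + 2) ?w"
   by (auto simp: flat_exp_def power2_eq_square)
  ultimately show ?thesis
   by (simp add: H_def step_def algebra_simps power2_eq_square)
 qed
 define \<beta> where "\<beta> n = H ((step ^^ n) ([:1:], 0))" for n
 have "(\<beta> n has_real_derivative \<beta> (Suc n) t) (at t)" for n t
  unfolding \<beta>_def using dH by simp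
 moreover have "\<beta> n t = 0" if "t \<notin> {a..b}" for n t
 proof -
  have "poly W t \<le> 0" unfolding W using that assms(1)
   by (auto simp: mult_le_0_iff)
  then show ?thesis by (simp add: \<beta>_def H_def flat_exp_def)
 qed
 moreover have "\<beta> 0 = (\<lambda>t. flat_exp c 0 ((t - a) * (b - t)))"
  by (simp add: \<beta>_def H_def[abs_def] W)
 ultimately show ?thesis unfolding smooth_bump_def by (intro exI[of _ \<beta>]) blast
qed

text \<open>\<open>B i n\<close> stands for the \<open>n\<close>-th derivative of the factor in coordinate \<open>i\<close>, and the list for the
 coordinates with respect to which the product is differentiated.\<close>
definition prod_deriv :: "'i set \<Rightarrow> ('i \<Rightarrow> nat \<Rightarrow> real \<Rightarrow> real) \<Rightarrow> 'i list \<Rightarrow> ('i \<Rightarrow> real) \<Rightarrow> real" where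
 "prod_deriv I B is x = (\<Prod>i\<in>I. B i (count_list is i) (x i))"

lemma prod_deriv_Cons:
 assumes "finite I" "i \<in> I"
 shows "prod_deriv I B (i # is) x =
   B i (Suc (count_list is i)) (x i) * (\<Prod>j\<in>I - {i}. B j (count_list is j) (x j))"
proof -
 have "prod_deriv I B (i # is) x = B i (Suc (count_list is i)) (x i) * (\<Prod>j\<in>I - {i}. B j (count_list (i # is) j) (x j))"
  unfolding prod_deriv_def by (subst prod.remove[OF assms]) simp
 also have "(\<Prod>j\<in>I - {i}. B j (count_list (i # is) j) (x j)) = (\<Prod>j\<in>I - {i}. B j (count_list is j) (x j))"
  by (rule prod.cong) auto
 finally show ?thesis .
qed

lemma prod_deriv_has_derivative:
 assumes I: "finite I"
  and B: "\<forall>i\<in>I. \<forall>n t. (B i n has_real_derivative B i (Suc n) t) (at t)"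
  and g: "\<And>i. i \<in> I \<Longrightarrow> (g i has_real_derivative g' i) (at s)"
 shows "((\<lambda>s. prod_deriv I B is (\<lambda>i. g i s)) has_real_derivative
   (\<Sum>i\<in>I. g' i * prod_deriv I B (i # is) (\<lambda>i. g i s))) (at s)"
proof -
 have "((\<lambda>s. prod_deriv I B is (\<lambda>i. g i s)) has_real_derivative
   (\<Sum>i\<in>I. (B i (Suc (count_list is i)) (g i s) * g' i) * (\<Prod>j\<in>I - {i}. B j (count_list is j) (g j s)))) (at s)"
  unfolding prod_deriv_def
  by (rule has_field_derivative_prod) (rule DERIV_chain2[OF B[rule_format] g])
 moreover have "(\<Sum>i\<in>I. (B i (Suc (count_list is i)) (g i s) * g' i) * (\<Prod>j\<in>I - {i}. B j (count_list is j) (g j s))) =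
  (\<Sum>i\<in>I. g' i * prod_deriv I B (i # is) (\<lambda>i. g i s))"
  by (rule sum.cong[OF refl]) (simp add: prod_deriv_Cons[OF I])
 ultimately show ?thesis by simp
qed

lemma partial_deriv_prod_deriv:
 assumes I: "finite I" and i: "i \<in> I"
  and B: "\<forall>i\<in>I. \<forall>n t. (B i n has_real_derivative B i (Suc n) t) (at t)"
 shows "((\<lambda>t. prod_deriv I B is (x(i := t))) has_real_derivative prod_deriv I B (i # is) x) (at (x i))"
  and "partial_deriv i (prod_deriv I B is) = prod_deriv I B (i # is)"
proof -
 have d: "((\<lambda>t. prod_deriv I B is (x(i := t))) has_real_derivative prod_deriv I B (i # is) x) (at (x i))" for x
 proof -
  define g where "g j t = (if j = i then t else x j)" for j t
  have "((\<lambda>t. prod_deriv I B is (\<lambda>j. g j t)) has_real_derivative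
    (\<Sum>j\<in>I. (if j = i then 1 else 0) * prod_deriv I B (j # is) (\<lambda>j. g j (x i)))) (at (x i))"
   by (rule prod_deriv_has_derivative[OF I B]) (auto simp: g_def)
  moreover have "(\<lambda>j. g j t) = x(i := t)" for t by (auto simp: g_def)
  moreover have "(\<Sum>j\<in>I. (if j = i then 1 else 0) * prod_deriv I B (j # is) y) = prod_deriv I B (i # is) y" for y
   using I i by (simp add: if_distrib[of "\<lambda>u. u * _"] cong: if_cong)
  ultimately show ?thesis by simp
 qed
 then show "((\<lambda>t. prod_deriv I B is (x(i := t))) has_real_derivative prod_deriv I B (i # is) x) (at (x i))" .
 show "partial_deriv i (prod_deriv I B is) = prod_deriv I B (i # is)"
  unfolding partial_deriv_def[abs_def] using DERIV_imp_deriv[OF d] by blast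
qed

lemma partial_derivs_prod_deriv:
 assumes I: "finite I" and "set is \<subseteq> I"
  and B: "\<forall>i\<in>I. \<forall>n t. (B i n has_real_derivative B i (Suc n) t) (at t)"
 shows "partial_derivs is (prod_deriv I B []) = prod_deriv I B is"
 using assms(2)
proof (induction "is")
 case Nil
 then show ?case by (simp add: partial_derivs_def)
next
 case (Cons i js)
 have "partial_derivs (i # js) (prod_deriv I B []) = partial_deriv i (partial_derivs js (prod_deriv I B []))"
  by (simp add: partial_derivs_def)
 also have "\<dots> = prod_deriv I B (i # js)"
  using Cons partial_deriv_prod_deriv(2)[OF I _ B] by simp
 finally show ?case .
qed

lemma test_function_prod_deriv:
 assumes I: "finite I" and B: "\<And>i. i \<in> I \<Longrightarrow> smooth_bump (a i) (b i) (B i)"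
  and D: "PiE I (\<lambda>i. {a i..b i}) \<subseteq> D"
 shows "test_function I D (prod_deriv I B [])"
 unfolding test_function_def
proof
 have dB: "\<forall>i\<in>I. \<forall>n t. (B i n has_real_derivative B i (Suc n) t) (at t)"
  using B by (simp add: smooth_bump_def)
 show "smooth I (prod_deriv I B [])"
  unfolding smooth_def
 proof (intro ballI conjI)
  fix js assume "js \<in> lists I"
  then have js: "partial_derivs js (prod_deriv I B []) = prod_deriv I B js"
   by (intro partial_derivs_prod_deriv[OF I _ dB]) auto
  show "continuous_map (eucl_top I) euclideanreal (partial_derivs js (prod_deriv I B []))"
   unfolding js unfolding prod_deriv_def[abs_def] eucl_top_def
  proof (rule continuous_map_prod[OF I])
   fix i assume i: "i \<in> I"
   have "continuous_map euclideanreal euclideanreal (B i (count_list js i))"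
    using smooth_bump_continuous[OF B[OF i]] by simp
   then show "continuous_map (product_topology (\<lambda>_. euclideanreal) I) euclideanreal (\<lambda>x. B i (count_list js i) (x i))"
    using continuous_map_compose[OF continuous_map_product_projection[OF i, of "\<lambda>_. euclideanreal"],
      of euclideanreal "B i (count_list js i)"] by (simp add: o_def)
  qed
  fix i x assume "i \<in> I"
  then show "(\<lambda>t. partial_derivs js (prod_deriv I B []) (x(i := t))) field_differentiable at (x i)"
   unfolding js field_differentiable_def using partial_deriv_prod_deriv(1)[OF I _ dB] by blast
 qed
 show "\<exists>K\<subseteq>D. compactin (eucl_top I) K \<and> (\<forall>x\<in>(I \<rightarrow>\<^sub>E UNIV) - K. prod_deriv I B [] x = 0)"
 proof (intro exI[of _ "PiE I (\<lambda>i. {a i..b i})"] conjI D ballI)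
  show "compactin (eucl_top I) (PiE I (\<lambda>i. {a i..b i}))"
   unfolding eucl_top_def by (auto simp: compactin_PiE)
  fix x assume "x \<in> (I \<rightarrow>\<^sub>E UNIV) - PiE I (\<lambda>i. {a i..b i})"
  then obtain i where "i \<in> I" "x i \<notin> {a i..b i}" by (auto simp: PiE_def Pi_def)
  then have "B i (count_list [] i) (x i) = 0" using B by (auto simp: smooth_bump_def)
  then show "prod_deriv I B [] x = 0"
   unfolding prod_deriv_def using I \<open>i \<in> I\<close> by (metis prod_zero)
 qed
qed

section \<open>Taylor's formula for weak derivatives\<close>

abbreviation leb :: "'i set \<Rightarrow> ('i \<Rightarrow> real) measure" where
 "leb I \<equiv> PiM I (\<lambda>_. lborel)"

interpretation lborel_prod: product_sigma_finite "\<lambda>_::'i. lborel :: real measure"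
 by standard


lemma sigma_finite_leb: "finite I \<Longrightarrow> sigma_finite_measure (leb I)"
 by (rule lborel_prod.sigma_finite)

lemma measurable_affine_leb:
 "(\<lambda>x. \<lambda>i\<in>I. v i + t * x i) \<in> measurable (leb I) (leb I)"
 by measurable

lemma leb_affine:
 assumes I: "finite I" and t: "t \<noteq> 0"
 shows "density (distr (leb I) (leb I) (\<lambda>x. \<lambda>i\<in>I. v i + t * x i)) (\<lambda>_. ennreal (\<bar>t\<bar> ^ card I)) = leb I"
proof (rule lborel_prod.PiM_eqI[OF I])
 interpret LI: finite_product_sigma_finite "\<lambda>_. lborel" I by standard (rule I)
 let ?T = "\<lambda>x. \<lambda>i\<in>I. v i + t * x i"
 fix A :: "'a \<Rightarrow> real set" assume A: "\<And>i. i \<in> I \<Longrightarrow> A i \<in> sets lborel"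
 have AI: "Pi\<^sub>E I A \<in> sets (leb I)" by (rule sets_PiM_I_finite[OF I A])
 have pre: "?T -` Pi\<^sub>E I A \<inter> space (leb I) = (\<Pi>\<^sub>E i\<in>I. (\<lambda>y. v i + t * y) -` A i)"
  by (auto simp: space_PiM PiE_def Pi_def)
 have pm: "(\<lambda>y. v i + t * y) -` A i \<in> sets lborel" if "i \<in> I" for i
  using measurable_sets[of "\<lambda>y. v i + t * y" lborel lborel "A i"] A[OF that] by simp
 have one: "ennreal \<bar>t\<bar> * emeasure lborel ((\<lambda>y. v i + t * y) -` A i) = emeasure lborel (A i)" if "i \<in> I" for i
 proof -
  have "emeasure lborel (A i) = emeasure (density (distr lborel borel (\<lambda>x. v i + t * x)) (\<lambda>_. ennreal \<bar>t\<bar>)) (A i)"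
   using lborel_real_affine[OF t, of "v i"] by simp
  also have "\<dots> = ennreal \<bar>t\<bar> * emeasure (distr lborel borel (\<lambda>x. v i + t * x)) (A i)"
   using A[OF that] by (subst emeasure_density_const) auto
  also have "\<dots> = ennreal \<bar>t\<bar> * emeasure lborel ((\<lambda>y. v i + t * y) -` A i)"
   using A[OF that] by (subst emeasure_distr) auto
  finally show ?thesis ..
 qed
 have "emeasure (density (distr (leb I) (leb I) ?T) (\<lambda>_. ennreal (\<bar>t\<bar> ^ card I))) (Pi\<^sub>E I A) =
   ennreal (\<bar>t\<bar> ^ card I) * emeasure (leb I) (\<Pi>\<^sub>E i\<in>I. (\<lambda>y. v i + t * y) -` A i)"
  using AI by (simp add: emeasure_density_const emeasure_distr[OF measurable_affine_leb] pre)
 also have "emeasure (leb I) (\<Pi>\<^sub>E i\<in>I. (\<lambda>y. v i + t * y) -` A i) = (\<Prod>i\<in>I. emeasure lborel ((\<lambda>y. v i + t * y) -` A i))"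
  by (rule LI.measure_times) (rule pm)
 also have "ennreal (\<bar>t\<bar> ^ card I) * \<dots> = (\<Prod>i\<in>I. ennreal \<bar>t\<bar> * emeasure lborel ((\<lambda>y. v i + t * y) -` A i))"
  by (simp add: prod.distrib ennreal_power)
 also have "\<dots> = (\<Prod>i\<in>I. emeasure lborel (A i))"
  by (rule prod.cong[OF refl one])
 finally show "emeasure (density (distr (leb I) (leb I) ?T) (\<lambda>_. ennreal (\<bar>t\<bar> ^ card I))) (Pi\<^sub>E I A) = (\<Prod>i\<in>I. emeasure lborel (A i))" .
qed simp

lemma nn_integral_leb_affine:
 assumes I: "finite I" and t: "t \<noteq> 0" and F[measurable]: "F \<in> borel_measurable (leb I)"
 shows "(\<integral>\<^sup>+x. F x \<partial>leb I) = ennreal (\<bar>t\<bar> ^ card I) * (\<integral>\<^sup>+x. F (\<lambda>i\<in>I. v i + t * x i) \<partial>leb I)"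
proof -
 note [measurable] = measurable_affine_leb
 have "(\<integral>\<^sup>+x. F x \<partial>leb I) = (\<integral>\<^sup>+x. F x \<partial>density (distr (leb I) (leb I) (\<lambda>x. \<lambda>i\<in>I. v i + t * x i)) (\<lambda>_. ennreal (\<bar>t\<bar> ^ card I)))"
  by (simp only: leb_affine[OF I t])
 also have "\<dots> = ennreal (\<bar>t\<bar> ^ card I) * (\<integral>\<^sup>+x. F (\<lambda>i\<in>I. v i + t * x i) \<partial>leb I)"
  by (simp add: nn_integral_density nn_integral_distr nn_integral_cmult)
 finally show ?thesis .
qed

lemma distr_leb_translate:
 assumes I: "finite I"
 shows "distr (leb I) (leb I) (\<lambda>x. \<lambda>i\<in>I. x i + v i) = leb I"
proof -
 have "(\<lambda>x. \<lambda>i\<in>I. x i + v i) = (\<lambda>x. \<lambda>i\<in>I. v i + 1 * x i)" by (auto simp: fun_eq_iff)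
 then show ?thesis using leb_affine[OF I, of 1 v] by (simp add: density_1)
qed

lemma measurable_translate_leb: "(\<lambda>x. \<lambda>i\<in>I. x i + v i) \<in> measurable (leb I) (leb I)"
 by measurable

lemma integral_leb_translate:
 fixes F :: "('i \<Rightarrow> real) \<Rightarrow> real"
 assumes I: "finite I" and F: "F \<in> borel_measurable (leb I)"
 shows "(\<integral>x. F (\<lambda>i\<in>I. x i + v i) \<partial>leb I) = (\<integral>x. F x \<partial>leb I)"
  and "integrable (leb I) (\<lambda>x. F (\<lambda>i\<in>I. x i + v i)) \<longleftrightarrow> integrable (leb I) F"
 using integral_distr[OF measurable_translate_leb F] integrable_distr_eq[OF measurable_translate_leb F]
 unfolding distr_leb_translate[OF I] by auto

lemma nn_integral_leb_translate:
 assumes I: "finite I" and F: "F \<in> borel_measurable (leb I)"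
 shows "(\<integral>\<^sup>+x. F (\<lambda>i\<in>I. x i + v i) \<partial>leb I) = (\<integral>\<^sup>+x. F x \<partial>leb I)"
 using nn_integral_distr[OF measurable_translate_leb, of F I v] F by (simp add: distr_leb_translate[OF I])

lemma integral_dom_measure:
 fixes f :: "('i \<Rightarrow> real) \<Rightarrow> real"
 assumes "D \<in> sets (leb I)"
 shows "(\<integral>x. f x \<partial>dom_measure I D) = (\<integral>x. indicator D x * f x \<partial>leb I)"
  and "integrable (dom_measure I D) f \<longleftrightarrow> integrable (leb I) (\<lambda>x. indicator D x * f x)"
 using assms sets.sets_into_space[OF assms] integral_restrict_space[of D "leb I" f] integrable_restrict_space[of D "leb I" f]
 by (auto simp: dom_measure_def Int_absorb1 Int_absorb2)

lemma (in pair_sigma_finite) integrable_tensor: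
 fixes f :: "'a \<Rightarrow> real" and g :: "'b \<Rightarrow> real"
 assumes f: "integrable M1 f" and g: "integrable M2 g"
 shows "integrable (M1 \<Otimes>\<^sub>M M2) (\<lambda>z. f (fst z) * g (snd z))"
proof -
 note [measurable] = borel_measurable_integrable[OF f] borel_measurable_integrable[OF g]
 have "integrable (M1 \<Otimes>\<^sub>M M2) (\<lambda>(x, y). f x * g y)"
 proof (rule Fubini_integrable)
  show "(\<lambda>(x, y). f x * g y) \<in> borel_measurable (M1 \<Otimes>\<^sub>M M2)" by measurable
  show "integrable M1 (\<lambda>x. \<integral>y. norm (case (x, y) of (x, y) \<Rightarrow> f x * g y) \<partial>M2)"
   using f by (simp add: abs_mult)
  show "AE x in M1. integrable M2 (\<lambda>y. case (x, y) of (x, y) \<Rightarrow> f x * g y)"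
   using g by simp
 qed
 then show ?thesis by (simp add: split_beta')
qed

lemma (in pair_sigma_finite) swap_integrals:
 fixes H :: "'a \<times> 'b \<Rightarrow> real"
 assumes "integrable (M1 \<Otimes>\<^sub>M M2) H"
 shows "(\<integral>x. (\<integral>y. H (x, y) \<partial>M2) \<partial>M1) = (\<integral>y. (\<integral>x. H (x, y) \<partial>M1) \<partial>M2)"
 using integral_fst[of "curry H"] integral_snd[of "curry H"] assms by simp

text \<open>The kernel of the integral remainder of order \<open>p\<close> on the unit interval.\<close>
definition taylor_weight :: "nat \<Rightarrow> real \<Rightarrow> real" where
 "taylor_weight p s = indicator {0..1} s * ((1 - s) ^ (p - 1) / fact (p - 1))"

lemma taylor_weight_measurable [measurable]: "taylor_weight p \<in> borel_measurable borel"
 unfolding taylor_weight_def by measurable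

lemma taylor_weight_bounds: "0 \<le> taylor_weight p s" "taylor_weight p s \<le> indicator {0..1} s"
proof -
 show "0 \<le> taylor_weight p s" by (auto simp: taylor_weight_def indicator_def)
 have "(1 - s) ^ (p - 1) / fact (p - 1) \<le> 1" if "s \<in> {0..1}"
 proof -
  have "(1 - s) ^ (p - 1) \<le> 1" using that by (intro power_le_one) auto
  moreover have "(1::real) \<le> fact (p - 1)" by simp
  ultimately have "(1 - s) ^ (p - 1) \<le> fact (p - 1)" by (rule order_trans)
  then show ?thesis by simp
 qed
 then show "taylor_weight p s \<le> indicator {0..1} s" by (auto simp: taylor_weight_def indicator_def)
qed

lemma taylor_weight_integrable: "integrable lborel (taylor_weight p)"
proof (rule Bochner_Integration.integrable_bound[where f = "indicator {0..1::real}"])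
 show "AE s in lborel. norm (taylor_weight p s) \<le> norm (indicator {0..1::real} s :: real)"
  using taylor_weight_bounds by auto
qed auto

lemma Taylor_lebesgue:
 fixes Df :: "nat \<Rightarrow> real \<Rightarrow> real"
 assumes p: "p > 0"
  and Df: "\<forall>m<p. \<forall>t. (Df m has_real_derivative Df (Suc m) t) (at t)"
  and cont: "continuous_on UNIV (Df p)"
 shows "Df 0 1 = (\<Sum>i<p. Df i 0 / fact i) + (\<integral>s. taylor_weight p s * Df p s \<partial>lborel)"
proof -
 let ?i = "\<lambda>s. ((1 - s) ^ (p - 1) / fact (p - 1)) * Df p s"
 have "Df 0 1 = (\<Sum>i<p. ((1 - 0) ^ i / fact i) *\<^sub>R Df i 0) + integral {0..1} (\<lambda>x. ((1 - x) ^ (p - 1) / fact (p - 1)) *\<^sub>R Df p x)"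
  by (rule Taylor_integral[OF p refl])
    (use Df in \<open>auto simp: has_real_derivative_iff_has_vector_derivative intro: has_vector_derivative_at_within\<close>)
 moreover have "integral {0..1} ?i = (\<integral>s. taylor_weight p s * Df p s \<partial>lborel)"
 proof -
  have "continuous_on {0..1} ?i"
   by (intro continuous_intros continuous_on_subset[OF cont]) auto
  then have "set_integrable lborel {0..1} ?i" by (rule borel_integrable_atLeastAtMost')
  from set_borel_integral_eq_integral(2)[OF this]
  show ?thesis by (simp add: set_lebesgue_integral_def taylor_weight_def mult.assoc)
 qed
 ultimately show ?thesis by simp
qed

text \<open>The remainder in Taylor's formula for \<open>s\<^sup>p / p!\<close> is the whole function.\<close>
lemma integral_taylor_weight:
 assumes "p > 0"
 shows "(\<integral>s. taylor_weight p s \<partial>lborel) = 1 / fact p"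
proof -
 define Df where "Df i s = s ^ (p - i) / fact (p - i)" for i and s :: real
 have d: "(Df m has_real_derivative Df (Suc m) t) (at t)" if "m < p" for m t
 proof -
  obtain k where k: "p - m = Suc k" "p - Suc m = k" using \<open>m < p\<close> by (metis Suc_diff_Suc)
  have "real (Suc k) * t ^ k / fact (Suc k) = t ^ k / fact k"
   by (simp add: fact_Suc del: of_nat_Suc)
  then show ?thesis unfolding Df_def[abs_def] k
   using DERIV_cdivide[OF DERIV_pow[of "Suc k" t], of "fact (Suc k)"] by simp
 qed
 have "Df 0 1 = (\<Sum>i<p. Df i 0 / fact i) + (\<integral>s. taylor_weight p s * Df p s \<partial>lborel)"
  by (rule Taylor_lebesgue[OF assms]) (use d in \<open>simp_all add: Df_def[abs_def]\<close>)
 moreover have "(\<Sum>i<p. Df i 0 / fact i) = 0"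
  by (rule sum.neutral) (auto simp: Df_def power_0_left)
 ultimately show ?thesis by (simp add: Df_def)
qed

text \<open>As for weak derivatives, partial derivatives of order \<open>k\<close> are indexed by lists of coordinates.  A
 multi-index occurs once for each of its orderings, which accounts for the multinomial coefficients
 in Taylor's formula.\<close>
definition index_lists :: "'i set \<Rightarrow> nat \<Rightarrow> 'i list set" where
 "index_lists I k = {is. set is \<subseteq> I \<and> length is = k}"

definition list_power :: "('i \<Rightarrow> real) \<Rightarrow> 'i list \<Rightarrow> real" where
 "list_power h is = prod_list (map h is)"

lemma list_power_simps [simp]: "list_power h [] = 1" "list_power h (i # is) = h i * list_power h is"
 by (simp_all add: list_power_def)

lemma finite_index_lists: "finite I \<Longrightarrow> finite (index_lists I k)"
 unfolding index_lists_def by (rule finite_lists_length_eq)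

lemma index_lists_0: "index_lists I 0 = {[]}"
 by (auto simp: index_lists_def)

lemma sum_index_lists_Suc:
 fixes F :: "'i list \<Rightarrow> real"
 shows "(\<Sum>is\<in>index_lists I (Suc k). F is) = (\<Sum>is\<in>index_lists I k. \<Sum>i\<in>I. F (i # is))"
proof -
 have "index_lists I (Suc k) = (\<lambda>(xs, n). n # xs) ` (index_lists I k \<times> I)"
  unfolding index_lists_def by (rule lists_length_Suc_eq)
 moreover have "inj_on (\<lambda>(xs, n). n # xs) (index_lists I k \<times> I)" by (auto intro!: inj_onI)
 ultimately show ?thesis
  by (simp only: sum.reindex sum.cartesian_product o_def) (rule sum.cong, auto)
qed

text \<open>Along the segment from \<open>x\<close> to \<open>x - h\<close> each differentiation brings a factor \<open>- h i\<close> and prepends \<open>i\<close>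
 to the list of coordinates.\<close>
lemma prod_deriv_Taylor:
 assumes I: "finite I" and B: "\<forall>i\<in>I. \<forall>n t. (B i n has_real_derivative B i (Suc n) t) (at t)" and p: "p > 0"
 shows "prod_deriv I B [] (\<lambda>i. x i - h i) =
   (\<Sum>k<p. (- 1) ^ k / fact k * (\<Sum>is\<in>index_lists I k. list_power h is * prod_deriv I B is x))
  + (\<integral>s. taylor_weight p s * ((- 1) ^ p * (\<Sum>is\<in>index_lists I p. list_power h is * prod_deriv I B is (\<lambda>i. x i - s * h i))) \<partial>lborel)"
proof -
 define Df where "Df k s = (- 1) ^ k * (\<Sum>is\<in>index_lists I k. list_power h is * prod_deriv I B is (\<lambda>i. x i - s * h i))" for k s
 have d: "(Df k has_real_derivative Df (Suc k) t) (at t)" for k t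
 proof -
  have "((\<lambda>s. prod_deriv I B is (\<lambda>i. x i - s * h i)) has_real_derivative
    (\<Sum>i\<in>I. (- h i) * prod_deriv I B (i # is) (\<lambda>i. x i - t * h i))) (at t)" for "is"
   by (rule prod_deriv_has_derivative[OF I B]) (auto intro!: derivative_eq_intros)
  then have "(Df k has_real_derivative ((- 1) ^ k * (\<Sum>is\<in>index_lists I k. list_power h is *
    (\<Sum>i\<in>I. (- h i) * prod_deriv I B (i # is) (\<lambda>i. x i - t * h i))))) (at t)"
   unfolding Df_def[abs_def] by (intro DERIV_cmult DERIV_sum)
  moreover have "((- 1) ^ k * (\<Sum>is\<in>index_lists I k. list_power h is *
    (\<Sum>i\<in>I. (- h i) * prod_deriv I B (i # is) (\<lambda>i. x i - t * h i)))) = Df (Suc k) t"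
   unfolding Df_def sum_index_lists_Suc
   by (simp add: sum_distrib_left sum_negf mult_ac)
  ultimately show ?thesis by simp
 qed
 have "Df 0 1 = (\<Sum>k<p. Df k 0 / fact k) + (\<integral>s. taylor_weight p s * Df p s \<partial>lborel)"
 proof (rule Taylor_lebesgue[OF p])
  show "\<forall>m<p. \<forall>t. (Df m has_real_derivative Df (Suc m) t) (at t)" using d by blast
  show "continuous_on UNIV (Df p)"
   using DERIV_isCont[OF d] by (simp add: continuous_on_eq_continuous_at)
 qed
 then show ?thesis by (simp add: Df_def index_lists_0)
qed

text \<open>The Taylor formula for weak derivatives, tested against a product of bumps: the formula for the
 translates of the bump is multiplied by \<open>u\<close> and integrated, and weak differentiation moves the
 derivatives onto \<open>u\<close>.  All functions are extended by zero outside of the domain.\<close>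
lemma weak_Taylor_tested:
 fixes g :: "'i list \<Rightarrow> ('i \<Rightarrow> real) \<Rightarrow> real" and u :: "('i \<Rightarrow> real) \<Rightarrow> real"
 assumes I: "finite I" and D: "D \<in> sets (leb I)" and p: "p > 0"
  and u: "integrable (dom_measure I D) u"
  and g: "\<forall>is. set is \<subseteq> I \<longrightarrow> length is \<le> p \<longrightarrow> integrable (dom_measure I D) (g is) \<and> weak_deriv I D is u (g is)"
  and B: "\<forall>i\<in>I. smooth_bump (a i) (b i) (B i)"
  and seg: "\<forall>s\<in>{0..1}. PiE I (\<lambda>i. {a i + s * h i..b i + s * h i}) \<subseteq> D"
 defines "E \<equiv> \<lambda>v x. indicator D x * v x"
 shows "(\<integral>x. E u (\<lambda>i\<in>I. x i + h i) * prod_deriv I B [] x \<partial>leb I) =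
   (\<Sum>k<p. 1 / fact k * (\<Sum>is\<in>index_lists I k. list_power h is * (\<integral>x. E (g is) x * prod_deriv I B [] x \<partial>leb I)))
   + (\<integral>s. taylor_weight p s * (\<Sum>is\<in>index_lists I p. list_power h is *
     (\<integral>x. E (g is) (\<lambda>i\<in>I. x i + s * h i) * prod_deriv I B [] x \<partial>leb I)) \<partial>lborel)"
proof -
 let ?L = "leb I"
 let ?N = "index_lists I p"
 interpret L: sigma_finite_measure ?L by (rule sigma_finite_leb[OF I])
 interpret LP: pair_sigma_finite ?L lborel by unfold_locales
 have dB: "\<forall>i\<in>I. \<forall>n t. (B i n has_real_derivative B i (Suc n) t) (at t)"
  using B by (simp add: smooth_bump_def)
 have Eu: "integrable ?L (E u)" using u unfolding integral_dom_measure(2)[OF D] E_def .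
 have Eg: "integrable ?L (E (g is))" if "is \<in> index_lists I k" "k \<le> p" for "is" k
  using g that unfolding integral_dom_measure(2)[OF D] E_def index_lists_def by blast
 note [measurable] = borel_measurable_integrable[OF Eu]
 have Bm [measurable]: "B i n \<in> borel_measurable borel" if "i \<in> I" for i n
  using smooth_bump_continuous[of "a i" "b i" "B i" n] B that by (auto intro: borel_measurable_continuous_onI)
 obtain C where C: "\<And>i n. i \<in> I \<Longrightarrow> C i n \<ge> 0" "\<And>i n t. i \<in> I \<Longrightarrow> \<bar>B i n t\<bar> \<le> C i n"
 proof -
  have "\<forall>i\<in>I. \<exists>c. \<forall>n. c n \<ge> 0 \<and> (\<forall>t. \<bar>B i n t\<bar> \<le> c n)"
  proof
   fix i assume "i \<in> I"
   then have "\<forall>n. \<exists>c\<ge>0. \<forall>t. \<bar>B i n t\<bar> \<le> c" using smooth_bump_bounded B by blast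
   then show "\<exists>c. \<forall>n. c n \<ge> 0 \<and> (\<forall>t. \<bar>B i n t\<bar> \<le> c n)" by metis
  qed
  then show ?thesis using that by (metis (full_types))
 qed
 define Cp where "Cp is = (\<Prod>i\<in>I. C i (count_list is i))" for "is"
 have Cp: "\<bar>prod_deriv I B is x\<bar> \<le> Cp is" "Cp is \<ge> 0" for "is" x
  unfolding prod_deriv_def Cp_def abs_prod by (auto intro!: prod_mono prod_nonneg C)
 have pm [measurable]: "(\<lambda>x. prod_deriv I B is x) \<in> borel_measurable ?L" for "is"
  unfolding prod_deriv_def by measurable
 have pms: "(\<lambda>z. prod_deriv I B is (\<lambda>i. fst z i - snd z * h i)) \<in> borel_measurable (?L \<Otimes>\<^sub>M lborel)" for "is"
  unfolding prod_deriv_def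
 proof (rule borel_measurable_prod)
  fix i assume i: "i \<in> I"
  have "(\<lambda>z. fst z i - snd z * h i) \<in> borel_measurable (?L \<Otimes>\<^sub>M lborel)" using i by measurable
  from measurable_compose[OF this Bm[OF i]]
  show "(\<lambda>z. B i (count_list is i) (fst z i - snd z * h i)) \<in> borel_measurable (?L \<Otimes>\<^sub>M lborel)" .
 qed
 have pmx: "(\<lambda>x. prod_deriv I B is (\<lambda>i. x i - s * h i)) \<in> borel_measurable ?L" for "is" s
  unfolding prod_deriv_def
 proof (rule borel_measurable_prod)
  fix i assume i: "i \<in> I"
  have "(\<lambda>x. x i - s * h i) \<in> borel_measurable ?L" using i by measurable
  from measurable_compose[OF this Bm[OF i]]
  show "(\<lambda>x. B i (count_list is i) (x i - s * h i)) \<in> borel_measurable ?L" .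
 qed
 have ip: "integrable ?L (\<lambda>x. E v x * prod_deriv I B is (\<lambda>i. x i - s * h i))" if "integrable ?L (E v)" for v "is" s
 proof (rule Bochner_Integration.integrable_bound[of _ "\<lambda>x. Cp is * E v x"])
  show "integrable ?L (\<lambda>x. Cp is * E v x)" using that by simp
  show "(\<lambda>x. E v x * prod_deriv I B is (\<lambda>i. x i - s * h i)) \<in> borel_measurable ?L"
   using pmx that by (intro borel_measurable_times) auto
  show "AE x in ?L. norm (E v x * prod_deriv I B is (\<lambda>i. x i - s * h i)) \<le> norm (Cp is * E v x)"
   using Cp by (auto simp: abs_mult intro!: AE_I2 mult_right_mono mult_mono simp: mult.commute[of "\<bar>E v _\<bar>"])
 qed
 have ip0: "integrable ?L (\<lambda>x. E v x * prod_deriv I B is x)" if "integrable ?L (E v)" for v "is"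
  using ip[OF that, of "is" 0] by simp
 have pdt: "prod_deriv I B [] (\<lambda>i. (\<lambda>i\<in>I. x i + s * h i) i - s * h i) = prod_deriv I B [] x" for x s
  unfolding prod_deriv_def by (rule prod.cong) auto
 have tr: "(\<integral>x. E v (\<lambda>i\<in>I. x i + s * h i) * prod_deriv I B [] x \<partial>?L) =
   (\<integral>x. E v x * prod_deriv I B [] (\<lambda>i. x i - s * h i) \<partial>?L)" if v: "integrable ?L (E v)" for v s
 proof -
  define F where "F y = E v y * prod_deriv I B [] (\<lambda>i. y i - s * h i)" for y
  have "(\<integral>x. F (\<lambda>i\<in>I. x i + s * h i) \<partial>?L) = (\<integral>x. F x \<partial>?L)"
   by (rule integral_leb_translate(1)[OF I]) (use ip[OF v, of "[]" s] in \<open>simp add: F_def[abs_def]\<close>)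
  then show ?thesis unfolding F_def pdt .
 qed
 (* The segment condition keeps the support of the translated bump inside the domain. *)
 have wd: "(\<integral>x. E u x * prod_deriv I B is (\<lambda>i. x i - s * h i) \<partial>?L) =
   (- 1) ^ k * (\<integral>x. E (g is) x * prod_deriv I B [] (\<lambda>i. x i - s * h i) \<partial>?L)"
  if "is": "is \<in> index_lists I k" "k \<le> p" and s: "s \<in> {0..1}" for "is" k s
 proof -
  define B' where "B' i n t = B i n (t - s * h i)" for i n t
  have B': "smooth_bump (a i + s * h i) (b i + s * h i) (B' i)" if "i \<in> I" for i
   using smooth_bump_translate[OF B[rule_format, OF that], of "s * h i"] by (simp add: B'_def[abs_def])
  have pB': "prod_deriv I B' js x = prod_deriv I B js (\<lambda>i. x i - s * h i)" for js x
   by (simp add: prod_deriv_def B'_def)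
  have tf: "test_function I D (prod_deriv I B' [])"
   by (rule test_function_prod_deriv[OF I B' seg[rule_format, OF s]])
  have isI: "set is \<subseteq> I" "length is = k" using "is" by (auto simp: index_lists_def)
  have pd: "partial_derivs is (prod_deriv I B' []) = prod_deriv I B' is"
   by (rule partial_derivs_prod_deriv[OF I isI(1)]) (use B' in \<open>simp add: smooth_bump_def\<close>)
  have "weak_deriv I D is u (g is)" using g isI "is"(2) by blast
  from this[unfolded weak_deriv_def, rule_format, OF tf]
  show ?thesis
   unfolding pd pB' isI integral_dom_measure(1)[OF D] E_def by (simp add: mult.assoc)
 qed
 have T: "prod_deriv I B [] (\<lambda>i. x i - h i) =
   (\<Sum>k<p. (- 1) ^ k / fact k * (\<Sum>is\<in>index_lists I k. list_power h is * prod_deriv I B is x))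
  + (\<integral>s. taylor_weight p s * ((- 1) ^ p * (\<Sum>is\<in>?N. list_power h is * prod_deriv I B is (\<lambda>i. x i - s * h i))) \<partial>lborel)" for x
  by (rule prod_deriv_Taylor[OF I dB p])
 define Q where "Q z = E u (fst z) * (taylor_weight p (snd z) * ((- 1) ^ p * (\<Sum>is\<in>?N. list_power h is * prod_deriv I B is (\<lambda>i. fst z i - snd z * h i))))" for z
 have Qi: "integrable (?L \<Otimes>\<^sub>M lborel) Q"
 proof -
  have 1: "integrable (?L \<Otimes>\<^sub>M lborel) (\<lambda>z. E u (fst z) * taylor_weight p (snd z) * prod_deriv I B is (\<lambda>i. fst z i - snd z * h i))" for "is"
  proof (rule Bochner_Integration.integrable_bound[of _ "\<lambda>z. Cp is * (E u (fst z) * taylor_weight p (snd z))"])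
   show "integrable (?L \<Otimes>\<^sub>M lborel) (\<lambda>z. Cp is * (E u (fst z) * taylor_weight p (snd z)))"
    using LP.integrable_tensor[OF Eu taylor_weight_integrable[of p]] by simp
   note [measurable] = pms[of "is"]
   show "(\<lambda>z. E u (fst z) * taylor_weight p (snd z) * prod_deriv I B is (\<lambda>i. fst z i - snd z * h i)) \<in> borel_measurable (?L \<Otimes>\<^sub>M lborel)"
    by measurable
   have "\<bar>t * prod_deriv I B is y\<bar> \<le> \<bar>Cp is * t\<bar>" for t y
    using Cp[of "is"] by (simp add: abs_mult mult.commute[of "Cp is"] mult_left_mono)
   then show "AE z in ?L \<Otimes>\<^sub>M lborel. norm (E u (fst z) * taylor_weight p (snd z) * prod_deriv I B is (\<lambda>i. fst z i - snd z * h i)) \<le> norm (Cp is * (E u (fst z) * taylor_weight p (snd z)))"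
    by simp
  qed
  have "Q = (\<lambda>z. \<Sum>is\<in>?N. ((- 1) ^ p * list_power h is) * (E u (fst z) * taylor_weight p (snd z) * prod_deriv I B is (\<lambda>i. fst z i - snd z * h i)))"
   by (rule ext) (simp add: Q_def sum_distrib_left mult_ac)
  then show ?thesis using 1 by simp
 qed
 have Qm: "integrable ?L (\<lambda>x. \<integral>s. Q (x, s) \<partial>lborel)"
  using LP.integrable_fst[of "curry Q"] Qi by simp
 have "(\<integral>x. E u (\<lambda>i\<in>I. x i + h i) * prod_deriv I B [] x \<partial>?L) =
   (\<integral>x. E u x * prod_deriv I B [] (\<lambda>i. x i - h i) \<partial>?L)"
  using tr[OF Eu, of 1] by simp
 also have "\<dots> = (\<integral>x. (\<Sum>k<p. (- 1) ^ k / fact k * (\<Sum>is\<in>index_lists I k. list_power h is * (E u x * prod_deriv I B is x))) + (\<integral>s. Q (x, s) \<partial>lborel) \<partial>?L)"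
 proof (rule Bochner_Integration.integral_cong[OF refl])
  fix x
  have "E u x * (\<Sum>k<p. (- 1) ^ k / fact k * (\<Sum>is\<in>index_lists I k. list_power h is * prod_deriv I B is x)) =
   (\<Sum>k<p. (- 1) ^ k / fact k * (\<Sum>is\<in>index_lists I k. list_power h is * (E u x * prod_deriv I B is x)))"
   by (simp add: sum_distrib_left mult_ac)
  then show "E u x * prod_deriv I B [] (\<lambda>i. x i - h i) =
   (\<Sum>k<p. (- 1) ^ k / fact k * (\<Sum>is\<in>index_lists I k. list_power h is * (E u x * prod_deriv I B is x))) + (\<integral>s. Q (x, s) \<partial>lborel)"
   unfolding T Q_def distrib_left fst_conv snd_conv by simp
 qed
 also have "\<dots> = (\<Sum>k<p. (- 1) ^ k / fact k * (\<Sum>is\<in>index_lists I k. list_power h is * (\<integral>x. E u x * prod_deriv I B is x \<partial>?L))) + (\<integral>x. (\<integral>s. Q (x, s) \<partial>lborel) \<partial>?L)"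
  using ip0[OF Eu] Qm by simp
 also have "(\<Sum>k<p. (- 1) ^ k / fact k * (\<Sum>is\<in>index_lists I k. list_power h is * (\<integral>x. E u x * prod_deriv I B is x \<partial>?L))) =
   (\<Sum>k<p. 1 / fact k * (\<Sum>is\<in>index_lists I k. list_power h is * (\<integral>x. E (g is) x * prod_deriv I B [] x \<partial>?L)))"
 proof (rule sum.cong[OF refl])
  fix k assume "k \<in> {..<p}"
  then have "(\<Sum>is\<in>index_lists I k. list_power h is * (\<integral>x. E u x * prod_deriv I B is x \<partial>?L)) =
   (\<Sum>is\<in>index_lists I k. (- 1) ^ k * (list_power h is * (\<integral>x. E (g is) x * prod_deriv I B [] x \<partial>?L)))"
   by (intro sum.cong refl) (use wd[where s = 0] in simp)
  also have "\<dots> = (- 1) ^ k * (\<Sum>is\<in>index_lists I k. list_power h is * (\<integral>x. E (g is) x * prod_deriv I B [] x \<partial>?L))"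
   by (rule sum_distrib_left[symmetric])
  finally show "(- 1) ^ k / fact k * (\<Sum>is\<in>index_lists I k. list_power h is * (\<integral>x. E u x * prod_deriv I B is x \<partial>?L)) =
    1 / fact k * (\<Sum>is\<in>index_lists I k. list_power h is * (\<integral>x. E (g is) x * prod_deriv I B [] x \<partial>?L))"
   by (simp flip: power_add mult_2)
 qed
 also have "(\<integral>x. (\<integral>s. Q (x, s) \<partial>lborel) \<partial>?L) = (\<integral>s. (\<integral>x. Q (x, s) \<partial>?L) \<partial>lborel)"
  by (rule LP.swap_integrals[OF Qi])
 also have "\<dots> = (\<integral>s. taylor_weight p s * (\<Sum>is\<in>?N. list_power h is *
     (\<integral>x. E (g is) (\<lambda>i\<in>I. x i + s * h i) * prod_deriv I B [] x \<partial>?L)) \<partial>lborel)"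
 proof (rule Bochner_Integration.integral_cong[OF refl])
  fix s :: real
  show "(\<integral>x. Q (x, s) \<partial>?L) = taylor_weight p s * (\<Sum>is\<in>?N. list_power h is *
     (\<integral>x. E (g is) (\<lambda>i\<in>I. x i + s * h i) * prod_deriv I B [] x \<partial>?L))"
  proof (cases "s \<in> {0..1}")
   case False
   then show ?thesis by (simp add: Q_def taylor_weight_def)
  next
   case True
   have "(\<integral>x. Q (x, s) \<partial>?L) = (\<integral>x. taylor_weight p s * ((- 1) ^ p * (\<Sum>is\<in>?N. list_power h is * (E u x * prod_deriv I B is (\<lambda>i. x i - s * h i)))) \<partial>?L)"
    unfolding Q_def by (simp add: sum_distrib_left mult_ac)
   also have "\<dots> = taylor_weight p s * ((- 1) ^ p * (\<Sum>is\<in>?N. list_power h is * (\<integral>x. E u x * prod_deriv I B is (\<lambda>i. x i - s * h i) \<partial>?L)))"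
    using ip[OF Eu] by simp
   also have "(\<Sum>is\<in>?N. list_power h is * (\<integral>x. E u x * prod_deriv I B is (\<lambda>i. x i - s * h i) \<partial>?L)) =
    (\<Sum>is\<in>?N. (- 1) ^ p * (list_power h is * (\<integral>x. E (g is) (\<lambda>i\<in>I. x i + s * h i) * prod_deriv I B [] x \<partial>?L)))"
   proof (rule sum.cong[OF refl])
    fix "is" assume i: "is \<in> ?N"
    have "(\<integral>x. E (g is) (\<lambda>i\<in>I. x i + s * h i) * prod_deriv I B [] x \<partial>?L) = (\<integral>y. E (g is) y * prod_deriv I B [] (\<lambda>i. y i - s * h i) \<partial>?L)"
     by (rule tr[OF Eg[OF i order_refl]])
    then show "list_power h is * (\<integral>x. E u x * prod_deriv I B is (\<lambda>i. x i - s * h i) \<partial>?L) =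
     (- 1) ^ p * (list_power h is * (\<integral>x. E (g is) (\<lambda>i\<in>I. x i + s * h i) * prod_deriv I B [] x \<partial>?L))"
     using wd[OF i order_refl True] by simp
   qed
   also have "\<dots> = (- 1) ^ p * (\<Sum>is\<in>?N. list_power h is * (\<integral>x. E (g is) (\<lambda>i\<in>I. x i + s * h i) * prod_deriv I B [] x \<partial>?L))"
    by (rule sum_distrib_left[symmetric])
   finally show ?thesis by (simp add: mult.assoc[symmetric] flip: power_add mult_2)
  qed
 qed
 finally show ?thesis .
qed

section \<open>Functions that vanish when tested with bumps\<close>

definition open_box :: "'i set \<Rightarrow> ('i \<Rightarrow> real) \<Rightarrow> ('i \<Rightarrow> real) \<Rightarrow> ('i \<Rightarrow> real) set" where
 "open_box I a b = PiE I (\<lambda>i. {a i<..<b i})"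

lemma open_box_sets: "finite I \<Longrightarrow> open_box I a b \<in> sets (leb I)"
 unfolding open_box_def by (rule sets_PiM_I_finite) auto

lemma open_box_Int: "open_box I a b \<inter> open_box I a' b' = open_box I (\<lambda>i. max (a i) (a' i)) (\<lambda>i. min (b i) (b' i))"
 by (auto simp: open_box_def PiE_def Pi_def)

lemma sets_leb_open_box:
 assumes I: "finite I"
 shows "sets (leb I) = sigma_sets (space (leb I)) (range (\<lambda>(a, b). open_box I a b))" (is "_ = sigma_sets ?X ?E")
proof
 have sub: "?E \<subseteq> Pow ?X" by (auto simp: open_box_def space_PiM PiE_def)
 show "sigma_sets ?X ?E \<subseteq> sets (leb I)"
  using open_box_sets[OF I] by (intro sets.sigma_sets_subset) auto
 have m: "(\<lambda>x. \<lambda>i\<in>I. x i) \<in> measurable (sigma ?X ?E) (leb I)"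
 proof (rule measurable_restrict)
  fix i assume i: "i \<in> I"
  have "(\<lambda>x. x i) \<in> borel_measurable (sigma ?X ?E)"
  proof (subst borel_measurable_iff_less, rule allI)
   fix c :: real
   have "{x \<in> ?X. x i < c} = (\<Union>n::nat. open_box I (\<lambda>_. - real n) (\<lambda>j. if j = i then c else real n))" (is "?l = ?r")
   proof
    show "?r \<subseteq> ?l" using i by (auto simp: open_box_def space_PiM PiE_def Pi_def)
    show "?l \<subseteq> ?r"
    proof
     fix x assume x: "x \<in> ?l"
     obtain n :: nat where n: "(\<Sum>j\<in>I. \<bar>x j\<bar>) < real n" using reals_Archimedean2 by blast
     have "- real n < x j \<and> x j < real n" if "j \<in> I" for j
      using member_le_sum[of j I "\<lambda>j. \<bar>x j\<bar>"] that I n by auto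
     then have "x \<in> open_box I (\<lambda>_. - real n) (\<lambda>j. if j = i then c else real n)"
      using x by (auto simp: open_box_def space_PiM PiE_def Pi_def)
     then show "x \<in> ?r" by blast
    qed
   qed
   also have "\<dots> \<in> sets (sigma ?X ?E)"
    by (rule sets.countable_UN) (use sub in auto)
   finally show "{x \<in> space (sigma ?X ?E). x i < c} \<in> sets (sigma ?X ?E)"
    using sub by (simp add: space_measure_of)
  qed
  then show "(\<lambda>x. x i) \<in> measurable (sigma ?X ?E) lborel" by simp
 qed
 show "sets (leb I) \<subseteq> sigma_sets ?X ?E"
 proof
  fix A assume A: "A \<in> sets (leb I)"
  then have AX: "A \<subseteq> ?X" by (rule sets.sets_into_space)
  have r: "(\<lambda>i\<in>I. x i) = x" if "x \<in> ?X" for x using that by (auto simp: space_PiM PiE_def extensional_def fun_eq_iff)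
  have "(\<lambda>x. \<lambda>i\<in>I. x i) -` A \<inter> space (sigma ?X ?E) = A"
   using AX r sub by (auto simp: space_measure_of subset_eq)
  with measurable_sets[OF m A] show "A \<in> sigma_sets ?X ?E"
   using sub by (simp add: sets_measure_of)
 qed
qed

lemma integrable_indicator_times:
 fixes W :: "'a \<Rightarrow> real"
 assumes "A \<in> sets M" "integrable M W"
 shows "integrable M (\<lambda>x. indicator A x * W x)"
 using integrable_mult_indicator[OF assms] by simp

text \<open>The measures with the positive and the negative part of \<open>W\<close> as densities agree on the boxes, which
 form a generator closed under intersections.\<close>
lemma AE_zero_if_box_integrals_zero:
 assumes I: "finite I" and W: "integrable (leb I) W"
  and zero: "\<And>a b. (\<integral>x. indicator (open_box I a b) x * W x \<partial>leb I) = 0"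
 shows "AE x in leb I. W x = (0::real)"
proof -
 let ?L = "leb I"
 interpret L: sigma_finite_measure ?L by (rule sigma_finite_leb[OF I])
 note [measurable] = borel_measurable_integrable[OF W]
 define P where "P = density ?L (\<lambda>x. ennreal (W x))"
 define N where "N = density ?L (\<lambda>x. ennreal (- W x))"
 have fin: "(\<integral>\<^sup>+x. ennreal (W x) * indicator A x \<partial>?L) < \<infinity>" "(\<integral>\<^sup>+x. ennreal (- W x) * indicator A x \<partial>?L) < \<infinity>" for A
 proof -
  have "(\<integral>\<^sup>+x. ennreal (norm (W x)) \<partial>?L) < \<infinity>" using W by (simp add: integrable_iff_bounded)
  moreover have "(\<integral>\<^sup>+x. ennreal (W x) * indicator A x \<partial>?L) \<le> (\<integral>\<^sup>+x. ennreal (norm (W x)) \<partial>?L)"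
   by (intro nn_integral_mono) (auto simp: indicator_def ennreal_leI)
  moreover have "(\<integral>\<^sup>+x. ennreal (- W x) * indicator A x \<partial>?L) \<le> (\<integral>\<^sup>+x. ennreal (norm (W x)) \<partial>?L)"
   by (intro nn_integral_mono) (auto simp: indicator_def ennreal_leI)
  ultimately show "(\<integral>\<^sup>+x. ennreal (W x) * indicator A x \<partial>?L) < \<infinity>" "(\<integral>\<^sup>+x. ennreal (- W x) * indicator A x \<partial>?L) < \<infinity>"
   by (meson le_less_trans)+
 qed
 have eqb: "emeasure P (open_box I a b) = emeasure N (open_box I a b)" for a b
 proof -
  let ?A = "open_box I a b"
  note A[measurable] = open_box_sets[OF I, of a b]
  note i = integrable_indicator_times[OF A W]
  have *: "ennreal (indicator ?A x * W x) = ennreal (W x) * indicator ?A x"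
   "ennreal (- (indicator ?A x * W x)) = ennreal (- W x) * indicator ?A x" for x
   by (auto simp: indicator_def)
  have f: "(\<integral>\<^sup>+x. ennreal (W x) * indicator ?A x \<partial>?L) \<noteq> top" "(\<integral>\<^sup>+x. ennreal (- W x) * indicator ?A x \<partial>?L) \<noteq> top"
   using fin[of ?A] by auto
  have "enn2real (\<integral>\<^sup>+x. ennreal (W x) * indicator ?A x \<partial>?L) = enn2real (\<integral>\<^sup>+x. ennreal (- W x) * indicator ?A x \<partial>?L)"
   using zero[of a b] unfolding real_lebesgue_integral_def[OF i] * by simp
  then have "(\<integral>\<^sup>+x. ennreal (W x) * indicator ?A x \<partial>?L) = (\<integral>\<^sup>+x. ennreal (- W x) * indicator ?A x \<partial>?L)"
  proof -
   assume eq: "enn2real (\<integral>\<^sup>+x. ennreal (W x) * indicator ?A x \<partial>?L) = enn2real (\<integral>\<^sup>+x. ennreal (- W x) * indicator ?A x \<partial>?L)"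
   have "a = b" if "enn2real a = enn2real b" "a \<noteq> top" "b \<noteq> top" for a b :: ennreal
    using that by (cases a; cases b) auto
   from this[OF eq f] show ?thesis .
  qed
  then show ?thesis by (simp add: P_def N_def emeasure_density)
 qed
 have "P = N"
 proof (rule measure_eqI_generator_eq[where \<Omega> = "space ?L" and E = "range (\<lambda>(a, b). open_box I a b)" and A = "\<lambda>n. open_box I (\<lambda>_. - real n) (\<lambda>_. real n)"])
  show "Int_stable (range (\<lambda>(a, b). open_box I a b))"
   by (auto simp: Int_stable_def open_box_Int)
  show "range (\<lambda>(a, b). open_box I a b) \<subseteq> Pow (space ?L)" by (auto simp: open_box_def space_PiM PiE_def)
  show "emeasure P X = emeasure N X" if "X \<in> range (\<lambda>(a, b). open_box I a b)" for X using that eqb by auto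
  show "sets P = sigma_sets (space ?L) (range (\<lambda>(a, b). open_box I a b))" "sets N = sigma_sets (space ?L) (range (\<lambda>(a, b). open_box I a b))"
   using sets_leb_open_box[OF I] by (simp_all add: P_def N_def)
  show "range (\<lambda>n. open_box I (\<lambda>_. - real n) (\<lambda>_. real n)) \<subseteq> range (\<lambda>(a, b). open_box I a b)" by auto
  show "(\<Union>n. open_box I (\<lambda>_. - real n) (\<lambda>_. real n)) = space ?L"
  proof
   show "space ?L \<subseteq> (\<Union>n. open_box I (\<lambda>_. - real n) (\<lambda>_. real n))"
   proof
    fix x assume x: "x \<in> space ?L"
    obtain n :: nat where n: "(\<Sum>j\<in>I. \<bar>x j\<bar>) < real n" using reals_Archimedean2 by blast
    have "- real n < x j \<and> x j < real n" if "j \<in> I" for j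
     using member_le_sum[of j I "\<lambda>j. \<bar>x j\<bar>"] that I n by auto
    then have "x \<in> open_box I (\<lambda>_. - real n) (\<lambda>_. real n)"
     using x by (auto simp: open_box_def space_PiM PiE_def Pi_def)
    then show "x \<in> (\<Union>n. open_box I (\<lambda>_. - real n) (\<lambda>_. real n))" by blast
   qed
  qed (auto simp: open_box_def space_PiM PiE_def)
  show "emeasure P (open_box I (\<lambda>_. - real n) (\<lambda>_. real n)) \<noteq> \<infinity>" for n
   using fin(1)[of "open_box I (\<lambda>_. - real n) (\<lambda>_. real n)"] open_box_sets[OF I]
   by (simp add: P_def emeasure_density)
 qed
 then have "AE x in ?L. ennreal (W x) = ennreal (- W x)"
  unfolding P_def N_def by (subst (asm) L.density_unique_iff) auto
 then show ?thesis
 proof eventually_elim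
  case (elim x)
  then show ?case by (cases "W x \<ge> 0"; cases "W x = 0") (auto simp: ennreal_neg)
 qed
qed

text \<open>The fundamental lemma: the bumps \<open>exp(- 1 / (n (t - a) (b - t)))\<close> increase to the indicator of
 the interval, so testing with products of bumps determines the integrals over boxes.\<close>
lemma box_integral_zero_if_tested_zero:
 assumes I: "finite I" and W: "integrable (leb I) W" and ab: "\<And>i. i \<in> I \<Longrightarrow> a i < b i"
  and test: "\<And>B. (\<forall>i\<in>I. smooth_bump (a i) (b i) (B i)) \<Longrightarrow> (\<integral>x. W x * prod_deriv I B [] x \<partial>leb I) = 0"
 shows "(\<integral>x. indicator (open_box I a b) x * W x \<partial>leb I) = (0::real)"
proof -
 let ?L = "leb I"
 note [measurable] = borel_measurable_integrable[OF W]
 define w where "w i t = (t - a i) * (b i - t)" for i t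
 have "\<forall>n. \<exists>B. \<forall>i\<in>I. smooth_bump (a i) (b i) (B i) \<and> B i 0 = (\<lambda>t. flat_exp (1 / real (Suc n)) 0 (w i t))"
 proof
  fix n
  have "\<forall>i\<in>I. \<exists>\<beta>. smooth_bump (a i) (b i) \<beta> \<and> \<beta> 0 = (\<lambda>t. flat_exp (1 / real (Suc n)) 0 (w i t))"
   unfolding w_def using smooth_bump_exists[OF ab] by auto
  then show "\<exists>B. \<forall>i\<in>I. smooth_bump (a i) (b i) (B i) \<and> B i 0 = (\<lambda>t. flat_exp (1 / real (Suc n)) 0 (w i t))"
   by (rule bchoice)
 qed
 from choice[OF this] obtain B where B: "\<forall>n. \<forall>i\<in>I. smooth_bump (a i) (b i) (B n i) \<and> B n i 0 = (\<lambda>t. flat_exp (1 / real (Suc n)) 0 (w i t))"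
  by (elim exE) (rule that)
 have val: "prod_deriv I (B n) [] x = (\<Prod>i\<in>I. flat_exp (1 / real (Suc n)) 0 (w i (x i)))" for n x
  unfolding prod_deriv_def by (rule prod.cong[OF refl]) (use B in simp)
 have f01: "0 \<le> flat_exp c 0 t" "flat_exp c 0 t \<le> 1" if "c > 0" for c t
  using that by (auto simp: flat_exp_def)
 have flim: "(\<lambda>n. flat_exp (1 / real (Suc n)) 0 t) \<longlonglongrightarrow> (if t > 0 then 1 else 0)" for t
 proof (cases "t > 0")
  case True
  have "(\<lambda>n. 1 / real (Suc n)) \<longlonglongrightarrow> 0" using LIMSEQ_inverse_real_of_nat by (simp add: inverse_eq_divide)
  then have "(\<lambda>n. exp (- (1 / real (Suc n)) / t)) \<longlonglongrightarrow> exp (- 0 / t)"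
   using True by (intro tendsto_intros) auto
  then show ?thesis using True by (simp add: flat_exp_def)
 qed (simp add: flat_exp_def)
 have wpos: "w i t > 0 \<longleftrightarrow> t \<in> {a i<..<b i}" if "i \<in> I" for i t
  using ab[OF that] by (auto simp: w_def zero_less_mult_iff)
 have "(\<lambda>n. \<integral>x. W x * prod_deriv I (B n) [] x \<partial>?L) \<longlonglongrightarrow> (\<integral>x. indicator (open_box I a b) x * W x \<partial>?L)"
 proof (rule integral_dominated_convergence[where w = "\<lambda>x. \<bar>W x\<bar>"])
  show "(\<lambda>x. indicator (open_box I a b) x * W x) \<in> borel_measurable ?L"
   using open_box_sets[OF I, of a b] by measurable
  show "(\<lambda>x. W x * prod_deriv I (B n) [] x) \<in> borel_measurable ?L" for n
  proof -
   have "(\<lambda>x. flat_exp (1 / real (Suc n)) 0 (w i (x i))) \<in> borel_measurable ?L" if "i \<in> I" for i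
    unfolding flat_exp_def w_def using that by measurable
   then show ?thesis unfolding val by (intro borel_measurable_times borel_measurable_prod) auto
  qed
  show "integrable ?L (\<lambda>x. \<bar>W x\<bar>)" using W by simp
  show "AE x in ?L. (\<lambda>n. W x * prod_deriv I (B n) [] x) \<longlonglongrightarrow> indicator (open_box I a b) x * W x"
  proof (rule AE_I2)
   fix x assume x: "x \<in> space ?L"
   have "(\<lambda>n. prod_deriv I (B n) [] x) \<longlonglongrightarrow> (\<Prod>i\<in>I. if w i (x i) > 0 then 1 else 0)"
    unfolding val by (intro tendsto_prod flim)
   moreover have "(\<Prod>i\<in>I. if w i (x i) > 0 then 1 else 0) = (indicator (open_box I a b) x :: real)"
   proof (cases "x \<in> open_box I a b")
    case True
    then have "\<forall>i\<in>I. w i (x i) > 0" using wpos by (auto simp: open_box_def PiE_def Pi_def)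
    then show ?thesis using True by simp
   next
    case False
    then obtain i where "i \<in> I" "\<not> w i (x i) > 0"
     using x wpos by (auto simp: open_box_def PiE_def Pi_def space_PiM)
    then show ?thesis using False I by (auto intro: prod_zero)
   qed
   ultimately have "(\<lambda>n. prod_deriv I (B n) [] x) \<longlonglongrightarrow> indicator (open_box I a b) x" by (simp only:)
   from tendsto_mult_left[OF this, of "W x"]
   show "(\<lambda>n. W x * prod_deriv I (B n) [] x) \<longlonglongrightarrow> indicator (open_box I a b) x * W x"
    by (simp only: mult.commute[of "indicator (open_box I a b) x"])
  qed
  show "AE x in ?L. norm (W x * prod_deriv I (B n) [] x) \<le> \<bar>W x\<bar>" for n
  proof (rule AE_I2)
   fix x
   have "0 \<le> prod_deriv I (B n) [] x" "prod_deriv I (B n) [] x \<le> 1"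
    unfolding val by (auto intro!: prod_nonneg prod_le_1 f01)
   then show "norm (W x * prod_deriv I (B n) [] x) \<le> \<bar>W x\<bar>"
    by (simp add: abs_mult mult_left_le)
  qed
 qed
 moreover have "(\<integral>x. W x * prod_deriv I (B n) [] x \<partial>?L) = 0" for n
  by (rule test) (use B in blast)
 ultimately have "(\<lambda>n. 0) \<longlonglongrightarrow> (\<integral>x. indicator (open_box I a b) x * W x \<partial>?L)" by (simp only:)
 from LIMSEQ_unique[OF this tendsto_const] show ?thesis .
qed

lemma AE_zero_on_box_if_tested_zero:
 assumes I: "finite I" and W: "integrable (leb I) W"
  and test: "\<And>a' b' B. (\<forall>i\<in>I. a i \<le> a' i \<and> b' i \<le> b i) \<Longrightarrow> (\<forall>i\<in>I. smooth_bump (a' i) (b' i) (B i)) \<Longrightarrow>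
    (\<integral>x. W x * prod_deriv I B [] x \<partial>leb I) = 0"
 shows "AE x in leb I. x \<in> open_box I a b \<longrightarrow> W x = (0::real)"
proof -
 have "AE x in leb I. indicator (open_box I a b) x * W x = 0"
 proof (rule AE_zero_if_box_integrals_zero[OF I])
  show "integrable (leb I) (\<lambda>x. indicator (open_box I a b) x * W x)"
   by (rule integrable_indicator_times[OF open_box_sets[OF I] W])
  fix a' b'
  let ?a = "\<lambda>i. max (a i) (a' i)" and ?b = "\<lambda>i. min (b i) (b' i)"
  have "(\<integral>x. indicator (open_box I a' b') x * (indicator (open_box I a b) x * W x) \<partial>leb I) =
    (\<integral>x. indicator (open_box I ?a ?b) x * W x \<partial>leb I)"
   unfolding open_box_Int[symmetric]
   by (rule Bochner_Integration.integral_cong[OF refl]) (auto simp: indicator_def)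
  also have "\<dots> = 0"
  proof (cases "\<forall>i\<in>I. ?a i < ?b i")
   case True
   show ?thesis
    by (rule box_integral_zero_if_tested_zero[OF I W])
      (use True in simp, rule test[where a' = ?a and b' = ?b], auto)
  next
   case False
   then have "open_box I ?a ?b = {}" by (force simp: open_box_def PiE_eq_empty_iff)
   then show ?thesis by simp
  qed
  finally show "(\<integral>x. indicator (open_box I a' b') x * (indicator (open_box I a b) x * W x) \<partial>leb I) = 0" .
 qed
 then show ?thesis by eventually_elim (auto simp: indicator_def)
qed

text \<open>All norms give the same open sets; the supremum norm fits boxes and cubes.\<close>
definition sup_open :: "'i set \<Rightarrow> ('i \<Rightarrow> real) set \<Rightarrow> bool" where
 "sup_open I D \<longleftrightarrow> D \<subseteq> (I \<rightarrow>\<^sub>E UNIV) \<and>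
   (\<forall>x\<in>D. \<exists>d>0. \<forall>y\<in>I \<rightarrow>\<^sub>E UNIV. (\<forall>i\<in>I. \<bar>y i - x i\<bar> < d) \<longrightarrow> y \<in> D)"

text \<open>The segment is compact, so its points share a margin.\<close>
lemma segment_neighbourhood:
 assumes I: "finite I" and D: "sup_open I D" and seg: "\<forall>s\<in>{0..1}. (\<lambda>i\<in>I. x i + s * h i) \<in> D"
 shows "\<exists>d>0. \<forall>s\<in>{0..1}. \<forall>y\<in>I \<rightarrow>\<^sub>E UNIV. (\<forall>i\<in>I. \<bar>y i - (x i + s * h i)\<bar> < d) \<longrightarrow> y \<in> D"
proof -
 have "\<forall>s\<in>{0..1}. \<exists>d>0. \<forall>y\<in>I \<rightarrow>\<^sub>E UNIV. (\<forall>i\<in>I. \<bar>y i - (x i + s * h i)\<bar> < d) \<longrightarrow> y \<in> D"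
 proof
  fix s :: real assume "s \<in> {0..1}"
  then obtain d where "d > 0" "\<forall>y\<in>I \<rightarrow>\<^sub>E UNIV. (\<forall>i\<in>I. \<bar>y i - (\<lambda>i\<in>I. x i + s * h i) i\<bar> < d) \<longrightarrow> y \<in> D"
   using D seg unfolding sup_open_def by blast
  then show "\<exists>d>0. \<forall>y\<in>I \<rightarrow>\<^sub>E UNIV. (\<forall>i\<in>I. \<bar>y i - (x i + s * h i)\<bar> < d) \<longrightarrow> y \<in> D"
   by (intro exI[of _ d]) simp
 qed
 from bchoice[OF this] obtain d where dd: "\<forall>s\<in>{0..1}. d s > 0 \<and> (\<forall>y\<in>I \<rightarrow>\<^sub>E UNIV. (\<forall>i\<in>I. \<bar>y i - (x i + s * h i)\<bar> < d s) \<longrightarrow> y \<in> D)"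
  by (elim exE) (rule that)
 have d1: "d s > 0" if "s \<in> {0..1}" for s using bspec[OF dd that] by (rule conjunct1)
 have d2: "y \<in> D" if "s \<in> {0..1}" "y \<in> I \<rightarrow>\<^sub>E UNIV" "\<forall>i\<in>I. \<bar>y i - (x i + s * h i)\<bar> < d s" for s y
  using bspec[OF dd that(1), THEN conjunct2] that(2,3) by simp
 define H where "H = 1 + (\<Sum>i\<in>I. \<bar>h i\<bar>)"
 have H: "\<bar>h i\<bar> < H" if "i \<in> I" for i
  using member_le_sum[of i I "\<lambda>i. \<bar>h i\<bar>"] that I by (simp add: H_def)
 have Hp: "H > 0" unfolding H_def by (intro add_pos_nonneg sum_nonneg) auto
 have cov: "{0..1} \<subseteq> (\<Union>s\<in>{0..1}. ball s (d s / (2 * H)))"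
 proof
  fix s :: real assume s: "s \<in> {0..1}"
  have "s \<in> ball s (d s / (2 * H))" using d1[OF s] Hp by simp
  then show "s \<in> (\<Union>s\<in>{0..1}. ball s (d s / (2 * H)))" using s by (rule UN_I[rotated])
 qed
 obtain T where T: "T \<subseteq> {0..1}" "finite T" "{0..1} \<subseteq> (\<Union>s\<in>T. ball s (d s / (2 * H)))"
  by (rule compactE_image[OF compact_Icc[of 0 "1::real"] open_ball cov])
 have Tne: "T \<noteq> {}" using T(3) by force
 define e where "e = Min ((\<lambda>s. d s / 2) ` T)"
 have e: "e \<le> d s / 2" if "s \<in> T" for s unfolding e_def by (rule Min_le) (use that T(2) in auto)
 have "e > 0" unfolding e_def using T Tne d1 by (subst Min_gr_iff) auto
 moreover have "y \<in> D" if s: "s \<in> {0..1}" and y: "y \<in> I \<rightarrow>\<^sub>E UNIV" "\<forall>i\<in>I. \<bar>y i - (x i + s * h i)\<bar> < e" for s y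
 proof -
  obtain s0 where s0: "s0 \<in> T" "\<bar>s0 - s\<bar> < d s0 / (2 * H)" using T(3) s by (auto simp: dist_real_def)
  have "\<bar>y i - (x i + s0 * h i)\<bar> < d s0" if i: "i \<in> I" for i
  proof -
   have "\<bar>s * h i - s0 * h i\<bar> = \<bar>s0 - s\<bar> * \<bar>h i\<bar>" by (simp add: abs_mult[symmetric] left_diff_distrib abs_minus_commute)
   also have "\<dots> \<le> \<bar>s0 - s\<bar> * H" using H[OF i] by (intro mult_left_mono) auto
   also have "\<dots> \<le> d s0 / 2" using s0(2) Hp by (simp add: field_simps)
   finally show ?thesis using y(2)[rule_format, OF i] e[OF s0(1)] by linarith
  qed
  then show ?thesis using d2[of s0 y] s0 T(1) y(1) by blast
 qed
 ultimately show ?thesis by (intro exI[of _ e] conjI ballI impI)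
qed

section \<open>Polynomial approximation on cells visible from a cube\<close>

text \<open>The Taylor polynomial at \<open>x\<close>, with constants \<open>c\<close> in place of the derivatives of order \<open>p\<close>: the
 remainder then involves only the deviation of these derivatives from \<open>c\<close>.\<close>
definition taylor_sum ::
 "'i set \<Rightarrow> nat \<Rightarrow> ('i list \<Rightarrow> ('i \<Rightarrow> real) \<Rightarrow> real) \<Rightarrow> ('i list \<Rightarrow> real) \<Rightarrow> ('i \<Rightarrow> real) \<Rightarrow> ('i \<Rightarrow> real) \<Rightarrow> real" where
 "taylor_sum I p g c x h = (\<Sum>k<p. 1 / fact k * (\<Sum>is\<in>index_lists I k. list_power h is * g is x))
   + 1 / fact p * (\<Sum>is\<in>index_lists I p. list_power h is * c is)"

text \<open>Cauchy--Schwarz; the weight is at most \<open>1\<close> on the unit interval.\<close>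
lemma power2_integral_taylor_weight_le:
 fixes X :: "real \<Rightarrow> real"
 assumes X: "X \<in> borel_measurable lborel"
 shows "ennreal ((\<integral>s. taylor_weight p s * X s \<partial>lborel)\<^sup>2) \<le> (\<integral>\<^sup>+s. indicator {0..1} s * ennreal ((X s)\<^sup>2) \<partial>lborel)"
proof (cases "integrable lborel (\<lambda>s. taylor_weight p s * X s)")
 case False
 then show ?thesis by (simp add: not_integrable_integral_eq)
next
 case True
 note [measurable] = X
 have "ennreal \<bar>\<integral>s. taylor_weight p s * X s \<partial>lborel\<bar> \<le> (\<integral>\<^sup>+s. ennreal (norm (taylor_weight p s * X s)) \<partial>lborel)"
  using integral_norm_bound_ennreal[OF True] by simp
 also have "\<dots> \<le> (\<integral>\<^sup>+s. indicator {0..1} s * (indicator {0..1} s * ennreal \<bar>X s\<bar>) \<partial>lborel)"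
 proof (rule nn_integral_mono)
  fix s :: real
  have "\<bar>taylor_weight p s * X s\<bar> \<le> indicator {0..1} s * \<bar>X s\<bar>"
   unfolding abs_mult using taylor_weight_bounds[of p s] by (intro mult_right_mono) auto
  then show "ennreal (norm (taylor_weight p s * X s)) \<le> indicator {0..1} s * (indicator {0..1} s * ennreal \<bar>X s\<bar>)"
   by (auto simp: indicator_def ennreal_leI split: if_splits)
 qed
 finally have 1: "ennreal \<bar>\<integral>s. taylor_weight p s * X s \<partial>lborel\<bar> \<le> (\<integral>\<^sup>+s. indicator {0..1} s * (indicator {0..1} s * ennreal \<bar>X s\<bar>) \<partial>lborel)" .
 have "ennreal ((\<integral>s. taylor_weight p s * X s \<partial>lborel)\<^sup>2) = (ennreal \<bar>\<integral>s. taylor_weight p s * X s \<partial>lborel\<bar>)\<^sup>2"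
  by (simp add: ennreal_power)
 also have "\<dots> \<le> (\<integral>\<^sup>+s. indicator {0..1} s * (indicator {0..1} s * ennreal \<bar>X s\<bar>) \<partial>lborel)\<^sup>2"
  by (rule power_mono[OF 1]) simp
 also have "\<dots> \<le> (\<integral>\<^sup>+s. (indicator {0..1::real} s)\<^sup>2 \<partial>lborel) * (\<integral>\<^sup>+s. (indicator {0..1} s * ennreal \<bar>X s\<bar>)\<^sup>2 \<partial>lborel)"
  by (rule Cauchy_Schwarz_nn_integral) measurable
 also have "(\<integral>\<^sup>+s. (indicator {0..1::real} s)\<^sup>2 \<partial>lborel) = 1"
 proof -
  have "(\<integral>\<^sup>+s. (indicator {0..1::real} s)\<^sup>2 \<partial>lborel) = (\<integral>\<^sup>+s. indicator {0..1::real} s \<partial>lborel)"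
   by (rule nn_integral_cong) (auto simp: indicator_def)
  then show ?thesis by simp
 qed
 also have "(\<integral>\<^sup>+s. (indicator {0..1} s * ennreal \<bar>X s\<bar>)\<^sup>2 \<partial>lborel) = (\<integral>\<^sup>+s. indicator {0..1} s * ennreal ((X s)\<^sup>2) \<partial>lborel)"
  by (rule nn_integral_cong) (auto simp: indicator_def ennreal_power)
 finally show ?thesis by simp
qed

lemma prod_deriv_bounded:
 assumes "\<forall>i\<in>I. smooth_bump (a i) (b i) (B i)"
 shows "\<exists>C. \<forall>x. \<bar>prod_deriv I B is x\<bar> \<le> C"
proof -
 have "\<forall>i\<in>I. \<exists>C. 0 \<le> C \<and> (\<forall>t. \<bar>B i (count_list is i) t\<bar> \<le> C)" using smooth_bump_bounded assms by blast
 from bchoice[OF this] obtain C where C: "\<forall>i\<in>I. 0 \<le> C i \<and> (\<forall>t. \<bar>B i (count_list is i) t\<bar> \<le> C i)"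
  by (elim exE) (rule that)
 have "\<bar>prod_deriv I B is x\<bar> \<le> (\<Prod>i\<in>I. C i)" for x
  unfolding prod_deriv_def abs_prod using C by (intro prod_mono) simp
 then show ?thesis by blast
qed

lemma prod_deriv_measurable:
 assumes "\<forall>i\<in>I. smooth_bump (a i) (b i) (B i)"
 shows "prod_deriv I B is \<in> borel_measurable (leb I)"
 unfolding prod_deriv_def
proof (rule borel_measurable_prod)
 fix i assume i: "i \<in> I"
 have "B i (count_list is i) \<in> borel_measurable borel"
  using smooth_bump_continuous[of "a i" "b i" "B i" "count_list is i"] assms i
  by (auto intro: borel_measurable_continuous_onI)
 then show "(\<lambda>x. B i (count_list is i) (x i)) \<in> borel_measurable (leb I)" using i by simp
qed

lemma integrable_mult_bounded:
 fixes v f :: "'a \<Rightarrow> real"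
 assumes v: "integrable M v" and f: "f \<in> borel_measurable M" and C: "\<And>x. \<bar>f x\<bar> \<le> C"
 shows "integrable M (\<lambda>x. v x * f x)"
proof (rule Bochner_Integration.integrable_bound[of _ "\<lambda>x. C * v x"])
 show "AE x in M. norm (v x * f x) \<le> norm (C * v x)"
 proof (rule AE_I2)
  fix x
  have "\<bar>v x\<bar> * \<bar>f x\<bar> \<le> \<bar>v x\<bar> * \<bar>C\<bar>" using C[of x] by (intro mult_left_mono) auto
  then show "norm (v x * f x) \<le> norm (C * v x)" by (simp add: abs_mult mult.commute)
 qed
qed (use v f in auto)

text \<open>Local version of the fundamental lemma: countably many boxes with rational corners suffice.\<close>
lemma AE_zero_if_locally_tested_zero:
 fixes W :: "('i \<Rightarrow> real) \<Rightarrow> real"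
 assumes I: "finite I" and W: "integrable (leb I) W"
  and mono: "\<And>a b a' b'. good a b \<Longrightarrow> (\<forall>i\<in>I. a i \<le> a' i \<and> b' i \<le> b i) \<Longrightarrow> good a' b'"
  and test: "\<And>a b B. good a b \<Longrightarrow> (\<forall>i\<in>I. smooth_bump (a i) (b i) (B i)) \<Longrightarrow>
    (\<integral>x. W x * prod_deriv I B [] x \<partial>leb I) = 0"
 shows "AE x in leb I. (\<exists>d>0. \<forall>a b. (\<forall>i\<in>I. x i - d < a i \<and> a i < x i \<and> x i < b i \<and> b i < x i + d) \<longrightarrow> good a b)
   \<longrightarrow> W x = 0"
proof -
 define rats where "rats = {(a, b). a \<in> PiE I (\<lambda>_. \<rat>) \<and> b \<in> PiE I (\<lambda>_. \<rat>) \<and> good a b}"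
 have "rats \<subseteq> PiE I (\<lambda>_. \<rat>) \<times> PiE I (\<lambda>_. \<rat>)" by (auto simp: rats_def)
 moreover have "countable (PiE I (\<lambda>_. \<rat> :: real set))" by (rule countable_PiE[OF I]) (rule countable_rat)
 ultimately have cr: "countable rats" by (meson countable_SIGMA countable_subset)
 have "AE x in leb I. \<forall>ab\<in>rats. x \<in> open_box I (fst ab) (snd ab) \<longrightarrow> W x = 0"
 proof (rule AE_ball_countable[THEN iffD2, OF cr], rule ballI)
  fix ab assume "ab \<in> rats"
  then have ab: "good (fst ab) (snd ab)" by (auto simp: rats_def)
  show "AE x in leb I. x \<in> open_box I (fst ab) (snd ab) \<longrightarrow> W x = 0"
   by (rule AE_zero_on_box_if_tested_zero[OF I W]) (rule test[OF mono[OF ab]])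
 qed
 then show ?thesis
  using AE_space
 proof eventually_elim
  case (elim x)
  show ?case
  proof
   assume "\<exists>d>0. \<forall>a b. (\<forall>i\<in>I. x i - d < a i \<and> a i < x i \<and> x i < b i \<and> b i < x i + d) \<longrightarrow> good a b"
   then obtain d where d: "d > 0" "\<forall>a b. (\<forall>i\<in>I. x i - d < a i \<and> a i < x i \<and> x i < b i \<and> b i < x i + d) \<longrightarrow> good a b"
    by blast
   have "\<forall>i. \<exists>r\<in>\<rat>. x i - d < r \<and> r < x i" using d(1) by (intro allI Rats_dense_in_real) simp
   then obtain a0 where a0: "\<forall>i. a0 i \<in> \<rat> \<and> x i - d < a0 i \<and> a0 i < x i" by metis
   have "\<forall>i. \<exists>r\<in>\<rat>. x i < r \<and> r < x i + d" using d(1) by (intro allI Rats_dense_in_real) simp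
   then obtain b0 where b0: "\<forall>i. b0 i \<in> \<rat> \<and> x i < b0 i \<and> b0 i < x i + d" by metis
   define a b where "a = restrict a0 I" and "b = restrict b0 I"
   have "good a b" using d(2) a0 b0 by (simp add: a_def b_def)
   then have "(a, b) \<in> rats" using a0 b0 by (auto simp: rats_def a_def b_def)
   moreover have "x \<in> open_box I a b"
    using elim(2) a0 b0 by (auto simp: open_box_def space_PiM PiE_def a_def b_def)
   ultimately show "W x = 0" using elim(1) by fastforce
  qed
 qed
qed

lemma measurable_segment_leb:
 "(\<lambda>z. \<lambda>i\<in>I. snd z i + fst z * h i) \<in> measurable (lborel \<Otimes>\<^sub>M leb I) (leb I)"
proof (rule measurable_restrict)
 fix i assume "i \<in> I"
 then show "(\<lambda>z. snd z i + fst z * h i) \<in> measurable (lborel \<Otimes>\<^sub>M leb I) lborel" by measurable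
qed

text \<open>The weak Taylor formula for a fixed increment \<open>h\<close>: the difference of its two sides vanishes
 almost everywhere where the segment stays in \<open>D\<close>, because it vanishes when tested with bumps.\<close>
lemma weak_Taylor_AE_bound:
 fixes g :: "'i list \<Rightarrow> ('i \<Rightarrow> real) \<Rightarrow> real" and u :: "('i \<Rightarrow> real) \<Rightarrow> real"
 assumes I: "finite I" and D: "D \<in> sets (leb I)" and op: "sup_open I D" and p: "p > 0"
  and u: "integrable (dom_measure I D) u"
  and g: "\<forall>is. set is \<subseteq> I \<longrightarrow> length is \<le> p \<longrightarrow> integrable (dom_measure I D) (g is) \<and> weak_deriv I D is u (g is)"
 shows "AE x in leb I. (\<forall>s\<in>{0..1}. (\<lambda>i\<in>I. x i + s * h i) \<in> D) \<longrightarrow>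
   ennreal ((u (\<lambda>i\<in>I. x i + h i) - taylor_sum I p g c x h)\<^sup>2) \<le>
   (\<integral>\<^sup>+s. indicator {0..1} s * ennreal ((\<Sum>is\<in>index_lists I p. list_power h is * (g is (\<lambda>i\<in>I. x i + s * h i) - c is))\<^sup>2) \<partial>lborel)"
proof -
 let ?L = "leb I"
 let ?N = "index_lists I p"
 define E where "E v x = indicator D x * v x" for v :: "('i \<Rightarrow> real) \<Rightarrow> real" and x
 interpret L: sigma_finite_measure ?L by (rule sigma_finite_leb[OF I])
 interpret SL: pair_sigma_finite lborel ?L by unfold_locales
 have Eu: "integrable ?L (E u)" using u unfolding integral_dom_measure(2)[OF D] E_def[abs_def] .
 have Eg: "integrable ?L (E (g is))" if "is \<in> index_lists I k" "k \<le> p" for "is" k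
  using g that unfolding integral_dom_measure(2)[OF D] E_def[abs_def] index_lists_def by blast
 define sh where "sh s x = (\<lambda>i\<in>I. x i + s * h i)" for s :: real and x :: "'i \<Rightarrow> real"
 have Egm: "(\<lambda>z. E (g is) (sh (fst z) (snd z))) \<in> borel_measurable (lborel \<Otimes>\<^sub>M ?L)" if "is \<in> ?N" for "is"
  using measurable_compose[OF measurable_segment_leb borel_measurable_integrable[OF Eg[OF that order_refl]]]
  unfolding sh_def .
 define R where "R z = (\<Sum>is\<in>?N. list_power h is * (taylor_weight p (fst z) * E (g is) (sh (fst z) (snd z))))" for z
 have Ri: "integrable (lborel \<Otimes>\<^sub>M ?L) R"
  unfolding R_def
 proof (intro Bochner_Integration.integrable_sum integrable_mult_right)
  fix "is" assume i: "is \<in> ?N"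
  note [measurable] = Egm[OF i]
  have int: "integrable ?L (\<lambda>x. E (g is) (sh s x))" "(\<integral>x. \<bar>E (g is) (sh s x)\<bar> \<partial>?L) = (\<integral>x. \<bar>E (g is) x\<bar> \<partial>?L)" for s
  proof -
   have m: "E (g is) \<in> borel_measurable ?L" using Eg[OF i order_refl] by simp
   then have m': "(\<lambda>x. \<bar>E (g is) x\<bar>) \<in> borel_measurable ?L" by simp
   show "integrable ?L (\<lambda>x. E (g is) (sh s x))"
    unfolding sh_def integral_leb_translate(2)[OF I m] by (rule Eg[OF i order_refl])
   show "(\<integral>x. \<bar>E (g is) (sh s x)\<bar> \<partial>?L) = (\<integral>x. \<bar>E (g is) x\<bar> \<partial>?L)"
    unfolding sh_def by (rule integral_leb_translate(1)[OF I m'])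
  qed
  show "integrable (lborel \<Otimes>\<^sub>M ?L) (\<lambda>z. taylor_weight p (fst z) * E (g is) (sh (fst z) (snd z)))"
  proof (rule SL.Fubini_integrable)
   show "(\<lambda>z. taylor_weight p (fst z) * E (g is) (sh (fst z) (snd z))) \<in> borel_measurable (lborel \<Otimes>\<^sub>M ?L)"
    by measurable
   show "integrable lborel (\<lambda>s. \<integral>x. norm (taylor_weight p (fst (s, x)) * E (g is) (sh (fst (s, x)) (snd (s, x)))) \<partial>?L)"
    using taylor_weight_integrable[of p] taylor_weight_bounds(1)[of p] by (simp add: abs_mult int(2))
   show "AE s in lborel. integrable ?L (\<lambda>x. taylor_weight p (fst (s, x)) * E (g is) (sh (fst (s, x)) (snd (s, x))))"
    using int(1) by simp
  qed
 qed
 have RAE: "AE x in ?L. integrable lborel (\<lambda>s. R (s, x))" "integrable ?L (\<lambda>x. \<integral>s. R (s, x) \<partial>lborel)"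
  using SL.AE_integrable_snd[of "curry R"] SL.integrable_snd[of "curry R"] Ri by simp_all
 have Eu1: "integrable ?L (\<lambda>x. E u (\<lambda>i\<in>I. x i + h i))"
  using integral_leb_translate(2)[OF I borel_measurable_integrable[OF Eu], of h] Eu by simp
 define T where "T x = (\<Sum>k<p. 1 / fact k * (\<Sum>is\<in>index_lists I k. list_power h is * E (g is) x))" for x
 have Ti: "integrable ?L T" unfolding T_def using Eg by (auto intro!: Bochner_Integration.integrable_sum integrable_mult_right)
 define W where "W x = E u (\<lambda>i\<in>I. x i + h i) - T x - (\<integral>s. R (s, x) \<partial>lborel)" for x
 have Wi: "integrable ?L W" unfolding W_def by (intro Bochner_Integration.integrable_diff Eu1 Ti RAE(2))
 define good where "good a b \<longleftrightarrow> (\<forall>s\<in>{0..1::real}. PiE I (\<lambda>i. {a i + s * h i..b i + s * h i}) \<subseteq> D)" for a b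
 have tested: "(\<integral>x. W x * prod_deriv I B [] x \<partial>?L) = 0" if gd: "good a b" and B: "\<forall>i\<in>I. smooth_bump (a i) (b i) (B i)" for a b B
 proof -
  let ?f = "prod_deriv I B []"
  obtain C where C: "\<And>x. \<bar>?f x\<bar> \<le> C" using prod_deriv_bounded[OF B] by blast
  note fm = prod_deriv_measurable[OF B, of "[]"]
  have if': "integrable ?L (\<lambda>x. v x * ?f x)" if v: "integrable ?L v" for v
   by (rule integrable_mult_bounded[OF v fm C])
  have Rf: "integrable (lborel \<Otimes>\<^sub>M ?L) (\<lambda>z. R z * ?f (snd z))"
   by (rule integrable_mult_bounded[OF Ri measurable_compose[OF measurable_snd fm] C])
  have "(\<integral>x. (\<integral>s. R (s, x) \<partial>lborel) * ?f x \<partial>?L) = (\<integral>x. (\<integral>s. R (s, x) * ?f x \<partial>lborel) \<partial>?L)" by simp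
  also have "\<dots> = (\<integral>s. (\<integral>x. R (s, x) * ?f x \<partial>?L) \<partial>lborel)"
   using SL.swap_integrals[OF Rf] by simp
  also have "\<dots> = (\<integral>s. taylor_weight p s * (\<Sum>is\<in>?N. list_power h is * (\<integral>x. E (g is) (sh s x) * ?f x \<partial>?L)) \<partial>lborel)"
  proof (rule Bochner_Integration.integral_cong[OF refl])
   fix s :: real
   have i: "integrable ?L (\<lambda>x. E (g is) (sh s x) * ?f x)" if "is \<in> ?N" for "is"
   proof (rule if')
    show "integrable ?L (\<lambda>x. E (g is) (sh s x))"
     unfolding sh_def integral_leb_translate(2)[OF I borel_measurable_integrable[OF Eg[OF that order_refl]]]
     by (rule Eg[OF that order_refl])
   qed
   have "(\<integral>x. R (s, x) * ?f x \<partial>?L) = (\<integral>x. (\<Sum>is\<in>?N. (taylor_weight p s * list_power h is) * (E (g is) (sh s x) * ?f x)) \<partial>?L)"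
    unfolding R_def fst_conv snd_conv sum_distrib_right by (intro Bochner_Integration.integral_cong sum.cong refl) simp
   also have "\<dots> = (\<Sum>is\<in>?N. (taylor_weight p s * list_power h is) * (\<integral>x. E (g is) (sh s x) * ?f x \<partial>?L))"
    using i by simp
   finally show "(\<integral>x. R (s, x) * ?f x \<partial>?L) = taylor_weight p s * (\<Sum>is\<in>?N. list_power h is * (\<integral>x. E (g is) (sh s x) * ?f x \<partial>?L))"
    by (simp add: sum_distrib_left mult.assoc)
  qed
  finally have RR: "(\<integral>x. (\<integral>s. R (s, x) \<partial>lborel) * ?f x \<partial>?L) =
    (\<integral>s. taylor_weight p s * (\<Sum>is\<in>?N. list_power h is * (\<integral>x. E (g is) (sh s x) * ?f x \<partial>?L)) \<partial>lborel)" .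
  have TT: "(\<integral>x. T x * ?f x \<partial>?L) = (\<Sum>k<p. 1 / fact k * (\<Sum>is\<in>index_lists I k. list_power h is * (\<integral>x. E (g is) x * ?f x \<partial>?L)))"
  proof -
   have i: "integrable ?L (\<lambda>x. E (g is) x * ?f x)" if "is \<in> index_lists I k" "k \<in> {..<p}" for "is" k
    using that(2) by (intro if' Eg[OF that(1)]) simp
   have "(\<integral>x. T x * ?f x \<partial>?L) = (\<integral>x. (\<Sum>k<p. 1 / fact k * (\<Sum>is\<in>index_lists I k. list_power h is * (E (g is) x * ?f x))) \<partial>?L)"
    unfolding T_def by (simp add: sum_distrib_right sum_distrib_left mult_ac)
   also have "\<dots> = (\<Sum>k<p. \<integral>x. 1 / fact k * (\<Sum>is\<in>index_lists I k. list_power h is * (E (g is) x * ?f x)) \<partial>?L)"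
   proof (rule Bochner_Integration.integral_sum)
    fix k assume k: "k \<in> {..<p}"
    show "integrable ?L (\<lambda>x. 1 / fact k * (\<Sum>is\<in>index_lists I k. list_power h is * (E (g is) x * ?f x)))"
     by (intro integrable_mult_right Bochner_Integration.integrable_sum i[OF _ k])
   qed
   also have "\<dots> = (\<Sum>k<p. 1 / fact k * (\<Sum>is\<in>index_lists I k. list_power h is * (\<integral>x. E (g is) x * ?f x \<partial>?L)))"
   proof (rule sum.cong[OF refl])
    fix k assume k: "k \<in> {..<p}"
    have "(\<integral>x. (\<Sum>is\<in>index_lists I k. list_power h is * (E (g is) x * ?f x)) \<partial>?L) = (\<Sum>is\<in>index_lists I k. \<integral>x. list_power h is * (E (g is) x * ?f x) \<partial>?L)"
     by (rule Bochner_Integration.integral_sum) (intro integrable_mult_right i[OF _ k])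
    then show "(\<integral>x. 1 / fact k * (\<Sum>is\<in>index_lists I k. list_power h is * (E (g is) x * ?f x)) \<partial>?L) =
      1 / fact k * (\<Sum>is\<in>index_lists I k. list_power h is * (\<integral>x. E (g is) x * ?f x \<partial>?L))" by simp
   qed
   finally show ?thesis .
  qed
  have "(\<integral>x. W x * ?f x \<partial>?L) = (\<integral>x. E u (\<lambda>i\<in>I. x i + h i) * ?f x - T x * ?f x - (\<integral>s. R (s, x) \<partial>lborel) * ?f x \<partial>?L)"
   unfolding W_def left_diff_distrib ..
  also have "\<dots> = (\<integral>x. E u (\<lambda>i\<in>I. x i + h i) * ?f x \<partial>?L) - (\<integral>x. T x * ?f x \<partial>?L) - (\<integral>x. (\<integral>s. R (s, x) \<partial>lborel) * ?f x \<partial>?L)"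
   using if'[OF Eu1] if'[OF Ti] if'[OF RAE(2)] by (simp only: Bochner_Integration.integral_diff Bochner_Integration.integrable_diff)
  also have "(\<integral>x. E u (\<lambda>i\<in>I. x i + h i) * ?f x \<partial>?L) = (\<integral>x. T x * ?f x \<partial>?L) + (\<integral>x. (\<integral>s. R (s, x) \<partial>lborel) * ?f x \<partial>?L)"
   unfolding TT RR sh_def E_def
   by (rule weak_Taylor_tested[OF I D p u g B]) (use gd in \<open>simp only: good_def\<close>)
  finally show ?thesis by simp
 qed
 have gmono: "good a' b'" if "good a b" "\<forall>i\<in>I. a i \<le> a' i \<and> b' i \<le> b i" for a b a' b'
  unfolding good_def
 proof
  fix s :: real assume s: "s \<in> {0..1}"
  have "PiE I (\<lambda>i. {a' i + s * h i..b' i + s * h i}) \<subseteq> PiE I (\<lambda>i. {a i + s * h i..b i + s * h i})"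
   using that(2) by (intro PiE_mono) auto
  then show "PiE I (\<lambda>i. {a' i + s * h i..b' i + s * h i}) \<subseteq> D"
   using that(1)[unfolded good_def, rule_format, OF s] by (rule order_trans)
 qed
 have "AE x in ?L. (\<exists>d>0. \<forall>a b. (\<forall>i\<in>I. x i - d < a i \<and> a i < x i \<and> x i < b i \<and> b i < x i + d) \<longrightarrow> good a b) \<longrightarrow> W x = 0"
  by (rule AE_zero_if_locally_tested_zero[OF I Wi gmono tested])
 then show ?thesis
  using RAE(1) AE_space
 proof eventually_elim
  case (elim x)
  show ?case
  proof
   assume seg: "\<forall>s\<in>{0..1}. (\<lambda>i\<in>I. x i + s * h i) \<in> D"
   obtain d where d: "d > 0" "\<forall>s\<in>{0..1}. \<forall>y\<in>I \<rightarrow>\<^sub>E UNIV. (\<forall>i\<in>I. \<bar>y i - (x i + s * h i)\<bar> < d) \<longrightarrow> y \<in> D"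
    using segment_neighbourhood[OF I op seg] by (elim exE conjE) (rule that)
   have "good a b" if ab: "\<forall>i\<in>I. x i - d < a i \<and> a i < x i \<and> x i < b i \<and> b i < x i + d" for a b
    unfolding good_def
   proof (intro ballI subsetI)
    fix s :: real and y assume s: "s \<in> {0..1}" and y: "y \<in> PiE I (\<lambda>i. {a i + s * h i..b i + s * h i})"
    have "\<bar>y i - (x i + s * h i)\<bar> < d" if "i \<in> I" for i
     using PiE_mem[OF y that] ab[rule_format, OF that] by auto
    moreover have "y \<in> I \<rightarrow>\<^sub>E UNIV" using y by (auto simp: PiE_def)
    ultimately show "y \<in> D" using d(2) s by blast
   qed
   then have W0: "W x = 0" using elim(1) d(1) by blast
   have xD: "x \<in> D"
   proof -
    have "(\<lambda>i\<in>I. x i + 0 * h i) = x" using elim(3) by (auto simp: space_PiM PiE_def extensional_def fun_eq_iff)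
    then show ?thesis using seg[rule_format, of 0] by simp
   qed
   have hD: "(\<lambda>i\<in>I. x i + h i) \<in> D" using seg[rule_format, of 1] by simp
   define X where "X s = (\<Sum>is\<in>?N. list_power h is * (E (g is) (sh s x) - c is))" for s
   have Xm: "X \<in> borel_measurable lborel"
    unfolding X_def[abs_def]
   proof (intro borel_measurable_sum borel_measurable_times borel_measurable_diff borel_measurable_const)
    fix "is" assume "is \<in> ?N"
    from measurable_compose[OF measurable_Pair2'[OF elim(3), of lborel] Egm[OF this]]
    show "(\<lambda>s. E (g is) (sh s x)) \<in> borel_measurable lborel" by simp
   qed
   have split: "R (s, x) = taylor_weight p s * X s + taylor_weight p s * (\<Sum>is\<in>?N. list_power h is * c is)" for s
    unfolding R_def X_def by (simp add: sum_distrib_left sum.distrib[symmetric] right_diff_distrib mult_ac)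
   have wX: "integrable lborel (\<lambda>s. taylor_weight p s * X s)"
   proof -
    have "(\<lambda>s. taylor_weight p s * X s) = (\<lambda>s. R (s, x) - taylor_weight p s * (\<Sum>is\<in>?N. list_power h is * c is))"
     unfolding split by simp
    then show ?thesis using elim(2) taylor_weight_integrable[of p] by simp
   qed
   have "(\<integral>s. R (s, x) \<partial>lborel) = (\<integral>s. taylor_weight p s * X s \<partial>lborel) + 1 / fact p * (\<Sum>is\<in>?N. list_power h is * c is)"
    unfolding split using wX taylor_weight_integrable[of p] by (simp add: integral_taylor_weight[OF p])
   moreover have "T x = (\<Sum>k<p. 1 / fact k * (\<Sum>is\<in>index_lists I k. list_power h is * g is x))"
    unfolding T_def E_def using xD by simp
   moreover have "E u (\<lambda>i\<in>I. x i + h i) = u (\<lambda>i\<in>I. x i + h i)" unfolding E_def using hD by simp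
   ultimately have "u (\<lambda>i\<in>I. x i + h i) - taylor_sum I p g c x h = (\<integral>s. taylor_weight p s * X s \<partial>lborel)"
    using W0 unfolding W_def taylor_sum_def by simp
   then have "ennreal ((u (\<lambda>i\<in>I. x i + h i) - taylor_sum I p g c x h)\<^sup>2) \<le> (\<integral>\<^sup>+s. indicator {0..1} s * ennreal ((X s)\<^sup>2) \<partial>lborel)"
    using power2_integral_taylor_weight_le[OF Xm, of p] by simp
   also have "\<dots> = (\<integral>\<^sup>+s. indicator {0..1} s * ennreal ((\<Sum>is\<in>?N. list_power h is * (g is (\<lambda>i\<in>I. x i + s * h i) - c is))\<^sup>2) \<partial>lborel)"
   proof (rule nn_integral_cong)
    fix s :: real
    show "indicator {0..1} s * ennreal ((X s)\<^sup>2) = indicator {0..1} s * ennreal ((\<Sum>is\<in>?N. list_power h is * (g is (\<lambda>i\<in>I. x i + s * h i) - c is))\<^sup>2)"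
    proof (cases "s \<in> {0..1}")
     case True
     then show ?thesis unfolding X_def E_def sh_def using seg by simp
    qed simp
   qed
   finally show "ennreal ((u (\<lambda>i\<in>I. x i + h i) - taylor_sum I p g c x h)\<^sup>2) \<le>
    (\<integral>\<^sup>+s. indicator {0..1} s * ennreal ((\<Sum>is\<in>?N. list_power h is * (g is (\<lambda>i\<in>I. x i + s * h i) - c is))\<^sup>2) \<partial>lborel)" .
  qed
 qed
qed

lemma weak_deriv_Nil_AE_eq:
 fixes u v :: "('i \<Rightarrow> real) \<Rightarrow> real"
 assumes I: "finite I" and D: "D \<in> sets (leb I)" and op: "sup_open I D"
  and u: "integrable (dom_measure I D) u" and v: "integrable (dom_measure I D) v"
  and wd: "weak_deriv I D [] u v"
 shows "AE x in leb I. x \<in> D \<longrightarrow> u x = v x"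
proof -
 let ?L = "leb I"
 define W where "W x = indicator D x * u x - indicator D x * v x" for x
 have iu: "integrable ?L (\<lambda>x. indicator D x * u x)" "integrable ?L (\<lambda>x. indicator D x * v x)"
  using u v unfolding integral_dom_measure(2)[OF D] .
 have Wi: "integrable ?L W" unfolding W_def by (rule Bochner_Integration.integrable_diff[OF iu])
 define good where "good a b \<longleftrightarrow> PiE I (\<lambda>i. {a i..b i}) \<subseteq> D" for a b
 have tested: "(\<integral>x. W x * prod_deriv I B [] x \<partial>?L) = 0" if gd: "good a b" and B: "\<forall>i\<in>I. smooth_bump (a i) (b i) (B i)" for a b B
 proof -
  let ?f = "prod_deriv I B []"
  have "test_function I D ?f"
   by (rule test_function_prod_deriv[OF I B[rule_format]]) (use gd in \<open>simp_all add: good_def\<close>)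
  from wd[unfolded weak_deriv_def, rule_format, OF this]
  have eq: "(\<integral>x. indicator D x * (u x * ?f x) \<partial>?L) = (\<integral>x. indicator D x * (v x * ?f x) \<partial>?L)"
   unfolding integral_dom_measure(1)[OF D] by (simp add: partial_derivs_def)
  obtain C where C: "\<And>x. \<bar>?f x\<bar> \<le> C" using prod_deriv_bounded[OF B] by blast
  note fm = prod_deriv_measurable[OF B, of "[]"]
  have if': "integrable ?L (\<lambda>x. v x * ?f x)" if v: "integrable ?L v" for v
   by (rule integrable_mult_bounded[OF v fm C])
  have "(\<integral>x. W x * ?f x \<partial>?L) = (\<integral>x. indicator D x * u x * ?f x \<partial>?L) - (\<integral>x. indicator D x * v x * ?f x \<partial>?L)"
   unfolding W_def left_diff_distrib
   by (rule Bochner_Integration.integral_diff[OF if'[OF iu(1)] if'[OF iu(2)]])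
  then show ?thesis using eq by (simp add: mult.assoc)
 qed
 have gmono: "good a' b'" if "good a b" "\<forall>i\<in>I. a i \<le> a' i \<and> b' i \<le> b i" for a b a' b'
 proof -
  have "PiE I (\<lambda>i. {a' i..b' i}) \<subseteq> PiE I (\<lambda>i. {a i..b i})"
   using that(2) by (intro PiE_mono) auto
  then show ?thesis using that(1) unfolding good_def by (rule order_trans)
 qed
 have "AE x in ?L. (\<exists>d>0. \<forall>a b. (\<forall>i\<in>I. x i - d < a i \<and> a i < x i \<and> x i < b i \<and> b i < x i + d) \<longrightarrow> good a b) \<longrightarrow> W x = 0"
  by (rule AE_zero_if_locally_tested_zero[OF I Wi gmono tested])
 then show ?thesis
 proof eventually_elim
  case (elim x)
  show ?case
  proof
   assume xD: "x \<in> D"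
   obtain d where d: "d > 0" "\<forall>y\<in>I \<rightarrow>\<^sub>E UNIV. (\<forall>i\<in>I. \<bar>y i - x i\<bar> < d) \<longrightarrow> y \<in> D"
    using op xD unfolding sup_open_def by blast
   have "good a b" if ab: "\<forall>i\<in>I. x i - d < a i \<and> a i < x i \<and> x i < b i \<and> b i < x i + d" for a b
    unfolding good_def
   proof (intro subsetI)
    fix y assume y: "y \<in> PiE I (\<lambda>i. {a i..b i})"
    have "\<bar>y i - x i\<bar> < d" if "i \<in> I" for i
     using PiE_mem[OF y that] ab[rule_format, OF that] by auto
    moreover have "y \<in> I \<rightarrow>\<^sub>E UNIV" using y by (auto simp: PiE_def)
    ultimately show "y \<in> D" using d(2) by blast
   qed
   then have "W x = 0" using elim d(1) by blast
   then show "u x = v x" using xD by (simp add: W_def)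
  qed
 qed
qed

lemma list_power_cong: "set is \<subseteq> I \<Longrightarrow> (\<And>i. i \<in> I \<Longrightarrow> h i = h' i) \<Longrightarrow> list_power h is = list_power h' is"
 by (induction "is") auto

lemma taylor_sum_cong:
 assumes "\<And>i. i \<in> I \<Longrightarrow> h i = h' i" and "\<And>is k. is \<in> index_lists I k \<Longrightarrow> g is x = g' is x"
 shows "taylor_sum I p g c x h = taylor_sum I p g' c x h'"
proof -
 have l: "list_power h is = list_power h' is" if "is \<in> index_lists I k" for "is" k
  using that by (intro list_power_cong[of "is" I]) (auto simp: index_lists_def assms(1))
 show ?thesis unfolding taylor_sum_def
  by (intro arg_cong2[where f = "(+)"] arg_cong2[where f = "(*)"] refl sum.cong) (simp_all add: l assms(2))
qed

lemma abs_list_power_le: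
 assumes "set is \<subseteq> I" "\<And>i. i \<in> I \<Longrightarrow> \<bar>h i\<bar> \<le> \<rho>"
 shows "\<bar>list_power h is\<bar> \<le> \<rho> ^ length is"
 using assms(1)
proof (induction "is")
 case (Cons i js)
 then have "\<bar>h i\<bar> * \<bar>list_power h js\<bar> \<le> \<rho> * \<rho> ^ length js"
  using assms(2)[of i] by (intro mult_mono) auto
 then show ?case by (simp add: abs_mult)
qed simp

lemma power2_sum_le_card:
 fixes f :: "'a \<Rightarrow> real"
 assumes "finite A"
 shows "(\<Sum>i\<in>A. f i)\<^sup>2 \<le> real (card A) * (\<Sum>i\<in>A. (f i)\<^sup>2)"
 using Cauchy_Schwarz_ineq_sum[of "\<lambda>_. 1" f A] by simp

lemma measurable_list_power_diff:
 assumes "set is \<subseteq> I" and f: "f \<in> measurable M (leb I)" and f': "f' \<in> measurable M (leb I)"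
 shows "(\<lambda>z. list_power (\<lambda>i. f z i - f' z i) is) \<in> borel_measurable M"
 using assms(1)
proof (induction "is")
 case (Cons i js)
 have [measurable]: "(\<lambda>z. f z i) \<in> borel_measurable M" "(\<lambda>z. f' z i) \<in> borel_measurable M"
  using Cons.prems measurable_compose[OF f measurable_component_singleton[of i I "\<lambda>_. lborel"]]
   measurable_compose[OF f' measurable_component_singleton[of i I "\<lambda>_. lborel"]] by simp_all
 have [measurable]: "(\<lambda>z. list_power (\<lambda>i. f z i - f' z i) js) \<in> borel_measurable M" using Cons by simp
 show ?case by simp
qed simp

text \<open>Contracting by at most one half costs at most a factor \<open>2\<close> in each coordinate.\<close>
lemma nn_integral_leb_affine_le:
 assumes I: "finite I" and t: "t \<ge> 1/2" and V: "V \<in> borel_measurable (leb I)"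
 shows "(\<integral>\<^sup>+x. V (\<lambda>i\<in>I. v i + t * x i) \<partial>leb I) \<le> 2 ^ card I * (\<integral>\<^sup>+x. V x \<partial>leb I)"
proof -
 let ?X = "\<integral>\<^sup>+x. V (\<lambda>i\<in>I. v i + t * x i) \<partial>leb I"
 have "?X = 2 ^ card I * (ennreal ((1/2) ^ card I) * ?X)"
 proof -
  have "(2::ennreal) ^ card I * ennreal ((1/2) ^ card I) = ennreal (2 ^ card I * (1/2) ^ card I)"
   by (simp add: ennreal_mult' ennreal_power[symmetric])
  also have "(2::real) ^ card I * (1/2) ^ card I = 1" by (simp flip: power_mult_distrib)
  finally show ?thesis by (simp add: mult.assoc[symmetric])
 qed
 also have "\<dots> \<le> 2 ^ card I * (ennreal (\<bar>t\<bar> ^ card I) * ?X)"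
  using t by (intro mult_left_mono mult_right_mono ennreal_leI power_mono) auto
 also have "ennreal (\<bar>t\<bar> ^ card I) * ?X = (\<integral>\<^sup>+x. V x \<partial>leb I)"
  by (rule nn_integral_leb_affine[OF I _ V, symmetric]) (use t in auto)
 finally show ?thesis .
qed

text \<open>Averaging over both end points of the segments: whichever of the weights \<open>s\<close>, \<open>1 - s\<close> is at
 least \<open>1/2\<close> gives a change of variables with bounded Jacobian, so no singular kernel appears.\<close>
lemma nn_integral_segments_le:
 assumes I: "finite I" and V[measurable]: "V \<in> borel_measurable (leb I)"
  and B[measurable]: "B \<in> sets (leb I)" and Q[measurable]: "Q \<in> sets (leb I)"
  and mB: "emeasure (leb I) B \<le> b" and mQ: "emeasure (leb I) Q \<le> b" and s: "s \<in> {0..1::real}"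
 shows "(\<integral>\<^sup>+y. (\<integral>\<^sup>+x. indicator B y * indicator Q x * V (\<lambda>i\<in>I. y i + s * (x i - y i)) \<partial>leb I) \<partial>leb I)
  \<le> 2 ^ card I * b * (\<integral>\<^sup>+x. V x \<partial>leb I)"
proof -
 let ?L = "leb I"
 let ?LL = "leb I \<Otimes>\<^sub>M leb I"
 interpret L: sigma_finite_measure ?L by (rule sigma_finite_leb[OF I])
 interpret LL: pair_sigma_finite ?L ?L by unfold_locales
 have m[measurable]: "(\<lambda>z. \<lambda>i\<in>I. fst z i + s * (snd z i - fst z i)) \<in> measurable ?LL ?L"
 proof (rule measurable_restrict)
  fix i assume "i \<in> I"
  then show "(\<lambda>z. fst z i + s * (snd z i - fst z i)) \<in> measurable ?LL lborel" by measurable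
 qed
 show ?thesis
 proof (cases "s \<ge> 1/2")
  case True
  have "(\<integral>\<^sup>+x. indicator B y * indicator Q x * V (\<lambda>i\<in>I. y i + s * (x i - y i)) \<partial>?L) \<le>
    indicator B y * (2 ^ card I * (\<integral>\<^sup>+x. V x \<partial>?L))" for y
  proof -
   have eq: "(\<lambda>i\<in>I. y i + s * (x i - y i)) = (\<lambda>i\<in>I. (1 - s) * y i + s * x i)" for x
    by (auto simp: fun_eq_iff algebra_simps)
   have "(\<integral>\<^sup>+x. indicator B y * indicator Q x * V (\<lambda>i\<in>I. y i + s * (x i - y i)) \<partial>?L) \<le>
    (\<integral>\<^sup>+x. indicator B y * V (\<lambda>i\<in>I. (1 - s) * y i + s * x i) \<partial>?L)"
    unfolding eq by (intro nn_integral_mono) (auto simp: indicator_def)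
   also have "\<dots> = indicator B y * (\<integral>\<^sup>+x. V (\<lambda>i\<in>I. (1 - s) * y i + s * x i) \<partial>?L)"
    by (rule nn_integral_cmult) (rule measurable_compose[OF measurable_affine_leb V])
   also have "\<dots> \<le> indicator B y * (2 ^ card I * (\<integral>\<^sup>+x. V x \<partial>?L))"
    by (intro mult_left_mono nn_integral_leb_affine_le[OF I True V]) simp
   finally show ?thesis .
  qed
  then have "(\<integral>\<^sup>+y. (\<integral>\<^sup>+x. indicator B y * indicator Q x * V (\<lambda>i\<in>I. y i + s * (x i - y i)) \<partial>?L) \<partial>?L) \<le>
    (\<integral>\<^sup>+y. indicator B y * (2 ^ card I * (\<integral>\<^sup>+x. V x \<partial>?L)) \<partial>?L)"
   by (intro nn_integral_mono)
  also have "\<dots> = emeasure ?L B * (2 ^ card I * (\<integral>\<^sup>+x. V x \<partial>?L))"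
   by (simp add: nn_integral_multc)
  also have "\<dots> \<le> b * (2 ^ card I * (\<integral>\<^sup>+x. V x \<partial>?L))" by (rule mult_right_mono[OF mB]) simp
  finally show ?thesis by (simp add: mult_ac)
 next
  case False
  then have t: "1 - s \<ge> 1/2" by simp
  have "(\<integral>\<^sup>+y. (\<integral>\<^sup>+x. indicator B y * indicator Q x * V (\<lambda>i\<in>I. y i + s * (x i - y i)) \<partial>?L) \<partial>?L) =
   (\<integral>\<^sup>+x. (\<integral>\<^sup>+y. indicator B y * indicator Q x * V (\<lambda>i\<in>I. y i + s * (x i - y i)) \<partial>?L) \<partial>?L)"
  proof (rule LL.Fubini')
   have [measurable]: "(\<lambda>z. \<lambda>i\<in>I. snd z i + s * (fst z i - snd z i)) \<in> measurable ?LL ?L"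
   proof (rule measurable_restrict)
    fix i assume "i \<in> I"
    then show "(\<lambda>z. snd z i + s * (fst z i - snd z i)) \<in> measurable ?LL lborel" by measurable
   qed
   have "(\<lambda>z. indicator B (snd z) * indicator Q (fst z) * V (\<lambda>i\<in>I. snd z i + s * (fst z i - snd z i))) \<in> borel_measurable ?LL"
    by measurable
   then show "(\<lambda>(x, y). indicator B y * indicator Q x * V (\<lambda>i\<in>I. y i + s * (x i - y i))) \<in> borel_measurable ?LL"
    by (simp only: case_prod_beta')
  qed
  moreover have "(\<integral>\<^sup>+y. indicator B y * indicator Q x * V (\<lambda>i\<in>I. y i + s * (x i - y i)) \<partial>?L) \<le>
    indicator Q x * (2 ^ card I * (\<integral>\<^sup>+x. V x \<partial>?L))" for x
  proof -
   have eq: "(\<lambda>i\<in>I. y i + s * (x i - y i)) = (\<lambda>i\<in>I. s * x i + (1 - s) * y i)" for y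
    by (auto simp: fun_eq_iff algebra_simps)
   have "(\<integral>\<^sup>+y. indicator B y * indicator Q x * V (\<lambda>i\<in>I. y i + s * (x i - y i)) \<partial>?L) \<le>
    (\<integral>\<^sup>+y. indicator Q x * V (\<lambda>i\<in>I. s * x i + (1 - s) * y i) \<partial>?L)"
    unfolding eq by (intro nn_integral_mono) (auto simp: indicator_def)
   also have "\<dots> = indicator Q x * (\<integral>\<^sup>+y. V (\<lambda>i\<in>I. s * x i + (1 - s) * y i) \<partial>?L)"
    by (rule nn_integral_cmult) (rule measurable_compose[OF measurable_affine_leb V])
   also have "\<dots> \<le> indicator Q x * (2 ^ card I * (\<integral>\<^sup>+x. V x \<partial>?L))"
    by (intro mult_left_mono nn_integral_leb_affine_le[OF I t V]) simp
   finally show ?thesis .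
  qed
  then have "(\<integral>\<^sup>+x. (\<integral>\<^sup>+y. indicator B y * indicator Q x * V (\<lambda>i\<in>I. y i + s * (x i - y i)) \<partial>?L) \<partial>?L) \<le>
    (\<integral>\<^sup>+x. indicator Q x * (2 ^ card I * (\<integral>\<^sup>+x. V x \<partial>?L)) \<partial>?L)"
   by (intro nn_integral_mono)
  also have "\<dots> = emeasure ?L Q * (2 ^ card I * (\<integral>\<^sup>+x. V x \<partial>?L))"
   by (simp add: nn_integral_multc)
  also have "\<dots> \<le> b * (2 ^ card I * (\<integral>\<^sup>+x. V x \<partial>?L))" by (rule mult_right_mono[OF mQ]) simp
  ultimately show ?thesis by (simp add: mult_ac)
 qed
qed

lemma exists_le_average:
 fixes F :: "'a \<Rightarrow> ennreal"
 assumes F: "F \<in> borel_measurable M" and B: "B \<in> sets M" and b: "emeasure M B = ennreal b" "b > 0"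
  and avg: "(\<integral>\<^sup>+y. indicator B y * F y \<partial>M) \<le> ennreal b * K"
 shows "\<exists>y\<in>B. F y \<le> K"
proof (rule ccontr)
 assume "\<not> ?thesis"
 then have gt: "\<And>y. y \<in> B \<Longrightarrow> K < F y" by (auto simp: not_le)
 have "B \<noteq> {}" using b by auto
 then have K: "K < \<infinity>" using gt by (metis ex_in_conv infinity_ennreal_def less_le_trans top_greatest)
 note [measurable] = F B
 have "(\<integral>\<^sup>+y. K * indicator B y \<partial>M) < (\<integral>\<^sup>+y. indicator B y * F y \<partial>M)"
 proof (rule nn_integral_less)
  show "(\<integral>\<^sup>+y. K * indicator B y \<partial>M) \<noteq> \<infinity>" using K b by (simp add: nn_integral_cmult_indicator ennreal_mult_eq_top_iff)
  show "AE y in M. K * indicator B y \<le> indicator B y * F y" using gt by (auto simp: indicator_def less_imp_le)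
  show "\<not> (AE y in M. indicator B y * F y \<le> K * indicator B y)"
  proof
   assume "AE y in M. indicator B y * F y \<le> K * indicator B y"
   then have "AE y in M. y \<notin> B"
    by eventually_elim (use gt in \<open>auto simp: indicator_def not_le[symmetric] split: if_splits\<close>)
   then have "B \<in> null_sets M" using AE_iff_null_sets[OF B] by simp
   with b show False by auto
  qed
 qed measurable
 also have "(\<integral>\<^sup>+y. K * indicator B y \<partial>M) = K * ennreal b" using b by (simp add: nn_integral_cmult_indicator)
 finally show False using avg by (simp add: mult.commute not_less[symmetric])
qed

text \<open>Polynomial approximation (Bramble--Hilbert) on \<open>Q\<close>: the mean of the Taylor error over the
 centres \<open>y \<in> B\<close> is controlled, so some centre does at least as well.  In the coordinates \<open>y\<close> and
 \<open>h = x - y\<close> the weak Taylor formula applies for each fixed \<open>h\<close> and almost every \<open>y\<close>.\<close>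
theorem local_Taylor_approximation:
 fixes g :: "'i list \<Rightarrow> ('i \<Rightarrow> real) \<Rightarrow> real" and u :: "('i \<Rightarrow> real) \<Rightarrow> real"
 assumes I: "finite I" and D: "D \<in> sets (leb I)" and op: "sup_open I D"
  and u: "integrable (dom_measure I D) u"
  and g: "\<forall>is. set is \<subseteq> I \<longrightarrow> length is \<le> p \<longrightarrow> integrable (dom_measure I D) (g is) \<and> weak_deriv I D is u (g is)"
  and B[measurable]: "B \<in> sets (leb I)" and Q[measurable]: "Q \<in> sets (leb I)" and S[measurable]: "S \<in> sets (leb I)"
  and mB: "emeasure (leb I) B = ennreal b" "b > 0" and mQ: "emeasure (leb I) Q \<le> ennreal b"
  and SD: "S \<subseteq> D"
  and seg: "\<And>y x s. y \<in> B \<Longrightarrow> x \<in> Q \<Longrightarrow> s \<in> {0..1} \<Longrightarrow> (\<lambda>i\<in>I. y i + s * (x i - y i)) \<in> S"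
  and \<rho>: "\<And>y x i. y \<in> B \<Longrightarrow> x \<in> Q \<Longrightarrow> i \<in> I \<Longrightarrow> \<bar>x i - y i\<bar> \<le> \<rho>" and \<rho>0: "\<rho> \<ge> 0"
 shows "\<exists>y\<in>B. (\<integral>\<^sup>+x. indicator Q x * ennreal ((u x - taylor_sum I p g c y (\<lambda>i. x i - y i))\<^sup>2) \<partial>leb I) \<le>
   2 ^ card I * ennreal (real (card (index_lists I p)) * \<rho> ^ (2 * p)) *
    (\<Sum>is\<in>index_lists I p. \<integral>\<^sup>+x. indicator S x * ennreal ((g is x - c is)\<^sup>2) \<partial>leb I)"
proof (cases "Q = {}")
 case True
 have "B \<noteq> {}" using mB by auto
 then show ?thesis using True by auto
next
 case Qne: False
 let ?L = "leb I"
 let ?N = "index_lists I p"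
 let ?LL = "leb I \<Otimes>\<^sub>M leb I"
 interpret L: sigma_finite_measure ?L by (rule sigma_finite_leb[OF I])
 interpret LL: pair_sigma_finite ?L ?L by unfold_locales
 interpret SL: pair_sigma_finite lborel ?L by unfold_locales
 define E where "E v x = indicator D x * v x" for v :: "('i \<Rightarrow> real) \<Rightarrow> real" and x
 have Eu[measurable]: "E u \<in> borel_measurable ?L"
  using u unfolding integral_dom_measure(2)[OF D] E_def[abs_def] by simp
 have Eg: "E (g is) \<in> borel_measurable ?L" if "is \<in> index_lists I k" "k \<le> p" for "is" k
  using g that unfolding integral_dom_measure(2)[OF D] E_def[abs_def] index_lists_def by blast
 have ext: "(\<lambda>i\<in>I. z i) = z" if "z \<in> space ?L" for z
  using that by (auto simp: space_PiM PiE_def extensional_def fun_eq_iff)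
 have Bsp: "y \<in> space ?L" if "y \<in> B" for y using sets.sets_into_space[OF B] that by blast
 have Qsp: "y \<in> space ?L" if "y \<in> Q" for y using sets.sets_into_space[OF Q] that by blast
 have QS: "x \<in> S" if "x \<in> Q" for x
 proof -
  obtain y where "y \<in> B" using mB by fastforce
  have "(\<lambda>i\<in>I. y i + 1 * (x i - y i)) = x" using ext[OF Qsp[OF that]] by simp
  then show ?thesis using seg[OF \<open>y \<in> B\<close> that, of 1] by simp
 qed
 have BD: "y \<in> D" if "y \<in> B" for y
 proof -
  obtain x where "x \<in> Q" using Qne by blast
  have "(\<lambda>i\<in>I. y i + 0 * (x i - y i)) = y" using ext[OF Bsp[OF that]] by simp
  then show ?thesis using seg[OF that \<open>x \<in> Q\<close>, of 0] SD by auto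
 qed
 define V where "V is x = indicator S x * ennreal ((E (g is) x - c is)\<^sup>2)" for "is" x
 have V[measurable]: "V is \<in> borel_measurable ?L" if "is \<in> ?N" for "is"
  using Eg[OF that order_refl] unfolding V_def[abs_def] by measurable
 have Vg: "(\<integral>\<^sup>+x. indicator S x * ennreal ((g is x - c is)\<^sup>2) \<partial>?L) = (\<integral>\<^sup>+x. V is x \<partial>?L)" for "is"
  by (rule nn_integral_cong) (use SD in \<open>auto simp: V_def E_def indicator_def\<close>)
 define C0 where "C0 = ennreal (real (card (?N)) * \<rho> ^ (2 * p))"
 have fin: "finite (?N)" by (rule finite_index_lists[OF I])
 show ?thesis
 proof (cases "p = 0")
  case True
  have intg: "integrable (dom_measure I D) (g [])" and wd: "weak_deriv I D [] u (g [])" using g by simp_all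
  have ae: "AE x in ?L. x \<in> D \<longrightarrow> u x = g [] x"
   by (rule weak_deriv_Nil_AE_eq[OF I D op u intg wd])
  obtain y where y: "y \<in> B" using mB by fastforce
  have T: "taylor_sum I p g c y h = c []" for h by (simp add: taylor_sum_def True index_lists_0)
  have "(\<integral>\<^sup>+x. indicator Q x * ennreal ((u x - c [])\<^sup>2) \<partial>?L) \<le> (\<integral>\<^sup>+x. indicator S x * ennreal ((g [] x - c [])\<^sup>2) \<partial>?L)"
  proof (rule nn_integral_mono_AE)
   show "AE x in ?L. indicator Q x * ennreal ((u x - c [])\<^sup>2) \<le> indicator S x * ennreal ((g [] x - c [])\<^sup>2)"
    using ae by eventually_elim (use QS SD in \<open>auto simp: indicator_def\<close>)
  qed
  also have "\<dots> \<le> 2 ^ card I * (\<integral>\<^sup>+x. indicator S x * ennreal ((g [] x - c [])\<^sup>2) \<partial>?L)"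
  proof -
   have "(1::ennreal) \<le> 2 ^ card I" by (rule one_le_power) simp
   then have "1 * (\<integral>\<^sup>+x. indicator S x * ennreal ((g [] x - c [])\<^sup>2) \<partial>?L) \<le> 2 ^ card I * (\<integral>\<^sup>+x. indicator S x * ennreal ((g [] x - c [])\<^sup>2) \<partial>?L)"
    by (rule mult_right_mono) simp
   then show ?thesis by simp
  qed
  finally show ?thesis using y by (intro bexI[OF _ y]) (simp add: T[unfolded True] True index_lists_0)
 next
  case False
  then have p: "p > 0" by simp
  define G where "G y x = indicator B y * indicator Q x * ennreal ((E u x - taylor_sum I p (\<lambda>is. E (g is)) c y (\<lambda>i. x i - y i))\<^sup>2)" for y x
  have Gm: "case_prod G \<in> borel_measurable ?LL"
  proof -
   have [measurable]: "(\<lambda>z. list_power (\<lambda>i. snd z i - fst z i) is) \<in> borel_measurable ?LL" if "is \<in> index_lists I k" for "is" k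
    by (rule measurable_list_power_diff[of _ I]) (use that in \<open>auto simp: index_lists_def\<close>)
   have [measurable]: "(\<lambda>z. E (g is) (fst z)) \<in> borel_measurable ?LL" if "is \<in> index_lists I k" "k \<le> p" for "is" k
    by (rule measurable_compose[OF measurable_fst Eg[OF that]])
   have "(\<lambda>z. taylor_sum I p (\<lambda>is. E (g is)) c (fst z) (\<lambda>i. snd z i - fst z i)) \<in> borel_measurable ?LL"
    unfolding taylor_sum_def
    by (intro borel_measurable_add borel_measurable_sum borel_measurable_times borel_measurable_const) auto
   then have "(\<lambda>z. G (fst z) (snd z)) \<in> borel_measurable ?LL"
    unfolding G_def by measurable
   then show ?thesis by (simp add: case_prod_beta')
  qed
  have addm: "(\<lambda>z. \<lambda>i\<in>I. fst z i + snd z i) \<in> measurable ?LL ?L"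
  proof (rule measurable_restrict)
   fix i assume "i \<in> I"
   then show "(\<lambda>z. fst z i + snd z i) \<in> measurable ?LL lborel" by measurable
  qed
  have shear: "(\<integral>\<^sup>+y. (\<integral>\<^sup>+x. H y x \<partial>?L) \<partial>?L) = (\<integral>\<^sup>+h. (\<integral>\<^sup>+y. H y (\<lambda>i\<in>I. h i + y i) \<partial>?L) \<partial>?L)"
   if H: "case_prod H \<in> borel_measurable ?LL" for H :: "('i \<Rightarrow> real) \<Rightarrow> ('i \<Rightarrow> real) \<Rightarrow> ennreal"
  proof -
   have "(\<integral>\<^sup>+y. (\<integral>\<^sup>+x. H y x \<partial>?L) \<partial>?L) = (\<integral>\<^sup>+y. (\<integral>\<^sup>+h. H y (\<lambda>i\<in>I. h i + y i) \<partial>?L) \<partial>?L)"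
   proof (rule nn_integral_cong)
    fix y assume "y \<in> space ?L"
    then have "H y \<in> borel_measurable ?L" using measurable_Pair2[OF H] by simp
    from nn_integral_leb_translate[OF I this, of y]
    show "(\<integral>\<^sup>+x. H y x \<partial>?L) = (\<integral>\<^sup>+h. H y (\<lambda>i\<in>I. h i + y i) \<partial>?L)" by simp
   qed
   also have "\<dots> = (\<integral>\<^sup>+h. (\<integral>\<^sup>+y. H y (\<lambda>i\<in>I. h i + y i) \<partial>?L) \<partial>?L)"
   proof (rule LL.Fubini')
    have "(\<lambda>z. case_prod H (snd z, \<lambda>i\<in>I. fst z i + snd z i)) \<in> borel_measurable ?LL"
     by (rule measurable_compose[OF measurable_Pair[OF measurable_snd addm] H])
    then show "(\<lambda>(x, y). H y (\<lambda>i\<in>I. x i + y i)) \<in> borel_measurable ?LL"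
     by (simp only: case_prod_beta' fst_conv snd_conv)
   qed
   finally show ?thesis .
  qed
  define H where "H y x = (\<integral>\<^sup>+s. indicator {0..1} s * (indicator B y * indicator Q x * (C0 * (\<Sum>is\<in>?N. V is (\<lambda>i\<in>I. y i + s * (x i - y i))))) \<partial>lborel)" for y x
  have segm: "(\<lambda>w. \<lambda>i\<in>I. fst (snd w) i + fst w * (snd (snd w) i - fst (snd w) i)) \<in> measurable (lborel \<Otimes>\<^sub>M ?LL) ?L"
  proof (rule measurable_restrict)
   fix i assume "i \<in> I"
   then show "(\<lambda>w. fst (snd w) i + fst w * (snd (snd w) i - fst (snd w) i)) \<in> measurable (lborel \<Otimes>\<^sub>M ?LL) lborel" by measurable
  qed
  have intm: "(\<lambda>w. indicator {0..1} (fst w) * (indicator B (fst (snd w)) * indicator Q (snd (snd w)) * (C0 * (\<Sum>is\<in>?N. V is (\<lambda>i\<in>I. fst (snd w) i + fst w * (snd (snd w) i - fst (snd w) i))))))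
    \<in> borel_measurable (lborel \<Otimes>\<^sub>M ?LL)"
  proof -
   have [measurable]: "(\<lambda>w. V is (\<lambda>i\<in>I. fst (snd w) i + fst w * (snd (snd w) i - fst (snd w) i))) \<in> borel_measurable (lborel \<Otimes>\<^sub>M ?LL)" if "is \<in> ?N" for "is"
    by (rule measurable_compose[OF segm V[OF that]])
   show ?thesis by measurable
  qed
  interpret P: pair_sigma_finite lborel "?L \<Otimes>\<^sub>M ?L"
   by unfold_locales
  have Hm: "case_prod H \<in> borel_measurable ?LL"
  proof -
   have "(\<lambda>z. \<integral>\<^sup>+s. indicator {0..1} s * (indicator B (fst z) * indicator Q (snd z) * (C0 * (\<Sum>is\<in>?N. V is (\<lambda>i\<in>I. fst z i + s * (snd z i - fst z i))))) \<partial>lborel) \<in> borel_measurable ?LL"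
   proof (rule lborel.borel_measurable_nn_integral)
    have "(\<lambda>w. (snd w, fst w)) \<in> measurable (?LL \<Otimes>\<^sub>M lborel) (lborel \<Otimes>\<^sub>M ?LL)" by measurable
    from measurable_compose[OF this intm]
    show "(\<lambda>(z, s). indicator {0..1} s * (indicator B (fst z) * indicator Q (snd z) * (C0 * (\<Sum>is\<in>?N. V is (\<lambda>i\<in>I. fst z i + s * (snd z i - fst z i)))))) \<in> borel_measurable (?LL \<Otimes>\<^sub>M lborel)"
     by (simp add: case_prod_beta')
   qed
   then show ?thesis by (simp add: H_def case_prod_beta')
  qed
  have GH: "AE y in ?L. G y (\<lambda>i\<in>I. h i + y i) \<le> H y (\<lambda>i\<in>I. h i + y i)" for h
   using weak_Taylor_AE_bound[OF I D op p u g, of h c]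
  proof eventually_elim
   case (elim y)
   let ?x = "\<lambda>i\<in>I. h i + y i"
   show ?case
   proof (cases "y \<in> B \<and> ?x \<in> Q")
    case False
    then show ?thesis by (auto simp: G_def)
   next
    case True
    then have y: "y \<in> B" and x: "?x \<in> Q" by auto
    have hx: "(\<lambda>i\<in>I. y i + s * (?x i - y i)) = (\<lambda>i\<in>I. y i + s * h i)" for s
     by (auto simp: fun_eq_iff)
    have sS: "(\<lambda>i\<in>I. y i + s * h i) \<in> S" if "s \<in> {0..1}" for s using seg[OF y x that] unfolding hx .
    have hr: "\<bar>h i\<bar> \<le> \<rho>" if "i \<in> I" for i using \<rho>[OF y x that] that by simp
    have xx: "(\<lambda>i\<in>I. y i + h i) = ?x" by (auto simp: fun_eq_iff)
    have "ennreal ((E u ?x - taylor_sum I p (\<lambda>is. E (g is)) c y (\<lambda>i. ?x i - y i))\<^sup>2) = ennreal ((u ?x - taylor_sum I p g c y h)\<^sup>2)"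
    proof -
     have "taylor_sum I p (\<lambda>is. E (g is)) c y (\<lambda>i. ?x i - y i) = taylor_sum I p g c y h"
      by (rule taylor_sum_cong) (use BD[OF y] in \<open>auto simp: E_def\<close>)
     moreover have "E u ?x = u ?x" using QS[OF x] SD by (auto simp: E_def)
     ultimately show ?thesis by simp
    qed
    also have "\<dots> \<le> (\<integral>\<^sup>+s. indicator {0..1} s * ennreal ((\<Sum>is\<in>?N. list_power h is * (g is (\<lambda>i\<in>I. y i + s * h i) - c is))\<^sup>2) \<partial>lborel)"
     using elim sS SD unfolding xx by blast
    also have "\<dots> \<le> (\<integral>\<^sup>+s. indicator {0..1} s * (C0 * (\<Sum>is\<in>?N. V is (\<lambda>i\<in>I. y i + s * h i))) \<partial>lborel)"
    proof (rule nn_integral_mono)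
     fix s :: real
     show "indicator {0..1} s * ennreal ((\<Sum>is\<in>?N. list_power h is * (g is (\<lambda>i\<in>I. y i + s * h i) - c is))\<^sup>2) \<le>
       indicator {0..1} s * (C0 * (\<Sum>is\<in>?N. V is (\<lambda>i\<in>I. y i + s * h i)))"
     proof (cases "s \<in> {0..1}")
      case s: True
      define z where "z = (\<lambda>i\<in>I. y i + s * h i)"
      have "(\<Sum>is\<in>?N. list_power h is * (g is z - c is))\<^sup>2 \<le>
        real (card (?N)) * (\<Sum>is\<in>?N. (list_power h is * (g is z - c is))\<^sup>2)"
       by (rule power2_sum_le_card[OF fin])
      also have "\<dots> \<le> real (card (?N)) * (\<Sum>is\<in>?N. \<rho> ^ (2 * p) * (g is z - c is)\<^sup>2)"
      proof (intro mult_left_mono sum_mono)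
       fix "is" assume i: "is \<in> ?N"
       then have "\<bar>list_power h is\<bar> \<le> \<rho> ^ p" using abs_list_power_le[of "is" I h \<rho>] hr by (auto simp: index_lists_def)
       then have "\<bar>list_power h is\<bar>\<^sup>2 \<le> (\<rho> ^ p)\<^sup>2" by (intro power_mono) auto
       then have "(list_power h is)\<^sup>2 \<le> \<rho> ^ (2 * p)" by (simp add: power_mult[symmetric] mult.commute)
       then show "(list_power h is * (g is z - c is))\<^sup>2 \<le> \<rho> ^ (2 * p) * (g is z - c is)\<^sup>2"
        by (simp add: power_mult_distrib mult_right_mono)
      qed simp
      also have "\<dots> = (real (card (?N)) * \<rho> ^ (2 * p)) * (\<Sum>is\<in>?N. (g is z - c is)\<^sup>2)"
       by (simp add: sum_distrib_left mult.assoc)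
      finally have "ennreal ((\<Sum>is\<in>?N. list_power h is * (g is z - c is))\<^sup>2) \<le>
        ennreal ((real (card (?N)) * \<rho> ^ (2 * p)) * (\<Sum>is\<in>?N. (g is z - c is)\<^sup>2))"
       by (rule ennreal_leI)
      also have "\<dots> = C0 * (\<Sum>is\<in>?N. ennreal ((g is z - c is)\<^sup>2))"
       unfolding C0_def using \<rho>0 by (simp add: ennreal_mult' sum_nonneg)
      also have "(\<Sum>is\<in>?N. ennreal ((g is z - c is)\<^sup>2)) = (\<Sum>is\<in>?N. V is z)"
       by (rule sum.cong[OF refl]) (use sS[OF s, folded z_def] SD in \<open>auto simp: V_def E_def\<close>)
      finally show ?thesis using s unfolding z_def[symmetric] by simp
     qed simp
    qed
    finally have le: "ennreal ((E u ?x - taylor_sum I p (\<lambda>is. E (g is)) c y (\<lambda>i. ?x i - y i))\<^sup>2) \<le>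
     (\<integral>\<^sup>+s. indicator {0..1} s * (C0 * (\<Sum>is\<in>?N. V is (\<lambda>i\<in>I. y i + s * h i))) \<partial>lborel)" .
    have ind: "indicator B y = (1::ennreal)" "indicator Q ?x = (1::ennreal)" using y x by auto
    show ?thesis unfolding G_def H_def hx ind mult_1 by (rule le)
   qed
  qed
  have "(\<integral>\<^sup>+y. (\<integral>\<^sup>+x. G y x \<partial>?L) \<partial>?L) = (\<integral>\<^sup>+h. (\<integral>\<^sup>+y. G y (\<lambda>i\<in>I. h i + y i) \<partial>?L) \<partial>?L)"
   by (rule shear[OF Gm])
  also have "\<dots> \<le> (\<integral>\<^sup>+h. (\<integral>\<^sup>+y. H y (\<lambda>i\<in>I. h i + y i) \<partial>?L) \<partial>?L)"
   by (intro nn_integral_mono nn_integral_mono_AE GH)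
  also have "\<dots> = (\<integral>\<^sup>+y. (\<integral>\<^sup>+x. H y x \<partial>?L) \<partial>?L)"
   by (rule shear[OF Hm, symmetric])
  also have "\<dots> = (\<integral>\<^sup>+z. case_prod H z \<partial>?LL)"
   using L.nn_integral_fst[OF Hm] by simp
  also have "\<dots> = (\<integral>\<^sup>+s. (\<integral>\<^sup>+z. indicator {0..1} s * (indicator B (fst z) * indicator Q (snd z) * (C0 * (\<Sum>is\<in>?N. V is (\<lambda>i\<in>I. fst z i + s * (snd z i - fst z i))))) \<partial>?LL) \<partial>lborel)"
   using P.Fubini'[of "\<lambda>s z. indicator {0..1} s * (indicator B (fst z) * indicator Q (snd z) * (C0 * (\<Sum>is\<in>?N. V is (\<lambda>i\<in>I. fst z i + s * (snd z i - fst z i)))))"] intm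
   by (simp add: H_def case_prod_beta')
  also have "\<dots> \<le> (\<integral>\<^sup>+s. indicator {0..1::real} s * (C0 * (\<Sum>is\<in>?N. 2 ^ card I * ennreal b * (\<integral>\<^sup>+x. V is x \<partial>?L))) \<partial>lborel)"
  proof (rule nn_integral_mono)
   fix s :: real
   show "(\<integral>\<^sup>+z. indicator {0..1} s * (indicator B (fst z) * indicator Q (snd z) * (C0 * (\<Sum>is\<in>?N. V is (\<lambda>i\<in>I. fst z i + s * (snd z i - fst z i))))) \<partial>?LL)
     \<le> indicator {0..1} s * (C0 * (\<Sum>is\<in>?N. 2 ^ card I * ennreal b * (\<integral>\<^sup>+x. V is x \<partial>?L)))"
   proof (cases "s \<in> {0..1}")
    case s: True
    have sm: "(\<lambda>z. \<lambda>i\<in>I. fst z i + s * (snd z i - fst z i)) \<in> measurable ?LL ?L"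
    proof (rule measurable_restrict)
     fix i assume "i \<in> I"
     then show "(\<lambda>z. fst z i + s * (snd z i - fst z i)) \<in> measurable ?LL lborel" by measurable
    qed
    have vm: "(\<lambda>z. indicator B (fst z) * indicator Q (snd z) * V is (\<lambda>i\<in>I. fst z i + s * (snd z i - fst z i))) \<in> borel_measurable ?LL" if "is \<in> ?N" for "is"
    proof -
     note [measurable] = measurable_compose[OF sm V[OF that]]
     show ?thesis by measurable
    qed
    have "(\<integral>\<^sup>+z. indicator {0..1} s * (indicator B (fst z) * indicator Q (snd z) * (C0 * (\<Sum>is\<in>?N. V is (\<lambda>i\<in>I. fst z i + s * (snd z i - fst z i))))) \<partial>?LL) =
     (\<integral>\<^sup>+z. C0 * (\<Sum>is\<in>?N. indicator B (fst z) * indicator Q (snd z) * V is (\<lambda>i\<in>I. fst z i + s * (snd z i - fst z i))) \<partial>?LL)"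
     using s by (intro nn_integral_cong) (simp add: sum_distrib_left mult_ac)
    also have "\<dots> = C0 * (\<Sum>is\<in>?N. \<integral>\<^sup>+z. indicator B (fst z) * indicator Q (snd z) * V is (\<lambda>i\<in>I. fst z i + s * (snd z i - fst z i)) \<partial>?LL)"
     using vm by (subst nn_integral_cmult) (auto intro!: borel_measurable_sum simp: nn_integral_sum)
    also have "\<dots> \<le> C0 * (\<Sum>is\<in>?N. 2 ^ card I * ennreal b * (\<integral>\<^sup>+x. V is x \<partial>?L))"
    proof (intro mult_left_mono sum_mono)
     fix "is" assume i: "is \<in> ?N"
     have "(\<integral>\<^sup>+z. indicator B (fst z) * indicator Q (snd z) * V is (\<lambda>i\<in>I. fst z i + s * (snd z i - fst z i)) \<partial>?LL) =
      (\<integral>\<^sup>+y. (\<integral>\<^sup>+x. indicator B y * indicator Q x * V is (\<lambda>i\<in>I. y i + s * (x i - y i)) \<partial>?L) \<partial>?L)"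
      using L.nn_integral_fst[OF vm[OF i], symmetric] by simp
     also have "\<dots> \<le> 2 ^ card I * ennreal b * (\<integral>\<^sup>+x. V is x \<partial>?L)"
      by (rule nn_integral_segments_le[OF I V[OF i] B Q _ mQ s]) (simp add: mB)
     finally show "(\<integral>\<^sup>+z. indicator B (fst z) * indicator Q (snd z) * V is (\<lambda>i\<in>I. fst z i + s * (snd z i - fst z i)) \<partial>?LL) \<le>
      2 ^ card I * ennreal b * (\<integral>\<^sup>+x. V is x \<partial>?L)" .
    qed simp
    finally show ?thesis using s by simp
   qed simp
  qed
  also have "\<dots> = C0 * (\<Sum>is\<in>?N. 2 ^ card I * ennreal b * (\<integral>\<^sup>+x. V is x \<partial>?L))"
   by (subst nn_integral_multc) auto
  also have "\<dots> = ennreal b * (2 ^ card I * C0 * (\<Sum>is\<in>?N. \<integral>\<^sup>+x. V is x \<partial>?L))"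
   by (simp add: sum_distrib_left mult_ac)
  finally have total: "(\<integral>\<^sup>+y. (\<integral>\<^sup>+x. G y x \<partial>?L) \<partial>?L) \<le> ennreal b * (2 ^ card I * C0 * (\<Sum>is\<in>?N. \<integral>\<^sup>+x. V is x \<partial>?L))" .
  have "\<exists>y\<in>B. (\<integral>\<^sup>+x. G y x \<partial>?L) \<le> 2 ^ card I * C0 * (\<Sum>is\<in>?N. \<integral>\<^sup>+x. V is x \<partial>?L)"
  proof (rule exists_le_average[OF _ B mB])
   show "(\<lambda>y. \<integral>\<^sup>+x. G y x \<partial>?L) \<in> borel_measurable ?L" by (rule L.borel_measurable_nn_integral[OF Gm])
   have "indicator B y * (\<integral>\<^sup>+x. G y x \<partial>?L) = (\<integral>\<^sup>+x. G y x \<partial>?L)" for y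
    by (cases "y \<in> B") (simp_all add: G_def)
   then show "(\<integral>\<^sup>+y. indicator B y * (\<integral>\<^sup>+x. G y x \<partial>?L) \<partial>?L) \<le> ennreal b * (2 ^ card I * C0 * (\<Sum>is\<in>?N. \<integral>\<^sup>+x. V is x \<partial>?L))"
    using total by simp
  qed
  then obtain y where y: "y \<in> B" "(\<integral>\<^sup>+x. G y x \<partial>?L) \<le> 2 ^ card I * C0 * (\<Sum>is\<in>?N. \<integral>\<^sup>+x. V is x \<partial>?L)" by blast
  have "(\<integral>\<^sup>+x. G y x \<partial>?L) = (\<integral>\<^sup>+x. indicator Q x * ennreal ((u x - taylor_sum I p g c y (\<lambda>i. x i - y i))\<^sup>2) \<partial>?L)"
  proof (rule nn_integral_cong)
   fix x
   show "G y x = indicator Q x * ennreal ((u x - taylor_sum I p g c y (\<lambda>i. x i - y i))\<^sup>2)"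
   proof (cases "x \<in> Q")
    case True
    have "taylor_sum I p (\<lambda>is. E (g is)) c y (\<lambda>i. x i - y i) = taylor_sum I p g c y (\<lambda>i. x i - y i)"
     by (rule taylor_sum_cong) (use BD[OF y(1)] in \<open>auto simp: E_def\<close>)
    moreover have "E u x = u x" using QS[OF True] SD by (auto simp: E_def)
    ultimately show ?thesis using y(1) True by (simp add: G_def)
   qed (simp add: G_def)
  qed
  with y show ?thesis unfolding C0_def Vg by (intro bexI[OF _ y(1)]) simp
 qed
qed

section \<open>The cone condition on Lipschitz domains\<close>

lemma abs_diff_le_eucl_dist: "finite I \<Longrightarrow> i \<in> I \<Longrightarrow> \<bar>x i - y i\<bar> \<le> eucl_dist I x y"
 unfolding eucl_dist_def using member_le_L2_set[of I i "\<lambda>i. \<bar>x i - y i\<bar>"]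
 by (simp add: L2_set_def)

lemma eucl_dist_le_card:
 assumes "\<And>i. i \<in> I \<Longrightarrow> \<bar>x i - y i\<bar> \<le> d"
 shows "eucl_dist I x y \<le> real (card I) * d"
proof -
 have "eucl_dist I x y \<le> (\<Sum>i\<in>I. \<bar>x i - y i\<bar>)" unfolding eucl_dist_def by (rule L2_set_le_sum_abs)
 also have "\<dots> \<le> (\<Sum>i\<in>I. d)" by (intro sum_mono assms)
 finally show ?thesis by simp
qed

lemma sup_open_if_openin:
 assumes I: "finite I" and D: "openin (eucl_top I) D"
 shows "sup_open I D"
 unfolding sup_open_def
proof
 show "D \<subseteq> (I \<rightarrow>\<^sub>E UNIV)" using openin_subset[OF D] by (simp add: eucl_top_def)
 show "\<forall>x\<in>D. \<exists>d>0. \<forall>y\<in>I \<rightarrow>\<^sub>E UNIV. (\<forall>i\<in>I. \<bar>y i - x i\<bar> < d) \<longrightarrow> y \<in> D"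
 proof
  fix x assume x: "x \<in> D"
  obtain U where U: "\<forall>i\<in>I. open (U i)" "x \<in> Pi\<^sub>E I U" "Pi\<^sub>E I U \<subseteq> D"
   using D x unfolding eucl_top_def openin_product_topology_alt by (force simp flip: open_openin)
  have "\<forall>i\<in>I. \<exists>d>0. \<forall>t. \<bar>t - x i\<bar> < d \<longrightarrow> t \<in> U i"
  proof
   fix i assume i: "i \<in> I"
   then have "open (U i)" "x i \<in> U i" using U by auto
   then show "\<exists>d>0. \<forall>t. \<bar>t - x i\<bar> < d \<longrightarrow> t \<in> U i" unfolding open_dist dist_real_def by blast
  qed
  from bchoice[OF this] obtain d where d: "\<forall>i\<in>I. d i > 0 \<and> (\<forall>t. \<bar>t - x i\<bar> < d i \<longrightarrow> t \<in> U i)"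
   by (elim exE) (rule that)
  define e where "e = Min (insert 1 (d ` I))"
  have "e > 0" unfolding e_def using I d by (subst Min_gr_iff) auto
  moreover have "e \<le> d i" if "i \<in> I" for i unfolding e_def by (rule Min_le) (use I that in auto)
  moreover have "y \<in> D" if y: "y \<in> I \<rightarrow>\<^sub>E UNIV" "\<forall>i\<in>I. \<bar>y i - x i\<bar> < e" for y
  proof (rule subsetD[OF U(3)])
   have "y i \<in> U i" if i: "i \<in> I" for i
    using d[rule_format, OF i] y(2)[rule_format, OF i] \<open>\<And>i. i \<in> I \<Longrightarrow> e \<le> d i\<close>[OF i] by auto
   then show "y \<in> Pi\<^sub>E I U" using y(1) by (auto simp: PiE_def)
  qed
  ultimately show "\<exists>d>0. \<forall>y\<in>I \<rightarrow>\<^sub>E UNIV. (\<forall>i\<in>I. \<bar>y i - x i\<bar> < d) \<longrightarrow> y \<in> D"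
   by (intro exI[of _ e] conjI ballI impI)
 qed
qed

text \<open>The uniform cone condition, with the same constants at all points.  The cone chosen at \<open>x\<close> also
 serves the points of \<open>D\<close> near \<open>x\<close>; hence a whole cell can be seen from one cube.\<close>
definition cone_condition :: "'i set \<Rightarrow> ('i \<Rightarrow> real) set \<Rightarrow> real \<Rightarrow> real \<Rightarrow> bool" where
 "cone_condition I D h0 c0 \<longleftrightarrow> (\<forall>x\<in>D. \<exists>e. (\<forall>i\<in>I. \<bar>e i\<bar> \<le> 1) \<and>
   (\<forall>x'\<in>D. (\<forall>i\<in>I. \<bar>x' i - x i\<bar> \<le> h0) \<longrightarrow>
    (\<forall>v t. (\<forall>i\<in>I. \<bar>v i - e i\<bar> \<le> c0) \<longrightarrow> 0 < t \<longrightarrow> t \<le> h0 \<longrightarrow> (\<lambda>i\<in>I. x' i + t * v i) \<in> D)))"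

text \<open>The local form of the condition.  The point \<open>p\<close> need not belong to \<open>D\<close>, because boundary points
 must be covered as well.\<close>
definition cone_near :: "'i set \<Rightarrow> ('i \<Rightarrow> real) set \<Rightarrow> ('i \<Rightarrow> real) \<Rightarrow> real \<Rightarrow> real \<Rightarrow> ('i \<Rightarrow> real) \<Rightarrow> bool" where
 "cone_near I D p r c e \<longleftrightarrow> (\<forall>i\<in>I. \<bar>e i\<bar> \<le> 1) \<and>
   (\<forall>x'\<in>D. (\<forall>i\<in>I. \<bar>x' i - p i\<bar> < r) \<longrightarrow>
    (\<forall>v t. (\<forall>i\<in>I. \<bar>v i - e i\<bar> \<le> c) \<longrightarrow> 0 < t \<longrightarrow> t \<le> r \<longrightarrow> (\<lambda>i\<in>I. x' i + t * v i) \<in> D))"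

lemma cone_near_interior:
 fixes D :: "('i \<Rightarrow> real) set"
 assumes op: "sup_open I D" and p: "p \<in> D"
 shows "\<exists>r>0. \<exists>c>0. \<exists>e. cone_near I D p r c e"
proof -
 obtain d where d: "d > 0" "\<forall>y\<in>I \<rightarrow>\<^sub>E UNIV. (\<forall>i\<in>I. \<bar>y i - p i\<bar> < d) \<longrightarrow> y \<in> D"
  using op p unfolding sup_open_def by blast
 have "cone_near I D p (d / 2) (1/2) (\<lambda>_. 0)"
  unfolding cone_near_def
 proof (intro conjI ballI allI impI)
  fix x' v :: "'i \<Rightarrow> real" and t :: real
  assume x': "\<forall>i\<in>I. \<bar>x' i - p i\<bar> < d / 2" and v: "\<forall>i\<in>I. \<bar>v i - 0\<bar> \<le> 1/2" and t: "0 < t" "t \<le> d / 2"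
  have "\<bar>(x' i + t * v i) - p i\<bar> < d" if i: "i \<in> I" for i
  proof -
   have "\<bar>t * v i\<bar> \<le> (d / 2) * (1/2)" unfolding abs_mult using t v i by (intro mult_mono) auto
   then show ?thesis using x'[rule_format, OF i] d(1) by linarith
  qed
  then show "(\<lambda>i\<in>I. x' i + t * v i) \<in> D" using d(2) by (auto simp: PiE_def)
 qed simp
 then show ?thesis using d(1) by (intro exI[of _ "d / 2"] exI[of _ "1/2"] exI conjI) auto
qed

text \<open>A step of length \<open>t\<close> in a direction close to \<open>e\<close> raises the height over the hyperplane by nearly
 \<open>t\<close>, while the graph function changes only by a small multiple of \<open>t\<close>.\<close>
lemma cone_near_lipschitz_graph:
 assumes I: "finite I" and DX: "D \<subseteq> (I \<rightarrow>\<^sub>E UNIV)" and lg: "lipschitz_graph_near I D p"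
 shows "\<exists>r>0. \<exists>c>0. \<exists>e. cone_near I D p r c e"
proof -
 obtain \<rho> e \<gamma> L where \<rho>: "\<rho> > 0" and eX: "e \<in> I \<rightarrow>\<^sub>E UNIV" and ee: "eucl_inner I e e = 1"
  and lip: "\<forall>y \<in> I \<rightarrow>\<^sub>E UNIV. \<forall>z \<in> I \<rightarrow>\<^sub>E UNIV. eucl_inner I y e = 0 \<longrightarrow> eucl_inner I z e = 0 \<longrightarrow>
      \<bar>\<gamma> y - \<gamma> z\<bar> \<le> L * eucl_dist I y z"
  and gr: "\<forall>x \<in> I \<rightarrow>\<^sub>E UNIV. eucl_dist I x p < \<rho> \<longrightarrow>
      (x \<in> D \<longleftrightarrow> \<gamma> (\<lambda>i\<in>I. x i - eucl_inner I x e * e i) < eucl_inner I x e)"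
  using lg unfolding lipschitz_graph_near_def by (elim exE bexE conjE) (rule that)
 define N where "N = real (card I)"
 define K where "K = \<bar>L\<bar>"
 (* With this c the change of the graph function, at most K * N * (N + 1) * c * t, is smaller than the
   gain in height, at least (1 - N * c) * t. *)
 define c where "c = 1 / (2 * (N + 1)\<^sup>2 * (K + 1))"
 define r where "r = \<rho> / (3 * N + 1)"
 have N0: "N \<ge> 0" and K0: "K \<ge> 0" by (simp_all add: N_def K_def)
 have r: "r > 0" "3 * N * r < \<rho>" using \<rho> N0 by (simp_all add: r_def field_simps)
 have c: "c > 0" using N0 K0 by (simp add: c_def)
 have cN: "N * (N + 1) * c * K + N * c < 1"
 proof -
  have "(N + 1)\<^sup>2 * (K + 1) > 0" using N0 K0 by simp
  moreover have "M * (1 / (2 * M)) = 1/2" if "M > 0" for M :: real using that by simp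
  ultimately have "((N + 1)\<^sup>2 * (K + 1)) * (1 / (2 * ((N + 1)\<^sup>2 * (K + 1)))) = 1/2" by blast
  then have a: "(N + 1)\<^sup>2 * (K + 1) * c = 1/2" by (simp only: c_def mult.assoc)
  have "N * (N + 1) * c * K + N * c \<le> (N + 1)\<^sup>2 * c * K + (N + 1)\<^sup>2 * c"
   using N0 K0 c by (intro add_mono mult_right_mono) (auto simp: power2_eq_square algebra_simps)
  also have "\<dots> = (N + 1)\<^sup>2 * (K + 1) * c" by (simp add: algebra_simps)
  finally show ?thesis using a by simp
 qed
 have c1: "c \<le> 1"
 proof -
  have "1 * 1 \<le> (N + 1)\<^sup>2 * (K + 1)" using N0 K0 by (intro mult_mono) (auto simp: power2_eq_square algebra_simps)
  then show ?thesis unfolding c_def mult.assoc by (intro divide_le_eq_1_pos[THEN iffD2]) auto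
 qed
 have e1: "\<bar>e i\<bar> \<le> 1" if i: "i \<in> I" for i
 proof -
  have "e i * e i \<le> eucl_inner I e e" unfolding eucl_inner_def using i I by (intro member_le_sum) auto
  then have "(e i)\<^sup>2 \<le> 1\<^sup>2" using ee by (simp add: power2_eq_square)
  then show ?thesis using abs_le_square_iff[of "e i" 1] by simp
 qed
 have inner_restrict: "eucl_inner I (\<lambda>i\<in>I. f i) g = eucl_inner I f g" for f g
  unfolding eucl_inner_def by (rule sum.cong) auto
 have "cone_near I D p r c e"
  unfolding cone_near_def
 proof (intro conjI ballI allI impI)
  show "\<bar>e i\<bar> \<le> 1" if "i \<in> I" for i by (rule e1[OF that])
  fix x' v and t :: real
  assume xD: "x' \<in> D" and x': "\<forall>i\<in>I. \<bar>x' i - p i\<bar> < r" and v: "\<forall>i\<in>I. \<bar>v i - e i\<bar> \<le> c" and t: "0 < t" "t \<le> r"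
  define w where "w i = v i - e i" for i
  define z where "z = (\<lambda>i\<in>I. x' i + t * v i)"
  define a where "a = eucl_inner I w e"
  have zX: "z \<in> I \<rightarrow>\<^sub>E UNIV" by (simp add: z_def)
  have xX: "x' \<in> I \<rightarrow>\<^sub>E UNIV" using xD DX by blast
  have wc: "\<bar>w i\<bar> \<le> c" if "i \<in> I" for i using v that by (simp add: w_def)
  have a_le: "\<bar>a\<bar> \<le> N * c"
  proof -
   have "\<bar>a\<bar> \<le> (\<Sum>i\<in>I. \<bar>w i * e i\<bar>)" unfolding a_def eucl_inner_def by (rule sum_abs)
   also have "\<dots> \<le> (\<Sum>i\<in>I. c * 1)" unfolding abs_mult using wc e1 c by (intro sum_mono mult_mono) auto
   finally show ?thesis by (simp add: N_def)
  qed
  have ve: "eucl_inner I v e = 1 + a"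
  proof -
   have "eucl_inner I v e = (\<Sum>i\<in>I. e i * e i + w i * e i)" unfolding eucl_inner_def w_def by (simp add: algebra_simps)
   then show ?thesis using ee by (simp add: sum.distrib a_def eucl_inner_def)
  qed
  have ze: "eucl_inner I z e = eucl_inner I x' e + t * (1 + a)"
  proof -
   have "eucl_inner I z e = (\<Sum>i\<in>I. x' i * e i + t * (v i * e i))"
    unfolding z_def inner_restrict eucl_inner_def by (simp add: algebra_simps)
   also have "\<dots> = eucl_inner I x' e + t * eucl_inner I v e"
    by (simp add: eucl_inner_def sum.distrib sum_distrib_left)
   finally show ?thesis by (simp add: ve)
  qed
  define P where "P x = (\<lambda>i\<in>I. x i - eucl_inner I x e * e i)" for x
  have Pe: "eucl_inner I (P x) e = 0" for x
  proof -
   have "eucl_inner I (P x) e = (\<Sum>i\<in>I. x i * e i - eucl_inner I x e * (e i * e i))"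
    unfolding P_def inner_restrict by (simp add: eucl_inner_def algebra_simps)
   also have "\<dots> = eucl_inner I x e - eucl_inner I x e * eucl_inner I e e"
    by (simp add: eucl_inner_def sum_subtractf sum_distrib_left)
   finally show ?thesis using ee by simp
  qed
  have Pd: "eucl_dist I (P z) (P x') \<le> N * (t * ((N + 1) * c))"
   unfolding N_def
  proof (rule eucl_dist_le_card)
   fix i assume i: "i \<in> I"
   have "P z i - P x' i = t * (w i - a * e i)"
    using i unfolding P_def ze by (simp add: z_def w_def algebra_simps)
   then have "\<bar>P z i - P x' i\<bar> = t * \<bar>w i - a * e i\<bar>"
    using t(1) by (simp add: abs_mult)
   moreover have "\<bar>w i - a * e i\<bar> \<le> (N + 1) * c"
   proof -
    have "\<bar>a * e i\<bar> \<le> N * c * 1" unfolding abs_mult using a_le e1[OF i] by (intro mult_mono) auto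
    then show ?thesis using wc[OF i] by (simp add: algebra_simps)
   qed
   ultimately show "\<bar>P z i - P x' i\<bar> \<le> t * ((real (card I) + 1) * c)"
    using t(1) by (simp add: N_def)
  qed
  have gz: "\<gamma> (P z) \<le> \<gamma> (P x') + K * (N * (t * ((N + 1) * c)))"
  proof -
   have "\<bar>\<gamma> (P z) - \<gamma> (P x')\<bar> \<le> L * eucl_dist I (P z) (P x')"
    using lip Pe by (auto simp: P_def)
   also have "\<dots> \<le> K * eucl_dist I (P z) (P x')"
    unfolding K_def by (intro mult_right_mono) (auto simp: eucl_dist_def L2_set_nonneg)
   also have "\<dots> \<le> K * (N * (t * ((N + 1) * c)))" by (rule mult_left_mono[OF Pd K0])
   finally show ?thesis by linarith
  qed
  have xp: "eucl_dist I x' p < \<rho>"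
  proof -
   have "eucl_dist I x' p \<le> N * r" unfolding N_def using x' by (intro eucl_dist_le_card) (simp add: less_imp_le)
   also have "\<dots> \<le> 3 * N * r" using N0 r(1) by simp
   finally show ?thesis using r(2) by simp
  qed
  have zp: "eucl_dist I z p < \<rho>"
  proof -
   have "eucl_dist I z p \<le> N * (3 * r)"
    unfolding N_def
   proof (rule eucl_dist_le_card)
    fix i assume i: "i \<in> I"
    have "\<bar>v i\<bar> \<le> 2" using v[rule_format, OF i] e1[OF i] c1 by linarith
    then have "\<bar>t * v i\<bar> \<le> r * 2" unfolding abs_mult using t by (intro mult_mono) auto
    then show "\<bar>z i - p i\<bar> \<le> 3 * r" using x'[rule_format, OF i] i by (simp add: z_def)
   qed
   then show ?thesis using r(2) by (simp add: mult.left_commute)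
  qed
  have gx: "\<gamma> (P x') < eucl_inner I x' e" using gr xX xp xD unfolding P_def by blast
  have "K * (N * (t * ((N + 1) * c))) \<le> t * (1 + a)"
  proof -
   have "t * (N * (N + 1) * c * K + N * c) \<le> t * 1" using cN t by (intro mult_left_mono) auto
   moreover have "t * (1 + a) \<ge> t * (1 - N * c)" using a_le t by (intro mult_left_mono) auto
   ultimately show ?thesis by (simp add: algebra_simps)
  qed
  then have "\<gamma> (P z) < eucl_inner I z e" using gz gx ze by linarith
  then have "z \<in> D" using gr zX zp unfolding P_def by blast
  then show "(\<lambda>i\<in>I. x' i + t * v i) \<in> D" by (simp add: z_def)
 qed
 then show ?thesis using r(1) c by (intro exI[of _ r] exI[of _ c] exI[of _ e] conjI)
qed

lemma bounded_lipschitz_domain_bounded: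
 assumes I: "finite I" and D: "bounded_lipschitz_domain I D"
 shows "\<exists>R>0. \<forall>x\<in>D. \<forall>i\<in>I. \<bar>x i\<bar> \<le> R"
proof -
 obtain R x0 where R: "\<forall>x\<in>D. \<forall>y\<in>D. eucl_dist I x y \<le> R" and x0: "x0 \<in> D"
  using D unfolding bounded_lipschitz_domain_def by blast
 have "\<bar>x i\<bar> \<le> \<bar>R\<bar> + 1 + (\<Sum>i\<in>I. \<bar>x0 i\<bar>)" if "x \<in> D" "i \<in> I" for x i
 proof -
  have "\<bar>x i - x0 i\<bar> \<le> R" using abs_diff_le_eucl_dist[OF I that(2), of x x0] R that(1) x0 by force
  moreover have "\<bar>x0 i\<bar> \<le> (\<Sum>i\<in>I. \<bar>x0 i\<bar>)" by (rule member_le_sum) (use that I in auto)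
  ultimately show ?thesis by linarith
 qed
 moreover have "(\<bar>R\<bar> + 1) + (\<Sum>i\<in>I. \<bar>x0 i\<bar>) > 0"
  by (rule add_pos_nonneg) (simp, simp add: sum_nonneg)
 ultimately show ?thesis by blast
qed

text \<open>Compactness of the closure makes the local cones uniform.\<close>
theorem cone_condition_lipschitz_domain:
 assumes I: "finite I" and D: "bounded_lipschitz_domain I D"
 shows "\<exists>h0>0. \<exists>c0>0. cone_condition I D h0 c0"
proof -
 have opn: "openin (eucl_top I) D" and ne: "D \<noteq> {}"
  and fr: "\<forall>p \<in> eucl_top I frontier_of D. lipschitz_graph_near I D p"
  using D unfolding bounded_lipschitz_domain_def by auto
 have op: "sup_open I D" by (rule sup_open_if_openin[OF I opn])
 have DX: "D \<subseteq> (I \<rightarrow>\<^sub>E UNIV)" using op by (simp add: sup_open_def)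
 obtain R where R: "\<forall>x\<in>D. \<forall>i\<in>I. \<bar>x i\<bar> \<le> R" using bounded_lipschitz_domain_bounded[OF I D] by blast
 define C where "C = eucl_top I closure_of D"
 have DC: "D \<subseteq> C" unfolding C_def using DX by (intro closure_of_subset) (simp add: eucl_top_def)
 have "compactin (eucl_top I) C"
 proof (rule closed_compactin)
  show "compactin (eucl_top I) (PiE I (\<lambda>_. {-R..R}))"
   unfolding eucl_top_def by (auto simp: compactin_PiE)
  show "closedin (eucl_top I) C" unfolding C_def by simp
  show "C \<subseteq> PiE I (\<lambda>_. {-R..R})"
   unfolding C_def
  proof (rule closure_of_minimal)
   show "D \<subseteq> PiE I (\<lambda>_. {-R..R})"
   proof
    fix x assume x: "x \<in> D"
    have "x i \<in> {-R..R}" if "i \<in> I" for i using R x that by (auto simp: abs_le_iff) (smt (verit))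
    then show "x \<in> PiE I (\<lambda>_. {-R..R})" using x DX by (auto simp: PiE_def)
   qed
   show "closedin (eucl_top I) (PiE I (\<lambda>_. {-R..R}))"
    unfolding eucl_top_def by (simp add: closedin_product_topology)
  qed
 qed
 have loc: "\<forall>p\<in>C. \<exists>q. fst q > 0 \<and> fst (snd q) > 0 \<and> cone_near I D p (fst q) (fst (snd q)) (snd (snd q))"
 proof
  fix p assume p: "p \<in> C"
  have "\<exists>r>0. \<exists>c>0. \<exists>e. cone_near I D p r c e"
  proof (cases "p \<in> D")
   case True
   then show ?thesis by (rule cone_near_interior[OF op])
  next
   case False
   then have "p \<in> eucl_top I frontier_of D"
    using p opn unfolding C_def by (simp add: frontier_of_def interior_of_openin)
   then show ?thesis using fr cone_near_lipschitz_graph[OF I DX] by blast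
  qed
  then obtain r c e where "r > 0" "c > 0" "cone_near I D p r c e" by blast
  then show "\<exists>q. fst q > 0 \<and> fst (snd q) > 0 \<and> cone_near I D p (fst q) (fst (snd q)) (snd (snd q))"
   by (intro exI[of _ "(r, c, e)"]) simp
 qed
 from bchoice[OF loc] obtain q where q: "\<forall>p\<in>C. fst (q p) > 0 \<and> fst (snd (q p)) > 0 \<and> cone_near I D p (fst (q p)) (fst (snd (q p))) (snd (snd (q p)))"
  by (elim exE) (rule that)
 define U where "U p = PiE I (\<lambda>i. {p i - fst (q p) / 2<..<p i + fst (q p) / 2})" for p
 have Uo: "openin (eucl_top I) (U p)" for p
  unfolding U_def eucl_top_def using I by (subst openin_PiE) auto
 have CX: "C \<subseteq> (I \<rightarrow>\<^sub>E UNIV)" unfolding C_def using closure_of_subset_topspace[of "eucl_top I" D] by (simp add: eucl_top_def)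
 have pU: "p \<in> U p" if "p \<in> C" for p
  using that CX q by (auto simp: U_def PiE_def)
 obtain F where F: "finite F" "F \<subseteq> U ` C" "C \<subseteq> \<Union>F"
 proof -
  have "\<exists>F. finite F \<and> F \<subseteq> U ` C \<and> C \<subseteq> \<Union>F"
  proof (rule compactinD[OF \<open>compactin (eucl_top I) C\<close>])
   show "openin (eucl_top I) V" if "V \<in> U ` C" for V using that Uo by auto
   show "C \<subseteq> \<Union>(U ` C)" using pU by blast
  qed
  then show ?thesis using that by blast
 qed
 obtain G where G: "finite G" "G \<subseteq> C" "F = U ` G" using finite_subset_image[OF F(1,2)] by blast
 have Gne: "G \<noteq> {}" using F(3) G DC ne by auto
 define h0 where "h0 = Min ((\<lambda>p. fst (q p) / 2) ` G)"
 define c0 where "c0 = Min ((\<lambda>p. fst (snd (q p))) ` G)"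
 have h0: "h0 \<le> fst (q p) / 2" if "p \<in> G" for p unfolding h0_def by (rule Min_le) (use that G in auto)
 have c0: "c0 \<le> fst (snd (q p))" if "p \<in> G" for p unfolding c0_def by (rule Min_le) (use that G in auto)
 have "h0 > 0" unfolding h0_def using G Gne q by (subst Min_gr_iff) auto
 moreover have "c0 > 0" unfolding c0_def using G Gne q by (subst Min_gr_iff) auto
 moreover have "cone_condition I D h0 c0"
  unfolding cone_condition_def
 proof
  fix x assume x: "x \<in> D"
  then obtain p where p: "p \<in> G" "x \<in> U p" using F(3) G(3) DC by auto
  have pC: "p \<in> C" using p(1) G(2) by blast
  have xp: "\<bar>x i - p i\<bar> < fst (q p) / 2" if "i \<in> I" for i
   using PiE_mem[OF p(2)[unfolded U_def] that] by (intro abs_diff_less_iff[THEN iffD2]) simp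
  have cn: "cone_near I D p (fst (q p)) (fst (snd (q p))) (snd (snd (q p)))" and qp: "fst (q p) > 0" using q pC by auto
  let ?e = "snd (snd (q p))"
  show "\<exists>e. (\<forall>i\<in>I. \<bar>e i\<bar> \<le> 1) \<and> (\<forall>x'\<in>D. (\<forall>i\<in>I. \<bar>x' i - x i\<bar> \<le> h0) \<longrightarrow>
    (\<forall>v t. (\<forall>i\<in>I. \<bar>v i - e i\<bar> \<le> c0) \<longrightarrow> 0 < t \<longrightarrow> t \<le> h0 \<longrightarrow> (\<lambda>i\<in>I. x' i + t * v i) \<in> D))"
  proof (intro exI[of _ ?e] conjI ballI allI impI)
   show "\<bar>?e i\<bar> \<le> 1" if "i \<in> I" for i using cn that unfolding cone_near_def by blast
   fix x' v and t :: real
   assume x': "x' \<in> D" "\<forall>i\<in>I. \<bar>x' i - x i\<bar> \<le> h0" and v: "\<forall>i\<in>I. \<bar>v i - ?e i\<bar> \<le> c0" and t: "0 < t" "t \<le> h0"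
   have 1: "\<forall>i\<in>I. \<bar>x' i - p i\<bar> < fst (q p)"
   proof
    fix i assume i: "i \<in> I"
    show "\<bar>x' i - p i\<bar> < fst (q p)" using x'(2)[rule_format, OF i] xp[OF i] h0[OF p(1)] by linarith
   qed
   have 2: "\<forall>i\<in>I. \<bar>v i - ?e i\<bar> \<le> fst (snd (q p))" using v c0[OF p(1)] by force
   have 3: "t \<le> fst (q p)" using t(2) h0[OF p(1)] qp by linarith
   show "(\<lambda>i\<in>I. x' i + t * v i) \<in> D"
    using cn x'(1) 1 2 t(1) 3 unfolding cone_near_def by blast
  qed
 qed
 ultimately show ?thesis by blast
qed

lemma cone_condition_mono:
 assumes "cone_condition I D h0 c0" "h1 \<le> h0" "c1 \<le> c0"
 shows "cone_condition I D h1 c1"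
 unfolding cone_condition_def
proof
 fix x assume "x \<in> D"
 then obtain e where e: "\<forall>i\<in>I. \<bar>e i\<bar> \<le> 1" "\<forall>x'\<in>D. (\<forall>i\<in>I. \<bar>x' i - x i\<bar> \<le> h0) \<longrightarrow>
    (\<forall>v t. (\<forall>i\<in>I. \<bar>v i - e i\<bar> \<le> c0) \<longrightarrow> 0 < t \<longrightarrow> t \<le> h0 \<longrightarrow> (\<lambda>i\<in>I. x' i + t * v i) \<in> D)"
  using assms(1) unfolding cone_condition_def by blast
 show "\<exists>e. (\<forall>i\<in>I. \<bar>e i\<bar> \<le> 1) \<and> (\<forall>x'\<in>D. (\<forall>i\<in>I. \<bar>x' i - x i\<bar> \<le> h1) \<longrightarrow>
    (\<forall>v t. (\<forall>i\<in>I. \<bar>v i - e i\<bar> \<le> c1) \<longrightarrow> 0 < t \<longrightarrow> t \<le> h1 \<longrightarrow> (\<lambda>i\<in>I. x' i + t * v i) \<in> D))"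
  using e assms(2,3) by (intro exI[of _ e] conjI) (blast, meson order_trans)
qed

section \<open>Piecewise polynomial approximation on a grid\<close>

definition monomial :: "'i set \<Rightarrow> ('i \<Rightarrow> nat) \<Rightarrow> ('i \<Rightarrow> real) \<Rightarrow> real" where
 "monomial I a x = (\<Prod>i\<in>I. x i ^ a i)"

text \<open>The degree is bounded in each variable separately, so that every monomial is a product of functions
 of one variable chosen from \<open>d + 1\<close> powers.\<close>
definition is_poly :: "'i set \<Rightarrow> nat \<Rightarrow> (('i \<Rightarrow> real) \<Rightarrow> real) \<Rightarrow> bool" where
 "is_poly I d f \<longleftrightarrow> (\<exists>A. \<forall>x. f x = (\<Sum>a\<in>PiE I (\<lambda>_. {..d}). A a * monomial I a x))"

lemma is_polyI_subset:
 assumes I: "finite I" and S: "S \<subseteq> PiE I (\<lambda>_. {..d})"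
  and f: "\<And>x. f x = (\<Sum>a\<in>S. A a * monomial I a x)"
 shows "is_poly I d f"
 unfolding is_poly_def
proof (intro exI[of _ "\<lambda>a. if a \<in> S then A a else 0"] allI)
 fix x
 have "finite (PiE I (\<lambda>_. {..d}))" by (rule finite_PiE[OF I]) simp
 then show "f x = (\<Sum>a\<in>PiE I (\<lambda>_. {..d}). (if a \<in> S then A a else 0) * monomial I a x)"
  unfolding f by (rule sum.mono_neutral_cong_left) (use S in auto)
qed

lemma is_poly_mono:
 assumes I: "finite I" and f: "is_poly I d f" and "d \<le> d'"
 shows "is_poly I d' f"
proof -
 obtain A where A: "\<forall>x. f x = (\<Sum>a\<in>PiE I (\<lambda>_. {..d}). A a * monomial I a x)"
  using f unfolding is_poly_def by (elim exE) (rule that)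
 show ?thesis
  by (rule is_polyI_subset[OF I _ A[rule_format]]) (use \<open>d \<le> d'\<close> in \<open>auto intro!: PiE_mono\<close>)
qed

lemma is_poly_const:
 assumes I: "finite I"
 shows "is_poly I d (\<lambda>_. c)"
proof -
 have "c = (\<Sum>a\<in>{\<lambda>i\<in>I. 0}. c * monomial I a x)" for x by (simp add: monomial_def)
 then show ?thesis by (rule is_polyI_subset[OF I, rotated]) auto
qed

lemma is_poly_add:
 assumes "is_poly I d f" "is_poly I d g"
 shows "is_poly I d (\<lambda>x. f x + g x)"
proof -
 obtain A A' where A: "\<forall>x. f x = (\<Sum>a\<in>PiE I (\<lambda>_. {..d}). A a * monomial I a x)"
  "\<forall>x. g x = (\<Sum>a\<in>PiE I (\<lambda>_. {..d}). A' a * monomial I a x)"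
  using assms unfolding is_poly_def by (elim exE) (rule that)
 show ?thesis unfolding is_poly_def
  by (intro exI[of _ "\<lambda>a. A a + A' a"] allI) (simp add: A sum.distrib[symmetric] distrib_right)
qed

lemma is_poly_cmult:
 assumes "is_poly I d f"
 shows "is_poly I d (\<lambda>x. c * f x)"
proof -
 obtain A where A: "\<forall>x. f x = (\<Sum>a\<in>PiE I (\<lambda>_. {..d}). A a * monomial I a x)"
  using assms unfolding is_poly_def by (elim exE) (rule that)
 show ?thesis unfolding is_poly_def
  by (intro exI[of _ "\<lambda>a. c * A a"] allI) (simp add: A sum_distrib_left mult.assoc)
qed

lemma is_poly_sum:
 assumes I: "finite I" and "\<And>s. s \<in> S \<Longrightarrow> is_poly I d (f s)"
 shows "is_poly I d (\<lambda>x. \<Sum>s\<in>S. f s x)"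
 using assms(2)
 by (induction S rule: infinite_finite_induct) (auto intro: is_poly_add is_poly_const[OF I])

lemma is_poly_mult_var:
 assumes I: "finite I" and j: "j \<in> I" and f: "is_poly I d f"
 shows "is_poly I (Suc d) (\<lambda>x. x j * f x)"
proof -
 obtain A where A: "\<forall>x. f x = (\<Sum>a\<in>PiE I (\<lambda>_. {..d}). A a * monomial I a x)"
  using f unfolding is_poly_def by (elim exE) (rule that)
 define s where "s a = a(j := Suc (a j))" for a :: "'a \<Rightarrow> nat"
 define s' where "s' a = a(j := a j - 1)" for a :: "'a \<Rightarrow> nat"
 have s's: "s' (s a) = a" for a by (simp add: s_def s'_def)
 have inj: "inj_on s (PiE I (\<lambda>_. {..d}))" by (metis inj_onI s's)
 have mon: "monomial I (s a) x = x j * monomial I a x" for a x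
 proof -
  have "monomial I (s a) x = x j ^ Suc (a j) * (\<Prod>i\<in>I - {j}. x i ^ s a i)"
   unfolding monomial_def by (subst prod.remove[OF I j]) (simp add: s_def)
  also have "(\<Prod>i\<in>I - {j}. x i ^ s a i) = (\<Prod>i\<in>I - {j}. x i ^ a i)"
   by (rule prod.cong) (auto simp: s_def)
  finally show ?thesis unfolding monomial_def by (subst prod.remove[OF I j]) simp
 qed
 show ?thesis
 proof (rule is_polyI_subset[OF I])
  show "s ` PiE I (\<lambda>_. {..d}) \<subseteq> PiE I (\<lambda>_. {..Suc d})"
   using j by (auto simp: s_def PiE_def extensional_def Pi_def le_SucI)
  fix x
  have "(\<Sum>b\<in>s ` PiE I (\<lambda>_. {..d}). A (s' b) * monomial I b x) = (\<Sum>a\<in>PiE I (\<lambda>_. {..d}). A a * (x j * monomial I a x))"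
   by (subst sum.reindex[OF inj]) (simp add: s's mon)
  then show "x j * f x = (\<Sum>b\<in>s ` PiE I (\<lambda>_. {..d}). A (s' b) * monomial I b x)"
   by (simp add: A sum_distrib_left mult.left_commute)
 qed
qed

lemma is_poly_list_power:
 assumes I: "finite I" and "set is \<subseteq> I"
 shows "is_poly I (length is) (\<lambda>x. list_power (\<lambda>i. x i - y i) is)"
 using assms(2)
proof (induction "is")
 case Nil
 then show ?case by (simp add: is_poly_const[OF I])
next
 case (Cons i js)
 then have f: "is_poly I (length js) (\<lambda>x. list_power (\<lambda>i. x i - y i) js)" and i: "i \<in> I" by auto
 have "is_poly I (Suc (length js)) (\<lambda>x. x i * list_power (\<lambda>i. x i - y i) js + (- y i) * list_power (\<lambda>i. x i - y i) js)"
  by (intro is_poly_add is_poly_mult_var[OF I i f] is_poly_cmult is_poly_mono[OF I f]) simp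
 then show ?case by (simp add: left_diff_distrib)
qed

lemma is_poly_taylor_sum:
 assumes I: "finite I"
 shows "is_poly I p (\<lambda>x. taylor_sum I p g c y (\<lambda>i. x i - y i))"
proof -
 have l: "is_poly I p (\<lambda>x. list_power (\<lambda>i. x i - y i) is * v)" if i: "is \<in> index_lists I k" "k \<le> p" for "is" k v
 proof -
  have "is_poly I p (\<lambda>x. list_power (\<lambda>i. x i - y i) is)"
   by (rule is_poly_mono[OF I is_poly_list_power[OF I]]) (use i in \<open>auto simp: index_lists_def\<close>)
  from is_poly_cmult[OF this, of v] show ?thesis by (simp add: mult.commute)
 qed
 show ?thesis unfolding taylor_sum_def
  by (intro is_poly_add is_poly_sum[OF I] is_poly_cmult l; assumption?) auto
qed

text \<open>An open set is a countable union of boxes with rational corners.\<close>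
lemma sup_open_sets:
 fixes D :: "('i \<Rightarrow> real) set"
 assumes I: "finite I" and D: "sup_open I D"
 shows "D \<in> sets (leb I)"
proof -
 define rats where "rats = {(a, b). a \<in> PiE I (\<lambda>_. \<rat>) \<and> b \<in> PiE I (\<lambda>_. \<rat>) \<and> open_box I a b \<subseteq> D}"
 have "rats \<subseteq> PiE I (\<lambda>_. \<rat>) \<times> PiE I (\<lambda>_. \<rat>)" by (auto simp: rats_def)
 moreover have "countable (PiE I (\<lambda>_. \<rat> :: real set))" by (rule countable_PiE[OF I]) (rule countable_rat)
 ultimately have cr: "countable rats" by (meson countable_SIGMA countable_subset)
 have "D = (\<Union>ab\<in>rats. open_box I (fst ab) (snd ab))"
 proof
  show "(\<Union>ab\<in>rats. open_box I (fst ab) (snd ab)) \<subseteq> D" by (auto simp: rats_def)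
  show "D \<subseteq> (\<Union>ab\<in>rats. open_box I (fst ab) (snd ab))"
  proof
   fix x assume x: "x \<in> D"
   obtain d where d: "d > 0" "\<forall>y\<in>I \<rightarrow>\<^sub>E UNIV. (\<forall>i\<in>I. \<bar>y i - x i\<bar> < d) \<longrightarrow> y \<in> D"
    using D x unfolding sup_open_def by blast
   have "\<forall>i. \<exists>r\<in>\<rat>. x i - d < r \<and> r < x i" using d(1) by (intro allI Rats_dense_in_real) simp
   then obtain a0 where a0: "\<forall>i. a0 i \<in> \<rat> \<and> x i - d < a0 i \<and> a0 i < x i" by metis
   have "\<forall>i. \<exists>r\<in>\<rat>. x i < r \<and> r < x i + d" using d(1) by (intro allI Rats_dense_in_real) simp
   then obtain b0 where b0: "\<forall>i. b0 i \<in> \<rat> \<and> x i < b0 i \<and> b0 i < x i + d" by metis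
   define a b where "a = restrict a0 I" and "b = restrict b0 I"
   have "open_box I a b \<subseteq> D"
   proof
    fix y assume y: "y \<in> open_box I a b"
    have "\<bar>y i - x i\<bar> < d" if "i \<in> I" for i
     using PiE_mem[OF y[unfolded open_box_def] that] a0[rule_format, of i] b0[rule_format, of i] that by (auto simp: a_def b_def)
    then show "y \<in> D" using d(2) y by (auto simp: open_box_def PiE_def)
   qed
   then have "(a, b) \<in> rats" using a0 b0 by (auto simp: rats_def a_def b_def)
   moreover have "x \<in> open_box I a b"
    using x D a0 b0 by (auto simp: open_box_def sup_open_def PiE_def a_def b_def)
   ultimately show "x \<in> (\<Union>ab\<in>rats. open_box I (fst ab) (snd ab))" by force
  qed
 qed
 then show ?thesis using open_box_sets[OF I] by (simp only:) (intro sets.countable_UN' cr, auto)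
qed

text \<open>One cell of the grid: the cone at a point \<open>x0\<close> of the cell \<open>Q\<close> provides a cube \<open>B\<close> of
 comparable size from which all of \<open>Q\<close> is visible inside \<open>D\<close>.\<close>
lemma cell_approximation:
 fixes D :: "('i \<Rightarrow> real) set" and g :: "'i list \<Rightarrow> ('i \<Rightarrow> real) \<Rightarrow> real"
 assumes I: "finite I" and op: "sup_open I D" and cone: "cone_condition I D h0 c0"
  and c0: "0 < c0" "c0 \<le> 1" and h: "0 < h" "h \<le> h0"
  and u: "integrable (dom_measure I D) u"
  and g: "\<forall>is. set is \<subseteq> I \<longrightarrow> length is \<le> p \<longrightarrow> integrable (dom_measure I D) (g is) \<and> weak_deriv I D is u (g is)"
  and Q: "Q \<in> sets (leb I)" "Q \<subseteq> D" and x0: "x0 \<in> Q"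
  and dQ: "\<forall>x\<in>Q. \<forall>i\<in>I. \<bar>x i - x0 i\<bar> \<le> h * c0 / 2"
  and mQ: "emeasure (leb I) Q \<le> ennreal ((h * c0) ^ card I)"
 defines "S \<equiv> {x \<in> D. \<forall>i\<in>I. \<bar>x i - x0 i\<bar> \<le> 4 * h}"
 shows "\<exists>B. B \<in> sets (leb I) \<and> B \<subseteq> S \<and> emeasure (leb I) B = ennreal ((h * c0) ^ card I) \<and>
  (\<forall>c. \<exists>y\<in>B. (\<integral>\<^sup>+x. indicator Q x * ennreal ((u x - taylor_sum I p g c y (\<lambda>i. x i - y i))\<^sup>2) \<partial>leb I) \<le>
   2 ^ card I * ennreal (real (card (index_lists I p)) * (2 * h) ^ (2 * p)) *
    (\<Sum>is\<in>index_lists I p. \<integral>\<^sup>+x. indicator S x * ennreal ((g is x - c is)\<^sup>2) \<partial>leb I))"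
proof -
 interpret LI: finite_product_sigma_finite "\<lambda>_. lborel" I by standard (rule I)
 have Ds: "D \<in> sets (leb I)" by (rule sup_open_sets[OF I op])
 have DX: "D \<subseteq> (I \<rightarrow>\<^sub>E UNIV)" using op by (simp add: sup_open_def)
 have x0D: "x0 \<in> D" using x0 Q by blast
 obtain e where e: "\<forall>i\<in>I. \<bar>e i\<bar> \<le> 1" "\<forall>x'\<in>D. (\<forall>i\<in>I. \<bar>x' i - x0 i\<bar> \<le> h0) \<longrightarrow>
    (\<forall>v t. (\<forall>i\<in>I. \<bar>v i - e i\<bar> \<le> c0) \<longrightarrow> 0 < t \<longrightarrow> t \<le> h0 \<longrightarrow> (\<lambda>i\<in>I. x' i + t * v i) \<in> D)"
  using cone x0D unfolding cone_condition_def by blast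
 define B where "B = PiE I (\<lambda>i. {x0 i + h * e i - h * c0 / 2<..<x0 i + h * e i + h * c0 / 2})"
 have Bs: "B \<in> sets (leb I)" unfolding B_def by (rule sets_PiM_I_finite[OF I]) simp
 have mB: "emeasure (leb I) B = ennreal ((h * c0) ^ card I)"
 proof -
  have "emeasure (leb I) B = (\<Prod>i\<in>I. emeasure lborel {x0 i + h * e i - h * c0 / 2<..<x0 i + h * e i + h * c0 / 2})"
   unfolding B_def by (rule LI.measure_times) simp
  also have "\<dots> = (\<Prod>i\<in>I. ennreal (h * c0))" using h c0 by (intro prod.cong refl) simp
  finally show ?thesis using h c0 by (simp add: ennreal_power)
 qed
 have hc: "0 < h * c0" "h * c0 \<le> h" using h c0 by (simp_all add: mult_left_le)
 have Ss: "S \<in> sets (leb I)"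
 proof -
  have "S = D \<inter> PiE I (\<lambda>i. {x0 i - 4 * h..x0 i + 4 * h})"
   using DX by (auto simp: S_def abs_le_iff PiE_def Pi_def)
  moreover have "PiE I (\<lambda>i. {x0 i - 4 * h..x0 i + 4 * h}) \<in> sets (leb I)" by (rule sets_PiM_I_finite[OF I]) simp
  ultimately show ?thesis using Ds by simp
 qed
 have Bd: "\<bar>y i - (x0 i + h * e i)\<bar> \<le> h * c0 / 2" if "y \<in> B" "i \<in> I" for y i
  using PiE_mem[OF that(1)[unfolded B_def] that(2)] by (intro abs_leI) auto
 have Be: "y \<in> extensional I" if "y \<in> B" for y using that by (simp add: B_def PiE_def)
 have yx: "\<bar>x i - y i\<bar> \<le> 2 * h" if y: "y \<in> B" and x: "x \<in> Q" and i: "i \<in> I" for y x i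
 proof -
  have "\<bar>h * e i\<bar> \<le> h * 1" unfolding abs_mult using h e(1) i by (intro mult_mono) auto
  then show ?thesis using Bd[OF y i] dQ[rule_format, OF x i] hc by linarith
 qed
 have seg: "(\<lambda>i\<in>I. y i + s * (x i - y i)) \<in> S" if y: "y \<in> B" and x: "x \<in> Q" and s: "s \<in> {0..1}" for y x s
 proof -
  let ?z = "\<lambda>i\<in>I. y i + s * (x i - y i)"
  have xX: "x \<in> extensional I" and xD: "x \<in> D" using x Q DX by (auto simp: PiE_def)
  have "?z \<in> D"
  proof (cases "s = 1")
   case True
   then have "?z = x" using xX by (auto simp: extensional_def fun_eq_iff)
   then show ?thesis using xD by simp
  next
   case False
   define v where "v i = (y i - x i) / h" for i
   have "\<forall>i\<in>I. \<bar>v i - e i\<bar> \<le> c0"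
   proof
    fix i assume i: "i \<in> I"
    have "\<bar>(y i - x i) - h * e i\<bar> \<le> h * c0"
     using Bd[OF y i] dQ[rule_format, OF x i] by linarith
    moreover have "v i - e i = ((y i - x i) - h * e i) / h" using h by (simp add: v_def diff_divide_distrib)
    ultimately show "\<bar>v i - e i\<bar> \<le> c0" using h by (simp add: abs_divide pos_divide_le_eq mult.commute)
   qed
   moreover have "\<forall>i\<in>I. \<bar>x i - x0 i\<bar> \<le> h0"
   proof
    fix i assume i: "i \<in> I"
    show "\<bar>x i - x0 i\<bar> \<le> h0" using dQ[rule_format, OF x i] hc h by linarith
   qed
   moreover have "0 < (1 - s) * h" "(1 - s) * h \<le> h0"
   proof -
    show "0 < (1 - s) * h" using s False h by simp
    have "(1 - s) * h \<le> 1 * h" using s h by (intro mult_right_mono) auto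
    then show "(1 - s) * h \<le> h0" using h(2) by linarith
   qed
   ultimately have "(\<lambda>i\<in>I. x i + ((1 - s) * h) * v i) \<in> D" using e(2) xD by blast
   moreover have "(\<lambda>i\<in>I. x i + ((1 - s) * h) * v i) = ?z"
   proof (rule restrict_ext)
    fix i
    have "h * v i = y i - x i" using h by (simp add: v_def)
    then have "((1 - s) * h) * v i = (1 - s) * (y i - x i)" by (simp only: mult.assoc)
    then show "x i + ((1 - s) * h) * v i = y i + s * (x i - y i)" by (simp only:) (simp add: algebra_simps)
   qed
   ultimately show ?thesis by simp
  qed
  moreover have "\<bar>?z i - x0 i\<bar> \<le> 4 * h" if i: "i \<in> I" for i
  proof -
   have "\<bar>(1 - s) * (x i - y i)\<bar> \<le> 1 * (2 * h)" unfolding abs_mult using s yx[OF y x i] by (intro mult_mono) auto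
   moreover have "?z i = x i - (1 - s) * (x i - y i)" using i by (simp add: algebra_simps)
   ultimately show ?thesis using dQ[rule_format, OF x i] hc h by linarith
  qed
  ultimately show ?thesis by (simp add: S_def)
 qed
 have BS: "B \<subseteq> S"
 proof
  fix y assume y: "y \<in> B"
  have "(\<lambda>i\<in>I. y i + 0 * (x0 i - y i)) = y" using Be[OF y] by (auto simp: extensional_def fun_eq_iff)
  then show "y \<in> S" using seg[OF y x0, of 0] by simp
 qed
 have SD: "S \<subseteq> D" by (auto simp: S_def)
 have "\<forall>c. \<exists>y\<in>B. (\<integral>\<^sup>+x. indicator Q x * ennreal ((u x - taylor_sum I p g c y (\<lambda>i. x i - y i))\<^sup>2) \<partial>leb I) \<le>
   2 ^ card I * ennreal (real (card (index_lists I p)) * (2 * h) ^ (2 * p)) *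
    (\<Sum>is\<in>index_lists I p. \<integral>\<^sup>+x. indicator S x * ennreal ((g is x - c is)\<^sup>2) \<partial>leb I)"
 proof
  fix c
  show "\<exists>y\<in>B. (\<integral>\<^sup>+x. indicator Q x * ennreal ((u x - taylor_sum I p g c y (\<lambda>i. x i - y i))\<^sup>2) \<partial>leb I) \<le>
   2 ^ card I * ennreal (real (card (index_lists I p)) * (2 * h) ^ (2 * p)) *
    (\<Sum>is\<in>index_lists I p. \<integral>\<^sup>+x. indicator S x * ennreal ((g is x - c is)\<^sup>2) \<partial>leb I)"
  proof (rule local_Taylor_approximation[OF I Ds op u g Bs Q(1) Ss mB])
   show "0 < (h * c0) ^ card I" using hc by simp
   show "emeasure (leb I) Q \<le> ennreal ((h * c0) ^ card I)" by (rule mQ)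
   show "S \<subseteq> D" by (rule SD)
   show "0 \<le> 2 * h" using h by simp
  qed (use seg yx in blast)+
 qed
 then show ?thesis using Bs BS mB by (intro exI[of _ B] conjI)
qed

lemma eucl_dist_measurable_pair:
 assumes I: "finite I"
 shows "(\<lambda>z. eucl_dist I (snd z) (fst z)) \<in> borel_measurable (leb I \<Otimes>\<^sub>M leb I)"
proof -
 have m: "(\<lambda>z. snd z i - fst z i) \<in> borel_measurable (leb I \<Otimes>\<^sub>M leb I)" if i: "i \<in> I" for i
  by (intro borel_measurable_diff measurable_compose[OF measurable_snd, where g = "\<lambda>x. x i"]
     measurable_compose[OF measurable_fst, where g = "\<lambda>x. x i"]) (use i in measurable)
 have "(\<lambda>z. \<Sum>i\<in>I. (snd z i - fst z i)\<^sup>2) \<in> borel_measurable (leb I \<Otimes>\<^sub>M leb I)"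
  using m by (intro borel_measurable_sum borel_measurable_power)
 moreover have "sqrt \<in> borel_measurable borel"
  by (intro borel_measurable_continuous_onI continuous_intros)
 ultimately show ?thesis
  unfolding eucl_dist_def L2_set_def by (rule measurable_compose)
qed

text \<open>The fractional Poincare inequality is immediate: some \<open>y \<in> B\<close> does at least as well as the
 average, and on \<open>S\<close> the distance in the denominator is at most the diameter.\<close>
lemma fractional_constant_approximation:
 fixes v :: "'j \<Rightarrow> ('i \<Rightarrow> real) \<Rightarrow> real"
 assumes I: "finite I" and A: "finite A" and vm: "\<forall>j\<in>A. v j \<in> borel_measurable (leb I)"
  and B: "B \<in> sets (leb I)" "B \<subseteq> S" and S: "S \<in> sets (leb I)"
  and mB: "emeasure (leb I) B = ennreal b" "b > 0"
  and diam: "\<forall>x\<in>S. \<forall>y\<in>S. \<forall>i\<in>I. \<bar>x i - y i\<bar> \<le> d" and \<sigma>: "\<sigma> > 0"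
 shows "\<exists>y\<in>B. (\<Sum>j\<in>A. \<integral>\<^sup>+x. indicator S x * ennreal ((v j x - v j y)\<^sup>2) \<partial>leb I) \<le>
  ennreal ((real (card I) * d) powr \<sigma> / b) * (\<Sum>j\<in>A. \<integral>\<^sup>+y. (\<integral>\<^sup>+x. indicator S y * indicator S x *
    ennreal ((v j x - v j y)\<^sup>2 / eucl_dist I x y powr \<sigma>) \<partial>leb I) \<partial>leb I)"
proof -
 let ?L = "leb I"
 let ?LL = "leb I \<Otimes>\<^sub>M leb I"
 interpret L: sigma_finite_measure ?L by (rule sigma_finite_leb[OF I])
 interpret LL: pair_sigma_finite ?L ?L by unfold_locales
 note [measurable] = B(1) S
 have v: "v j \<in> borel_measurable ?L" if "j \<in> A" for j using vm that by blast
 have [measurable]: "(\<lambda>z. v j (fst z)) \<in> borel_measurable ?LL" "(\<lambda>z. v j (snd z)) \<in> borel_measurable ?LL" if "j \<in> A" for j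
  using measurable_compose[OF measurable_fst v[OF that]] measurable_compose[OF measurable_snd v[OF that]] by auto
 note [measurable] = eucl_dist_measurable_pair[OF I]
 define F where "F y = (\<Sum>j\<in>A. \<integral>\<^sup>+x. indicator S x * ennreal ((v j x - v j y)\<^sup>2) \<partial>?L)" for y
 define H where "H j y x = indicator S y * indicator S x * ennreal ((v j x - v j y)\<^sup>2 / eucl_dist I x y powr \<sigma>)" for j y x
 define K where "K = (real (card I) * d) powr \<sigma>"
 have K0: "K \<ge> 0" by (simp add: K_def)
 have Hm: "(\<lambda>z. H j (fst z) (snd z)) \<in> borel_measurable ?LL" if "j \<in> A" for j
  unfolding H_def using that by measurable
 have Fm: "F \<in> borel_measurable ?L"
  unfolding F_def
 proof (rule borel_measurable_sum, rule L.borel_measurable_nn_integral)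
  fix j assume "j \<in> A"
  then have "(\<lambda>z. indicator S (snd z) * ennreal ((v j (snd z) - v j (fst z))\<^sup>2)) \<in> borel_measurable ?LL" by measurable
  then show "(\<lambda>(y, x). indicator S x * ennreal ((v j x - v j y)\<^sup>2)) \<in> borel_measurable ?LL" by (simp add: case_prod_beta')
 qed
 have pt: "indicator B y * (indicator S x * ennreal ((v j x - v j y)\<^sup>2)) \<le> ennreal K * H j y x"
  if xy: "x \<in> space ?L" "y \<in> space ?L" for j x y
 proof (cases "y \<in> B \<and> x \<in> S")
  case False
  then show ?thesis by auto
 next
  case True
  then have y: "y \<in> S" and x: "x \<in> S" using B(2) by auto
  have e0: "eucl_dist I x y \<ge> 0" by (simp add: eucl_dist_def L2_set_nonneg)
  have eb: "eucl_dist I x y \<le> real (card I) * d" by (rule eucl_dist_le_card) (use diam x y in blast)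
  have "(v j x - v j y)\<^sup>2 \<le> K * ((v j x - v j y)\<^sup>2 / eucl_dist I x y powr \<sigma>)"
  proof (cases "eucl_dist I x y = 0")
   case True
   have "x i = y i" if "i \<in> I" for i using abs_diff_le_eucl_dist[OF I that, of x y] True by simp
   then have "x = y" using xy by (intro PiE_ext[of x I "\<lambda>_. UNIV" y]) (auto simp: space_PiM)
   then show ?thesis by simp
  next
   case False
   have "eucl_dist I x y powr \<sigma> \<le> K" unfolding K_def using \<sigma> e0 eb by (intro powr_mono2) auto
   then have "eucl_dist I x y powr \<sigma> * (v j x - v j y)\<^sup>2 \<le> K * (v j x - v j y)\<^sup>2" by (intro mult_right_mono) simp_all
   moreover have "eucl_dist I x y powr \<sigma> > 0" using False e0 by simp
   ultimately show ?thesis by (simp add: pos_le_divide_eq mult.commute)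
  qed
  then have "ennreal ((v j x - v j y)\<^sup>2) \<le> ennreal (K * ((v j x - v j y)\<^sup>2 / eucl_dist I x y powr \<sigma>))" by (rule ennreal_leI)
  also have "\<dots> = ennreal K * ennreal ((v j x - v j y)\<^sup>2 / eucl_dist I x y powr \<sigma>)" using K0 by (intro ennreal_mult) simp_all
  finally show ?thesis using True x y by (simp add: H_def)
 qed
 have "(\<integral>\<^sup>+y. indicator B y * F y \<partial>?L) = (\<integral>\<^sup>+y. (\<Sum>j\<in>A. \<integral>\<^sup>+x. indicator B y * (indicator S x * ennreal ((v j x - v j y)\<^sup>2)) \<partial>?L) \<partial>?L)"
 proof (rule nn_integral_cong)
  fix y assume "y \<in> space ?L"
  have m: "(\<lambda>x. indicator S x * ennreal ((v j x - v j y)\<^sup>2)) \<in> borel_measurable ?L" if "j \<in> A" for j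
   using v[OF that] by measurable
  show "indicator B y * F y = (\<Sum>j\<in>A. \<integral>\<^sup>+x. indicator B y * (indicator S x * ennreal ((v j x - v j y)\<^sup>2)) \<partial>?L)"
   unfolding F_def sum_distrib_left by (rule sum.cong[OF refl]) (rule nn_integral_cmult[symmetric, OF m])
 qed
 also have "\<dots> \<le> (\<integral>\<^sup>+y. (\<Sum>j\<in>A. \<integral>\<^sup>+x. ennreal K * H j y x \<partial>?L) \<partial>?L)"
  by (intro nn_integral_mono sum_mono pt)
 also have "\<dots> = (\<integral>\<^sup>+y. (\<Sum>j\<in>A. ennreal K * (\<integral>\<^sup>+x. H j y x \<partial>?L)) \<partial>?L)"
 proof (intro nn_integral_cong sum.cong refl)
  fix y j assume "y \<in> space ?L" "j \<in> A"
  then have "H j y \<in> borel_measurable ?L" using measurable_Pair2[OF Hm] by simp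
  then show "(\<integral>\<^sup>+x. ennreal K * H j y x \<partial>?L) = ennreal K * (\<integral>\<^sup>+x. H j y x \<partial>?L)" by (rule nn_integral_cmult)
 qed
 also have "\<dots> = (\<Sum>j\<in>A. \<integral>\<^sup>+y. ennreal K * (\<integral>\<^sup>+x. H j y x \<partial>?L) \<partial>?L)"
 proof (rule nn_integral_sum)
  fix j assume j: "j \<in> A"
  have "(\<lambda>y. \<integral>\<^sup>+x. H j y x \<partial>?L) \<in> borel_measurable ?L"
   by (rule L.borel_measurable_nn_integral) (use Hm[OF j] in \<open>simp add: case_prod_beta'\<close>)
  then show "(\<lambda>y. ennreal K * (\<integral>\<^sup>+x. H j y x \<partial>?L)) \<in> borel_measurable ?L" by simp
 qed
 also have "\<dots> = ennreal K * (\<Sum>j\<in>A. \<integral>\<^sup>+y. (\<integral>\<^sup>+x. H j y x \<partial>?L) \<partial>?L)"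
  unfolding sum_distrib_left
 proof (rule sum.cong[OF refl])
  fix j assume j: "j \<in> A"
  have "(\<lambda>y. \<integral>\<^sup>+x. H j y x \<partial>?L) \<in> borel_measurable ?L"
   by (rule L.borel_measurable_nn_integral) (use Hm[OF j] in \<open>simp add: case_prod_beta'\<close>)
  then show "(\<integral>\<^sup>+y. ennreal K * (\<integral>\<^sup>+x. H j y x \<partial>?L) \<partial>?L) = ennreal K * (\<integral>\<^sup>+y. (\<integral>\<^sup>+x. H j y x \<partial>?L) \<partial>?L)"
   by (rule nn_integral_cmult)
 qed
 also have "ennreal K = ennreal b * ennreal (K / b)" using mB(2) K0 by (simp flip: ennreal_mult)
 finally have avg: "(\<integral>\<^sup>+y. indicator B y * F y \<partial>?L) \<le> ennreal b * (ennreal (K / b) * (\<Sum>j\<in>A. \<integral>\<^sup>+y. (\<integral>\<^sup>+x. H j y x \<partial>?L) \<partial>?L))"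
  by (simp add: mult.assoc)
 have "\<exists>y\<in>B. F y \<le> ennreal (K / b) * (\<Sum>j\<in>A. \<integral>\<^sup>+y. (\<integral>\<^sup>+x. H j y x \<partial>?L) \<partial>?L)"
  by (rule exists_le_average[OF Fm B(1) mB avg])
 then show ?thesis unfolding F_def H_def K_def .
qed

lemma is_poly_measurable:
 assumes I: "finite I" and f: "is_poly I d f"
 shows "f \<in> borel_measurable (leb I)"
proof -
 obtain A where A: "\<forall>x. f x = (\<Sum>a\<in>PiE I (\<lambda>_. {..d}). A a * monomial I a x)"
  using f unfolding is_poly_def by (elim exE) (rule that)
 have "(\<lambda>x. \<Sum>a\<in>PiE I (\<lambda>_. {..d}). A a * monomial I a x) \<in> borel_measurable (leb I)"
  unfolding monomial_def by measurable
 then show ?thesis using A by (simp add: fun_eq_iff[symmetric] cong: measurable_cong)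
qed

lemma nn_integral_dom_measure:
 assumes D: "D \<in> sets (leb I)"
 shows "(\<integral>\<^sup>+x. F x \<partial>dom_measure I D) = (\<integral>\<^sup>+x. indicator D x * F x \<partial>leb I)"
 unfolding dom_measure_def using D
 by (subst nn_integral_restrict_space) (auto simp: mult.commute)


text \<open>The estimate on a single cell for a Sobolev function of arbitrary real order.  For integer
 order the Taylor polynomial stops below the top order, for fractional order its top order
 coefficients are the values of the top derivatives at a suitable point.  In both cases the error is
 controlled by the integral of a fixed energy density \<open>W\<close> over a neighbourhood of the cell.\<close>
lemma sobolev_cell_approximation:
 fixes D :: "('i \<Rightarrow> real) set" and u :: "('i \<Rightarrow> real) \<Rightarrow> real"
 assumes I: "finite I" and op: "sup_open I D" and cone: "cone_condition I D h0 c0"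
  and c0: "0 < c0" "c0 \<le> 1" and fin: "finite_measure (dom_measure I D)"
  and k: "k > 0" and u: "sobolev k I D u"
 shows "\<exists>W K. W \<in> borel_measurable (leb I) \<and> (\<integral>\<^sup>+x. indicator D x * W x \<partial>leb I) < \<infinity> \<and> K \<ge> 0 \<and>
  (\<forall>h Q x0. 0 < h \<longrightarrow> h \<le> h0 \<longrightarrow> Q \<in> sets (leb I) \<longrightarrow> Q \<subseteq> D \<longrightarrow> x0 \<in> Q \<longrightarrow>
   (\<forall>x\<in>Q. \<forall>i\<in>I. \<bar>x i - x0 i\<bar> \<le> h * c0 / 2) \<longrightarrow> emeasure (leb I) Q \<le> ennreal ((h * c0) ^ card I) \<longrightarrow>
   (\<exists>P. is_poly I (nat \<lfloor>k\<rfloor>) P \<and> (\<integral>\<^sup>+x. indicator Q x * ennreal ((u x - P x)\<^sup>2) \<partial>leb I) \<le>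
     ennreal (K * h powr (2 * k)) * (\<integral>\<^sup>+x. indicator {x \<in> D. \<forall>i\<in>I. \<bar>x i - x0 i\<bar> \<le> 4 * h} x * W x \<partial>leb I)))"
proof -
 let ?L = "leb I" and ?M = "dom_measure I D"
 let ?LL = "leb I \<Otimes>\<^sub>M leb I"
 interpret FM: finite_measure ?M by (rule fin)
 interpret MM: pair_sigma_finite ?M ?M by unfold_locales
 interpret L: sigma_finite_measure ?L by (rule sigma_finite_leb[OF I])
 have Ds: "D \<in> sets ?L" by (rule sup_open_sets[OF I op])
 define p where "p = nat \<lfloor>k\<rfloor>"
 define N where "N = card I"
 define L where "L = index_lists I p"
 have finL: "finite L" unfolding L_def by (rule finite_index_lists[OF I])
 define good where "good is gi \<longleftrightarrow> L2 ?M gi \<and> weak_deriv I D is u gi \<and>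
   (length is = p \<and> k \<notin> \<int> \<longrightarrow> gagliardo_finite I D (frac k) gi)" for "is" gi
 have "\<forall>is\<in>{is. set is \<subseteq> I \<and> length is \<le> p}. \<exists>gi. good is gi"
  using u unfolding sobolev_def p_def good_def by (auto simp: in_lists_conv_set subset_eq)
 from bchoice[OF this] obtain g where g0: "\<forall>is\<in>{is. set is \<subseteq> I \<and> length is \<le> p}. good is (g is)" ..
 have gL: "good is (g is)" "length is = p" if "is \<in> L" for "is"
  using g0 that by (auto simp: L_def index_lists_def)
 have g: "\<forall>is. set is \<subseteq> I \<longrightarrow> length is \<le> p \<longrightarrow> integrable ?M (g is) \<and> weak_deriv I D is u (g is)"
  using g0 FM.L2_integrable by (auto simp: good_def)
 have ui: "integrable ?M u" using u FM.L2_integrable by (auto simp: sobolev_def)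
 define E where "E is x = indicator D x * g is x" for "is" x
 have Em: "E is \<in> borel_measurable ?L" if "is \<in> L" for "is"
  using g that unfolding integral_dom_measure(2)[OF Ds] E_def[abs_def] L_def index_lists_def
  by (auto dest: borel_measurable_integrable)
 have LI: "\<exists>B. B \<in> sets ?L \<and> B \<subseteq> {x \<in> D. \<forall>i\<in>I. \<bar>x i - x0 i\<bar> \<le> 4 * h} \<and> emeasure ?L B = ennreal ((h * c0) ^ N) \<and>
    (\<forall>c. \<exists>P. is_poly I p P \<and> (\<integral>\<^sup>+x. indicator Q x * ennreal ((u x - P x)\<^sup>2) \<partial>?L) \<le>
    ennreal (2 ^ N * real (card L) * 4 ^ p * h ^ (2 * p)) *
     (\<Sum>is\<in>L. \<integral>\<^sup>+x. indicator {x \<in> D. \<forall>i\<in>I. \<bar>x i - x0 i\<bar> \<le> 4 * h} x * ennreal ((E is x - c is)\<^sup>2) \<partial>?L))"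
  if h: "0 < h" "h \<le> h0" and Q: "Q \<in> sets ?L" "Q \<subseteq> D" and x0: "x0 \<in> Q"
   and dQ: "\<forall>x\<in>Q. \<forall>i\<in>I. \<bar>x i - x0 i\<bar> \<le> h * c0 / 2" and mQ: "emeasure ?L Q \<le> ennreal ((h * c0) ^ N)" for h Q x0
 proof -
  let ?S = "{x \<in> D. \<forall>i\<in>I. \<bar>x i - x0 i\<bar> \<le> 4 * h}"
  obtain B where B: "B \<in> sets ?L" "B \<subseteq> ?S" "emeasure ?L B = ennreal ((h * c0) ^ N)"
   and ap: "\<forall>c. \<exists>y\<in>B. (\<integral>\<^sup>+x. indicator Q x * ennreal ((u x - taylor_sum I p g c y (\<lambda>i. x i - y i))\<^sup>2) \<partial>?L) \<le>
    2 ^ N * ennreal (real (card L) * (2 * h) ^ (2 * p)) *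
     (\<Sum>is\<in>L. \<integral>\<^sup>+x. indicator ?S x * ennreal ((g is x - c is)\<^sup>2) \<partial>?L)"
   using cell_approximation[OF I op cone c0 h ui g Q x0 dQ mQ[unfolded N_def], folded N_def L_def]
   by (elim exE conjE) (rule that)
  have ce: "2 ^ N * ennreal (real (card L) * (2 * h) ^ (2 * p)) = ennreal (2 ^ N * real (card L) * 4 ^ p * h ^ (2 * p))"
  proof -
   have "(2 * h) ^ (2 * p) = 4 ^ p * h ^ (2 * p)" by (simp add: power_mult_distrib power_mult)
   moreover have "(2::ennreal) ^ N = ennreal (2 ^ N)" by (simp add: ennreal_power[symmetric])
   ultimately show ?thesis using h by (simp add: mult.assoc flip: ennreal_mult)
  qed
  have "\<forall>c. \<exists>P. is_poly I p P \<and> (\<integral>\<^sup>+x. indicator Q x * ennreal ((u x - P x)\<^sup>2) \<partial>?L) \<le>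
    ennreal (2 ^ N * real (card L) * 4 ^ p * h ^ (2 * p)) *
     (\<Sum>is\<in>L. \<integral>\<^sup>+x. indicator ?S x * ennreal ((E is x - c is)\<^sup>2) \<partial>?L)"
  proof
   fix c
   obtain y where y: "(\<integral>\<^sup>+x. indicator Q x * ennreal ((u x - taylor_sum I p g c y (\<lambda>i. x i - y i))\<^sup>2) \<partial>?L) \<le>
    2 ^ N * ennreal (real (card L) * (2 * h) ^ (2 * p)) *
     (\<Sum>is\<in>L. \<integral>\<^sup>+x. indicator ?S x * ennreal ((g is x - c is)\<^sup>2) \<partial>?L)"
    using ap[rule_format, of c] by (elim bexE) (rule that)
   have e: "(\<Sum>is\<in>L. \<integral>\<^sup>+x. indicator ?S x * ennreal ((g is x - c is)\<^sup>2) \<partial>?L) =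
     (\<Sum>is\<in>L. \<integral>\<^sup>+x. indicator ?S x * ennreal ((E is x - c is)\<^sup>2) \<partial>?L)"
    by (intro sum.cong nn_integral_cong refl) (simp add: E_def indicator_def)
   show "\<exists>P. is_poly I p P \<and> (\<integral>\<^sup>+x. indicator Q x * ennreal ((u x - P x)\<^sup>2) \<partial>?L) \<le>
    ennreal (2 ^ N * real (card L) * 4 ^ p * h ^ (2 * p)) *
     (\<Sum>is\<in>L. \<integral>\<^sup>+x. indicator ?S x * ennreal ((E is x - c is)\<^sup>2) \<partial>?L)"
    using y unfolding e ce by (intro exI[of _ "\<lambda>x. taylor_sum I p g c y (\<lambda>i. x i - y i)"] conjI is_poly_taylor_sum[OF I])
  qed
  then show ?thesis
   using B by (intro exI[of _ B] conjI)
 qed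
 have Ss: "{x \<in> D. \<forall>i\<in>I. \<bar>x i - x0 i\<bar> \<le> r} \<in> sets ?L" for x0 r
 proof -
  have "{x \<in> D. \<forall>i\<in>I. \<bar>x i - x0 i\<bar> \<le> r} = D \<inter> PiE I (\<lambda>i. {x0 i - r..x0 i + r})"
   using op by (auto simp: sup_open_def abs_le_iff PiE_def Pi_def)
  then show ?thesis using sets_PiM_I_finite[OF I, of "\<lambda>i. {x0 i - r..x0 i + r}" "\<lambda>_. lborel"] Ds by simp
 qed
 define est where "est W K \<longleftrightarrow> (\<forall>h Q x0. 0 < h \<longrightarrow> h \<le> h0 \<longrightarrow> Q \<in> sets ?L \<longrightarrow> Q \<subseteq> D \<longrightarrow> x0 \<in> Q \<longrightarrow>
   (\<forall>x\<in>Q. \<forall>i\<in>I. \<bar>x i - x0 i\<bar> \<le> h * c0 / 2) \<longrightarrow> emeasure ?L Q \<le> ennreal ((h * c0) ^ N) \<longrightarrow>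
   (\<exists>P. is_poly I p P \<and> (\<integral>\<^sup>+x. indicator Q x * ennreal ((u x - P x)\<^sup>2) \<partial>?L) \<le>
     ennreal (K * h powr (2 * k)) * (\<integral>\<^sup>+x. indicator {x \<in> D. \<forall>i\<in>I. \<bar>x i - x0 i\<bar> \<le> 4 * h} x * W x \<partial>?L)))" for W and K :: real
 show ?thesis
 proof (cases "k \<in> \<int>")
  case True
  then obtain z where z: "k = of_int z" by (elim Ints_cases)
  then have pk: "real p = k" using k by (simp add: p_def)
  define W where "W x = (\<Sum>is\<in>L. ennreal ((E is x)\<^sup>2))" for x
  define K where "K = 2 ^ N * real (card L) * 4 ^ p"
  have Wm: "W \<in> borel_measurable ?L" unfolding W_def using Em by measurable
  have Wf: "(\<integral>\<^sup>+x. indicator D x * W x \<partial>?L) < \<infinity>"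
  proof -
   have "(\<integral>\<^sup>+x. indicator D x * W x \<partial>?L) = (\<integral>\<^sup>+x. (\<Sum>is\<in>L. indicator D x * ennreal ((g is x)\<^sup>2)) \<partial>?L)"
    by (intro nn_integral_cong) (auto simp: W_def E_def indicator_def)
   also have "\<dots> = (\<integral>\<^sup>+x. (\<Sum>is\<in>L. ennreal ((g is x)\<^sup>2)) \<partial>?M)"
    unfolding nn_integral_dom_measure[OF Ds] sum_distrib_left ..
   also have "\<dots> = (\<Sum>is\<in>L. \<integral>\<^sup>+x. ennreal ((g is x)\<^sup>2) \<partial>?M)"
    using gL by (intro nn_integral_sum) (auto simp: good_def square_integrable_def)
   also have "\<dots> < \<infinity>"
   proof -
    have "(\<integral>\<^sup>+x. ennreal ((g is x)\<^sup>2) \<partial>?M) < top" if "is \<in> L" for "is"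
     using gL(1)[OF that] by (auto simp: good_def square_integrable_def real_integrable_def less_top)
    then show ?thesis using finL by (simp add: less_top)
   qed
   finally show ?thesis .
  qed
  have "est W K"
   unfolding est_def
  proof (intro allI impI)
   fix h Q x0 assume h: "0 < h" "h \<le> h0" and Q: "Q \<in> sets ?L" "Q \<subseteq> D" and x0: "x0 \<in> Q"
    and dQ: "\<forall>x\<in>Q. \<forall>i\<in>I. \<bar>x i - x0 i\<bar> \<le> h * c0 / 2" and mQ: "emeasure ?L Q \<le> ennreal ((h * c0) ^ N)"
   let ?S = "{x \<in> D. \<forall>i\<in>I. \<bar>x i - x0 i\<bar> \<le> 4 * h}"
   obtain P where P: "is_poly I p P" "(\<integral>\<^sup>+x. indicator Q x * ennreal ((u x - P x)\<^sup>2) \<partial>?L) \<le>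
    ennreal (2 ^ N * real (card L) * 4 ^ p * h ^ (2 * p)) * (\<Sum>is\<in>L. \<integral>\<^sup>+x. indicator ?S x * ennreal ((E is x - 0)\<^sup>2) \<partial>?L)"
    using LI[OF h Q x0 dQ mQ] by (elim exE conjE) (drule spec[of _ "\<lambda>_. 0"], elim exE conjE, rule that)
   have "h ^ (2 * p) = h powr (2 * k)" using h(1) pk by (simp add: powr_realpow[symmetric])
   then have "2 ^ N * real (card L) * 4 ^ p * h ^ (2 * p) = K * h powr (2 * k)" by (simp add: K_def)
   moreover have "(\<Sum>is\<in>L. \<integral>\<^sup>+x. indicator ?S x * ennreal ((E is x - 0)\<^sup>2) \<partial>?L) = (\<integral>\<^sup>+x. indicator ?S x * W x \<partial>?L)"
    unfolding W_def sum_distrib_left diff_zero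
    by (rule nn_integral_sum[symmetric]) (use Em Ss in measurable)
   ultimately show "\<exists>P. is_poly I p P \<and> (\<integral>\<^sup>+x. indicator Q x * ennreal ((u x - P x)\<^sup>2) \<partial>?L) \<le>
     ennreal (K * h powr (2 * k)) * (\<integral>\<^sup>+x. indicator ?S x * W x \<partial>?L)"
    using P by (intro exI[of _ P] conjI) simp_all
  qed
  then show ?thesis using Wm Wf unfolding est_def p_def N_def
   by (intro exI[of _ W] exI[of _ K] conjI) (simp_all only:, simp add: K_def)
 next
  case False
  define \<theta> where "\<theta> = frac k"
  have \<theta>: "\<theta> > 0" using False by (simp add: \<theta>_def)
  have pk: "real p + \<theta> = k" using k by (simp add: p_def \<theta>_def frac_def)
  define \<sigma> where "\<sigma> = real N + 2 * \<theta>"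
  have \<sigma>: "\<sigma> > 0" using \<theta> by (simp add: \<sigma>_def)
  define H where "H is y x = ennreal ((E is x - E is y)\<^sup>2 / eucl_dist I x y powr \<sigma>)" for "is" y x
  define W where "W y = (\<Sum>is\<in>L. \<integral>\<^sup>+x. indicator D x * H is y x \<partial>?L)" for y
  define K1 where "K1 = (8 * real N) powr \<sigma> / c0 ^ N"
  define K where "K = 2 ^ N * real (card L) * 4 ^ p * K1"
  have K10: "K1 \<ge> 0" using c0 by (simp add: K1_def)
  have Hm: "(\<lambda>z. H is (fst z) (snd z)) \<in> borel_measurable ?LL" if "is \<in> L" for "is"
  proof -
   have [measurable]: "(\<lambda>z. E is (fst z)) \<in> borel_measurable ?LL" "(\<lambda>z. E is (snd z)) \<in> borel_measurable ?LL"
    using measurable_compose[OF measurable_fst Em[OF that]] measurable_compose[OF measurable_snd Em[OF that]] by auto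
   note [measurable] = eucl_dist_measurable_pair[OF I]
   show ?thesis unfolding H_def by measurable
  qed
  have HSm: "(\<lambda>z. indicator S (snd z) * H is (fst z) (snd z)) \<in> borel_measurable ?LL" if "is \<in> L" "S \<in> sets ?L" for "is" S
  proof -
   note [measurable] = Hm[OF that(1)] that(2)
   show ?thesis by measurable
  qed
  have HDm: "(\<lambda>y. \<integral>\<^sup>+x. indicator S x * H is y x \<partial>?L) \<in> borel_measurable ?L" if "is \<in> L" "S \<in> sets ?L" for "is" S
   by (rule L.borel_measurable_nn_integral) (use HSm[OF that] in \<open>simp add: case_prod_beta'\<close>)
  have Wm: "W \<in> borel_measurable ?L" unfolding W_def using HDm[OF _ Ds] by (intro borel_measurable_sum)
  have Wf: "(\<integral>\<^sup>+x. indicator D x * W x \<partial>?L) < \<infinity>"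
  proof -
   have "(\<integral>\<^sup>+y. indicator D y * W y \<partial>?L) = (\<Sum>is\<in>L. \<integral>\<^sup>+y. indicator D y * (\<integral>\<^sup>+x. indicator D x * H is y x \<partial>?L) \<partial>?L)"
    unfolding W_def sum_distrib_left
    by (rule nn_integral_sum) (use HDm[OF _ Ds] Ds in measurable)
   also have "\<dots> < \<infinity>"
   proof -
    have "(\<integral>\<^sup>+y. indicator D y * (\<integral>\<^sup>+x. indicator D x * H is y x \<partial>?L) \<partial>?L) < top" if i: "is \<in> L" for "is"
    proof -
     let ?f = "\<lambda>(x, y). (g is x - g is y)\<^sup>2 / eucl_dist I x y powr (real (card I) + 2 * \<theta>)"
     have int: "integrable (?M \<Otimes>\<^sub>M ?M) ?f"
      using gL[OF i] False by (simp add: good_def gagliardo_finite_def \<theta>_def)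
     have "(\<integral>\<^sup>+y. indicator D y * (\<integral>\<^sup>+x. indicator D x * H is y x \<partial>?L) \<partial>?L) =
       (\<integral>\<^sup>+y. indicator D y * (\<integral>\<^sup>+x. indicator D x * ennreal (?f (x, y)) \<partial>?L) \<partial>?L)"
     proof (rule nn_integral_cong)
      fix y
      have "(\<integral>\<^sup>+x. indicator D x * H is y x \<partial>?L) = (\<integral>\<^sup>+x. indicator D x * ennreal (?f (x, y)) \<partial>?L)" if "y \<in> D"
       by (rule nn_integral_cong) (use that in \<open>simp add: H_def E_def \<sigma>_def N_def indicator_def\<close>)
      then show "indicator D y * (\<integral>\<^sup>+x. indicator D x * H is y x \<partial>?L) = indicator D y * (\<integral>\<^sup>+x. indicator D x * ennreal (?f (x, y)) \<partial>?L)"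
       by (cases "y \<in> D") auto
     qed
     also have "\<dots> = (\<integral>\<^sup>+y. (\<integral>\<^sup>+x. ennreal (?f (x, y)) \<partial>?M) \<partial>?M)"
      unfolding nn_integral_dom_measure[OF Ds] ..
     also have "\<dots> = (\<integral>\<^sup>+z. ennreal (?f z) \<partial>(?M \<Otimes>\<^sub>M ?M))"
      using borel_measurable_integrable[OF int] by (intro MM.nn_integral_snd) simp
     also have "\<dots> < top" using int unfolding real_integrable_def by (auto simp: less_top)
     finally show ?thesis .
    qed
    then show ?thesis using finL by (simp add: less_top)
   qed
   finally show ?thesis .
  qed
  have "est W K"
   unfolding est_def
  proof (intro allI impI)
   fix h Q x0 assume h: "0 < h" "h \<le> h0" and Q: "Q \<in> sets ?L" "Q \<subseteq> D" and x0: "x0 \<in> Q"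
    and dQ: "\<forall>x\<in>Q. \<forall>i\<in>I. \<bar>x i - x0 i\<bar> \<le> h * c0 / 2" and mQ: "emeasure ?L Q \<le> ennreal ((h * c0) ^ N)"
   define S where "S = {x \<in> D. \<forall>i\<in>I. \<bar>x i - x0 i\<bar> \<le> 4 * h}"
   have Sm: "S \<in> sets ?L" unfolding S_def by (rule Ss)
   obtain B where B: "B \<in> sets ?L" "B \<subseteq> S" "emeasure ?L B = ennreal ((h * c0) ^ N)"
    and ap: "\<forall>c. \<exists>P. is_poly I p P \<and> (\<integral>\<^sup>+x. indicator Q x * ennreal ((u x - P x)\<^sup>2) \<partial>?L) \<le>
    ennreal (2 ^ N * real (card L) * 4 ^ p * h ^ (2 * p)) * (\<Sum>is\<in>L. \<integral>\<^sup>+x. indicator S x * ennreal ((E is x - c is)\<^sup>2) \<partial>?L)"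
    using LI[OF h Q x0 dQ mQ, folded S_def] by (elim exE conjE) (rule that)
   have diam: "\<forall>x\<in>S. \<forall>y\<in>S. \<forall>i\<in>I. \<bar>x i - y i\<bar> \<le> 8 * h"
   proof (intro ballI)
    fix x y i assume "x \<in> S" "y \<in> S" "i \<in> I"
    then have "\<bar>x i - x0 i\<bar> \<le> 4 * h" "\<bar>y i - x0 i\<bar> \<le> 4 * h" by (auto simp: S_def)
    then show "\<bar>x i - y i\<bar> \<le> 8 * h" by linarith
   qed
   have Em': "\<forall>is\<in>L. E is \<in> borel_measurable ?L" using Em by blast
   have b0: "(h * c0) ^ N > 0" using h c0 by simp
   obtain y where y: "(\<Sum>is\<in>L. \<integral>\<^sup>+x. indicator S x * ennreal ((E is x - E is y)\<^sup>2) \<partial>?L) \<le>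
    ennreal ((real (card I) * (8 * h)) powr \<sigma> / (h * c0) ^ N) * (\<Sum>is\<in>L. \<integral>\<^sup>+y. (\<integral>\<^sup>+x. indicator S y * indicator S x *
    ennreal ((E is x - E is y)\<^sup>2 / eucl_dist I x y powr \<sigma>) \<partial>?L) \<partial>?L)"
    using fractional_constant_approximation[where v = E and d = "8 * h", OF I finL Em' B(1,2) Sm B(3) b0 diam \<sigma>] by (elim bexE) (rule that)
   have c1: "(real (card I) * (8 * h)) powr \<sigma> / (h * c0) ^ N = K1 * h powr (2 * \<theta>)"
   proof -
    have "(real (card I) * (8 * h)) powr \<sigma> = (8 * real N) powr \<sigma> * h powr \<sigma>"
     using h by (subst powr_mult[symmetric]) (simp_all add: N_def mult_ac)
    moreover have "h powr \<sigma> = h ^ N * h powr (2 * \<theta>)" using h by (simp add: \<sigma>_def powr_add powr_realpow)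
    ultimately show ?thesis using h c0 by (simp add: K1_def power_mult_distrib)
   qed
   have le: "(\<Sum>is\<in>L. \<integral>\<^sup>+y. (\<integral>\<^sup>+x. indicator S y * indicator S x *
    ennreal ((E is x - E is y)\<^sup>2 / eucl_dist I x y powr \<sigma>) \<partial>?L) \<partial>?L) \<le> (\<integral>\<^sup>+y. indicator S y * W y \<partial>?L)"
   proof -
    have "(\<Sum>is\<in>L. \<integral>\<^sup>+y. (\<integral>\<^sup>+x. indicator S y * indicator S x *
    ennreal ((E is x - E is y)\<^sup>2 / eucl_dist I x y powr \<sigma>) \<partial>?L) \<partial>?L) \<le> (\<Sum>is\<in>L. \<integral>\<^sup>+y. indicator S y * (\<integral>\<^sup>+x. indicator D x * H is y x \<partial>?L) \<partial>?L)"
    proof (intro sum_mono nn_integral_mono)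
     fix "is" y
     show "(\<integral>\<^sup>+x. indicator S y * indicator S x * ennreal ((E is x - E is y)\<^sup>2 / eucl_dist I x y powr \<sigma>) \<partial>?L)
      \<le> indicator S y * (\<integral>\<^sup>+x. indicator D x * H is y x \<partial>?L)"
      by (cases "y \<in> S") (auto simp: H_def S_def indicator_def intro!: nn_integral_mono)
    qed
    also have "\<dots> = (\<integral>\<^sup>+y. indicator S y * W y \<partial>?L)"
     unfolding W_def sum_distrib_left
     by (rule nn_integral_sum[symmetric]) (use HDm[OF _ Ds] Sm in measurable)
    finally show ?thesis .
   qed
   obtain P where P: "is_poly I p P" "(\<integral>\<^sup>+x. indicator Q x * ennreal ((u x - P x)\<^sup>2) \<partial>?L) \<le>
    ennreal (2 ^ N * real (card L) * 4 ^ p * h ^ (2 * p)) * (\<Sum>is\<in>L. \<integral>\<^sup>+x. indicator S x * ennreal ((E is x - E is y)\<^sup>2) \<partial>?L)"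
    using ap[rule_format, of "\<lambda>is. E is y"] by (elim exE conjE) (rule that)
   note P(2)
   also have "ennreal (2 ^ N * real (card L) * 4 ^ p * h ^ (2 * p)) * (\<Sum>is\<in>L. \<integral>\<^sup>+x. indicator S x * ennreal ((E is x - E is y)\<^sup>2) \<partial>?L)
     \<le> ennreal (2 ^ N * real (card L) * 4 ^ p * h ^ (2 * p)) * (ennreal (K1 * h powr (2 * \<theta>)) * (\<integral>\<^sup>+y. indicator S y * W y \<partial>?L))"
    by (rule mult_left_mono[OF order_trans[OF y[unfolded c1] mult_left_mono[OF le]]]) simp_all
   also have "\<dots> = ennreal (K * h powr (2 * k)) * (\<integral>\<^sup>+y. indicator S y * W y \<partial>?L)"
   proof -
    have "h ^ (2 * p) * h powr (2 * \<theta>) = h powr (2 * k)"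
     using h(1) by (simp add: powr_realpow[symmetric] powr_add[symmetric] pk[symmetric] distrib_left)
    then have e: "(2 ^ N * real (card L) * 4 ^ p * h ^ (2 * p)) * (K1 * h powr (2 * \<theta>)) = K * h powr (2 * k)"
     by (simp add: K_def mult_ac)
    have "ennreal a * (ennreal b * X) = ennreal (a * b) * X" if "0 \<le> a" "0 \<le> b" for a b X
     using that by (simp add: ennreal_mult mult.assoc)
    from this[of "2 ^ N * real (card L) * 4 ^ p * h ^ (2 * p)" "K1 * h powr (2 * \<theta>)"] show ?thesis
     unfolding e using h K10 by simp
   qed
   finally show "\<exists>P. is_poly I p P \<and> (\<integral>\<^sup>+x. indicator Q x * ennreal ((u x - P x)\<^sup>2) \<partial>?L) \<le>
     ennreal (K * h powr (2 * k)) * (\<integral>\<^sup>+x. indicator {x \<in> D. \<forall>i\<in>I. \<bar>x i - x0 i\<bar> \<le> 4 * h} x * W x \<partial>?L)"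
    using P(1) unfolding S_def by (intro exI[of _ P] conjI)
  qed
  then show ?thesis using Wm Wf K10 unfolding est_def p_def N_def
   by (intro exI[of _ W] exI[of _ K] conjI) (simp_all only:, simp add: K_def)
 qed
qed

text \<open>Products of these functions are the monomials on the cells of the grid; so a piecewise polynomial is
 a combination of products of functions from one small family.\<close>
definition grid_monomial :: "real \<Rightarrow> int \<times> nat \<Rightarrow> real \<Rightarrow> real" where
 "grid_monomial \<delta> q t = (if \<lfloor>t / \<delta>\<rfloor> = fst q then t ^ snd q else 0)"

lemma grid_monomial_measurable: "grid_monomial \<delta> q \<in> borel_measurable borel"
 unfolding grid_monomial_def[abs_def] by measurable

lemma grid_monomial_bounded:
 assumes \<delta>: "\<delta> > 0"
 shows "\<exists>b. \<forall>t. \<bar>grid_monomial \<delta> q t\<bar> \<le> b"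
proof (intro exI allI)
 fix t
 show "\<bar>grid_monomial \<delta> q t\<bar> \<le> (\<delta> * (\<bar>of_int (fst q)\<bar> + 1)) ^ snd q"
 proof (cases "\<lfloor>t / \<delta>\<rfloor> = fst q")
  case True
  then have "of_int (fst q) \<le> t / \<delta>" "t / \<delta> < of_int (fst q) + 1" by linarith+
  then have "\<bar>t / \<delta>\<bar> \<le> \<bar>of_int (fst q)\<bar> + 1" by linarith
  then have "\<bar>t\<bar> \<le> \<delta> * (\<bar>of_int (fst q)\<bar> + 1)" using \<delta> by (simp add: abs_divide pos_divide_le_eq mult.commute)
  then show ?thesis using True by (simp add: grid_monomial_def power_abs power_mono)
 next
  case False
  then show ?thesis using \<delta> by (simp add: grid_monomial_def)
 qed
qed

text \<open>On the cell of the grid with index \<open>z\<close>, a combination of products of grid monomials is the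
 polynomial belonging to that cell, because only the terms with this cell index survive.\<close>
lemma grid_monomial_sum:
 assumes I: "finite I" and z: "z \<in> PiE I (\<lambda>_. Z)" and finZ: "finite Z" and x: "\<forall>i\<in>I. \<lfloor>x i / \<delta>\<rfloor> = z i"
 shows "(\<Sum>q\<in>PiE I (\<lambda>_. Z \<times> {..p}). A (\<lambda>i\<in>I. fst (q i)) (\<lambda>i\<in>I. snd (q i)) * (\<Prod>i\<in>I. grid_monomial \<delta> (q i) (x i))) =
  (\<Sum>a\<in>PiE I (\<lambda>_. {..p}). A z a * monomial I a x)"
proof -
 define P where "P = PiE I (\<lambda>_. {..p})"
 define s where "s a = (\<lambda>i\<in>I. (z i, a i))" for a :: "'a \<Rightarrow> nat"
 have rev: "(\<lambda>i\<in>I. fst (s a i)) = z" "(\<lambda>i\<in>I. snd (s a i)) = a" if "a \<in> P" for a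
  using that z by (auto simp: s_def P_def PiE_def extensional_def fun_eq_iff)
 have inj: "inj_on s P" by (rule inj_on_inverseI[where g = "\<lambda>q. \<lambda>i\<in>I. snd (q i)"]) (rule rev(2))
 have sub: "s ` P \<subseteq> PiE I (\<lambda>_. Z \<times> {..p})"
  using z by (auto simp: s_def P_def PiE_def Pi_def extensional_def)
 have zero: "(\<Prod>i\<in>I. grid_monomial \<delta> (q i) (x i)) = 0" if q: "q \<in> PiE I (\<lambda>_. Z \<times> {..p}) - s ` P" for q
 proof (rule ccontr)
  assume "(\<Prod>i\<in>I. grid_monomial \<delta> (q i) (x i)) \<noteq> 0"
  then have "\<forall>i\<in>I. grid_monomial \<delta> (q i) (x i) \<noteq> 0" using I by auto
  then have f: "\<forall>i\<in>I. fst (q i) = z i" using x by (auto simp: grid_monomial_def split: if_splits)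
  have "q = s (\<lambda>i\<in>I. snd (q i))"
   using q f by (auto simp: s_def PiE_def extensional_def fun_eq_iff prod_eq_iff)
  moreover have "(\<lambda>i\<in>I. snd (q i)) \<in> P" using q by (force simp: P_def PiE_def Pi_def mem_Times_iff)
  ultimately show False using q by blast
 qed
 have mon: "(\<Prod>i\<in>I. grid_monomial \<delta> (s a i) (x i)) = monomial I a x" for a
  unfolding monomial_def by (rule prod.cong) (use x in \<open>auto simp: s_def grid_monomial_def\<close>)
 have "(\<Sum>q\<in>PiE I (\<lambda>_. Z \<times> {..p}). A (\<lambda>i\<in>I. fst (q i)) (\<lambda>i\<in>I. snd (q i)) * (\<Prod>i\<in>I. grid_monomial \<delta> (q i) (x i))) =
   (\<Sum>q\<in>s ` P. A (\<lambda>i\<in>I. fst (q i)) (\<lambda>i\<in>I. snd (q i)) * (\<Prod>i\<in>I. grid_monomial \<delta> (q i) (x i)))"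
  by (rule sum.mono_neutral_right) (use I finZ sub zero in \<open>auto intro!: finite_PiE\<close>)
 also have "\<dots> = (\<Sum>a\<in>P. A z a * monomial I a x)"
  unfolding sum.reindex[OF inj] by (rule sum.cong) (simp_all only: comp_def rev mon)
 finally show ?thesis by (simp add: P_def)
qed

text \<open>Counting the cells near a point: boundedly many, if the radius is comparable to the grid width.\<close>
lemma card_near_grid_points:
 assumes \<delta>: "\<delta> > 0" and r: "r \<ge> 0" and Z: "finite Z"
 shows "real (card {z \<in> Z. \<bar>t - \<delta> * of_int z\<bar> \<le> r}) \<le> 2 * r / \<delta> + 1"
proof -
 have "{z \<in> Z. \<bar>t - \<delta> * of_int z\<bar> \<le> r} \<subseteq> {\<lceil>(t - r) / \<delta>\<rceil>..\<lfloor>(t + r) / \<delta>\<rfloor>}"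
 proof
  fix z assume "z \<in> {z \<in> Z. \<bar>t - \<delta> * of_int z\<bar> \<le> r}"
  then have "t - r \<le> of_int z * \<delta>" "of_int z * \<delta> \<le> t + r" by (auto simp: abs_le_iff mult.commute)
  then have "(t - r) / \<delta> \<le> of_int z" "of_int z \<le> (t + r) / \<delta>" using \<delta> by (simp_all add: pos_divide_le_eq pos_le_divide_eq)
  then show "z \<in> {\<lceil>(t - r) / \<delta>\<rceil>..\<lfloor>(t + r) / \<delta>\<rfloor>}" by (simp add: ceiling_le_iff le_floor_iff)
 qed
 then have "card {z \<in> Z. \<bar>t - \<delta> * of_int z\<bar> \<le> r} \<le> card {\<lceil>(t - r) / \<delta>\<rceil>..\<lfloor>(t + r) / \<delta>\<rfloor>}"
  by (intro card_mono) simp_all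
 also have "\<dots> = nat (\<lfloor>(t + r) / \<delta>\<rfloor> - \<lceil>(t - r) / \<delta>\<rceil> + 1)" by simp
 finally have "real (card {z \<in> Z. \<bar>t - \<delta> * of_int z\<bar> \<le> r}) \<le> real (nat (\<lfloor>(t + r) / \<delta>\<rfloor> - \<lceil>(t - r) / \<delta>\<rceil> + 1))" by simp
 also have "\<dots> \<le> 2 * r / \<delta> + 1"
 proof (cases "\<lfloor>(t + r) / \<delta>\<rfloor> - \<lceil>(t - r) / \<delta>\<rceil> + 1 \<ge> 0")
  case True
  have "of_int \<lfloor>(t + r) / \<delta>\<rfloor> - of_int \<lceil>(t - r) / \<delta>\<rceil> \<le> (t + r) / \<delta> - (t - r) / \<delta>" by linarith
  also have "\<dots> = 2 * r / \<delta>" by (simp add: diff_divide_distrib[symmetric])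
  finally show ?thesis using True by simp
 next
  case False
  then have "nat (\<lfloor>(t + r) / \<delta>\<rfloor> - \<lceil>(t - r) / \<delta>\<rceil> + 1) = 0" by linarith
  then show ?thesis using r \<delta> by simp
 qed
 finally show ?thesis .
qed

text \<open>The cells have width \<open>h c0 / 2\<close>, so that each is visible from a cube in the cone of any of its
 points.  The squared errors add up to at most a multiple of the total energy, because every point
 lies in boundedly many of the neighbourhoods over which the local bounds integrate the energy.\<close>
theorem piecewise_polynomial_approximation:
 fixes D :: "('i \<Rightarrow> real) set" and u :: "('i \<Rightarrow> real) \<Rightarrow> real"
 assumes I: "finite I" and op: "sup_open I D" and cone: "cone_condition I D h0 c0"
  and h0: "0 < h0" and c0: "0 < c0" "c0 \<le> 1" and bd: "\<forall>x\<in>D. \<forall>i\<in>I. \<bar>x i\<bar> \<le> R" and R: "0 < R"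
  and fin: "finite_measure (dom_measure I D)" and k: "k > 0" and u: "sobolev k I D u"
 shows "\<exists>C R'. 0 \<le> C \<and> 0 < R' \<and> (\<forall>h. 0 < h \<longrightarrow> h \<le> h0 \<longrightarrow>
  (\<exists>\<delta> E A. 0 < \<delta> \<and> finite (E :: (int \<times> nat) set) \<and> real (card E) \<le> R' / h \<and>
   (\<integral>\<^sup>+x. indicator D x * ennreal ((u x - (\<Sum>q\<in>PiE I (\<lambda>_. E). A q * (\<Prod>i\<in>I. grid_monomial \<delta> (q i) (x i))))\<^sup>2) \<partial>leb I)
    \<le> ennreal (C * h powr (2 * k))))"
proof -
 let ?L = "leb I"
 interpret LI: finite_product_sigma_finite "\<lambda>_. lborel" I by standard (rule I)
 have Ds: "D \<in> sets ?L" by (rule sup_open_sets[OF I op])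
 have DX: "D \<subseteq> (I \<rightarrow>\<^sub>E UNIV)" using op by (simp add: sup_open_def)
 define p where "p = nat \<lfloor>k\<rfloor>"
 define N where "N = card I"
 obtain W K where W: "W \<in> borel_measurable ?L" "(\<integral>\<^sup>+x. indicator D x * W x \<partial>?L) < \<infinity>" and K: "K \<ge> 0"
  and cell: "\<forall>h Q x0. 0 < h \<longrightarrow> h \<le> h0 \<longrightarrow> Q \<in> sets ?L \<longrightarrow> Q \<subseteq> D \<longrightarrow> x0 \<in> Q \<longrightarrow>
   (\<forall>x\<in>Q. \<forall>i\<in>I. \<bar>x i - x0 i\<bar> \<le> h * c0 / 2) \<longrightarrow> emeasure ?L Q \<le> ennreal ((h * c0) ^ N) \<longrightarrow>
   (\<exists>P. is_poly I p P \<and> (\<integral>\<^sup>+x. indicator Q x * ennreal ((u x - P x)\<^sup>2) \<partial>?L) \<le>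
     ennreal (K * h powr (2 * k)) * (\<integral>\<^sup>+x. indicator {x \<in> D. \<forall>i\<in>I. \<bar>x i - x0 i\<bar> \<le> 4 * h} x * W x \<partial>?L))"
  using sobolev_cell_approximation[OF I op cone c0 fin k u, folded p_def N_def] by (elim exE conjE) (rule that)
 define J where "J = (\<integral>\<^sup>+x. indicator D x * W x \<partial>?L)"
 define M where "M = (20 / c0 + 1) ^ N"
 have M0: "M \<ge> 0" using c0 by (simp add: M_def)
 define C where "C = K * M * enn2real J"
 define R' where "R' = (4 * R / c0 + 3 * h0) * real (p + 1)"
 have um: "(\<lambda>x. indicator D x * u x) \<in> borel_measurable ?L"
  using u Ds by (simp add: sobolev_def square_integrable_def dom_measure_def borel_measurable_restrict_space_iff)
 have main: "\<forall>h. 0 < h \<longrightarrow> h \<le> h0 \<longrightarrow> (\<exists>\<delta> E A. 0 < \<delta> \<and> finite (E :: (int \<times> nat) set) \<and> real (card E) \<le> R' / h \<and>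
   (\<integral>\<^sup>+x. indicator D x * ennreal ((u x - (\<Sum>q\<in>PiE I (\<lambda>_. E). A q * (\<Prod>i\<in>I. grid_monomial \<delta> (q i) (x i))))\<^sup>2) \<partial>?L)
    \<le> ennreal (C * h powr (2 * k)))"
 proof (intro allI impI)
  fix h assume h: "0 < h" "h \<le> h0"
  define \<delta> where "\<delta> = h * c0 / 2"
  have \<delta>: "0 < \<delta>" "\<delta> \<le> h" using h c0 mult_left_le[of c0 h] by (simp_all add: \<delta>_def)
  define Zn where "Zn = \<lceil>R / \<delta>\<rceil>"
  define Z where "Z = {-Zn..Zn}"
  have Rd: "R / \<delta> > 0" using R \<delta> by simp
  then have Zn0: "Zn \<ge> 0" unfolding Zn_def by linarith
  define ZZ where "ZZ = PiE I (\<lambda>_. Z)"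
  have finZ: "finite Z" by (simp add: Z_def)
  have finZZ: "finite ZZ" unfolding ZZ_def by (rule finite_PiE[OF I]) (simp add: finZ)
  define Q where "Q z = {x \<in> D. \<forall>i\<in>I. \<lfloor>x i / \<delta>\<rfloor> = z i}" for z
  define S where "S z = {x \<in> D. \<forall>i\<in>I. \<bar>x i - \<delta> * of_int (z i)\<bar> \<le> 5 * h}" for z
  have flo: "\<lfloor>t / \<delta>\<rfloor> = a \<longleftrightarrow> \<delta> * of_int a \<le> t \<and> t < \<delta> * of_int a + \<delta>" for t a
   using \<delta> by (simp add: floor_eq_iff pos_le_divide_eq pos_divide_less_eq algebra_simps)
  have Qb: "Q z \<subseteq> PiE I (\<lambda>i. {\<delta> * of_int (z i)..<\<delta> * of_int (z i) + \<delta>})"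
   "Q z = D \<inter> PiE I (\<lambda>i. {\<delta> * of_int (z i)..<\<delta> * of_int (z i) + \<delta>})" for z
   using DX by (auto simp: Q_def flo PiE_def Pi_def)
  have bs: "PiE I (\<lambda>i. {\<delta> * of_int (z i)..<\<delta> * of_int (z i) + \<delta>}) \<in> sets ?L" for z
   by (rule sets_PiM_I_finite[OF I]) simp
  have Qs: "Q z \<in> sets ?L" for z unfolding Qb(2) using Ds bs by simp
  have Ss: "S z \<in> sets ?L" for z
  proof -
   have "S z = D \<inter> PiE I (\<lambda>i. {\<delta> * of_int (z i) - 5 * h..\<delta> * of_int (z i) + 5 * h})"
    using DX by (auto simp: S_def abs_le_iff PiE_def Pi_def)
   then show ?thesis using sets_PiM_I_finite[OF I, of "\<lambda>i. {\<delta> * of_int (z i) - 5 * h..\<delta> * of_int (z i) + 5 * h}" "\<lambda>_. lborel"] Ds by simp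
  qed
  have mQ: "emeasure ?L (Q z) \<le> ennreal ((h * c0) ^ N)" for z
  proof -
   have "emeasure ?L (Q z) \<le> emeasure ?L (PiE I (\<lambda>i. {\<delta> * of_int (z i)..<\<delta> * of_int (z i) + \<delta>}))"
    by (rule emeasure_mono[OF Qb(1) bs])
   also have "\<dots> = (\<Prod>i\<in>I. emeasure lborel {\<delta> * of_int (z i)..<\<delta> * of_int (z i) + \<delta>})"
    by (rule LI.measure_times) simp
   also have "\<dots> = ennreal (\<delta> ^ N)" using \<delta> by (simp add: N_def ennreal_power)
   also have "\<dots> \<le> ennreal ((h * c0) ^ N)" using \<delta> h c0 by (intro ennreal_leI power_mono) (simp_all add: \<delta>_def)
   finally show ?thesis .
  qed
  have "\<forall>z. \<exists>B. (\<integral>\<^sup>+x. indicator (Q z) x * ennreal ((u x - (\<Sum>a\<in>PiE I (\<lambda>_. {..p}). B a * monomial I a x))\<^sup>2) \<partial>?L) \<le>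
    ennreal (K * h powr (2 * k)) * (\<integral>\<^sup>+x. indicator (S z) x * W x \<partial>?L)"
  proof
   fix z
   show "\<exists>B. (\<integral>\<^sup>+x. indicator (Q z) x * ennreal ((u x - (\<Sum>a\<in>PiE I (\<lambda>_. {..p}). B a * monomial I a x))\<^sup>2) \<partial>?L) \<le>
    ennreal (K * h powr (2 * k)) * (\<integral>\<^sup>+x. indicator (S z) x * W x \<partial>?L)"
   proof (cases "Q z = {}")
    case True
    then show ?thesis by simp
   next
    case False
    then obtain x0 where x0: "x0 \<in> Q z" by blast
    have dQ: "\<forall>x\<in>Q z. \<forall>i\<in>I. \<bar>x i - x0 i\<bar> \<le> h * c0 / 2"
    proof (intro ballI)
     fix x i assume "x \<in> Q z" "i \<in> I"
     then have "\<lfloor>x i / \<delta>\<rfloor> = z i" "\<lfloor>x0 i / \<delta>\<rfloor> = z i" using x0 by (auto simp: Q_def)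
     then show "\<bar>x i - x0 i\<bar> \<le> h * c0 / 2" unfolding flo \<delta>_def[symmetric] by linarith
    qed
    have QD: "Q z \<subseteq> D" by (auto simp: Q_def)
    obtain P where P: "is_poly I p P" "(\<integral>\<^sup>+x. indicator (Q z) x * ennreal ((u x - P x)\<^sup>2) \<partial>?L) \<le>
     ennreal (K * h powr (2 * k)) * (\<integral>\<^sup>+x. indicator {x \<in> D. \<forall>i\<in>I. \<bar>x i - x0 i\<bar> \<le> 4 * h} x * W x \<partial>?L)"
     using cell[THEN spec, THEN spec, THEN spec, THEN mp, OF h(1), THEN mp, OF h(2), THEN mp, OF Qs, THEN mp, OF QD, THEN mp, OF x0, THEN mp, OF dQ, THEN mp, OF mQ]
     by (elim exE conjE) (rule that)
    obtain B where B: "\<forall>x. P x = (\<Sum>a\<in>PiE I (\<lambda>_. {..p}). B a * monomial I a x)"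
     using P(1) unfolding is_poly_def by (elim exE) (rule that)
    have "{x \<in> D. \<forall>i\<in>I. \<bar>x i - x0 i\<bar> \<le> 4 * h} \<subseteq> S z"
    proof
     fix x assume x: "x \<in> {x \<in> D. \<forall>i\<in>I. \<bar>x i - x0 i\<bar> \<le> 4 * h}"
     have "\<bar>x i - \<delta> * of_int (z i)\<bar> \<le> 5 * h" if "i \<in> I" for i
     proof -
      have "\<lfloor>x0 i / \<delta>\<rfloor> = z i" "\<bar>x i - x0 i\<bar> \<le> 4 * h" using x0 x that by (auto simp: Q_def)
      then show ?thesis unfolding flo using \<delta> by linarith
     qed
     then show "x \<in> S z" using x by (simp add: S_def)
    qed
    then have "(\<integral>\<^sup>+x. indicator {x \<in> D. \<forall>i\<in>I. \<bar>x i - x0 i\<bar> \<le> 4 * h} x * W x \<partial>?L) \<le> (\<integral>\<^sup>+x. indicator (S z) x * W x \<partial>?L)"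
     by (intro nn_integral_mono mult_right_mono) (auto simp: indicator_def)
    from order_trans[OF P(2) mult_left_mono[OF this]] show ?thesis
     unfolding B[rule_format] by (intro exI[of _ B]) simp
   qed
  qed
  from choice[OF this] obtain B where B: "\<forall>z. (\<integral>\<^sup>+x. indicator (Q z) x * ennreal ((u x - (\<Sum>a\<in>PiE I (\<lambda>_. {..p}). B z a * monomial I a x))\<^sup>2) \<partial>?L) \<le>
    ennreal (K * h powr (2 * k)) * (\<integral>\<^sup>+x. indicator (S z) x * W x \<partial>?L)" ..
  define P where "P z x = (\<Sum>a\<in>PiE I (\<lambda>_. {..p}). B z a * monomial I a x)" for z x
  have Pm: "P z \<in> borel_measurable ?L" for z
   by (rule is_poly_measurable[OF I, of p]) (auto simp: is_poly_def P_def)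
  define T where "T x = (\<Sum>q\<in>PiE I (\<lambda>_. Z \<times> {..p}). B (\<lambda>i\<in>I. fst (q i)) (\<lambda>i\<in>I. snd (q i)) * (\<Prod>i\<in>I. grid_monomial \<delta> (q i) (x i)))" for x
  have pt: "indicator D x * ennreal ((u x - T x)\<^sup>2) \<le> (\<Sum>z\<in>ZZ. indicator (Q z) x * ennreal ((u x - P z x)\<^sup>2))" for x
  proof (cases "x \<in> D")
   case True
   define z where "z = (\<lambda>i\<in>I. \<lfloor>x i / \<delta>\<rfloor>)"
   have zZ: "z \<in> ZZ" unfolding ZZ_def z_def
   proof (rule restrict_PiE_iff[THEN iffD2], intro ballI)
    fix i assume "i \<in> I"
    then have "\<bar>x i\<bar> \<le> R" using bd True by blast
    then have "\<bar>x i / \<delta>\<bar> \<le> R / \<delta>" using \<delta> by (simp add: abs_divide divide_right_mono)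
    then show "\<lfloor>x i / \<delta>\<rfloor> \<in> Z" unfolding Z_def Zn_def atLeastAtMost_iff by linarith
   qed
   have xz: "\<forall>i\<in>I. \<lfloor>x i / \<delta>\<rfloor> = z i" by (simp add: z_def)
   have "T x = P z x" unfolding T_def P_def by (rule grid_monomial_sum[OF I zZ[unfolded ZZ_def] finZ xz])
   moreover have "x \<in> Q z" using True xz by (simp add: Q_def)
   ultimately have "indicator D x * ennreal ((u x - T x)\<^sup>2) = indicator (Q z) x * ennreal ((u x - P z x)\<^sup>2)" using True by simp
   also have "\<dots> \<le> (\<Sum>z\<in>ZZ. indicator (Q z) x * ennreal ((u x - P z x)\<^sup>2))"
    by (rule member_le_sum[OF zZ]) (use finZZ in auto)
   finally show ?thesis .
  qed simp
  have ov: "(\<Sum>z\<in>ZZ. indicator (S z) x * W x) \<le> ennreal M * (indicator D x * W x)" for x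
  proof (cases "x \<in> D")
   case False
   then show ?thesis by (simp add: S_def)
  next
   case True
   have "(\<Sum>z\<in>ZZ. indicator (S z) x * W x) = (\<Sum>z\<in>ZZ. indicator (S z) x) * W x" by (simp add: sum_distrib_right)
   also have "(\<Sum>z\<in>ZZ. indicator (S z) x :: ennreal) = (\<Sum>z\<in>{z \<in> ZZ. x \<in> S z}. 1)"
    by (rule sum.mono_neutral_cong_right) (use finZZ in auto)
   also have "\<dots> = ennreal (real (card {z \<in> ZZ. x \<in> S z}))" by (simp add: ennreal_of_nat_eq_real_of_nat)
   also have "{z \<in> ZZ. x \<in> S z} = PiE I (\<lambda>i. {z \<in> Z. \<bar>x i - \<delta> * of_int z\<bar> \<le> 5 * h})"
    using True by (auto simp: ZZ_def S_def PiE_def Pi_def)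
   also have "ennreal (real (card (PiE I (\<lambda>i. {z \<in> Z. \<bar>x i - \<delta> * of_int z\<bar> \<le> 5 * h})))) \<le> ennreal M"
   proof (rule ennreal_leI)
    have "real (card (PiE I (\<lambda>i. {z \<in> Z. \<bar>x i - \<delta> * of_int z\<bar> \<le> 5 * h}))) = (\<Prod>i\<in>I. real (card {z \<in> Z. \<bar>x i - \<delta> * of_int z\<bar> \<le> 5 * h}))"
     by (simp add: card_PiE[OF I])
    also have "\<dots> \<le> (\<Prod>i\<in>I. 20 / c0 + 1)"
    proof (rule prod_mono, intro conjI)
     fix i
     have "2 * (5 * h) / \<delta> = 20 / c0" using h c0 by (simp add: \<delta>_def)
     then show "real (card {z \<in> Z. \<bar>x i - \<delta> * of_int z\<bar> \<le> 5 * h}) \<le> 20 / c0 + 1"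
      using card_near_grid_points[OF \<delta>(1) _ finZ, of "5 * h" "x i"] h by simp
    qed simp
    also have "\<dots> = M" by (simp add: M_def N_def)
    finally show "real (card (PiE I (\<lambda>i. {z \<in> Z. \<bar>x i - \<delta> * of_int z\<bar> \<le> 5 * h}))) \<le> M" .
   qed
   finally show ?thesis using True by (simp add: mult_right_mono)
  qed
  have Qm: "(\<lambda>x. indicator (Q z) x * ennreal ((u x - P z x)\<^sup>2)) \<in> borel_measurable ?L" for z
  proof -
   note [measurable] = Pm[of z] um Qs[of z]
   have "(\<lambda>x. indicator (Q z) x * ennreal ((indicator D x * u x - P z x)\<^sup>2)) \<in> borel_measurable ?L" by measurable
   moreover have "(\<lambda>x. indicator (Q z) x * ennreal ((indicator D x * u x - P z x)\<^sup>2)) = (\<lambda>x. indicator (Q z) x * ennreal ((u x - P z x)\<^sup>2))"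
    by (auto simp: fun_eq_iff Q_def indicator_def)
   ultimately show ?thesis by simp
  qed
  have Sm: "(\<lambda>x. indicator (S z) x * W x) \<in> borel_measurable ?L" for z
   using W(1) Ss[of z] by measurable
  have DWm: "(\<lambda>x. indicator D x * W x) \<in> borel_measurable ?L"
   using W(1) Ds by measurable
  have "(\<integral>\<^sup>+x. indicator D x * ennreal ((u x - T x)\<^sup>2) \<partial>?L) \<le> (\<integral>\<^sup>+x. (\<Sum>z\<in>ZZ. indicator (Q z) x * ennreal ((u x - P z x)\<^sup>2)) \<partial>?L)"
   by (rule nn_integral_mono) (rule pt)
  also have "\<dots> = (\<Sum>z\<in>ZZ. \<integral>\<^sup>+x. indicator (Q z) x * ennreal ((u x - P z x)\<^sup>2) \<partial>?L)" by (rule nn_integral_sum) (rule Qm)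
  also have "\<dots> \<le> (\<Sum>z\<in>ZZ. ennreal (K * h powr (2 * k)) * (\<integral>\<^sup>+x. indicator (S z) x * W x \<partial>?L))"
   unfolding P_def by (rule sum_mono) (rule B[rule_format])
  also have "\<dots> = ennreal (K * h powr (2 * k)) * (\<integral>\<^sup>+x. (\<Sum>z\<in>ZZ. indicator (S z) x * W x) \<partial>?L)"
   unfolding sum_distrib_left[symmetric] by (subst nn_integral_sum) (simp_all only: Sm)
  also have "\<dots> \<le> ennreal (K * h powr (2 * k)) * (\<integral>\<^sup>+x. ennreal M * (indicator D x * W x) \<partial>?L)"
   by (intro mult_left_mono nn_integral_mono ov) simp
  also have "\<dots> = ennreal (K * h powr (2 * k)) * (ennreal M * J)"
   unfolding J_def by (subst nn_integral_cmult[OF DWm]) simp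
  also have "J = ennreal (enn2real J)" using W(2) by (simp add: J_def)
  also have "ennreal (K * h powr (2 * k)) * (ennreal M * ennreal (enn2real J)) = ennreal (C * h powr (2 * k))"
   using K M0 by (simp add: C_def ennreal_mult[symmetric] mult_ac)
  finally have err: "(\<integral>\<^sup>+x. indicator D x * ennreal ((u x - T x)\<^sup>2) \<partial>?L) \<le> ennreal (C * h powr (2 * k))" .
  have card: "real (card (Z \<times> {..p})) \<le> R' / h"
  proof -
   have "real (card Z) = 2 * of_int Zn + 1" using Zn0 by (simp add: Z_def)
   also have "of_int Zn \<le> R / \<delta> + 1" unfolding Zn_def by (rule of_int_ceiling_le_add_one)
   also have "R / \<delta> = 2 * R / (c0 * h)" by (simp add: \<delta>_def mult.commute)
   also have "2 * (2 * R / (c0 * h) + 1) + 1 \<le> (4 * R / c0 + 3 * h0) / h"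
    using h c0 by (simp add: field_simps)
   finally have "real (card Z) \<le> (4 * R / c0 + 3 * h0) / h" by simp
   then have "real (card Z) * real (p + 1) \<le> (4 * R / c0 + 3 * h0) / h * real (p + 1)" by (rule mult_right_mono) simp
   moreover have "real (card (Z \<times> {..p})) = real (card Z) * real (p + 1)"
    unfolding card_cartesian_product by (simp only: card_atMost of_nat_mult Suc_eq_plus1)
   ultimately show ?thesis by (simp only: R'_def times_divide_eq_left)
  qed
  have finE: "finite (Z \<times> {..p})" using finZ by simp
  show "\<exists>\<delta> E A. 0 < \<delta> \<and> finite (E :: (int \<times> nat) set) \<and> real (card E) \<le> R' / h \<and>
   (\<integral>\<^sup>+x. indicator D x * ennreal ((u x - (\<Sum>q\<in>PiE I (\<lambda>_. E). A q * (\<Prod>i\<in>I. grid_monomial \<delta> (q i) (x i))))\<^sup>2) \<partial>?L)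
    \<le> ennreal (C * h powr (2 * k))"
   by (rule exI[of _ \<delta>], rule exI[of _ "Z \<times> {..p}"], rule exI[of _ "\<lambda>q. B (\<lambda>i\<in>I. fst (q i)) (\<lambda>i\<in>I. snd (q i))"])
    (intro conjI \<delta>(1) card finE err[unfolded T_def])
 qed
 have "0 \<le> C" "0 < R'" using K M0 R c0 h0 by (simp_all add: C_def R'_def add_pos_pos)
 with main show ?thesis by - (rule exI[of _ C], rule exI[of _ R'], intro conjI)
qed

section \<open>The product of the domains\<close>

lemma finite_common_bound:
 fixes P :: "'a \<Rightarrow> real \<Rightarrow> bool"
 assumes J: "finite J" and ex: "\<forall>j\<in>J. \<exists>d>0. P j d" and down: "\<And>j d d'. P j d \<Longrightarrow> 0 < d' \<Longrightarrow> d' \<le> d \<Longrightarrow> P j d'"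
 shows "\<exists>d>0. d \<le> 1 \<and> (\<forall>j\<in>J. P j d)"
proof -
 from bchoice[OF ex] obtain d where d: "\<forall>j\<in>J. 0 < d j \<and> P j (d j)" ..
 define e where "e = Min (insert 1 (d ` J))"
 have "e > 0" unfolding e_def using d J by (subst Min_gr_iff) auto
 moreover have "e \<le> 1" unfolding e_def using J by (intro Min_le) auto
 moreover have "e \<le> d j" if "j \<in> J" for j unfolding e_def using J that by (intro Min_le) auto
 ultimately show ?thesis using d down by (intro exI[of _ e]) blast
qed

lemma finite_flat_index: "finite (flat_index m n)"
 by (simp add: flat_index_def)

lemma mem_flat_domain:
 "x \<in> flat_domain m n \<Omega> \<longleftrightarrow>
  x \<in> flat_index m n \<rightarrow>\<^sub>E UNIV \<and> (\<forall>j\<in>{1..m}. (\<lambda>i\<in>{1..n j}. x (j, i)) \<in> \<Omega> j)"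
 by (auto simp: flat_domain_def blocks_def restrict_PiE_iff)

text \<open>Openness, the cone condition and boundedness pass from the factors to their product.\<close>
lemma sup_open_flat_domain:
 assumes "\<And>j. j \<in> {1..m} \<Longrightarrow> sup_open {1..n j} (\<Omega> j)"
 shows "sup_open (flat_index m n) (flat_domain m n \<Omega>)"
 unfolding sup_open_def
proof (intro conjI ballI)
 show "flat_domain m n \<Omega> \<subseteq> flat_index m n \<rightarrow>\<^sub>E UNIV" by (auto simp: flat_domain_def)
 fix x assume x: "x \<in> flat_domain m n \<Omega>"
 define P where "P j d \<longleftrightarrow> (\<forall>y\<in>{1..n j} \<rightarrow>\<^sub>E UNIV. (\<forall>i\<in>{1..n j}. \<bar>y i - x (j, i)\<bar> < d) \<longrightarrow> y \<in> \<Omega> j)" for j d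
 have "\<forall>j\<in>{1..m}. \<exists>d>0. P j d"
 proof
  fix j assume j: "j \<in> {1..m}"
  then have "(\<lambda>i\<in>{1..n j}. x (j, i)) \<in> \<Omega> j" using x by (simp add: mem_flat_domain)
  then obtain d where "d > 0" "\<forall>y\<in>{1..n j} \<rightarrow>\<^sub>E UNIV. (\<forall>i\<in>{1..n j}. \<bar>y i - (\<lambda>i\<in>{1..n j}. x (j, i)) i\<bar> < d) \<longrightarrow> y \<in> \<Omega> j"
   using assms[OF j] unfolding sup_open_def by blast
  then show "\<exists>d>0. P j d" unfolding P_def by (intro exI[of _ d]) simp
 qed
 moreover have "P j d'" if "P j d" "d' \<le> d" for j d d'
  using that unfolding P_def by (meson less_le_trans)
 ultimately obtain d where d: "d > 0" "\<forall>j\<in>{1..m}. P j d"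
  using finite_common_bound[of "{1..m}" P] by blast
 show "\<exists>d>0. \<forall>y\<in>flat_index m n \<rightarrow>\<^sub>E UNIV. (\<forall>i\<in>flat_index m n. \<bar>y i - x i\<bar> < d) \<longrightarrow> y \<in> flat_domain m n \<Omega>"
 proof (intro exI[of _ d] conjI d(1) ballI impI)
  fix y assume y: "y \<in> flat_index m n \<rightarrow>\<^sub>E UNIV" "\<forall>i\<in>flat_index m n. \<bar>y i - x i\<bar> < d"
  have "(\<lambda>i\<in>{1..n j}. y (j, i)) \<in> \<Omega> j" if j: "j \<in> {1..m}" for j
   using d(2)[rule_format, OF j] y(2) j unfolding P_def
   by (elim ballE[where x = "\<lambda>i\<in>{1..n j}. y (j, i)"]) (auto simp: flat_index_def)
  then show "y \<in> flat_domain m n \<Omega>" using y(1) by (simp add: mem_flat_domain)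
 qed
qed

lemma cone_condition_flat_domain:
 assumes cone: "\<And>j. j \<in> {1..m} \<Longrightarrow> \<exists>h0>0. \<exists>c0>0. cone_condition {1..n j} (\<Omega> j) h0 c0"
 shows "\<exists>h0>0. h0 \<le> 1 \<and> cone_condition (flat_index m n) (flat_domain m n \<Omega>) h0 h0"
proof -
 have "\<forall>j\<in>{1..m}. \<exists>h>0. cone_condition {1..n j} (\<Omega> j) h h"
 proof
  fix j assume "j \<in> {1..m}"
  then obtain h c where "h > 0" "c > 0" "cone_condition {1..n j} (\<Omega> j) h c" using cone by blast
  then show "\<exists>h>0. cone_condition {1..n j} (\<Omega> j) h h"
   by (intro exI[of _ "min h c"] conjI) (simp, rule cone_condition_mono, auto)
 qed
 moreover have "cone_condition {1..n j} (\<Omega> j) d' d'" if "cone_condition {1..n j} (\<Omega> j) d d" "d' \<le> d" for j d d'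
  by (rule cone_condition_mono[OF that that(2)])
 ultimately obtain h where h: "h > 0" "h \<le> 1" "\<forall>j\<in>{1..m}. cone_condition {1..n j} (\<Omega> j) h h"
  using finite_common_bound[of "{1..m}" "\<lambda>j h. cone_condition {1..n j} (\<Omega> j) h h"] by blast
 have "cone_condition (flat_index m n) (flat_domain m n \<Omega>) h h"
  unfolding cone_condition_def
 proof
  fix x assume x: "x \<in> flat_domain m n \<Omega>"
  define X where "X y j = (\<lambda>i\<in>{1..n j}. y (j, i))" for y :: "nat \<times> nat \<Rightarrow> real" and j
  define good where "good j e \<longleftrightarrow> (\<forall>i\<in>{1..n j}. \<bar>e i\<bar> \<le> 1) \<and>
   (\<forall>x'\<in>\<Omega> j. (\<forall>i\<in>{1..n j}. \<bar>x' i - X x j i\<bar> \<le> h) \<longrightarrow>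
    (\<forall>v t. (\<forall>i\<in>{1..n j}. \<bar>v i - e i\<bar> \<le> h) \<longrightarrow> 0 < t \<longrightarrow> t \<le> h \<longrightarrow> (\<lambda>i\<in>{1..n j}. x' i + t * v i) \<in> \<Omega> j))" for j and e :: "nat \<Rightarrow> real"
  have "\<forall>j\<in>{1..m}. \<exists>e. good j e"
  proof
   fix j assume j: "j \<in> {1..m}"
   then have "X x j \<in> \<Omega> j" using x by (simp add: mem_flat_domain X_def)
   then show "\<exists>e. good j e" using h(3) j unfolding cone_condition_def good_def by blast
  qed
  from bchoice[OF this] obtain e where e: "\<forall>j\<in>{1..m}. good j (e j)" ..
  define e' where "e' p = e (fst p) (snd p)" for p
  have "\<forall>i\<in>flat_index m n. \<bar>e' i\<bar> \<le> 1" using e by (auto simp: flat_index_def e'_def good_def)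
  moreover have "(\<lambda>i\<in>flat_index m n. x' i + t * v i) \<in> flat_domain m n \<Omega>"
   if x': "x' \<in> flat_domain m n \<Omega>" and near: "\<forall>i\<in>flat_index m n. \<bar>x' i - x i\<bar> \<le> h"
    and v: "\<forall>i\<in>flat_index m n. \<bar>v i - e' i\<bar> \<le> h" and t: "0 < t" "t \<le> h" for x' v t
  proof -
   have "(\<lambda>i\<in>{1..n j}. (\<lambda>i\<in>flat_index m n. x' i + t * v i) (j, i)) \<in> \<Omega> j" if j: "j \<in> {1..m}" for j
   proof -
    have fi: "(j, i) \<in> flat_index m n" if "i \<in> {1..n j}" for i using j that by (simp add: flat_index_def)
    have 1: "X x' j \<in> \<Omega> j" using x' j by (simp add: mem_flat_domain X_def)
    have 2: "\<forall>i\<in>{1..n j}. \<bar>X x' j i - X x j i\<bar> \<le> h" using near fi by (simp add: X_def)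
    have 3: "\<forall>i\<in>{1..n j}. \<bar>v (j, i) - e j i\<bar> \<le> h" using v fi by (force simp: e'_def)
    have "(\<lambda>i\<in>{1..n j}. X x' j i + t * v (j, i)) \<in> \<Omega> j"
     using e[rule_format, OF j, unfolded good_def, THEN conjunct2, rule_format, OF 1 2[rule_format] 3[rule_format] t] .
    also have "(\<lambda>i\<in>{1..n j}. X x' j i + t * v (j, i)) = (\<lambda>i\<in>{1..n j}. (\<lambda>i\<in>flat_index m n. x' i + t * v i) (j, i))"
     by (rule restrict_ext) (simp add: X_def fi)
    finally show ?thesis .
   qed
   then show ?thesis by (simp add: mem_flat_domain)
  qed
  ultimately show "\<exists>e. (\<forall>i\<in>flat_index m n. \<bar>e i\<bar> \<le> 1) \<and>
   (\<forall>x'\<in>flat_domain m n \<Omega>. (\<forall>i\<in>flat_index m n. \<bar>x' i - x i\<bar> \<le> h) \<longrightarrow>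
    (\<forall>v t. (\<forall>i\<in>flat_index m n. \<bar>v i - e i\<bar> \<le> h) \<longrightarrow> 0 < t \<longrightarrow> t \<le> h \<longrightarrow> (\<lambda>i\<in>flat_index m n. x' i + t * v i) \<in> flat_domain m n \<Omega>))"
   by (intro exI[of _ e']) blast
 qed
 then show ?thesis using h by blast
qed

lemma bounded_flat_domain:
 assumes "\<And>j. j \<in> {1..m} \<Longrightarrow> \<exists>R>0. \<forall>x\<in>\<Omega> j. \<forall>i\<in>{1..n j}. \<bar>x i\<bar> \<le> R"
 shows "\<exists>R>0. \<forall>x\<in>flat_domain m n \<Omega>. \<forall>i\<in>flat_index m n. \<bar>x i\<bar> \<le> R"
proof -
 have "\<forall>j\<in>{1..m}. \<exists>R>0. \<forall>x\<in>\<Omega> j. \<forall>i\<in>{1..n j}. \<bar>x i\<bar> \<le> R" using assms by blast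
 from bchoice[OF this] obtain R where R: "\<forall>j\<in>{1..m}. 0 < R j \<and> (\<forall>x\<in>\<Omega> j. \<forall>i\<in>{1..n j}. \<bar>x i\<bar> \<le> R j)" ..
 have "\<bar>x p\<bar> \<le> 1 + (\<Sum>j=1..m. R j)" if x: "x \<in> flat_domain m n \<Omega>" and p: "p \<in> flat_index m n" for x p
 proof -
  obtain j i where ji: "p = (j, i)" "j \<in> {1..m}" "i \<in> {1..n j}" using p by (auto simp: flat_index_def)
  have "(\<lambda>i\<in>{1..n j}. x (j, i)) \<in> \<Omega> j" using x ji by (simp add: mem_flat_domain)
  then have "\<bar>(\<lambda>i\<in>{1..n j}. x (j, i)) i\<bar> \<le> R j" using R ji by blast
  then have "\<bar>x p\<bar> \<le> R j" using ji by simp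
  also have "R j \<le> (\<Sum>j=1..m. R j)" by (rule member_le_sum) (use ji R in \<open>auto intro: less_imp_le\<close>)
  finally show ?thesis by simp
 qed
 moreover have "0 < 1 + (\<Sum>j=1..m. R j)" using R by (intro add_pos_nonneg sum_nonneg) (auto intro: less_imp_le)
 ultimately show ?thesis by blast
qed

lemma finite_measure_dom_measure:
 fixes D :: "('i \<Rightarrow> real) set"
 assumes I: "finite I" and D: "D \<in> sets (leb I)" and bd: "\<forall>x\<in>D. \<forall>i\<in>I. \<bar>x i\<bar> \<le> R"
 shows "finite_measure (dom_measure I D)"
proof
 interpret LI: finite_product_sigma_finite "\<lambda>_. lborel" I by standard (rule I)
 have Dsp: "D \<subseteq> space (leb I)" by (rule sets.sets_into_space[OF D])
 have sub: "D \<subseteq> PiE I (\<lambda>_. {-R..R})"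
  using bd Dsp by (force simp: space_PiM PiE_def Pi_def abs_le_iff)
 have "emeasure (leb I) D \<le> emeasure (leb I) (PiE I (\<lambda>_. {-R..R}))"
  by (rule emeasure_mono[OF sub]) (rule sets_PiM_I_finite[OF I], simp)
 also have "\<dots> = (\<Prod>i\<in>I. emeasure lborel {-R..R})" by (rule LI.measure_times) simp
 also have "\<dots> < \<infinity>" by (simp add: power_less_top_ennreal emeasure_lborel_Icc_eq)
 finally have "emeasure (leb I) D < \<infinity>" .
 moreover have "emeasure (dom_measure I D) (space (dom_measure I D)) = emeasure (leb I) D"
  unfolding dom_measure_def using D Dsp
  by (subst emeasure_restrict_space) (auto simp: space_restrict_space Int_absorb2)
 ultimately show "emeasure (dom_measure I D) (space (dom_measure I D)) \<noteq> \<infinity>" by simp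
qed

definition unblocks :: "nat \<Rightarrow> (nat \<Rightarrow> nat) \<Rightarrow> (nat \<Rightarrow> nat \<Rightarrow> real) \<Rightarrow> nat \<times> nat \<Rightarrow> real" where
 "unblocks m n y = (\<lambda>p\<in>flat_index m n. y (fst p) (snd p))"


lemma blocks_unblocks:
 assumes "y \<in> (\<Pi>\<^sub>E j\<in>{1..m}. {1..n j} \<rightarrow>\<^sub>E UNIV)"
 shows "blocks m n (unblocks m n y) = y"
proof
 fix j
 show "blocks m n (unblocks m n y) j = y j"
 proof (cases "j \<in> {1..m}")
  case True
  then have "y j \<in> {1..n j} \<rightarrow>\<^sub>E UNIV" using assms by blast
  then have "(\<lambda>i\<in>{1..n j}. y j i) = y j" by (auto simp: PiE_def extensional_def fun_eq_iff)
  moreover have "blocks m n (unblocks m n y) j = (\<lambda>i\<in>{1..n j}. y j i)"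
   using True by (simp add: blocks_def) (rule restrict_ext, simp add: unblocks_def flat_index_def)
  ultimately show ?thesis by simp
 next
  case False
  then show ?thesis using PiE_arb[OF assms False] False by (auto simp: blocks_def)
 qed
qed

text \<open>Both measures are determined by their values on boxes, where the product of the side lengths may be
 taken block by block.\<close>
lemma leb_flat_eq_distr:
 "leb (flat_index m n) = distr (\<Pi>\<^sub>M j\<in>{1..m}. leb {1..n j}) (leb (flat_index m n)) (unblocks m n)"
proof -
 let ?P = "\<Pi>\<^sub>M j\<in>{1..m}. leb {1..n j}" and ?I = "flat_index m n"
 interpret LI: finite_product_sigma_finite "\<lambda>_. lborel" ?I by standard (rule finite_flat_index)
 have sf: "sigma_finite_measure (leb {1..n j})" for j by (rule sigma_finite_leb) simp
 interpret P: product_sigma_finite "\<lambda>j. leb {1..n j}" by (rule product_sigma_finite.intro) (rule sf)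
 interpret PJ: finite_product_sigma_finite "\<lambda>j. leb {1..n j}" "{1..m}" by standard simp
 have meas: "unblocks m n \<in> measurable ?P (leb ?I)"
  unfolding unblocks_def
 proof (rule measurable_restrict)
  fix p assume p: "p \<in> ?I"
  then have "fst p \<in> {1..m}" "snd p \<in> {1..n (fst p)}" by (auto simp: flat_index_def)
  then show "(\<lambda>y. y (fst p) (snd p)) \<in> measurable ?P lborel"
   using measurable_compose[OF measurable_component_singleton[of "fst p" "{1..m}" "\<lambda>j. leb {1..n j}"] measurable_component_singleton[of "snd p" "{1..n (fst p)}" "\<lambda>_. lborel"]]
   by simp
 qed
 show ?thesis
 proof (rule LI.PiM_eqI[symmetric])
  fix A assume A: "\<And>i. i \<in> ?I \<Longrightarrow> A i \<in> sets (lborel :: real measure)"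
  have As: "PiE ?I A \<in> sets (leb ?I)" by (rule sets_PiM_I_finite[OF finite_flat_index]) (rule A)
  have pre: "unblocks m n -` PiE ?I A \<inter> space ?P = (\<Pi>\<^sub>E j\<in>{1..m}. \<Pi>\<^sub>E i\<in>{1..n j}. A (j, i))"
  proof -
   have u: "unblocks m n y \<in> PiE ?I A \<longleftrightarrow> (\<forall>j\<in>{1..m}. \<forall>i\<in>{1..n j}. y j i \<in> A (j, i))" for y
    unfolding unblocks_def restrict_PiE_iff flat_index_def by auto
   show ?thesis
   proof (rule set_eqI)
    fix y
    show "y \<in> unblocks m n -` PiE ?I A \<inter> space ?P \<longleftrightarrow> y \<in> (\<Pi>\<^sub>E j\<in>{1..m}. \<Pi>\<^sub>E i\<in>{1..n j}. A (j, i))"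
     unfolding vimage_def Int_iff mem_Collect_eq u space_PiM by (auto simp: PiE_def Pi_def)
   qed
  qed
  have "emeasure (distr ?P (leb ?I) (unblocks m n)) (PiE ?I A) = emeasure ?P (\<Pi>\<^sub>E j\<in>{1..m}. \<Pi>\<^sub>E i\<in>{1..n j}. A (j, i))"
   unfolding emeasure_distr[OF meas As] pre ..
  also have "\<dots> = (\<Prod>j\<in>{1..m}. emeasure (leb {1..n j}) (\<Pi>\<^sub>E i\<in>{1..n j}. A (j, i)))"
   by (rule PJ.measure_times) (rule sets_PiM_I_finite, simp, rule A, simp add: flat_index_def)
  also have "\<dots> = (\<Prod>j\<in>{1..m}. \<Prod>i\<in>{1..n j}. emeasure lborel (A (j, i)))"
  proof (rule prod.cong[OF refl])
   fix j assume j: "j \<in> {1..m}"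
   interpret N: finite_product_sigma_finite "\<lambda>_. lborel" "{1..n j}" by standard simp
   show "emeasure (leb {1..n j}) (\<Pi>\<^sub>E i\<in>{1..n j}. A (j, i)) = (\<Prod>i\<in>{1..n j}. emeasure lborel (A (j, i)))"
    by (rule N.measure_times) (rule A, use j in \<open>simp add: flat_index_def\<close>)
  qed
  also have "\<dots> = (\<Prod>p\<in>?I. emeasure lborel (A p))"
   unfolding flat_index_def by (subst prod.Sigma) (auto simp: case_prod_beta')
  finally show "emeasure (distr ?P (leb ?I) (unblocks m n)) (PiE ?I A) = (\<Prod>i\<in>?I. emeasure lborel (A i))" .
 qed (simp_all add: finite_flat_index)
qed

text \<open>Hence the product measure on the product of the domains is the image of Lebesgue measure on the
 flat domain.\<close>
lemma prod_measure_eq_distr: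
 assumes \<Omega>: "\<And>j. \<Omega> j \<in> sets (leb {1..n j})" and fin: "\<And>j. finite_measure (block_measure n \<Omega> j)"
  and D: "flat_domain m n \<Omega> \<in> sets (leb (flat_index m n))"
 shows "prod_measure m n \<Omega> = distr (dom_measure (flat_index m n) (flat_domain m n \<Omega>)) (prod_measure m n \<Omega>) (blocks m n)"
  and "blocks m n \<in> measurable (dom_measure (flat_index m n) (flat_domain m n \<Omega>)) (prod_measure m n \<Omega>)"
  and "unblocks m n \<in> measurable (prod_measure m n \<Omega>) (dom_measure (flat_index m n) (flat_domain m n \<Omega>))"
proof -
 let ?I = "flat_index m n" and ?D = "flat_domain m n \<Omega>"
 let ?M = "dom_measure ?I ?D" and ?P = "\<Pi>\<^sub>M j\<in>{1..m}. leb {1..n j}" and ?Q = "prod_measure m n \<Omega>"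
 interpret F: finite_measure "block_measure n \<Omega> j" for j by (rule fin)
 interpret B: product_sigma_finite "block_measure n \<Omega>" by unfold_locales
 have sf: "sigma_finite_measure (leb {1..n j})" for j by (rule sigma_finite_leb) simp
 interpret P: product_sigma_finite "\<lambda>j. leb {1..n j}" by (rule product_sigma_finite.intro) (rule sf)
 interpret PJ: finite_product_sigma_finite "\<lambda>j. leb {1..n j}" "{1..m}" by standard simp
 have sp: "space (block_measure n \<Omega> j) = \<Omega> j" for j
  using sets.sets_into_space[OF \<Omega>] by (auto simp: block_measure_def dom_measure_def space_restrict_space)
 have spQ: "space ?Q = (\<Pi>\<^sub>E j\<in>{1..m}. \<Omega> j)" by (simp add: prod_measure_def space_PiM sp)
 have \<Omega>X: "\<Omega> j \<subseteq> {1..n j} \<rightarrow>\<^sub>E UNIV" for j using sets.sets_into_space[OF \<Omega>[of j]] by (simp add: space_PiM)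
 have bu: "blocks m n (unblocks m n y) = y" if "y \<in> space ?Q" for y
  by (rule blocks_unblocks) (use that \<Omega>X in \<open>force simp: spQ PiE_def Pi_def\<close>)
 have spM: "space ?M = ?D" using sets.sets_into_space[OF D] by (auto simp: dom_measure_def space_restrict_space)
 have blD: "blocks m n x \<in> (\<Pi>\<^sub>E j\<in>{1..m}. \<Omega> j)" if "x \<in> space ?M" for x
  using that unfolding spM by (simp add: flat_domain_def)
 have cm: "(\<lambda>x. x p) \<in> borel_measurable ?M" if "p \<in> ?I" for p
  unfolding dom_measure_def using measurable_component_singleton[OF that, of "\<lambda>_. lborel"]
  by (intro measurable_restrict_space1) simp
 show bm: "blocks m n \<in> measurable ?M ?Q"
  unfolding prod_measure_def
 proof (rule measurable_PiM_single')
  fix j assume j: "j \<in> {1..m}"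
  have "(\<lambda>x. blocks m n x j) \<in> measurable ?M (leb {1..n j})"
  proof -
   have "(\<lambda>x. \<lambda>i\<in>{1..n j}. x (j, i)) \<in> measurable ?M (leb {1..n j})"
    by (rule measurable_restrict) (use cm j in \<open>auto simp: flat_index_def\<close>)
   moreover have "(\<lambda>x. blocks m n x j) = (\<lambda>x. \<lambda>i\<in>{1..n j}. x (j, i))" using j by (simp add: blocks_def)
   ultimately show ?thesis by (simp only:)
  qed
  moreover have "(\<lambda>x. blocks m n x j) \<in> space ?M \<rightarrow> \<Omega> j" using blD j by blast
  ultimately show "(\<lambda>x. blocks m n x j) \<in> measurable ?M (block_measure n \<Omega> j)"
   unfolding block_measure_def dom_measure_def[of "{1..n j}"] by (intro measurable_restrict_space2) auto
 next
  show "blocks m n \<in> space ?M \<rightarrow> (\<Pi>\<^sub>E j\<in>{1..m}. space (block_measure n \<Omega> j))" unfolding sp using blD by blast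
 qed
 have cb: "(\<lambda>x. x i) \<in> borel_measurable (block_measure n \<Omega> j)" if "i \<in> {1..n j}" for i j
  unfolding block_measure_def dom_measure_def using measurable_component_singleton[OF that, of "\<lambda>_. lborel"]
  by (intro measurable_restrict_space1) simp
 show um: "unblocks m n \<in> measurable ?Q ?M"
  unfolding dom_measure_def
 proof (rule measurable_restrict_space2)
  show "unblocks m n \<in> space ?Q \<rightarrow> ?D"
  proof
   fix y assume y: "y \<in> space ?Q"
   then show "unblocks m n y \<in> ?D" using bu[OF y] unfolding flat_domain_def spQ by (simp add: unblocks_def)
  qed
  show "unblocks m n \<in> measurable ?Q (leb ?I)"
   unfolding unblocks_def prod_measure_def
  proof (rule measurable_restrict)
   fix p assume p: "p \<in> ?I"
   then have p': "fst p \<in> {1..m}" "snd p \<in> {1..n (fst p)}" by (auto simp: flat_index_def)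
   show "(\<lambda>y. y (fst p) (snd p)) \<in> measurable (PiM {1..m} (block_measure n \<Omega>)) lborel"
    using measurable_compose[OF measurable_component_singleton[of "fst p" "{1..m}" "block_measure n \<Omega>", OF p'(1)] cb[OF p'(2)]] by simp
  qed
 qed
 show "?Q = distr ?M ?Q (blocks m n)"
  unfolding prod_measure_def
 proof (rule B.PiM_eqI[symmetric])
  fix A assume A: "\<And>j. j \<in> {1..m} \<Longrightarrow> A j \<in> sets (block_measure n \<Omega> j)"
  have A': "A j \<in> sets (leb {1..n j})" "A j \<subseteq> \<Omega> j"
   "emeasure (leb {1..n j}) (A j) = emeasure (block_measure n \<Omega> j) (A j)" if j: "j \<in> {1..m}" for j
  proof -
   show 1: "A j \<subseteq> \<Omega> j" using sets.sets_into_space[OF A[OF j]] sp by simp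
   show "A j \<in> sets (leb {1..n j})"
    using A[OF j] \<Omega> unfolding block_measure_def dom_measure_def by (subst (asm) sets_restrict_space_iff) auto
   show "emeasure (leb {1..n j}) (A j) = emeasure (block_measure n \<Omega> j) (A j)"
    unfolding block_measure_def dom_measure_def using 1 \<Omega>
    by (subst emeasure_restrict_space) auto
  qed
  define X where "X = blocks m n -` PiE {1..m} A \<inter> space ?M"
  have pm: "PiE {1..m} A \<in> sets (PiM {1..m} (block_measure n \<Omega>))" by (rule sets_PiM_I_finite) (use A in auto)
  have Xm: "X \<in> sets ?M" unfolding X_def using bm pm unfolding prod_measure_def by (rule measurable_sets)
  then have Xl: "X \<in> sets (leb ?I)" "X \<subseteq> ?D"
   using D sets.sets_into_space[OF Xm] spM unfolding dom_measure_def by (auto simp: sets_restrict_space_iff)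
  have meas: "unblocks m n \<in> measurable ?P (leb ?I)"
   unfolding unblocks_def
  proof (rule measurable_restrict)
   fix p assume p: "p \<in> ?I"
   then have "fst p \<in> {1..m}" "snd p \<in> {1..n (fst p)}" by (auto simp: flat_index_def)
   then show "(\<lambda>y. y (fst p) (snd p)) \<in> measurable ?P lborel"
    using measurable_compose[OF measurable_component_singleton[of "fst p" "{1..m}" "\<lambda>j. leb {1..n j}"] measurable_component_singleton[of "snd p" "{1..n (fst p)}" "\<lambda>_. lborel"]]
    by simp
  qed
  have pre: "unblocks m n -` X \<inter> space ?P = PiE {1..m} A"
  proof
   show "unblocks m n -` X \<inter> space ?P \<subseteq> PiE {1..m} A"
   proof
    fix y assume y: "y \<in> unblocks m n -` X \<inter> space ?P"
    then have "blocks m n (unblocks m n y) = y" by (intro blocks_unblocks) (auto simp: space_PiM)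
    then show "y \<in> PiE {1..m} A" using y by (simp add: X_def)
   qed
   show "PiE {1..m} A \<subseteq> unblocks m n -` X \<inter> space ?P"
   proof
    fix y assume y: "y \<in> PiE {1..m} A"
    have yQ: "y \<in> space ?Q" using y A'(2) unfolding spQ by (auto simp: PiE_def Pi_def)
    have "unblocks m n y \<in> space ?M" using measurable_space[OF um yQ] .
    moreover have "(\<Pi>\<^sub>E j\<in>{1..m}. \<Omega> j) \<subseteq> space ?P"
     by (subst space_PiM, intro PiE_mono sets.sets_into_space \<Omega>)
    moreover from this have "y \<in> space ?P" using yQ unfolding spQ by (rule subsetD)
    ultimately show "y \<in> unblocks m n -` X \<inter> space ?P" using bu[OF yQ] y unfolding X_def by simp
   qed
  qed
  have "emeasure (distr ?M (PiM {1..m} (block_measure n \<Omega>)) (blocks m n)) (PiE {1..m} A) = emeasure ?M X"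
   unfolding X_def using bm pm unfolding prod_measure_def by (rule emeasure_distr)
  also have "\<dots> = emeasure (leb ?I) X"
   unfolding dom_measure_def using Xl D by (subst emeasure_restrict_space) auto
  also have "\<dots> = emeasure (distr ?P (leb ?I) (unblocks m n)) X" unfolding leb_flat_eq_distr[symmetric] ..
  also have "\<dots> = emeasure ?P (PiE {1..m} A)" unfolding emeasure_distr[OF meas Xl(1)] pre ..
  also have "\<dots> = (\<Prod>j\<in>{1..m}. emeasure (leb {1..n j}) (A j))" by (rule PJ.measure_times) (rule A'(1))
  also have "\<dots> = (\<Prod>j\<in>{1..m}. emeasure (block_measure n \<Omega> j) (A j))" by (intro prod.cong refl A'(3))
  finally show "emeasure (distr ?M (PiM {1..m} (block_measure n \<Omega>)) (blocks m n)) (PiE {1..m} A) =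
    (\<Prod>j\<in>{1..m}. emeasure (block_measure n \<Omega> j) (A j))" .
 qed simp_all
qed

section \<open>From approximation rates to decay of the eigenvalues\<close>

text \<open>An approximation rate for functions of finite rank is turned into one for the truncated singular
 value decomposition.  For large \<open>\<epsilon>\<close>, where the mesh width would exceed \<open>h0\<close>, the trivial bound by
 the norm suffices.\<close>
lemma (in eigen_pair) lam_tail_bound:
 fixes N :: nat and h0 R C k :: real
 assumes approx: "\<forall>h. 0 < h \<longrightarrow> h \<le> h0 \<longrightarrow> (\<exists>(S :: 's set) \<psi> G. finite S \<and> real (card S) \<le> (R / h) ^ N \<and>
   (\<forall>b\<in>S. L2 M1 (\<psi> b)) \<and> (\<forall>b\<in>S. L2 M2 (G b)) \<and>
   (\<integral>z. (F z - (\<Sum>b\<in>S. \<psi> b (fst z) * G b (snd z)))\<^sup>2 \<partial>M12) \<le> C * h powr (2 * k))"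
  and pos: "0 < h0" "0 < R" "0 \<le> C" "0 < k"
 defines "V \<equiv> \<integral>z. (F z)\<^sup>2 \<partial>M12"
 shows "(\<lambda>i. lam (r + 1 + i)) sums (V - (\<Sum>\<alpha>=1..r. lam \<alpha>))"
  and "0 < \<epsilon> \<Longrightarrow> \<epsilon> powr (- real N / k) \<le> real r \<Longrightarrow>
   (\<Sum>i. lam (r + 1 + i)) \<le> (C * R powr (2 * k) + V / (h0 / R) powr (2 * k)) * \<epsilon>\<^sup>2"
proof -
 have sV: "(\<lambda>i. lam (Suc i)) sums V"
  unfolding V_def
 proof (rule lam_sums_norm)
  fix d :: real assume d: "d > 0"
  define h where "h = min h0 ((d / (C + 1)) powr (1 / (2 * k)))"
  have h: "0 < h" "h \<le> h0" using pos d by (simp_all add: h_def)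
  obtain S :: "'s set" and \<psi> G where S: "finite S" "\<forall>b\<in>S. L2 M1 (\<psi> b)" "\<forall>b\<in>S. L2 M2 (G b)"
   "(\<integral>z. (F z - (\<Sum>b\<in>S. \<psi> b (fst z) * G b (snd z)))\<^sup>2 \<partial>M12) \<le> C * h powr (2 * k)"
   using approx[rule_format, OF h] by (elim exE conjE) (rule that)
  have "h powr (2 * k) \<le> ((d / (C + 1)) powr (1 / (2 * k))) powr (2 * k)"
   using h pos by (intro powr_mono2) (simp_all add: h_def)
  also have "\<dots> = d / (C + 1)" using pos d by (simp add: powr_powr)
  finally have "C * h powr (2 * k) \<le> C * (d / (C + 1))" using pos by (intro mult_left_mono)
  also have "\<dots> \<le> d" using pos d by (simp add: field_simps)
  finally have "(\<integral>z. (F z - (\<Sum>b\<in>S. \<psi> b (fst z) * G b (snd z)))\<^sup>2 \<partial>M12) \<le> d" using S(4) by linarith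
  then show "\<exists>(S :: 's set) \<psi> G. finite S \<and> (\<forall>b\<in>S. L2 M1 (\<psi> b)) \<and> (\<forall>b\<in>S. L2 M2 (G b)) \<and>
   (\<integral>z. (F z - (\<Sum>b\<in>S. \<psi> b (fst z) * G b (snd z)))\<^sup>2 \<partial>M12) \<le> d"
   using S by - (rule exI[of _ S], rule exI[of _ \<psi>], rule exI[of _ G], intro conjI)
 qed
 have V0: "V \<ge> 0" unfolding V_def by simp
 have ini: "(\<Sum>\<alpha>=1..r. lam \<alpha>) = (\<Sum>i<r. lam (Suc i))" for r
  using sum.atLeast1_atMost_eq[of lam r] by simp
 show tail: "(\<lambda>i. lam (r + 1 + i)) sums (V - (\<Sum>\<alpha>=1..r. lam \<alpha>))" for r
 proof -
  have "(\<lambda>i. lam (Suc (i + r))) sums (V - (\<Sum>i<r. lam (Suc i)))"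
   using sV by (intro sums_iff_shift[THEN iffD2]) simp
  then show ?thesis unfolding ini by (simp add: add.commute)
 qed
 assume \<epsilon>: "0 < \<epsilon>" and r: "\<epsilon> powr (- real N / k) \<le> real r"
 define \<epsilon>0 where "\<epsilon>0 = (h0 / R) powr k"
 have \<epsilon>0: "\<epsilon>0 > 0" using pos by (simp add: \<epsilon>0_def)
 have e02: "(h0 / R) powr (2 * k) = \<epsilon>0\<^sup>2"
  unfolding \<epsilon>0_def by (simp add: power2_eq_square flip: powr_add)
 have t1: "0 \<le> C * R powr (2 * k)" "0 \<le> V / (h0 / R) powr (2 * k)" using pos V0 by simp_all
 show "(\<Sum>i. lam (r + 1 + i)) \<le> (C * R powr (2 * k) + V / (h0 / R) powr (2 * k)) * \<epsilon>\<^sup>2"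
 proof (cases "\<epsilon> \<le> \<epsilon>0")
  case True
  (* This width makes (R / h) ^ N equal to \<epsilon> powr (- N / k), which r dominates. *)
  define h where "h = R * \<epsilon> powr (1 / k)"
  have h0': "0 < h" using pos \<epsilon> by (simp add: h_def)
  have "\<epsilon> powr (1 / k) \<le> \<epsilon>0 powr (1 / k)" using True \<epsilon> pos by (intro powr_mono2) simp_all
  also have "\<dots> = h0 / R" using pos by (simp add: \<epsilon>0_def powr_powr)
  finally have h: "h \<le> h0" using pos by (simp add: h_def pos_le_divide_eq mult.commute)
  obtain S :: "'s set" and \<psi> G where S: "finite S" "real (card S) \<le> (R / h) ^ N"
   "\<forall>b\<in>S. L2 M1 (\<psi> b)" "\<forall>b\<in>S. L2 M2 (G b)"
   "(\<integral>z. (F z - (\<Sum>b\<in>S. \<psi> b (fst z) * G b (snd z)))\<^sup>2 \<partial>M12) \<le> C * h powr (2 * k)"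
   using approx[rule_format, OF h0' h] by (elim exE conjE) (rule that)
  have "R / h = \<epsilon> powr (- 1 / k)" using pos \<epsilon> by (simp add: h_def powr_minus_divide)
  then have "(R / h) ^ N = \<epsilon> powr (- real N / k)" using \<epsilon> by (simp add: powr_realpow[symmetric] powr_powr)
  then have cS: "card S \<le> r" using S(2) r by linarith
  have eq: "h powr (2 * k) = R powr (2 * k) * \<epsilon>\<^sup>2"
   using pos \<epsilon> by (simp add: h_def powr_mult powr_powr)
  have "(\<Sum>i. lam (r + 1 + i)) \<le> C * h powr (2 * k)"
  proof (rule suminf_le_const)
   show "summable (\<lambda>i. lam (r + 1 + i))" using tail by (rule sums_summable)
   fix N'
   have "(\<Sum>i<N'. lam (r + 1 + i)) = (\<Sum>\<alpha>=Suc r..r + N'. lam \<alpha>)"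
    by (rule sum.reindex_bij_witness[of _ "\<lambda>\<alpha>. \<alpha> - Suc r" "\<lambda>i. r + 1 + i"]) auto
   also have "\<dots> \<le> (\<integral>z. (F z - (\<Sum>b\<in>S. \<psi> b (fst z) * G b (snd z)))\<^sup>2 \<partial>M12)"
    by (rule finite_rank_lower_bound[OF S(1) cS]) (use S in auto)
   finally show "(\<Sum>i<N'. lam (r + 1 + i)) \<le> C * h powr (2 * k)" using S(5) by linarith
  qed
  also have "\<dots> = C * R powr (2 * k) * \<epsilon>\<^sup>2" by (simp add: eq)
  also have "\<dots> \<le> (C * R powr (2 * k) + V / (h0 / R) powr (2 * k)) * \<epsilon>\<^sup>2"
   using t1 by (intro mult_right_mono) simp_all
  finally show ?thesis .
 next
  case False
  have "(\<Sum>i. lam (r + 1 + i)) = V - (\<Sum>\<alpha>=1..r. lam \<alpha>)" using tail by (rule sums_unique[symmetric])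
  also have "\<dots> \<le> V" using sum_nonneg[of "{1..r}" lam] lam_nonneg by simp
  also have "V = V / \<epsilon>0\<^sup>2 * \<epsilon>0\<^sup>2" using \<epsilon>0 by simp
  also have "\<dots> \<le> V / \<epsilon>0\<^sup>2 * \<epsilon>\<^sup>2" using False \<epsilon>0 V0 by (intro mult_left_mono power_mono) simp_all
  also have "\<dots> \<le> (C * R powr (2 * k) + V / (h0 / R) powr (2 * k)) * \<epsilon>\<^sup>2"
   unfolding e02 using t1 by (intro mult_right_mono) simp_all
  finally show ?thesis .
 qed
qed

lemma (in finite_measure) L2_prod_bounded:
 assumes K: "finite K" and \<eta>: "\<And>q. \<eta> q \<in> borel_measurable borel" "\<And>q. \<exists>b. \<forall>t. \<bar>\<eta> q t\<bar> \<le> (b::real)"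
  and c: "\<And>p. p \<in> K \<Longrightarrow> c p \<in> borel_measurable M"
 shows "L2 M (\<lambda>y. \<Prod>p\<in>K. \<eta> (s p) (c p y) :: real)"
proof -
 have "\<forall>q. \<exists>b. \<forall>t. \<bar>\<eta> q t\<bar> \<le> b" using \<eta>(2) by blast
 from choice[OF this] obtain \<beta> where \<beta>: "\<forall>q. \<forall>t. \<bar>\<eta> q t\<bar> \<le> \<beta> q" ..
 show ?thesis
 proof (rule L2_bounded)
  show "(\<lambda>y. \<Prod>p\<in>K. \<eta> (s p) (c p y)) \<in> borel_measurable M"
   by (intro borel_measurable_prod measurable_compose[OF c \<eta>(1)])
  show "\<bar>\<Prod>p\<in>K. \<eta> (s p) (c p y)\<bar> \<le> (\<Prod>p\<in>K. \<beta> (s p))" for y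
   unfolding abs_prod by (rule prod_mono) (simp add: \<beta>)
 qed
qed

text \<open>Sorting the terms of a sum of products of one-dimensional functions by their factors in the
 coordinates of block \<open>j\<close>.\<close>
lemma sum_prod_group_by_block:
 fixes \<eta> :: "'q \<Rightarrow> real \<Rightarrow> real"
 assumes j: "j \<in> {1..m}" and E: "finite E"
 shows "(\<Sum>q\<in>PiE (flat_index m n) (\<lambda>_. E). A q * (\<Prod>p\<in>flat_index m n. \<eta> (q p) ((y(j := x)) (fst p) (snd p)))) =
  (\<Sum>b\<in>PiE {1..n j} (\<lambda>_. E). (\<Prod>i\<in>{1..n j}. \<eta> (b i) (x i)) *
   (\<Sum>q\<in>{q \<in> PiE (flat_index m n) (\<lambda>_. E). (\<lambda>i\<in>{1..n j}. q (j, i)) = b}.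
    A q * (\<Prod>p\<in>{p \<in> flat_index m n. fst p \<noteq> j}. \<eta> (q p) (y (fst p) (snd p)))))"
proof -
 let ?I = "flat_index m n"
 define res where "res q = (\<lambda>i\<in>{1..n j}. q (j, i))" for q :: "nat \<times> nat \<Rightarrow> 'q"
 define Q where "Q = PiE ?I (\<lambda>_. E)"
 define T where "T q = A q * (\<Prod>p\<in>?I. \<eta> (q p) ((y(j := x)) (fst p) (snd p)))" for q
 have fQ: "finite Q" unfolding Q_def by (rule finite_PiE[OF finite_flat_index]) (rule E)
 have fT: "finite (PiE {1..n j} (\<lambda>_. E))" by (rule finite_PiE) (simp_all add: E)
 have im: "res ` Q \<subseteq> PiE {1..n j} (\<lambda>_. E)"
  using j by (auto simp: res_def Q_def flat_index_def)
 have split: "(\<Prod>p\<in>?I. \<eta> (q p) ((y(j := x)) (fst p) (snd p))) =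
   (\<Prod>i\<in>{1..n j}. \<eta> (res q i) (x i)) * (\<Prod>p\<in>{p \<in> ?I. fst p \<noteq> j}. \<eta> (q p) (y (fst p) (snd p)))" for q
 proof -
  define g where "g p = \<eta> (q p) ((y(j := x)) (fst p) (snd p))" for p
  have "prod g ?I = prod g {p \<in> ?I. fst p = j} * prod g {p \<in> ?I. fst p \<noteq> j}"
   by (subst prod.union_disjoint[symmetric]) (auto simp: finite_flat_index intro!: prod.cong)
  also have "prod g {p \<in> ?I. fst p = j} = (\<Prod>i\<in>{1..n j}. \<eta> (res q i) (x i))"
   by (rule prod.reindex_bij_witness[of _ "\<lambda>i. (j, i)" snd]) (use j in \<open>auto simp: flat_index_def g_def res_def\<close>)
  also have "prod g {p \<in> ?I. fst p \<noteq> j} = (\<Prod>p\<in>{p \<in> ?I. fst p \<noteq> j}. \<eta> (q p) (y (fst p) (snd p)))"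
   by (rule prod.cong) (auto simp: g_def)
  finally show ?thesis unfolding g_def .
 qed
 have "(\<Sum>q\<in>Q. T q) = (\<Sum>b\<in>PiE {1..n j} (\<lambda>_. E). \<Sum>q\<in>{q \<in> Q. res q = b}. T q)"
  by (rule sum.group[symmetric, OF fQ fT im])
 also have "\<dots> = (\<Sum>b\<in>PiE {1..n j} (\<lambda>_. E). (\<Prod>i\<in>{1..n j}. \<eta> (b i) (x i)) *
   (\<Sum>q\<in>{q \<in> Q. res q = b}. A q * (\<Prod>p\<in>{p \<in> ?I. fst p \<noteq> j}. \<eta> (q p) (y (fst p) (snd p)))))"
  unfolding sum_distrib_left T_def split
  by (intro sum.cong refl) (simp add: mult_ac)
 finally show ?thesis unfolding T_def Q_def res_def .
qed

text \<open>After sorting, each combination of factors in block \<open>j\<close> occurs once, with a coefficient that depends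
 on the other blocks; the number of combinations bounds the rank.\<close>
lemma mode_finite_rank_approximation:
 fixes \<eta> :: "'q \<Rightarrow> real \<Rightarrow> real"
 assumes \<Omega>: "\<And>j. \<Omega> j \<in> sets (leb {1..n j})" and fin: "\<And>j. finite_measure (block_measure n \<Omega> j)"
  and D: "flat_domain m n \<Omega> \<in> sets (leb (flat_index m n))"
  and f: "L2 (prod_measure m n \<Omega>) f" and j: "j \<in> {1..m}"
  and \<eta>: "\<And>q. \<eta> q \<in> borel_measurable borel" "\<And>q. \<exists>b. \<forall>t. \<bar>\<eta> q t\<bar> \<le> b"
  and E: "finite E" and d: "0 \<le> d"
  and err: "(\<integral>\<^sup>+x. indicator (flat_domain m n \<Omega>) x * ennreal ((f (blocks m n x) -
    (\<Sum>q\<in>PiE (flat_index m n) (\<lambda>_. E). A q * (\<Prod>p\<in>flat_index m n. \<eta> (q p) (x p))))\<^sup>2) \<partial>leb (flat_index m n)) \<le> ennreal d"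
 shows "\<exists>(S :: (nat \<Rightarrow> 'q) set) \<psi> G. finite S \<and> card S = card E ^ n j \<and>
  (\<forall>b\<in>S. L2 (block_measure n \<Omega> j) (\<psi> b)) \<and>
  (\<forall>b\<in>S. L2 (PiM ({1..m} - {j}) (block_measure n \<Omega>)) (G b)) \<and>
  (\<integral>z. (finite_product.slice j f z - (\<Sum>b\<in>S. \<psi> b (fst z) * G b (snd z)))\<^sup>2
    \<partial>(block_measure n \<Omega> j \<Otimes>\<^sub>M PiM ({1..m} - {j}) (block_measure n \<Omega>))) \<le> d"
proof -
 let ?I = "flat_index m n" and ?D = "flat_domain m n \<Omega>" and ?M = "block_measure n \<Omega>" and ?Q = "prod_measure m n \<Omega>"
 interpret B: finite_measure "?M i" for i by (rule fin)
 interpret FP: finite_product ?M "{1..m}" by unfold_locales (simp_all add: fin)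
 have Qeq: "?Q = PiM {1..m} ?M" by (simp add: prod_measure_def)
 interpret Q: finite_measure ?Q unfolding Qeq by (rule FP.finite_measure_PiM) simp
 interpret R: finite_measure "PiM ({1..m} - {j}) ?M" by (rule FP.finite_measure_PiM) simp
 note tr = prod_measure_eq_distr[OF \<Omega> fin D]
 have cb: "(\<lambda>x. x i) \<in> borel_measurable (?M j)" if "i \<in> {1..n j}" for i j
  unfolding block_measure_def dom_measure_def using measurable_component_singleton[OF that, of "\<lambda>_. lborel"]
  by (intro measurable_restrict_space1) simp
 have cP: "(\<lambda>y. y (fst p) (snd p)) \<in> borel_measurable (PiM J ?M)" if p: "p \<in> ?I" "fst p \<in> J" for p J
 proof -
  have "snd p \<in> {1..n (fst p)}" using p by (auto simp: flat_index_def)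
  from measurable_compose[OF measurable_component_singleton[of "fst p" J "?M", OF p(2)] cb[OF this]] show ?thesis .
 qed
 define S where "S = PiE {1..n j} (\<lambda>_. E)"
 define \<psi> where "\<psi> b x = (\<Prod>i\<in>{1..n j}. \<eta> (b i) (x i))" for b x
 define G where "G b y = (\<Sum>q\<in>{q \<in> PiE ?I (\<lambda>_. E). (\<lambda>i\<in>{1..n j}. q (j, i)) = b}.
    A q * (\<Prod>p\<in>{p \<in> ?I. fst p \<noteq> j}. \<eta> (q p) (y (fst p) (snd p))))" for b y
 define T where "T y = (\<Sum>q\<in>PiE ?I (\<lambda>_. E). A q * (\<Prod>p\<in>?I. \<eta> (q p) (y (fst p) (snd p))))" for y
 have fi: "finite {p \<in> ?I. fst p \<noteq> j}" using finite_flat_index by simp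
 have s1: "finite S" unfolding S_def by (rule finite_PiE) (simp_all add: E)
 have s2: "card S = card E ^ n j" unfolding S_def by (simp add: card_PiE)
 have s3: "\<forall>b\<in>S. L2 (?M j) (\<psi> b)"
  unfolding \<psi>_def by (intro ballI B.L2_prod_bounded[OF finite_atLeastAtMost \<eta>] cb)
 have s4: "\<forall>b\<in>S. L2 (PiM ({1..m} - {j}) ?M) (G b)"
  unfolding G_def
  by (intro ballI L2_sum L2_cmult R.L2_prod_bounded[OF fi \<eta>] cP)
   (auto simp: flat_index_def)
 have s5: "(\<integral>z. (FP.slice j f z - (\<Sum>b\<in>S. \<psi> b (fst z) * G b (snd z)))\<^sup>2 \<partial>(?M j \<Otimes>\<^sub>M PiM ({1..m} - {j}) ?M)) \<le> d"
 proof -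
  have Ts: "L2 ?Q T"
   unfolding T_def
  proof (intro L2_sum L2_cmult Q.L2_prod_bounded[OF finite_flat_index \<eta>])
   fix p assume "p \<in> ?I"
   then show "(\<lambda>y. y (fst p) (snd p)) \<in> borel_measurable ?Q"
    unfolding Qeq by (intro cP) (auto simp: flat_index_def)
  qed
  define g where "g y = f y - T y" for y
  have gs: "L2 ?Q g" unfolding g_def by (rule L2_diff[OF f Ts])
  have "FP.slice j f z - (\<Sum>b\<in>S. \<psi> b (fst z) * G b (snd z)) = FP.slice j g z" for z
   unfolding FP.slice_def g_def T_def S_def \<psi>_def G_def
   by (simp only: sum_prod_group_by_block[OF j E, where y = "snd z" and x = "fst z" and A = A and \<eta> = \<eta>])
  then have "(\<integral>z. (FP.slice j f z - (\<Sum>b\<in>S. \<psi> b (fst z) * G b (snd z)))\<^sup>2 \<partial>(?M j \<Otimes>\<^sub>M PiM ({1..m} - {j}) ?M)) =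
    (\<integral>z. (FP.slice j g z)\<^sup>2 \<partial>(?M j \<Otimes>\<^sub>M PiM ({1..m} - {j}) ?M))" by simp
  also have "\<dots> = (\<integral>y. (g y)\<^sup>2 \<partial>?Q)"
   using FP.integral_slice_power2[OF j gs[unfolded Qeq]] unfolding Qeq .
  also have "\<dots> = enn2real (\<integral>\<^sup>+y. ennreal ((g y)\<^sup>2) \<partial>?Q)"
   using L2D(1)[OF gs] by (intro integral_eq_nn_integral) simp_all
  also have "\<dots> \<le> d"
  proof -
   have gm: "(\<lambda>y. ennreal ((g y)\<^sup>2)) \<in> borel_measurable ?Q" using L2D(1)[OF gs] by simp
   have "(\<integral>\<^sup>+y. ennreal ((g y)\<^sup>2) \<partial>?Q) = (\<integral>\<^sup>+x. ennreal ((g (blocks m n x))\<^sup>2) \<partial>dom_measure ?I ?D)"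
    using nn_integral_distr[OF tr(2), of "\<lambda>y. ennreal ((g y)\<^sup>2)"] gm unfolding tr(1)[symmetric] by blast
   also have "\<dots> = (\<integral>\<^sup>+x. indicator ?D x * ennreal ((g (blocks m n x))\<^sup>2) \<partial>leb ?I)"
    by (rule nn_integral_dom_measure[OF D])
   also have "\<dots> \<le> ennreal d"
   proof -
    have "T (blocks m n x) = (\<Sum>q\<in>PiE ?I (\<lambda>_. E). A q * (\<Prod>p\<in>?I. \<eta> (q p) (x p)))" for x
     unfolding T_def by (intro sum.cong arg_cong2[where f = "(*)"] prod.cong refl) (auto simp: blocks_def flat_index_def)
    then show ?thesis using err by (simp add: g_def)
   qed
   finally show ?thesis using d by (metis enn2real_ennreal enn2real_mono ennreal_less_top)
  qed
  finally show ?thesis .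
 qed
 show ?thesis by (rule exI[of _ S], rule exI[of _ \<psi>], rule exI[of _ G]) (intro conjI s1 s2 s3 s4 s5)
qed

section \<open>The truncated Tucker decomposition\<close>

text \<open>Rounding up at most doubles a number that is at least \<open>1\<close>.\<close>
lemma prod_ranks_bounds:
 fixes n r :: "nat \<Rightarrow> nat" and k \<epsilon> :: real
 assumes k: "k > 0" and \<epsilon>: "0 < \<epsilon>" "\<epsilon> < 1" and r: "\<forall>j\<in>{1..m}. r j = nat \<lceil>\<epsilon> powr (- real (n j) / k)\<rceil>"
 shows "real (\<Prod>j=1..m. r j) \<le> 2 ^ m * \<epsilon> powr (- real (\<Sum>j=1..m. n j) / k)"
  and "\<epsilon> powr (- real (\<Sum>j=1..m. n j) / k) \<le> real (\<Prod>j=1..m. r j)"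
proof -
 define e where "e j = \<epsilon> powr (- real (n j) / k)" for j
 have e1: "e j \<ge> 1" for j
 proof -
  have "\<epsilon> powr 0 \<le> \<epsilon> powr (- real (n j) / k)" using k \<epsilon> by (intro powr_mono') (simp_all add: divide_nonneg_pos)
  then show ?thesis using \<epsilon> by (simp add: e_def)
 qed
 have rj: "e j \<le> real (r j)" "real (r j) \<le> 2 * e j" if j: "j \<in> {1..m}" for j
 proof -
  have "r j = nat \<lceil>e j\<rceil>" unfolding e_def using r j by blast
  then have "real (r j) = of_int \<lceil>e j\<rceil>" using e1[of j] by simp
  then show "e j \<le> real (r j)" "real (r j) \<le> 2 * e j" using e1[of j] by linarith+
 qed
 have "(\<Prod>j=1..m. e j) = \<epsilon> powr (\<Sum>j=1..m. - real (n j) / k)"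
  unfolding e_def using \<epsilon> by (subst powr_sum) simp_all
 also have "(\<Sum>j=1..m. - real (n j) / k) = - real (\<Sum>j=1..m. n j) / k"
  by (simp add: sum_divide_distrib[symmetric] sum_negf)
 finally have pe: "(\<Prod>j=1..m. e j) = \<epsilon> powr (- real (\<Sum>j=1..m. n j) / k)" .
 have e0: "0 \<le> e j" for j using e1[of j] by linarith
 have "(\<Prod>j=1..m. real (r j)) \<le> (\<Prod>j=1..m. 2 * e j)" by (rule prod_mono) (use rj in auto)
 also have "\<dots> = 2 ^ m * (\<Prod>j=1..m. e j)" by (simp add: prod.distrib)
 finally show "real (\<Prod>j=1..m. r j) \<le> 2 ^ m * \<epsilon> powr (- real (\<Sum>j=1..m. n j) / k)" unfolding pe by simp
 have "(\<Prod>j=1..m. e j) \<le> (\<Prod>j=1..m. real (r j))" by (rule prod_mono) (use rj e0 in auto)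
 then show "\<epsilon> powr (- real (\<Sum>j=1..m. n j) / k) \<le> real (\<Prod>j=1..m. r j)" unfolding pe by simp
qed

text \<open>All estimates with one constant for all \<open>\<epsilon>\<close>, all modes and all choices of the singular value
 decompositions; only families \<open>\<Omega>\<close> that are empty outside of \<open>{1..m}\<close> are considered, so that every
 block carries a finite measure.\<close>
lemma tucker_error_bound:
 fixes m :: nat and n :: "nat \<Rightarrow> nat" and k :: real
  and \<Omega> :: "nat \<Rightarrow> (nat \<Rightarrow> real) set"
  and f :: "(nat \<Rightarrow> nat \<Rightarrow> real) \<Rightarrow> real"
 assumes lip0: "\<forall>j\<in>{1..m}. bounded_lipschitz_domain {1..n j} (\<Omega> j)"
  and out: "\<forall>j. j \<notin> {1..m} \<longrightarrow> \<Omega> j = {}"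
  and k: "k > 0" and sob: "sobolev_prod k m n \<Omega> f"
 shows "\<exists>K\<ge>0. \<forall>lam \<phi> \<epsilon> r. svd_family m n \<Omega> f lam \<phi> \<longrightarrow> 0 < \<epsilon> \<longrightarrow>
   (\<forall>j\<in>{1..m}. \<epsilon> powr (- real (n j) / k) \<le> real (r j)) \<longrightarrow>
   L2 (prod_measure m n \<Omega>) (\<lambda>x. f x - tucker m n \<Omega> f \<phi> r x) \<and>
   (\<forall>j\<in>{1..m}. summable (\<lambda>i. lam j (r j + 1 + i))) \<and>
   (\<integral>x. (f x - tucker m n \<Omega> f \<phi> r x)\<^sup>2 \<partial>prod_measure m n \<Omega>) \<le> (\<Sum>j=1..m. \<Sum>i. lam j (r j + 1 + i)) \<and>
   (\<forall>j\<in>{1..m}. (\<Sum>i. lam j (r j + 1 + i)) \<le> K * \<epsilon>\<^sup>2)"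
proof -
 let ?I = "flat_index m n" and ?D = "flat_domain m n \<Omega>" and ?M = "block_measure n \<Omega>" and ?Q = "prod_measure m n \<Omega>"
 have lip: "bounded_lipschitz_domain {1..n j} (\<Omega> j)" if "j \<in> {1..m}" for j
  using lip0 that by blast
 have so: "sup_open {1..n j} (\<Omega> j)" if "j \<in> {1..m}" for j
  using lip[OF that] unfolding bounded_lipschitz_domain_def by (intro sup_open_if_openin) simp_all
 have \<Omega>: "\<Omega> j \<in> sets (leb {1..n j})" for j
  using sup_open_sets[OF _ so[of j]] out by (cases "j \<in> {1..m}") simp_all
 have bd: "\<exists>R>0. \<forall>x\<in>\<Omega> j. \<forall>i\<in>{1..n j}. \<bar>x i\<bar> \<le> R" if "j \<in> {1..m}" for j
  by (rule bounded_lipschitz_domain_bounded[OF _ lip[OF that]]) simp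
 have fin: "finite_measure (?M j)" for j
 proof (cases "j \<in> {1..m}")
  case True
  from bd[OF True] obtain R where "\<forall>x\<in>\<Omega> j. \<forall>i\<in>{1..n j}. \<bar>x i\<bar> \<le> R" by blast
  then show ?thesis unfolding block_measure_def by (intro finite_measure_dom_measure \<Omega>) simp_all
 next
  case False
  then show ?thesis unfolding block_measure_def
   by (intro finite_measure_dom_measure[where R = 0] \<Omega>) (simp_all add: out)
 qed
 have opD: "sup_open ?I ?D" by (rule sup_open_flat_domain[OF so])
 have D: "?D \<in> sets (leb ?I)" by (rule sup_open_sets[OF finite_flat_index opD])
 obtain R where R: "0 < R" "\<forall>x\<in>?D. \<forall>i\<in>?I. \<bar>x i\<bar> \<le> R" using bounded_flat_domain[of m \<Omega> n, OF bd] by blast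
 have finD: "finite_measure (dom_measure ?I ?D)" by (rule finite_measure_dom_measure[OF finite_flat_index D R(2)])
 have "\<exists>h0>0. \<exists>c0>0. cone_condition {1..n j} (\<Omega> j) h0 c0" if "j \<in> {1..m}" for j
  by (rule cone_condition_lipschitz_domain[OF _ lip[OF that]]) simp
 from cone_condition_flat_domain[of m n \<Omega>, OF this]
 obtain h0 where h0: "0 < h0" "h0 \<le> 1" "cone_condition ?I ?D h0 h0" by blast
 note sob' = sob[unfolded sobolev_prod_def]
 obtain C R' where C: "0 \<le> C" "0 < R'" and ap: "\<forall>h. 0 < h \<longrightarrow> h \<le> h0 \<longrightarrow>
  (\<exists>\<delta> E A. 0 < \<delta> \<and> finite (E :: (int \<times> nat) set) \<and> real (card E) \<le> R' / h \<and>
   (\<integral>\<^sup>+x. indicator ?D x * ennreal ((f (blocks m n x) - (\<Sum>q\<in>PiE ?I (\<lambda>_. E). A q * (\<Prod>i\<in>?I. grid_monomial \<delta> (q i) (x i))))\<^sup>2) \<partial>leb ?I)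
    \<le> ennreal (C * h powr (2 * k)))"
  using piecewise_polynomial_approximation[OF finite_flat_index opD h0(3) h0(1) h0(1) h0(2) R(2) R(1) finD k sob']
  by (elim exE conjE) (rule that)
 note tr = prod_measure_eq_distr[OF \<Omega> fin D]
 interpret B: finite_measure "?M i" for i by (rule fin)
 interpret FP: finite_product ?M "{1..m}" by unfold_locales (simp_all add: fin)
 have Qeq: "?Q = PiM {1..m} ?M" by (simp add: prod_measure_def)
 have f: "L2 ?Q f"
 proof -
  have u: "L2 (dom_measure ?I ?D) (\<lambda>x. f (blocks m n x))" using sob' by (simp add: sobolev_def)
  have "(\<lambda>y. f (blocks m n (unblocks m n y))) \<in> borel_measurable ?Q"
   by (rule measurable_compose[OF tr(3) L2D(1)[OF u]])
  moreover have "f (blocks m n (unblocks m n y)) = f y" if "y \<in> space ?Q" for y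
  proof -
   have "space (?M j) \<subseteq> {1..n j} \<rightarrow>\<^sub>E UNIV" for j
    unfolding block_measure_def dom_measure_def by (simp add: space_restrict_space space_PiM)
   then have "y \<in> (\<Pi>\<^sub>E j\<in>{1..m}. {1..n j} \<rightarrow>\<^sub>E UNIV)"
    using that unfolding Qeq space_PiM by (rule subsetD[OF PiE_mono])
   then show ?thesis by (simp add: blocks_unblocks)
  qed
  ultimately have fm: "f \<in> borel_measurable ?Q" by (subst (asm) measurable_cong) simp_all
  have "integrable (distr (dom_measure ?I ?D) ?Q (blocks m n)) (\<lambda>y. (f y)\<^sup>2)"
   using L2D(2)[OF u] fm by (subst integrable_distr_eq[OF tr(2)]) simp_all
  then have "integrable ?Q (\<lambda>y. (f y)\<^sup>2)" unfolding tr(1)[symmetric] .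
  then show ?thesis using fm by (simp add: square_integrable_def)
 qed
 define V where "V = (\<integral>x. (f x)\<^sup>2 \<partial>?Q)"
 define K where "K = C * R' powr (2 * k) + V / (h0 / R') powr (2 * k)"
 have "V \<ge> 0" unfolding V_def by simp
 then have K0: "K \<ge> 0" using C h0 by (simp add: K_def)
 have rank: "\<forall>h. 0 < h \<longrightarrow> h \<le> h0 \<longrightarrow> (\<exists>(S :: (nat \<Rightarrow> int \<times> nat) set) \<psi> G. finite S \<and> real (card S) \<le> (R' / h) ^ n j \<and>
   (\<forall>b\<in>S. L2 (?M j) (\<psi> b)) \<and> (\<forall>b\<in>S. L2 (PiM ({1..m} - {j}) ?M) (G b)) \<and>
   (\<integral>z. (FP.slice j f z - (\<Sum>b\<in>S. \<psi> b (fst z) * G b (snd z)))\<^sup>2 \<partial>(?M j \<Otimes>\<^sub>M PiM ({1..m} - {j}) ?M)) \<le> C * h powr (2 * k))"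
  if j: "j \<in> {1..m}" for j
 proof (intro allI impI)
  fix h assume h: "0 < h" "h \<le> h0"
  obtain \<delta> E A where E: "0 < \<delta>" "finite (E :: (int \<times> nat) set)" "real (card E) \<le> R' / h"
   "(\<integral>\<^sup>+x. indicator ?D x * ennreal ((f (blocks m n x) - (\<Sum>q\<in>PiE ?I (\<lambda>_. E). A q * (\<Prod>i\<in>?I. grid_monomial \<delta> (q i) (x i))))\<^sup>2) \<partial>leb ?I)
    \<le> ennreal (C * h powr (2 * k))"
   using ap[rule_format, OF h] by (elim exE conjE) (rule that)
  have d: "0 \<le> C * h powr (2 * k)" using C by simp
  obtain S :: "(nat \<Rightarrow> int \<times> nat) set" and \<psi> G where S: "finite S" "card S = card E ^ n j"
   "\<forall>b\<in>S. L2 (?M j) (\<psi> b)" "\<forall>b\<in>S. L2 (PiM ({1..m} - {j}) ?M) (G b)"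
   "(\<integral>z. (FP.slice j f z - (\<Sum>b\<in>S. \<psi> b (fst z) * G b (snd z)))\<^sup>2 \<partial>(?M j \<Otimes>\<^sub>M PiM ({1..m} - {j}) ?M)) \<le> C * h powr (2 * k)"
   using mode_finite_rank_approximation[OF \<Omega> fin D f j grid_monomial_measurable grid_monomial_bounded[OF E(1)] E(2) d E(4)]
   by (elim exE conjE) (rule that)
  have "real (card S) \<le> (R' / h) ^ n j" unfolding S(2) of_nat_power by (rule power_mono[OF E(3)]) simp
  with S show "\<exists>(S :: (nat \<Rightarrow> int \<times> nat) set) \<psi> G. finite S \<and> real (card S) \<le> (R' / h) ^ n j \<and>
   (\<forall>b\<in>S. L2 (?M j) (\<psi> b)) \<and> (\<forall>b\<in>S. L2 (PiM ({1..m} - {j}) ?M) (G b)) \<and>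
   (\<integral>z. (FP.slice j f z - (\<Sum>b\<in>S. \<psi> b (fst z) * G b (snd z)))\<^sup>2 \<partial>(?M j \<Otimes>\<^sub>M PiM ({1..m} - {j}) ?M)) \<le> C * h powr (2 * k)"
   by - (rule exI[of _ S], rule exI[of _ \<psi>], rule exI[of _ G], intro conjI)
 qed
 have main: "L2 ?Q (\<lambda>x. f x - tucker m n \<Omega> f \<phi> r x) \<and>
   (\<forall>j\<in>{1..m}. summable (\<lambda>i. lam j (r j + 1 + i))) \<and>
   (\<integral>x. (f x - tucker m n \<Omega> f \<phi> r x)\<^sup>2 \<partial>?Q) \<le> (\<Sum>j=1..m. \<Sum>i. lam j (r j + 1 + i)) \<and>
   (\<forall>j\<in>{1..m}. (\<Sum>i. lam j (r j + 1 + i)) \<le> K * \<epsilon>\<^sup>2)"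
  if svd: "svd_family m n \<Omega> f lam \<phi>" and \<epsilon>: "0 < \<epsilon>"
   and r: "\<forall>j\<in>{1..m}. \<epsilon> powr (- real (n j) / k) \<le> real (r j)" for lam \<phi> \<epsilon> r
 proof -
  have EP: "eigen_pair (?M j) (PiM ({1..m} - {j}) ?M) (FP.slice j f) (svd_kernel m n \<Omega> f j) (lam j) (\<phi> j)"
   if j: "j \<in> {1..m}" for j
  proof -
   interpret P: finite_pair "?M j" "PiM ({1..m} - {j}) ?M" by (rule FP.finite_pair_slice)
   show ?thesis
   proof unfold_locales
    show "L2 (?M j \<Otimes>\<^sub>M PiM ({1..m} - {j}) ?M) (FP.slice j f)"
     using FP.slice_L2[OF j] L2D(1)[OF f] f unfolding Qeq by blast
    show "svd_kernel m n \<Omega> f j x x' = (\<integral>y. FP.slice j f (x, y) * FP.slice j f (x', y) \<partial>PiM ({1..m} - {j}) ?M)" for x x'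
     by (simp add: svd_kernel_def FP.slice_def)
    show "eigensystem (?M j) (svd_kernel m n \<Omega> f j) (lam j) (\<phi> j)" using svd j by (simp add: svd_family_def)
   qed
  qed
  have Vj: "(\<integral>z. (FP.slice j f z)\<^sup>2 \<partial>(?M j \<Otimes>\<^sub>M PiM ({1..m} - {j}) ?M)) = V" if "j \<in> {1..m}" for j
   using FP.integral_slice_power2[OF that f[unfolded Qeq]] by (simp add: V_def Qeq)
  have tail: "(\<lambda>i. lam j (r j + 1 + i)) sums (V - (\<Sum>\<alpha>=1..r j. lam j \<alpha>))" "(\<Sum>i. lam j (r j + 1 + i)) \<le> K * \<epsilon>\<^sup>2"
   if j: "j \<in> {1..m}" for j
   using eigen_pair.lam_tail_bound[OF EP[OF j] rank[OF j] h0(1) C(2) C(1) k, unfolded Vj[OF j]] r j \<epsilon>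
   unfolding K_def by blast+
  have me: "FP.mode_error f \<phi> r j = (\<Sum>i. lam j (r j + 1 + i))" if j: "j \<in> {1..m}" for j
  proof -
   have "(\<Sum>\<alpha>=1..r j. \<integral>y. (finite_pair.coef (?M j) (FP.slice j f) (\<phi> j \<alpha>) y)\<^sup>2 \<partial>PiM ({1..m} - {j}) ?M) =
    (\<Sum>\<alpha>=1..r j. lam j \<alpha>)"
    by (rule sum.cong[OF refl], rule eigen_pair.integral_coef_phi_power2[OF EP[OF j]]) simp
   then have "FP.mode_error f \<phi> r j = V - (\<Sum>\<alpha>=1..r j. lam j \<alpha>)"
    unfolding FP.mode_error_def V_def Qeq by (simp only:)
   then show ?thesis using tail(1)[OF j] by (simp add: sums_unique)
  qed
  have phs: "L2 (?M j) (\<phi> j \<alpha>)" if "j \<in> {1..m}" "\<alpha> \<ge> 1" for j \<alpha>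
   by (rule eigen_pair.phi_L2[OF EP[OF that(1)] that(2)])
  have pho: "(\<integral>x. \<phi> j \<alpha> x * \<phi> j \<beta> x \<partial>?M j) = (if \<alpha> = \<beta> then 1 else 0)" if "j \<in> {1..m}" "\<alpha> \<ge> 1" "\<beta> \<ge> 1" for j \<alpha> \<beta>
   by (rule eigen_pair.phi_orthonormal[OF EP[OF that(1)] that(2,3)])
  note te = FP.truncated_expansion_error[OF f[unfolded Qeq] phs pho, of r]
  have tk: "tucker m n \<Omega> f \<phi> r = (\<lambda>x. \<Sum>\<alpha>\<in>PiE {1..m} (\<lambda>j. {1..r j}).
   (\<integral>x. f x * (\<Prod>i\<in>{1..m}. \<phi> i (\<alpha> i) (x i)) \<partial>PiM {1..m} ?M) * (\<Prod>i\<in>{1..m}. \<phi> i (\<alpha> i) (x i)))"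
   unfolding tucker_def core_def core_index_def Qeq ..
  have "L2 ?Q (\<lambda>x. f x - tucker m n \<Omega> f \<phi> r x)" unfolding tk Qeq by (rule te(1))
  moreover have "\<forall>j\<in>{1..m}. summable (\<lambda>i. lam j (r j + 1 + i))" using tail(1) sums_summable by blast
  moreover have "(\<integral>x. (f x - tucker m n \<Omega> f \<phi> r x)\<^sup>2 \<partial>?Q) \<le> (\<Sum>j=1..m. FP.mode_error f \<phi> r j)"
   unfolding tk Qeq by (rule te(2))
  then have "(\<integral>x. (f x - tucker m n \<Omega> f \<phi> r x)\<^sup>2 \<partial>?Q) \<le> (\<Sum>j=1..m. \<Sum>i. lam j (r j + 1 + i))"
   using sum.cong[OF refl me, of "{1..m}"] by (simp only:)
  moreover have "\<forall>j\<in>{1..m}. (\<Sum>i. lam j (r j + 1 + i)) \<le> K * \<epsilon>\<^sup>2" using tail(2) by blast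
  ultimately show ?thesis by (intro conjI)
 qed
 show ?thesis using K0 main by (intro exI[of _ K] conjI allI impI) blast+
qed

theorem theorem3p1:
 fixes m :: nat and n :: "nat \<Rightarrow> nat" and k :: real
  and \<Omega> :: "nat \<Rightarrow> (nat \<Rightarrow> real) set"
  and f :: "(nat \<Rightarrow> nat \<Rightarrow> real) \<Rightarrow> real"
 assumes "m \<ge> 2"
  and "\<And>j. j \<in> {1..m} \<Longrightarrow> n j \<ge> 1"
  and "\<And>j. j \<in> {1..m} \<Longrightarrow> bounded_lipschitz_domain {1..n j} (\<Omega> j)"
  and "k > 0"
  and "sobolev_prod k m n \<Omega> f"
 shows "\<exists>C>0. \<exists>c>0. \<forall>lam \<phi>. svd_family m n \<Omega> f lam \<phi> \<longrightarrow>
  (\<forall>\<epsilon> r. 0 < \<epsilon> \<longrightarrow> \<epsilon> < 1 \<longrightarrow>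
   (\<forall>j\<in>{1..m}. r j = nat \<lceil>\<epsilon> powr (- real (n j) / k)\<rceil>) \<longrightarrow>
   square_integrable (prod_measure m n \<Omega>) (\<lambda>x. f x - tucker m n \<Omega> f \<phi> r x) \<and>
   (\<forall>j\<in>{1..m}. summable (\<lambda>i. lam j (r j + 1 + i))) \<and>
   L2_norm (prod_measure m n \<Omega>) (\<lambda>x. f x - tucker m n \<Omega> f \<phi> r x)
    \<le> sqrt (\<Sum>j=1..m. \<Sum>i. lam j (r j + 1 + i)) \<and>
   sqrt (\<Sum>j=1..m. \<Sum>i. lam j (r j + 1 + i)) \<le> C * sqrt (real m) * \<epsilon> \<and>
   core_storage m r = (\<Prod>j=1..m. r j) \<and>
   real (\<Prod>j=1..m. r j) \<le> c * \<epsilon> powr (- real (\<Sum>j=1..m. n j) / k) \<and>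
   \<epsilon> powr (- real (\<Sum>j=1..m. n j) / k) \<le> c * real (\<Prod>j=1..m. r j))"
proof -
 (* Outside of {1..m} the family \<Omega> is arbitrary; it is replaced by empty sets there, so that all
   blocks carry finite measures. *)
 define \<Omega>' where "\<Omega>' j = (if j \<in> {1..m} then \<Omega> j else {})" for j
 have in': "\<Omega>' j = \<Omega> j" if "j \<in> {1..m}" for j unfolding \<Omega>'_def using that by (simp only: if_True)
 have bm: "block_measure n \<Omega>' j = block_measure n \<Omega> j" if "j \<in> {1..m}" for j
  unfolding block_measure_def in'[OF that] ..
 have pm: "prod_measure m n \<Omega>' = prod_measure m n \<Omega>"
  unfolding prod_measure_def by (rule PiM_cong[OF refl bm])
 have "flat_domain m n \<Omega>' = flat_domain m n \<Omega>"
  unfolding flat_domain_def using PiE_cong[OF in', of "{1..m}"] by (simp only:)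
 then have sob: "sobolev_prod k m n \<Omega>' f" using assms(5) by (simp only: sobolev_prod_def)
 have ker: "svd_kernel m n \<Omega>' f j = svd_kernel m n \<Omega> f j" for j
 proof -
  have "(\<Pi>\<^sub>M i\<in>{1..m} - {j}. block_measure n \<Omega>' i) = (\<Pi>\<^sub>M i\<in>{1..m} - {j}. block_measure n \<Omega> i)"
   by (rule PiM_cong[OF refl]) (rule bm, blast)
  then show ?thesis unfolding svd_kernel_def[abs_def] by (simp only:)
 qed
 have svd: "svd_family m n \<Omega>' f lam \<phi> \<longleftrightarrow> svd_family m n \<Omega> f lam \<phi>" for lam \<phi>
  unfolding svd_family_def ker by (intro ball_cong refl) (simp only: bm)
 have tk: "tucker m n \<Omega>' f \<phi> r = tucker m n \<Omega> f \<phi> r" for \<phi> r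
  unfolding tucker_def[abs_def] core_def pm ..
 have lip: "\<forall>j\<in>{1..m}. bounded_lipschitz_domain {1..n j} (\<Omega>' j)"
 proof
  fix j assume j: "j \<in> {1..m}"
  show "bounded_lipschitz_domain {1..n j} (\<Omega>' j)" unfolding in'[OF j] by (rule assms(3)[OF j])
 qed
 have out: "\<forall>j. j \<notin> {1..m} \<longrightarrow> \<Omega>' j = {}" unfolding \<Omega>'_def by (intro allI impI if_not_P)
 obtain K where K: "K \<ge> 0" and main: "\<forall>lam \<phi> \<epsilon> r. svd_family m n \<Omega> f lam \<phi> \<longrightarrow> 0 < \<epsilon> \<longrightarrow>
   (\<forall>j\<in>{1..m}. \<epsilon> powr (- real (n j) / k) \<le> real (r j)) \<longrightarrow>
   square_integrable (prod_measure m n \<Omega>) (\<lambda>x. f x - tucker m n \<Omega> f \<phi> r x) \<and>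
   (\<forall>j\<in>{1..m}. summable (\<lambda>i. lam j (r j + 1 + i))) \<and>
   (\<integral>x. (f x - tucker m n \<Omega> f \<phi> r x)\<^sup>2 \<partial>prod_measure m n \<Omega>) \<le> (\<Sum>j=1..m. \<Sum>i. lam j (r j + 1 + i)) \<and>
   (\<forall>j\<in>{1..m}. (\<Sum>i. lam j (r j + 1 + i)) \<le> K * \<epsilon>\<^sup>2)"
  using tucker_error_bound[OF lip out assms(4) sob, unfolded svd pm tk] by (elim exE conjE) (rule that)
 define C where "C = sqrt K + 1"
 have C: "C > 0" using K by (simp add: C_def add_nonneg_pos)
 show ?thesis
 proof (rule exI[of _ C], rule conjI[OF C], rule exI[of _ "2 ^ m"], rule conjI, simp, intro allI impI)
  fix lam \<phi> \<epsilon> r assume s: "svd_family m n \<Omega> f lam \<phi>" and \<epsilon>: "0 < \<epsilon>" "\<epsilon> < 1"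
   and r: "\<forall>j\<in>{1..m}. r j = nat \<lceil>\<epsilon> powr (- real (n j) / k)\<rceil>"
  have r': "\<forall>j\<in>{1..m}. \<epsilon> powr (- real (n j) / k) \<le> real (r j)"
  proof
   fix j assume "j \<in> {1..m}"
   then show "\<epsilon> powr (- real (n j) / k) \<le> real (r j)" using r by (simp only: real_nat_ceiling_ge)
  qed
  note M = main[THEN spec, THEN spec, THEN spec, THEN spec, THEN mp, OF s, THEN mp, OF \<epsilon>(1), THEN mp, OF r']
  have "L2_norm (prod_measure m n \<Omega>) (\<lambda>x. f x - tucker m n \<Omega> f \<phi> r x) \<le> sqrt (\<Sum>j=1..m. \<Sum>i. lam j (r j + 1 + i))"
   unfolding L2_norm_def by (intro real_sqrt_le_mono) (use M in blast)
  moreover have "sqrt (\<Sum>j=1..m. \<Sum>i. lam j (r j + 1 + i)) \<le> C * sqrt (real m) * \<epsilon>"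
  proof -
   have "(\<Sum>j=1..m. \<Sum>i. lam j (r j + 1 + i)) \<le> (\<Sum>j=1..m. K * \<epsilon>\<^sup>2)" by (rule sum_mono) (use M in blast)
   also have "\<dots> = K * real m * \<epsilon>\<^sup>2" by simp
   finally have "sqrt (\<Sum>j=1..m. \<Sum>i. lam j (r j + 1 + i)) \<le> sqrt (K * real m * \<epsilon>\<^sup>2)" by (rule real_sqrt_le_mono)
   also have "\<dots> = sqrt K * (sqrt (real m) * \<epsilon>)" using \<epsilon> by (simp add: real_sqrt_mult)
   also have "\<dots> \<le> C * (sqrt (real m) * \<epsilon>)" using \<epsilon> by (intro mult_right_mono) (simp_all add: C_def)
   finally show ?thesis by (simp only: mult.assoc)
  qed
  moreover have "core_storage m r = (\<Prod>j=1..m. r j)"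
   by (simp add: core_storage_def core_index_def card_PiE)
  moreover note prod_ranks_bounds(1)[OF assms(4) \<epsilon> r]
  moreover have "\<epsilon> powr (- real (\<Sum>j=1..m. n j) / k) \<le> 2 ^ m * real (\<Prod>j=1..m. r j)"
  proof -
   have "1 * real (\<Prod>j=1..m. r j) \<le> 2 ^ m * real (\<Prod>j=1..m. r j)" by (intro mult_right_mono of_nat_0_le_iff) simp
   then show ?thesis using prod_ranks_bounds(2)[OF assms(4) \<epsilon> r] by linarith
  qed
  ultimately show "square_integrable (prod_measure m n \<Omega>) (\<lambda>x. f x - tucker m n \<Omega> f \<phi> r x) \<and>
   (\<forall>j\<in>{1..m}. summable (\<lambda>i. lam j (r j + 1 + i))) \<and>
   L2_norm (prod_measure m n \<Omega>) (\<lambda>x. f x - tucker m n \<Omega> f \<phi> r x)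
    \<le> sqrt (\<Sum>j=1..m. \<Sum>i. lam j (r j + 1 + i)) \<and>
   sqrt (\<Sum>j=1..m. \<Sum>i. lam j (r j + 1 + i)) \<le> C * sqrt (real m) * \<epsilon> \<and>
   core_storage m r = (\<Prod>j=1..m. r j) \<and>
   real (\<Prod>j=1..m. r j) \<le> 2 ^ m * \<epsilon> powr (- real (\<Sum>j=1..m. n j) / k) \<and>
   \<epsilon> powr (- real (\<Sum>j=1..m. n j) / k) \<le> 2 ^ m * real (\<Prod>j=1..m. r j)"
   using M by (intro conjI) (elim conjE, assumption)+
 qed
qed

end
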